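(* The 2-category $\mathsf{TwTr}$ has binary products (in the 2-categorical sense): for objects $(H_1,\mathcal{R}_1)$ and $(H_2,\mathcal{R}_2)$ of $\mathsf{TwTr}$, the binary product is given by $$\big((H_1,\mathcal{R}_1)\otimes(H_2,\mathcal{R}_2),\ (\mathrm{Id}\otimes\varepsilon,1\otimes1),\ (\varepsilon\otimes\mathrm{Id},1\otimes1)\big),$$ where $(\mathrm{Id}\otimes\varepsilon,1\otimes1)$ and $(\varepsilon\otimes\mathrm{Id},1\otimes1)$ are the projections onto $(H_1,\mathcal{R}_1)$ and $(H_2,\mathcal{R}_2)$, respectively.
   Context: $\Bbbk$ is an arbitrary field; bialgebras and tensor products are over $\Bbbk$. $\tau$ is the canonical flip, $\varepsilon$ the counit. For $T=T^i\otimes T_i\in H\otimes H$ (summation understood), $T^{\mathrm{op}}=T_i\otimes T^i$. A triangular bialgebra is a pair $(H,\mathcal{R})$ with $H$ a bialgebra and $\mathcal{R}\in H\otimes H$ invertible such that $\Delta^{\mathrm{op}}(\cdot)=\mathcal{R}\Delta(\cdot)\mathcal{R}^{-1}$, $(\mathrm{Id}\otimes\Delta)(\mathcal{R})=\mathcal{R}_{13}\mathcal{R}_{12}$, $(\Delta\otimes\mathrm{Id})(\mathcal{R})=\mathcal{R}_{13}\mathcal{R}_{23}$ (leg notation) and $\mathcal{R}^{-1}=\mathcal{R}^{\mathrm{op}}$. A morphism $f:(H,\mathcal{R})\to(H',\mathcal{R}')$ of triangular bialgebras is a bialgebra map with $(f\otimes f)(\mathcal{R})=\mathcal{R}'$.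 A twist on $H$ is an invertible $\mathcal{F}\in H\otimes H$ with $(\mathcal{F}\otimes1)(\Delta\otimes\mathrm{Id})(\mathcal{F})=(1\otimes\mathcal{F})(\mathrm{Id}\otimes\Delta)(\mathcal{F})$ and $(\varepsilon\otimes\mathrm{Id})(\mathcal{F})=1=(\mathrm{Id}\otimes\varepsilon)(\mathcal{F})$. Then $H_{\mathcal{F}}$ is the bialgebra with the same algebra and counit and comultiplication $\Delta_{\mathcal{F}}(\cdot)=\mathcal{F}\Delta(\cdot)\mathcal{F}^{-1}$; if $(H,\mathcal{R})$ is triangular, so is $(H_{\mathcal{F}},\mathcal{R}_{\mathcal{F}})$ with $\mathcal{R}_{\mathcal{F}}:=\mathcal{F}^{\mathrm{op}}\mathcal{R}\mathcal{F}^{-1}$. The (strict) 2-category $\mathsf{TwTr}$: 0-cells are triangular bialgebras; a 1-cell $(f,\mathcal{F}):(H,\mathcal{R})\to(H',\mathcal{R}')$ is a pair with $\mathcal{F}$ a twist on $H'$ and $f:(H,\mathcal{R})\to(H'_{\mathcal{F}},\mathcal{R}'_{\mathcal{F}})$ a morphism of triangular bialgebras; a 2-cell (gauge transformation) $a:(f,\mathcal{F})\Rightarrow(f',\mathcal{F}')$ between 1-cells $(H,\mathcal{R})\to(H',\mathcal{R}')$ is an element $a\in H'$ with $\varepsilon'(a)=1$, $(a\otimes a)\mathcal{F}=\mathcal{F}'\Delta'(a)$ and $af(x)=f'(x)a$ for all $x\in H$. Composition of 1-cells: $(f',\mathcal{F}')\circ(f,\mathcal{F})=(f'f,(f'\otimes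 f')(\mathcal{F})\mathcal{F}')$; identity 1-cells $(\mathrm{Id},1\otimes1)$; vertical composition of 2-cells: $a\circ_v b=ab$; horizontal composition of $b:(f,\mathcal{F})\Rightarrow(f',\mathcal{F}')$ with $a:(g,\mathcal{G})\Rightarrow(g',\mathcal{G}')$: $a\circ_h b=a\,g(b)$; identity 2-cells are given by $1$. $(H_1,\mathcal{R}_1)\otimes(H_2,\mathcal{R}_2):=(H_1\otimes H_2,\widetilde{\mathcal{R}})$, where $H_1\otimes H_2$ is the tensor product bialgebra (comultiplication $(\mathrm{Id}\otimes\tau\otimes\mathrm{Id})(\Delta_{H_1}\otimes\Delta_{H_2})$) and $\widetilde{\mathcal{R}}=(\mathrm{Id}\otimes\tau\otimes\mathrm{Id})(\mathcal{R}_1\otimes\mathcal{R}_2)$; this is a triangular bialgebra. A product of two objects $A,B$ in a 2-category $\mathcal{C}$ is an object $A\times B$ with 1-cells $p:A\times B\to A$, $q:A\times B\to B$ such that for every object $X$ the functor $\mathcal{C}(X,A\times B)\to\mathcal{C}(X,A)\times\mathcal{C}(X,B)$, $h\mapsto(ph,qh)$, $\gamma\mapsto(p\gamma,q\gamma)$ (with $p\gamma:=\mathrm{Id}_p\circ_h\gamma$) is an equivalence of categories. *)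

theory Defs
  imports "HOL-Algebra.Free_Abelian_Groups" "HOL-Algebra.Module"
begin

section \<open>Categories and equivalences of categories\<close>

text \<open>
  Hom-sets need not be disjoint, so composition and the arrow part of a functor take the objects
  involved as arguments: \<open>Comp C x y z g f\<close> is the composite of \<open>f : x \<rightarrow> y\<close> with \<open>g : y \<rightarrow> z\<close>.
\<close>

record ('o, 'm) cat =
  Ob :: "'o set"
  Hom :: "'o \<Rightarrow> 'o \<Rightarrow> 'm set"
  Comp :: "'o \<Rightarrow> 'o \<Rightarrow> 'o \<Rightarrow> 'm \<Rightarrow> 'm \<Rightarrow> 'm"
  Ident :: "'o \<Rightarrow> 'm"

definition is_category :: "('o, 'm) cat \<Rightarrow> bool" where
  "is_category C \<longleftrightarrow>
     (\<forall>x\<in>Ob C. Ident C x \<in> Hom C x x) \<and>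
     (\<forall>x\<in>Ob C. \<forall>y\<in>Ob C. \<forall>z\<in>Ob C. \<forall>f\<in>Hom C x y. \<forall>g\<in>Hom C y z. Comp C x y z g f \<in> Hom C x z) \<and>
     (\<forall>x\<in>Ob C. \<forall>y\<in>Ob C. \<forall>f\<in>Hom C x y.
        Comp C x x y f (Ident C x) = f \<and> Comp C x y y (Ident C y) f = f) \<and>
     (\<forall>w\<in>Ob C. \<forall>x\<in>Ob C. \<forall>y\<in>Ob C. \<forall>z\<in>Ob C. \<forall>f\<in>Hom C w x. \<forall>g\<in>Hom C x y. \<forall>h\<in>Hom C y z.
        Comp C w y z h (Comp C w x y g f) = Comp C w x z (Comp C x y z h g) f)"

definition prod_cat :: "('o, 'm) cat \<Rightarrow> ('p, 'n) cat \<Rightarrow> ('o \<times> 'p, 'm \<times> 'n) cat" where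
  "prod_cat C D =
     \<lparr>Ob = Ob C \<times> Ob D,
      Hom = (\<lambda>(x, x') (y, y'). Hom C x y \<times> Hom D x' y'),
      Comp = (\<lambda>(x, x') (y, y') (z, z') (g, g') (f, f'). (Comp C x y z g f, Comp D x' y' z' g' f')),
      Ident = (\<lambda>(x, x'). (Ident C x, Ident D x'))\<rparr>"

record ('o, 'm, 'p, 'n) func =
  on_ob :: "'o \<Rightarrow> 'p"
  on_hom :: "'o \<Rightarrow> 'o \<Rightarrow> 'm \<Rightarrow> 'n"

definition is_functor :: "('o, 'm) cat \<Rightarrow> ('p, 'n) cat \<Rightarrow> ('o, 'm, 'p, 'n) func \<Rightarrow> bool" where
  "is_functor C D F \<longleftrightarrow>
     (\<forall>x\<in>Ob C. on_ob F x \<in> Ob D) \<and>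
     (\<forall>x\<in>Ob C. \<forall>y\<in>Ob C. \<forall>f\<in>Hom C x y. on_hom F x y f \<in> Hom D (on_ob F x) (on_ob F y)) \<and>
     (\<forall>x\<in>Ob C. on_hom F x x (Ident C x) = Ident D (on_ob F x)) \<and>
     (\<forall>x\<in>Ob C. \<forall>y\<in>Ob C. \<forall>z\<in>Ob C. \<forall>f\<in>Hom C x y. \<forall>g\<in>Hom C y z.
        on_hom F x z (Comp C x y z g f) =
        Comp D (on_ob F x) (on_ob F y) (on_ob F z) (on_hom F y z g) (on_hom F x y f))"

definition id_func :: "('o, 'm, 'o, 'm) func" where
  "id_func = \<lparr>on_ob = (\<lambda>x. x), on_hom = (\<lambda>x y f. f)\<rparr>"

definition comp_func ::
  "('p, 'n, 'q, 'l) func \<Rightarrow> ('o, 'm, 'p, 'n) func \<Rightarrow> ('o, 'm, 'q, 'l) func" where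
  "comp_func G F =
     \<lparr>on_ob = (\<lambda>x. on_ob G (on_ob F x)),
      on_hom = (\<lambda>x y f. on_hom G (on_ob F x) (on_ob F y) (on_hom F x y f))\<rparr>"

definition is_isomorphism :: "('o, 'm) cat \<Rightarrow> 'o \<Rightarrow> 'o \<Rightarrow> 'm \<Rightarrow> bool" where
  "is_isomorphism C x y f \<longleftrightarrow>
     f \<in> Hom C x y \<and>
     (\<exists>g\<in>Hom C y x. Comp C x y x g f = Ident C x \<and> Comp C y x y f g = Ident C y)"

definition is_natural_isomorphism ::
  "('o, 'm) cat \<Rightarrow> ('p, 'n) cat \<Rightarrow> ('o, 'm, 'p, 'n) func \<Rightarrow> ('o, 'm, 'p, 'n) func \<Rightarrow> ('o \<Rightarrow> 'n) \<Rightarrow> bool"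
  where
  "is_natural_isomorphism C D F G \<eta> \<longleftrightarrow>
     (\<forall>x\<in>Ob C. is_isomorphism D (on_ob F x) (on_ob G x) (\<eta> x)) \<and>
     (\<forall>x\<in>Ob C. \<forall>y\<in>Ob C. \<forall>f\<in>Hom C x y.
        Comp D (on_ob F x) (on_ob F y) (on_ob G y) (\<eta> y) (on_hom F x y f) =
        Comp D (on_ob F x) (on_ob G x) (on_ob G y) (on_hom G x y f) (\<eta> x))"

definition is_equivalence :: "('o, 'm) cat \<Rightarrow> ('p, 'n) cat \<Rightarrow> ('o, 'm, 'p, 'n) func \<Rightarrow> bool" where
  "is_equivalence C D F \<longleftrightarrow>
     is_category C \<and> is_category D \<and> is_functor C D F \<and>
     (\<exists>G \<eta> \<theta>. is_functor D C G \<and>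
        is_natural_isomorphism C C id_func (comp_func G F) \<eta> \<and>
        is_natural_isomorphism D D (comp_func F G) id_func \<theta>)"


section \<open>Tensor products\<close>

text \<open>
  The tensor product of two modules over \<open>K\<close> is the free abelian group on the pairs \<open>(a, b)\<close>
  modulo the subgroup generated by the bilinearity relations.
\<close>

type_synonym ('a, 'b) tens = "('a \<times> 'b \<Rightarrow>\<^sub>0 int) set"

definition tensor_relations ::
  "'k ring \<Rightarrow> ('k, 'a, 'm) module_scheme \<Rightarrow> ('k, 'b, 'n) module_scheme \<Rightarrow> ('a \<times> 'b \<Rightarrow>\<^sub>0 int) set" where
  "tensor_relations K A B =
     {frag_of (a \<oplus>\<^bsub>A\<^esub> a', b) - frag_of (a, b) - frag_of (a', b) | a a' b.
        a \<in> carrier A \<and> a' \<in> carrier A \<and> b \<in> carrier B} \<union>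
     {frag_of (a, b \<oplus>\<^bsub>B\<^esub> b') - frag_of (a, b) - frag_of (a, b') | a b b'.
        a \<in> carrier A \<and> b \<in> carrier B \<and> b' \<in> carrier B} \<union>
     {frag_of (r \<odot>\<^bsub>A\<^esub> a, b) - frag_of (a, r \<odot>\<^bsub>B\<^esub> b) | r a b.
        r \<in> carrier K \<and> a \<in> carrier A \<and> b \<in> carrier B}"

definition tensor_kernel ::
  "'k ring \<Rightarrow> ('k, 'a, 'm) module_scheme \<Rightarrow> ('k, 'b, 'n) module_scheme \<Rightarrow> ('a \<times> 'b \<Rightarrow>\<^sub>0 int) set" where
  "tensor_kernel K A B =
     generate (free_Abelian_group (carrier A \<times> carrier B)) (tensor_relations K A B)"

definition tensor_group ::
  "'k ring \<Rightarrow> ('k, 'a, 'm) module_scheme \<Rightarrow> ('k, 'b, 'n) module_scheme \<Rightarrow> ('a, 'b) tens monoid" where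
  "tensor_group K A B =
     free_Abelian_group (carrier A \<times> carrier B) Mod tensor_kernel K A B"

definition pure ::
  "'k ring \<Rightarrow> ('k, 'a, 'm) module_scheme \<Rightarrow> ('k, 'b, 'n) module_scheme \<Rightarrow> 'a \<Rightarrow> 'b \<Rightarrow> ('a, 'b) tens" where
  "pure K A B a b =
     tensor_kernel K A B #>\<^bsub>free_Abelian_group (carrier A \<times> carrier B)\<^esub> frag_of (a, b)"

text \<open>
  The homomorphism into the abelian group \<open>G\<close> that sends \<open>a \<otimes> b\<close> to \<open>\<beta> a b\<close>; existence and
  uniqueness for bilinear \<open>\<beta>\<close> is lemma \<open>tensor_lift_ex1\<close> below.
\<close>

definition tensor_lift ::
  "'k ring \<Rightarrow> ('k, 'a, 'm) module_scheme \<Rightarrow> ('k, 'b, 'n) module_scheme \<Rightarrow> ('c, 'l) monoid_scheme \<Rightarrow>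
   ('a \<Rightarrow> 'b \<Rightarrow> 'c) \<Rightarrow> ('a, 'b) tens \<Rightarrow> 'c" where
  "tensor_lift K A B G \<beta> =
     (THE h. h \<in> extensional (carrier (tensor_group K A B)) \<and> h \<in> hom (tensor_group K A B) G \<and>
             (\<forall>a\<in>carrier A. \<forall>b\<in>carrier B. h (pure K A B a b) = \<beta> a b))"

lemma tensor_relations_subset:
  assumes "module K A" "module K B"
  shows "tensor_relations K A B \<subseteq> carrier (free_Abelian_group (carrier A \<times> carrier B))"
proof -
  interpret A: module K A by fact
  interpret B: module K B by fact
  show ?thesis
    unfolding tensor_relations_def
    by (auto dest!: subsetD[OF keys_diff])
qed

lemma tensor_lift_ex1:
  assumes A: "module K A" and B: "module K B" and G: "comm_group G"
    and \<beta>: "\<And>a b. a \<in> carrier A \<Longrightarrow> b \<in> carrier B \<Longrightarrow> \<beta> a b \<in> carrier G"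
    and add_l: "\<And>a a' b. a \<in> carrier A \<Longrightarrow> a' \<in> carrier A \<Longrightarrow> b \<in> carrier B \<Longrightarrow>
                  \<beta> (a \<oplus>\<^bsub>A\<^esub> a') b = \<beta> a b \<otimes>\<^bsub>G\<^esub> \<beta> a' b"
    and add_r: "\<And>a b b'. a \<in> carrier A \<Longrightarrow> b \<in> carrier B \<Longrightarrow> b' \<in> carrier B \<Longrightarrow>
                  \<beta> a (b \<oplus>\<^bsub>B\<^esub> b') = \<beta> a b \<otimes>\<^bsub>G\<^esub> \<beta> a b'"
    and bal: "\<And>r a b. r \<in> carrier K \<Longrightarrow> a \<in> carrier A \<Longrightarrow> b \<in> carrier B \<Longrightarrow>
                  \<beta> (r \<odot>\<^bsub>A\<^esub> a) b = \<beta> a (r \<odot>\<^bsub>B\<^esub> b)"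
  shows "\<exists>!h. h \<in> extensional (carrier (tensor_group K A B)) \<and> h \<in> hom (tensor_group K A B) G \<and>
           (\<forall>a\<in>carrier A. \<forall>b\<in>carrier B. h (pure K A B a b) = \<beta> a b)"
proof -
  interpret A: module K A by fact
  interpret B: module K B by fact
  interpret G: comm_group G by fact
  let ?S = "carrier A \<times> carrier B"
  let ?F = "free_Abelian_group ?S"
  let ?N = "tensor_kernel K A B"
  interpret F: comm_group ?F by (rule abelian_free_Abelian_group)
  have sub: "tensor_relations K A B \<subseteq> carrier ?F"
    by (rule tensor_relations_subset) fact+
  have subN: "subgroup ?N ?F"
    unfolding tensor_kernel_def by (rule F.generate_is_subgroup[OF sub])
  then have N: "?N \<lhd> ?F" by (rule F.subgroup_imp_normal)
  interpret N: normal ?N ?F by (rule N)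
  interpret T: group "tensor_group K A B"
    unfolding tensor_group_def by (rule N.factorgroup_is_group)
  have carr: "carrier (tensor_group K A B) = (\<lambda>x. ?N #>\<^bsub>?F\<^esub> x) ` carrier ?F"
    by (simp add: tensor_group_def carrier_FactGroup)
  obtain g where g: "g \<in> hom ?F G" and g_of: "\<And>x. x \<in> ?S \<Longrightarrow> g (frag_of x) = case_prod \<beta> x"
    by (rule G.free_Abelian_group_universal[of "case_prod \<beta>" ?S]) (use \<beta> in auto)
  interpret g: group_hom ?F G g by unfold_locales (rule g)
  have g_diff: "g (u - v) = g u \<otimes>\<^bsub>G\<^esub> inv\<^bsub>G\<^esub> g v" if "u \<in> carrier ?F" "v \<in> carrier ?F" for u v
  proof -
    have "u - v = u \<otimes>\<^bsub>?F\<^esub> inv\<^bsub>?F\<^esub> v" using that by simp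
    then show ?thesis using that by (metis F.inv_closed g.hom_inv g.hom_mult)
  qed
  have fr: "frag_of (a, b) \<in> carrier ?F" if "a \<in> carrier A" "b \<in> carrier B" for a b
    using that by simp
  have fr2: "frag_of x - frag_of y \<in> carrier ?F" if "x \<in> ?S" "y \<in> ?S" for x y :: "'b \<times> 'd"
    using that by (auto dest!: subsetD[OF keys_diff])
  have g2: "g (frag_of (a, b)) = \<beta> a b" if "a \<in> carrier A" "b \<in> carrier B" for a b
    using g_of[of "(a, b)"] that by simp
  have cancel: "x \<otimes>\<^bsub>G\<^esub> y \<otimes>\<^bsub>G\<^esub> inv\<^bsub>G\<^esub> x \<otimes>\<^bsub>G\<^esub> inv\<^bsub>G\<^esub> y = \<one>\<^bsub>G\<^esub>" if "x \<in> carrier G" "y \<in> carrier G" for x y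
    using that by (metis G.inv_closed G.m_closed G.inv_solve_right' G.m_comm G.r_inv G.m_assoc)
  have rel: "g u = \<one>\<^bsub>G\<^esub>" if uu: "u \<in> tensor_relations K A B" for u
  proof -
    consider
        (1) a a' b where "a \<in> carrier A" "a' \<in> carrier A" "b \<in> carrier B"
              "u = frag_of (a \<oplus>\<^bsub>A\<^esub> a', b) - frag_of (a, b) - frag_of (a', b)"
      | (2) a b b' where "a \<in> carrier A" "b \<in> carrier B" "b' \<in> carrier B"
              "u = frag_of (a, b \<oplus>\<^bsub>B\<^esub> b') - frag_of (a, b) - frag_of (a, b')"
      | (3) r a b where "r \<in> carrier K" "a \<in> carrier A" "b \<in> carrier B"
              "u = frag_of (r \<odot>\<^bsub>A\<^esub> a, b) - frag_of (a, r \<odot>\<^bsub>B\<^esub> b)"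
      using uu[unfolded tensor_relations_def]
      apply -
      apply (elim UnE CollectE exE conjE)
      subgoal by (rule 1)
      subgoal by (rule 2)
      subgoal by (rule 3)
      done
    then show ?thesis
    proof cases
      case 1
      then have "g u = g (frag_of (a \<oplus>\<^bsub>A\<^esub> a', b)) \<otimes>\<^bsub>G\<^esub> inv\<^bsub>G\<^esub> g (frag_of (a, b)) \<otimes>\<^bsub>G\<^esub> inv\<^bsub>G\<^esub> g (frag_of (a', b))"
        by (simp only: g_diff fr fr2 A.M.add.m_closed B.M.add.m_closed mem_Times_iff fst_conv snd_conv)
      then show ?thesis using 1 by (simp add: g2 add_l \<beta> cancel)
    next
      case 2
      then have "g u = g (frag_of (a, b \<oplus>\<^bsub>B\<^esub> b')) \<otimes>\<^bsub>G\<^esub> inv\<^bsub>G\<^esub> g (frag_of (a, b)) \<otimes>\<^bsub>G\<^esub> inv\<^bsub>G\<^esub> g (frag_of (a, b'))"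
        by (simp only: g_diff fr fr2 A.M.add.m_closed B.M.add.m_closed mem_Times_iff fst_conv snd_conv)
      then show ?thesis using 2 by (simp add: g2 add_r \<beta> cancel)
    next
      case 3
      then have "g u = g (frag_of (r \<odot>\<^bsub>A\<^esub> a, b)) \<otimes>\<^bsub>G\<^esub> inv\<^bsub>G\<^esub> g (frag_of (a, r \<odot>\<^bsub>B\<^esub> b))"
        by (simp only: g_diff fr A.smult_closed B.smult_closed)
      then show ?thesis using 3 by (simp add: g2 bal \<beta>)
    qed
  qed
  have gN: "g u = \<one>\<^bsub>G\<^esub>" if "u \<in> ?N" for u
    using that unfolding tensor_kernel_def
  proof (induction rule: generate.induct)
    case one show ?case by (rule g.hom_one)
  next
    case (incl h) then show ?case by (rule rel)
  next
    case (inv h)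
    then have "h \<in> carrier ?F" using sub by (rule subsetD[rotated])
    then show ?case using g.hom_inv[of h] rel[OF inv] by (simp only: G.inv_one)
  next
    case (eng h1 h2)
    then show ?case
      using g.hom_mult[OF F.generate_in_carrier[OF sub] F.generate_in_carrier[OF sub], OF eng(1,2)]
      by (simp only: G.l_one G.one_closed)
  qed
  have eqg: "g x = g y" if "x \<in> carrier ?F" "y \<in> carrier ?F" "?N #>\<^bsub>?F\<^esub> x = ?N #>\<^bsub>?F\<^esub> y" for x y
  proof -
    have "x \<in> ?N #>\<^bsub>?F\<^esub> y" using F.rcos_self[OF that(1) subN] that(3) by simp
    then obtain n where "n \<in> ?N" "x = n \<otimes>\<^bsub>?F\<^esub> y" unfolding r_coset_def by blast
    then show ?thesis using gN that(2) N.subset g.hom_mult[of n y] by (auto simp: subset_iff)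
  qed
  obtain h0 where h0: "h0 \<in> hom (?F Mod ?N) G" "\<And>x. x \<in> carrier ?F \<Longrightarrow> h0 (?N #>\<^bsub>?F\<^esub> x) = g x"
    using FactGroup_universal[OF g N eqg] by blast
  define h where "h = restrict h0 (carrier (tensor_group K A B))"
  have hh: "h \<in> hom (tensor_group K A B) G"
    using h0(1) T.m_closed unfolding h_def tensor_group_def hom_def by auto
  have hp: "h (pure K A B a b) = \<beta> a b" if "a \<in> carrier A" "b \<in> carrier B" for a b
    using that h0(2)[OF fr[OF that]] fr[OF that] by (simp add: h_def pure_def carr g_of)
  show ?thesis
  proof (rule ex1I[of _ h])
    show "h \<in> extensional (carrier (tensor_group K A B)) \<and> h \<in> hom (tensor_group K A B) G \<and>
           (\<forall>a\<in>carrier A. \<forall>b\<in>carrier B. h (pure K A B a b) = \<beta> a b)"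
      using hh hp by (auto simp: h_def)
  next
    fix k assume k: "k \<in> extensional (carrier (tensor_group K A B)) \<and> k \<in> hom (tensor_group K A B) G \<and>
           (\<forall>a\<in>carrier A. \<forall>b\<in>carrier B. k (pure K A B a b) = \<beta> a b)"
    have proj: "(\<lambda>x. ?N #>\<^bsub>?F\<^esub> x) \<in> hom ?F (tensor_group K A B)"
      unfolding tensor_group_def by (rule N.r_coset_hom_Mod)
    interpret k': group_hom ?F G "k \<circ> (\<lambda>x. ?N #>\<^bsub>?F\<^esub> x)"
      by unfold_locales (use hom_compose[OF proj] k in blast)
    have kg: "k (?N #>\<^bsub>?F\<^esub> x) = g x" if "Poly_Mapping.keys x \<subseteq> ?S" for x
      using that
    proof (rule free_Abelian_group_induct)
      show "k (?N #>\<^bsub>?F\<^esub> 0) = g 0" using k'.hom_one g.hom_one by simp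
    next
      fix x y
      assume xy: "Poly_Mapping.keys x \<subseteq> ?S" "Poly_Mapping.keys y \<subseteq> ?S"
        and IH: "k (?N #>\<^bsub>?F\<^esub> x) = g x" "k (?N #>\<^bsub>?F\<^esub> y) = g y"
      then have cxy: "x \<in> carrier ?F" "y \<in> carrier ?F" by simp_all
      have eq: "x - y = x \<otimes>\<^bsub>?F\<^esub> inv\<^bsub>?F\<^esub> y" using xy by simp
      show "k (?N #>\<^bsub>?F\<^esub> (x - y)) = g (x - y)"
        using k'.hom_mult[OF cxy(1) F.inv_closed[OF cxy(2)]] k'.hom_inv[OF cxy(2)]
          g_diff[OF cxy] IH unfolding eq by (simp only: o_apply)
    next
      fix x assume "x \<in> ?S"
      then show "k (?N #>\<^bsub>?F\<^esub> frag_of x) = g (frag_of x)" using k g_of by (cases x) (auto simp: pure_def)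
    qed
    show "k = h"
    proof (rule extensionalityI[of _ "carrier (tensor_group K A B)"])
      fix t assume "t \<in> carrier (tensor_group K A B)"
      then obtain x where "x \<in> carrier ?F" "t = ?N #>\<^bsub>?F\<^esub> x" unfolding carr by blast
      then show "k t = h t" using kg[of x] h0(2)[of x] by (auto simp: h_def carr)
    qed (use k in \<open>auto simp: h_def\<close>)
  qed
qed

text \<open>
  The tensor product of two algebras. Modules without a multiplication can be passed as well; then
  only the additive structure and \<open>smult\<close> are meaningful.
\<close>

definition tensor ::
  "'k ring \<Rightarrow> ('k, 'a, 'm) module_scheme \<Rightarrow> ('k, 'b, 'n) module_scheme \<Rightarrow> ('k, ('a, 'b) tens) module" where
  "tensor K A B =
     \<lparr>carrier = carrier (tensor_group K A B),
      monoid.mult = (\<lambda>s t. tensor_lift K A B (tensor_group K A B)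
               (\<lambda>a b. tensor_lift K A B (tensor_group K A B)
                  (\<lambda>a' b'. pure K A B (a \<otimes>\<^bsub>A\<^esub> a') (b \<otimes>\<^bsub>B\<^esub> b')) t) s),
      one = pure K A B \<one>\<^bsub>A\<^esub> \<one>\<^bsub>B\<^esub>,
      ring.zero = \<one>\<^bsub>tensor_group K A B\<^esub>,
      ring.add = monoid.mult (tensor_group K A B),
      smult = (\<lambda>r. tensor_lift K A B (tensor_group K A B) (\<lambda>a b. pure K A B (r \<odot>\<^bsub>A\<^esub> a) b))\<rparr>"

definition tensor_map ::
  "'k ring \<Rightarrow> ('k, 'a, 'm) module_scheme \<Rightarrow> ('k, 'b, 'n) module_scheme \<Rightarrow>
   ('k, 'c, 'p) module_scheme \<Rightarrow> ('k, 'd, 'q) module_scheme \<Rightarrow>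
   ('a \<Rightarrow> 'c) \<Rightarrow> ('b \<Rightarrow> 'd) \<Rightarrow> ('a, 'b) tens \<Rightarrow> ('c, 'd) tens" where
  "tensor_map K A B C D f g = tensor_lift K A B (tensor_group K C D) (\<lambda>a b. pure K C D (f a) (g b))"

definition tensor_flip ::
  "'k ring \<Rightarrow> ('k, 'a, 'm) module_scheme \<Rightarrow> ('k, 'b, 'n) module_scheme \<Rightarrow> ('a, 'b) tens \<Rightarrow> ('b, 'a) tens"
  where
  "tensor_flip K A B = tensor_lift K A B (tensor_group K B A) (\<lambda>a b. pure K B A b a)"

text \<open>Triple tensor products are bracketed to the left, via \<open>a \<otimes> (b \<otimes> c) \<mapsto> (a \<otimes> b) \<otimes> c\<close>.\<close>

definition tensor_assoc ::
  "'k ring \<Rightarrow> ('k, 'a, 'm) module_scheme \<Rightarrow> ('k, 'b, 'n) module_scheme \<Rightarrow> ('k, 'c, 'l) module_scheme \<Rightarrow>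
   ('a, ('b, 'c) tens) tens \<Rightarrow> (('a, 'b) tens, 'c) tens" where
  "tensor_assoc K A B C =
     tensor_lift K A (tensor K B C) (tensor_group K (tensor K A B) C)
       (\<lambda>a. tensor_lift K B C (tensor_group K (tensor K A B) C)
          (\<lambda>b c. pure K (tensor K A B) C (pure K A B a b) c))"

text \<open>\<open>Id \<otimes> \<tau> \<otimes> Id\<close>, that is, \<open>(a \<otimes> b) \<otimes> (c \<otimes> d) \<mapsto> (a \<otimes> c) \<otimes> (b \<otimes> d)\<close>.\<close>

definition tensor_middle_flip ::
  "'k ring \<Rightarrow> ('k, 'a, 'm) module_scheme \<Rightarrow> ('k, 'b, 'n) module_scheme \<Rightarrow>
   ('k, 'c, 'p) module_scheme \<Rightarrow> ('k, 'd, 'q) module_scheme \<Rightarrow>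
   (('a, 'b) tens, ('c, 'd) tens) tens \<Rightarrow> (('a, 'c) tens, ('b, 'd) tens) tens" where
  "tensor_middle_flip K A B C D =
     (let G = tensor_group K (tensor K A C) (tensor K B D) in
      tensor_lift K (tensor K A B) (tensor K C D) G
        (\<lambda>s t. tensor_lift K A B G
           (\<lambda>a b. tensor_lift K C D G
              (\<lambda>c d. pure K (tensor K A C) (tensor K B D) (pure K A C a c) (pure K B D b d)) t) s))"


section \<open>Bialgebras\<close>

text \<open>The multiplication need not be commutative, unlike in the locale \<open>algebra\<close>.\<close>

definition unital_algebra :: "'k ring \<Rightarrow> ('k, 'a, 'm) module_scheme \<Rightarrow> bool" where
  "unital_algebra K A \<longleftrightarrow>
     module K A \<and> ring A \<and>
     (\<forall>r\<in>carrier K. \<forall>a\<in>carrier A. \<forall>b\<in>carrier A.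
        (r \<odot>\<^bsub>A\<^esub> a) \<otimes>\<^bsub>A\<^esub> b = r \<odot>\<^bsub>A\<^esub> (a \<otimes>\<^bsub>A\<^esub> b) \<and> a \<otimes>\<^bsub>A\<^esub> (r \<odot>\<^bsub>A\<^esub> b) = r \<odot>\<^bsub>A\<^esub> (a \<otimes>\<^bsub>A\<^esub> b))"

definition algebra_hom ::
  "'k ring \<Rightarrow> ('k, 'a, 'm) module_scheme \<Rightarrow> ('k, 'b, 'n) module_scheme \<Rightarrow> ('a \<Rightarrow> 'b) set" where
  "algebra_hom K A B =
     {f \<in> ring_hom A B. \<forall>r\<in>carrier K. \<forall>a\<in>carrier A. f (r \<odot>\<^bsub>A\<^esub> a) = r \<odot>\<^bsub>B\<^esub> f a}"

record ('k, 'a) bialg = "('k, 'a) module" +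
  comul :: "'a \<Rightarrow> ('a, 'a) tens"
  counit :: "'a \<Rightarrow> 'k"

text \<open>
  \<open>Id \<otimes> \<epsilon>\<close> and \<open>\<epsilon> \<otimes> Id\<close>, composed with the identifications \<open>A \<otimes> K = A\<close> and \<open>K \<otimes> B = B\<close>.
\<close>

definition id_counit ::
  "'k ring \<Rightarrow> ('k, 'a) bialg \<Rightarrow> ('k, 'b) bialg \<Rightarrow> ('a, 'b) tens \<Rightarrow> 'a" where
  "id_counit K A B = tensor_lift K A B (add_monoid A) (\<lambda>a b. counit B b \<odot>\<^bsub>A\<^esub> a)"

definition counit_id ::
  "'k ring \<Rightarrow> ('k, 'a) bialg \<Rightarrow> ('k, 'b) bialg \<Rightarrow> ('a, 'b) tens \<Rightarrow> 'b" where
  "counit_id K A B = tensor_lift K A B (add_monoid B) (\<lambda>a b. counit A a \<odot>\<^bsub>B\<^esub> b)"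

text \<open>\<open>\<Delta> \<otimes> Id\<close> and \<open>Id \<otimes> \<Delta>\<close> on \<open>H \<otimes> H\<close>; the latter takes values in \<open>H \<otimes> (H \<otimes> H)\<close>.\<close>

definition comul_id :: "'k ring \<Rightarrow> ('k, 'a) bialg \<Rightarrow> ('a, 'a) tens \<Rightarrow> (('a, 'a) tens, 'a) tens" where
  "comul_id K H = tensor_map K H H (tensor K H H) H (comul H) (\<lambda>x. x)"

definition id_comul :: "'k ring \<Rightarrow> ('k, 'a) bialg \<Rightarrow> ('a, 'a) tens \<Rightarrow> ('a, ('a, 'a) tens) tens" where
  "id_comul K H = tensor_map K H H H (tensor K H H) (\<lambda>x. x) (comul H)"

definition bialgebra :: "'k ring \<Rightarrow> ('k, 'a) bialg \<Rightarrow> bool" where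
  "bialgebra K H \<longleftrightarrow>
     unital_algebra K H \<and>
     comul H \<in> algebra_hom K H (tensor K H H) \<and>
     counit H \<in> ring_hom H K \<and>
     (\<forall>r\<in>carrier K. \<forall>x\<in>carrier H. counit H (r \<odot>\<^bsub>H\<^esub> x) = r \<otimes>\<^bsub>K\<^esub> counit H x) \<and>
     (\<forall>x\<in>carrier H. comul_id K H (comul H x) = tensor_assoc K H H H (id_comul K H (comul H x))) \<and>
     (\<forall>x\<in>carrier H. counit_id K H H (comul H x) = x \<and> id_counit K H H (comul H x) = x)"

definition bialgebra_hom ::
  "'k ring \<Rightarrow> ('k, 'a) bialg \<Rightarrow> ('k, 'b) bialg \<Rightarrow> ('a \<Rightarrow> 'b) set" where
  "bialgebra_hom K H H' =
     {f \<in> algebra_hom K H H'. \<forall>x\<in>carrier H.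
        comul H' (f x) = tensor_map K H H H' H' f f (comul H x) \<and> counit H' (f x) = counit H x}"

definition tensor_bialgebra ::
  "'k ring \<Rightarrow> ('k, 'a) bialg \<Rightarrow> ('k, 'b) bialg \<Rightarrow> ('k, ('a, 'b) tens) bialg" where
  "tensor_bialgebra K A B =
     \<lparr>carrier = carrier (tensor K A B), monoid.mult = monoid.mult (tensor K A B), one = one (tensor K A B),
      ring.zero = ring.zero (tensor K A B), ring.add = ring.add (tensor K A B), smult = smult (tensor K A B),
      comul = (\<lambda>t. tensor_middle_flip K A A B B
                (tensor_map K A B (tensor K A A) (tensor K B B) (comul A) (comul B) t)),
      counit = tensor_lift K A B (add_monoid K) (\<lambda>a b. counit A a \<otimes>\<^bsub>K\<^esub> counit B b)\<rparr>"


section \<open>Triangular bialgebras and twists\<close>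

text \<open>The leg embeddings \<open>H \<otimes> H \<rightarrow> (H \<otimes> H) \<otimes> H\<close>.\<close>

definition leg12 :: "'k ring \<Rightarrow> ('k, 'a) bialg \<Rightarrow> ('a, 'a) tens \<Rightarrow> (('a, 'a) tens, 'a) tens" where
  "leg12 K H t = pure K (tensor K H H) H t \<one>\<^bsub>H\<^esub>"

definition leg13 :: "'k ring \<Rightarrow> ('k, 'a) bialg \<Rightarrow> ('a, 'a) tens \<Rightarrow> (('a, 'a) tens, 'a) tens" where
  "leg13 K H = tensor_lift K H H (tensor_group K (tensor K H H) H)
     (\<lambda>a b. pure K (tensor K H H) H (pure K H H a \<one>\<^bsub>H\<^esub>) b)"

definition leg23 :: "'k ring \<Rightarrow> ('k, 'a) bialg \<Rightarrow> ('a, 'a) tens \<Rightarrow> (('a, 'a) tens, 'a) tens" where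
  "leg23 K H = tensor_lift K H H (tensor_group K (tensor K H H) H)
     (\<lambda>a b. pure K (tensor K H H) H (pure K H H \<one>\<^bsub>H\<^esub> a) b)"

type_synonym ('k, 'a) tribialg = "('k, 'a) bialg \<times> ('a, 'a) tens"

definition triangular_bialgebra :: "'k ring \<Rightarrow> ('k, 'a) tribialg \<Rightarrow> bool" where
  "triangular_bialgebra K = (\<lambda>(H, R).
     let H2 = tensor K H H; H3 = tensor K (tensor K H H) H in
     bialgebra K H \<and>
     R \<in> Units H2 \<and>
     (\<forall>x\<in>carrier H. tensor_flip K H H (comul H x) = R \<otimes>\<^bsub>H2\<^esub> comul H x \<otimes>\<^bsub>H2\<^esub> inv\<^bsub>H2\<^esub> R) \<and>
     tensor_assoc K H H H (id_comul K H R) = leg13 K H R \<otimes>\<^bsub>H3\<^esub> leg12 K H R \<and>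
     comul_id K H R = leg13 K H R \<otimes>\<^bsub>H3\<^esub> leg23 K H R \<and>
     inv\<^bsub>H2\<^esub> R = tensor_flip K H H R)"

definition triangular_hom ::
  "'k ring \<Rightarrow> ('k, 'a) tribialg \<Rightarrow> ('k, 'b) tribialg \<Rightarrow> ('a \<Rightarrow> 'b) set" where
  "triangular_hom K = (\<lambda>(H, R) (H', R').
     {f \<in> bialgebra_hom K H H'. tensor_map K H H H' H' f f R = R'})"

definition is_twist :: "'k ring \<Rightarrow> ('k, 'a) bialg \<Rightarrow> ('a, 'a) tens \<Rightarrow> bool" where
  "is_twist K H F \<longleftrightarrow>
     F \<in> Units (tensor K H H) \<and>
     pure K (tensor K H H) H F \<one>\<^bsub>H\<^esub> \<otimes>\<^bsub>tensor K (tensor K H H) H\<^esub> comul_id K H F =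
       tensor_assoc K H H H
         (pure K H (tensor K H H) \<one>\<^bsub>H\<^esub> F \<otimes>\<^bsub>tensor K H (tensor K H H)\<^esub> id_comul K H F) \<and>
     counit_id K H H F = \<one>\<^bsub>H\<^esub> \<and>
     id_counit K H H F = \<one>\<^bsub>H\<^esub>"

definition twisted :: "'k ring \<Rightarrow> ('k, 'a) tribialg \<Rightarrow> ('a, 'a) tens \<Rightarrow> ('k, 'a) tribialg" where
  "twisted K = (\<lambda>(H, R) F.
     let H2 = tensor K H H in
     (H\<lparr>comul := (\<lambda>x. F \<otimes>\<^bsub>H2\<^esub> comul H x \<otimes>\<^bsub>H2\<^esub> inv\<^bsub>H2\<^esub> F)\<rparr>,
      tensor_flip K H H F \<otimes>\<^bsub>H2\<^esub> R \<otimes>\<^bsub>H2\<^esub> inv\<^bsub>H2\<^esub> F))"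

definition tensor_triangular ::
  "'k ring \<Rightarrow> ('k, 'a) tribialg \<Rightarrow> ('k, 'b) tribialg \<Rightarrow> ('k, ('a, 'b) tens) tribialg" where
  "tensor_triangular K = (\<lambda>(H1, R1) (H2, R2).
     (tensor_bialgebra K H1 H2,
      tensor_middle_flip K H1 H1 H2 H2 (pure K (tensor K H1 H1) (tensor K H2 H2) R1 R2)))"


section \<open>The 2-category \<open>TwTr\<close>\<close>

text \<open>
  The 0-cells are the triangular bialgebras over \<open>K\<close> on arbitrary carrier types. The underlying map
  of a 1-cell is extensional, so that equality of 1-cells is equality on the carrier.
\<close>

type_synonym ('a, 'b) cell1 = "('a \<Rightarrow> 'b) \<times> ('b, 'b) tens"

definition twtr_1cells ::
  "'k ring \<Rightarrow> ('k, 'a) tribialg \<Rightarrow> ('k, 'b) tribialg \<Rightarrow> ('a, 'b) cell1 set" where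
  "twtr_1cells K X Y =
     {(f, F). is_twist K (fst Y) F \<and> f \<in> extensional (carrier (fst X)) \<and>
              f \<in> triangular_hom K X (twisted K Y F)}"

definition twtr_2cells ::
  "'k ring \<Rightarrow> ('k, 'a) tribialg \<Rightarrow> ('k, 'b) tribialg \<Rightarrow> ('a, 'b) cell1 \<Rightarrow> ('a, 'b) cell1 \<Rightarrow> 'b set" where
  "twtr_2cells K X Y = (\<lambda>(f, F) (f', F').
     let H = fst X; H' = fst Y in
     {a \<in> carrier H'.
        counit H' a = \<one>\<^bsub>K\<^esub> \<and>
        pure K H' H' a a \<otimes>\<^bsub>tensor K H' H'\<^esub> F = F' \<otimes>\<^bsub>tensor K H' H'\<^esub> comul H' a \<and>
        (\<forall>x\<in>carrier H. a \<otimes>\<^bsub>H'\<^esub> f x = f' x \<otimes>\<^bsub>H'\<^esub> a)})"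

definition twtr_id1 :: "'k ring \<Rightarrow> ('k, 'a) tribialg \<Rightarrow> ('a, 'a) cell1" where
  "twtr_id1 K X = (restrict (\<lambda>x. x) (carrier (fst X)), \<one>\<^bsub>tensor K (fst X) (fst X)\<^esub>)"

definition twtr_comp1 ::
  "'k ring \<Rightarrow> ('k, 'a) tribialg \<Rightarrow> ('k, 'b) tribialg \<Rightarrow> ('k, 'c) tribialg \<Rightarrow>
   ('b, 'c) cell1 \<Rightarrow> ('a, 'b) cell1 \<Rightarrow> ('a, 'c) cell1" where
  "twtr_comp1 K X Y Z = (\<lambda>(f', F') (f, F).
     (compose (carrier (fst X)) f' f,
      tensor_map K (fst Y) (fst Y) (fst Z) (fst Z) f' f' F \<otimes>\<^bsub>tensor K (fst Z) (fst Z)\<^esub> F'))"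

definition twtr_id2 :: "('k, 'b) tribialg \<Rightarrow> 'b" where
  "twtr_id2 Y = \<one>\<^bsub>fst Y\<^esub>"

definition twtr_vcomp :: "('k, 'b) tribialg \<Rightarrow> 'b \<Rightarrow> 'b \<Rightarrow> 'b" where
  "twtr_vcomp Y a b = a \<otimes>\<^bsub>fst Y\<^esub> b"

text \<open>
  Horizontal composition of \<open>b : (f, F) \<Rightarrow> (f', F')\<close> with a 2-cell \<open>a : (g, G) \<Rightarrow> (g', G')\<close> into \<open>Z\<close>.
\<close>

definition twtr_hcomp :: "('k, 'c) tribialg \<Rightarrow> ('b, 'c) cell1 \<Rightarrow> 'c \<Rightarrow> 'b \<Rightarrow> 'c" where
  "twtr_hcomp Z = (\<lambda>(g, G) a b. a \<otimes>\<^bsub>fst Z\<^esub> g b)"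

definition twtr_hom_cat ::
  "'k ring \<Rightarrow> ('k, 'a) tribialg \<Rightarrow> ('k, 'b) tribialg \<Rightarrow> (('a, 'b) cell1, 'b) cat" where
  "twtr_hom_cat K X Y =
     \<lparr>Ob = twtr_1cells K X Y,
      Hom = twtr_2cells K X Y,
      Comp = (\<lambda>_ _ _. twtr_vcomp Y),
      Ident = (\<lambda>_. twtr_id2 Y)\<rparr>"

text \<open>The functor \<open>h \<mapsto> (p h, q h)\<close>, \<open>\<gamma> \<mapsto> (p \<gamma>, q \<gamma>)\<close>.\<close>

definition twtr_pairing ::
  "'k ring \<Rightarrow> ('k, 'c) tribialg \<Rightarrow> ('k, 'p) tribialg \<Rightarrow> ('k, 'a) tribialg \<Rightarrow> ('k, 'b) tribialg \<Rightarrow>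
   ('p, 'a) cell1 \<Rightarrow> ('p, 'b) cell1 \<Rightarrow>
   (('c, 'p) cell1, 'p, ('c, 'a) cell1 \<times> ('c, 'b) cell1, 'a \<times> 'b) func" where
  "twtr_pairing K X P A B p q =
     \<lparr>on_ob = (\<lambda>h. (twtr_comp1 K X P A p h, twtr_comp1 K X P B q h)),
      on_hom = (\<lambda>_ _ \<gamma>. (twtr_hcomp A p (twtr_id2 A) \<gamma>, twtr_hcomp B q (twtr_id2 B) \<gamma>))\<rparr>"

text \<open>
  \<open>(P, p, q)\<close> is a product of \<open>A\<close> and \<open>B\<close>. A formula cannot quantify over types, so the test objects
  \<open>X\<close> range over the 0-cells with elements in the type given by the first argument; a theorem in
  which this type is a type variable covers all 0-cells \<open>X\<close>.
\<close>

definition twtr_product ::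
  "'c itself \<Rightarrow> 'k ring \<Rightarrow> ('k, 'a) tribialg \<Rightarrow> ('k, 'b) tribialg \<Rightarrow>
   ('k, 'p) tribialg \<Rightarrow> ('p, 'a) cell1 \<Rightarrow> ('p, 'b) cell1 \<Rightarrow> bool" where
  "twtr_product _ K A B P p q \<longleftrightarrow>
     triangular_bialgebra K P \<and> p \<in> twtr_1cells K P A \<and> q \<in> twtr_1cells K P B \<and>
     (\<forall>X :: ('k, 'c) tribialg. triangular_bialgebra K X \<longrightarrow>
        is_equivalence (twtr_hom_cat K X P) (prod_cat (twtr_hom_cat K X A) (twtr_hom_cat K X B))
          (twtr_pairing K X P A B p q))"

end

theory Submission
  imports Defs
begin

text \<open>
  A leg identity in a tensor power of \<open>H\<close> holds if and only if it holds after applying the map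
  \<open>\<phi>\<^sub>1 \<otimes> \<dots> \<otimes> \<phi>\<^sub>n\<close> induced by arbitrary algebra maps \<open>\<phi>\<^sub>i\<close> from \<open>H\<close> to one algebra \<open>Z\<close> with pairwise commuting
  images. Write \<open>T(\<phi>, \<psi>)\<close> for the image of \<open>T\<close> under \<open>a \<otimes> b \<mapsto> \<phi>(a) \<psi>(b)\<close> and \<open>\<phi> * \<psi>\<close> for the convolution
  product. Then the axioms of \<open>R\<close> read \<open>R(\<phi> * \<psi>, \<chi>) = R(\<phi>, \<chi>) R(\<psi>, \<chi>)\<close>,
  \<open>R(\<phi>, \<psi> * \<chi>) = R(\<phi>, \<chi>) R(\<phi>, \<psi>)\<close>, \<open>R(\<phi>, \<psi>) (\<phi> * \<psi>) = (\<psi> * \<phi>) R(\<phi>, \<psi>)\<close> and \<open>R(\<phi>, \<psi>) R(\<psi>, \<phi>) = 1\<close>, and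
  that of a twist reads \<open>F(\<phi>, \<psi>) F(\<phi> * \<psi>, \<chi>) = F(\<psi>, \<chi>) F(\<phi>, \<psi> * \<chi>)\<close>. An algebra map on \<open>H\<^sub>1 \<otimes> H\<^sub>2\<close> is
  a commuting pair of algebra maps on \<open>H\<^sub>1\<close> and \<open>H\<^sub>2\<close>, and convolution is componentwise.

  The inverse functor sends \<open>((f, F), (g, G))\<close> to \<open>(f \<otimes> g) \<Delta>\<close> with the twist whose value at
  \<open>(\<phi>\<^sub>1, \<phi>\<^sub>2)\<close>, \<open>(\<psi>\<^sub>1, \<psi>\<^sub>2)\<close> is \<open>R(\<psi>\<^sub>1 f, \<phi>\<^sub>2 g) F(\<phi>\<^sub>1, \<psi>\<^sub>1) G(\<phi>\<^sub>2, \<psi>\<^sub>2)\<close>, and 2-cells \<open>(a, b)\<close> to \<open>a \<otimes> b\<close>. It is a strict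
  section of the pairing functor \<open>h \<mapsto> (p h, q h)\<close>. In the other direction, a 1-cell \<open>(h, F)\<close> into
  \<open>H\<^sub>1 \<otimes> H\<^sub>2\<close> is isomorphic to the pairing of its projections through the gauge transformation
  \<open>(p \<otimes> q)(F)\<close>, because \<open>(p \<otimes> q) \<Delta> = Id\<close>.
\<close>

section \<open>The tensor product of modules\<close>

text \<open>The construction is the bialgebra form of a fact on symmetric monoidal categories. A
  1-cell \<open>(f, F)\<close> makes restriction of modules along \<open>f\<close> a symmetric
  monoidal functor: \<open>F\<close> acts as the isomorphism from the restriction of V \<otimes> W
  to the tensor product of the restrictions, and the condition on R-matrices is compatibility with
  the symmetries. A 2-cell is a monoidal natural transformation. The pairing of \<open>f\<close> and
  \<open>g\<close> sends V \<otimes> W, with V a module over the first factor and W over the second,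
  to the tensor product of V restricted along \<open>f\<close> and W restricted along
  \<open>g\<close>. Its monoidal structure must exchange two inner factors, and the symmetry of the
  source does this; that is the origin of the factor R in the twist. Compatibility with the
  symmetries then rests on R being inverse to its own flip. Conversely V \<otimes> W is the tensor
  product of V and W, each restricted along a projection. The monoidal structure of an arbitrary
  1-cell \<open>(h, F)\<close> at these two modules is the action of
  \<open>(p \<otimes> q)(F)\<close>, which is why this element compares \<open>h\<close> with the
  pairing of its projections.\<close>

lemma tensor_simps [simp]:
  "carrier (tensor K A B) = carrier (tensor_group K A B)"
  "ring.add (tensor K A B) = monoid.mult (tensor_group K A B)"
  "ring.zero (tensor K A B) = one (tensor_group K A B)"
  "one (tensor K A B) = pure K A B \<one>\<^bsub>A\<^esub> \<one>\<^bsub>B\<^esub>"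
  by (simp_all add: tensor_def)

text \<open>\<open>tensor_lift\<close> sees its target only through carrier and multiplication, and
  the addition of \<open>tensor K C D\<close> is the multiplication of
  \<open>tensor_group K C D\<close>. After this rewriting every lift has a target of the form
  \<open>add_monoid Z\<close>, so one set of rules covers lifts into tensor products and into
  algebras.\<close>

lemma tensor_lift_tensor_group:
  "tensor_lift K A B (tensor_group K C D) = tensor_lift K A B (add_monoid (tensor K C D))"
  by (simp add: tensor_lift_def hom_def fun_eq_iff)

section \<open>Bilinearity of pure tensors and induction over them\<close>

context
  fixes K :: "'k ring"
    and A :: "('k, 'a, 'm) module_scheme"
    and B :: "('k, 'b, 'n) module_scheme"
  assumes A: "module K A" and B: "module K B"
begin

interpretation A: module K A by (rule A)
interpretation B: module K B by (rule B)

abbreviation (input) FAB where "FAB \<equiv> free_Abelian_group (carrier A \<times> carrier B)"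
abbreviation (input) NAB where "NAB \<equiv> tensor_kernel K A B"

interpretation F: comm_group FAB by (rule abelian_free_Abelian_group)

lemma tensor_kernel_normal: "normal NAB FAB"
proof -
  have "subgroup NAB FAB"
    unfolding tensor_kernel_def by (rule F.generate_is_subgroup[OF tensor_relations_subset[OF A B]])
  then show ?thesis by (rule F.subgroup_imp_normal)
qed

interpretation N: normal NAB FAB by (rule tensor_kernel_normal)

lemma tensor_group_comm: "comm_group (tensor_group K A B)"
  unfolding tensor_group_def by (rule F.abelian_FactGroup) (rule N.subgroup_axioms)

interpretation T: comm_group "tensor_group K A B" by (rule tensor_group_comm)

interpretation proj: group_hom FAB "tensor_group K A B" "\<lambda>x. NAB #>\<^bsub>FAB\<^esub> x"
  by unfold_locales (simp add: tensor_group_def N.r_coset_hom_Mod)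

lemma pure_closed [simp, intro]:
  "a \<in> carrier A \<Longrightarrow> b \<in> carrier B \<Longrightarrow> pure K A B a b \<in> carrier (tensor_group K A B)"
  unfolding pure_def by (rule proj.hom_closed) simp

lemma tensor_relation_trivial:
  assumes "u \<in> tensor_relations K A B"
  shows "NAB #>\<^bsub>FAB\<^esub> u = \<one>\<^bsub>tensor_group K A B\<^esub>"
proof -
  have "u \<in> NAB" unfolding tensor_kernel_def using assms by (rule generate.incl)
  then show ?thesis
    using N.rcos_const[OF F.group_axioms] by (simp add: tensor_group_def)
qed

lemma proj_diff:
  assumes "x \<in> carrier FAB" "y \<in> carrier FAB"
  shows "NAB #>\<^bsub>FAB\<^esub> (x - y) =
    (NAB #>\<^bsub>FAB\<^esub> x) \<otimes>\<^bsub>tensor_group K A B\<^esub> inv\<^bsub>tensor_group K A B\<^esub> (NAB #>\<^bsub>FAB\<^esub> y)"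
proof -
  have eq: "x - y = x \<otimes>\<^bsub>FAB\<^esub> inv\<^bsub>FAB\<^esub> y" using assms by simp
  show ?thesis
    unfolding eq using assms by (simp only: proj.hom_mult proj.hom_inv F.inv_closed)
qed

lemma frag_diff_closed:
  "x \<in> carrier FAB \<Longrightarrow> y \<in> carrier FAB \<Longrightarrow> x - y \<in> carrier FAB"
  using keys_diff[of x y] by auto

lemma pure_add_left:
  assumes "a \<in> carrier A" "a' \<in> carrier A" "b \<in> carrier B"
  shows "pure K A B (a \<oplus>\<^bsub>A\<^esub> a') b = pure K A B a b \<otimes>\<^bsub>tensor_group K A B\<^esub> pure K A B a' b"
proof -
  let ?x = "pure K A B (a \<oplus>\<^bsub>A\<^esub> a') b" and ?y = "pure K A B a b" and ?z = "pure K A B a' b"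
  have fr: "frag_of (a \<oplus>\<^bsub>A\<^esub> a', b) \<in> carrier FAB" "frag_of (a, b) \<in> carrier FAB" "frag_of (a', b) \<in> carrier FAB"
    using assms by auto
  have "frag_of (a \<oplus>\<^bsub>A\<^esub> a', b) - frag_of (a, b) - frag_of (a', b) \<in> tensor_relations K A B"
    unfolding tensor_relations_def using assms by blast
  from tensor_relation_trivial[OF this]
  have 1: "?x \<otimes>\<^bsub>tensor_group K A B\<^esub> inv\<^bsub>tensor_group K A B\<^esub> ?y \<otimes>\<^bsub>tensor_group K A B\<^esub> inv\<^bsub>tensor_group K A B\<^esub> ?z
      = \<one>\<^bsub>tensor_group K A B\<^esub>"
    by (simp only: proj_diff frag_diff_closed fr pure_def)
  have c: "?x \<in> carrier (tensor_group K A B)" "?y \<in> carrier (tensor_group K A B)" "?z \<in> carrier (tensor_group K A B)"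
    using assms by auto
  from 1 c show ?thesis
    by (metis T.inv_closed T.inv_solve_right T.inv_inv T.l_one T.m_closed T.m_comm T.one_closed)
qed

lemma pure_add_right:
  assumes "a \<in> carrier A" "b \<in> carrier B" "b' \<in> carrier B"
  shows "pure K A B a (b \<oplus>\<^bsub>B\<^esub> b') = pure K A B a b \<otimes>\<^bsub>tensor_group K A B\<^esub> pure K A B a b'"
proof -
  let ?x = "pure K A B a (b \<oplus>\<^bsub>B\<^esub> b')" and ?y = "pure K A B a b" and ?z = "pure K A B a b'"
  have fr: "frag_of (a, b \<oplus>\<^bsub>B\<^esub> b') \<in> carrier FAB" "frag_of (a, b) \<in> carrier FAB" "frag_of (a, b') \<in> carrier FAB"
    using assms by auto
  have "frag_of (a, b \<oplus>\<^bsub>B\<^esub> b') - frag_of (a, b) - frag_of (a, b') \<in> tensor_relations K A B"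
    unfolding tensor_relations_def using assms by blast
  from tensor_relation_trivial[OF this]
  have 1: "?x \<otimes>\<^bsub>tensor_group K A B\<^esub> inv\<^bsub>tensor_group K A B\<^esub> ?y \<otimes>\<^bsub>tensor_group K A B\<^esub> inv\<^bsub>tensor_group K A B\<^esub> ?z
      = \<one>\<^bsub>tensor_group K A B\<^esub>"
    by (simp only: proj_diff frag_diff_closed fr pure_def)
  have c: "?x \<in> carrier (tensor_group K A B)" "?y \<in> carrier (tensor_group K A B)" "?z \<in> carrier (tensor_group K A B)"
    using assms by auto
  from 1 c show ?thesis
    by (metis T.inv_closed T.inv_solve_right T.inv_inv T.l_one T.m_closed T.m_comm T.one_closed)
qed

lemma pure_balanced:
  assumes "r \<in> carrier K" "a \<in> carrier A" "b \<in> carrier B"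
  shows "pure K A B (r \<odot>\<^bsub>A\<^esub> a) b = pure K A B a (r \<odot>\<^bsub>B\<^esub> b)"
proof -
  let ?x = "pure K A B (r \<odot>\<^bsub>A\<^esub> a) b" and ?y = "pure K A B a (r \<odot>\<^bsub>B\<^esub> b)"
  have fr: "frag_of (r \<odot>\<^bsub>A\<^esub> a, b) \<in> carrier FAB" "frag_of (a, r \<odot>\<^bsub>B\<^esub> b) \<in> carrier FAB"
    using assms by auto
  have "frag_of (r \<odot>\<^bsub>A\<^esub> a, b) - frag_of (a, r \<odot>\<^bsub>B\<^esub> b) \<in> tensor_relations K A B"
    unfolding tensor_relations_def using assms by blast
  from tensor_relation_trivial[OF this]
  have 1: "?x \<otimes>\<^bsub>tensor_group K A B\<^esub> inv\<^bsub>tensor_group K A B\<^esub> ?y = \<one>\<^bsub>tensor_group K A B\<^esub>"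
    by (simp only: proj_diff fr pure_def)
  have c: "?x \<in> carrier (tensor_group K A B)" "?y \<in> carrier (tensor_group K A B)"
    using assms by auto
  from 1 c show ?thesis
    by (metis T.inv_closed T.inv_inv T.inv_equality)
qed

lemma pure_zero_left:
  assumes "b \<in> carrier B"
  shows "pure K A B \<zero>\<^bsub>A\<^esub> b = \<one>\<^bsub>tensor_group K A B\<^esub>"
  using pure_add_left[of "\<zero>\<^bsub>A\<^esub>" "\<zero>\<^bsub>A\<^esub>" b] assms by simp

lemma pure_minus_left:
  assumes "a \<in> carrier A" "b \<in> carrier B"
  shows "pure K A B (\<ominus>\<^bsub>A\<^esub> a) b = inv\<^bsub>tensor_group K A B\<^esub> pure K A B a b"
  using pure_add_left[of "\<ominus>\<^bsub>A\<^esub> a" a b] assms pure_zero_left[of b]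
  by (simp add: A.M.l_neg T.inv_equality)

text \<open>The induction rule of the free abelian group runs over differences, whereas the premises
  here speak of sums. The claim is therefore proved for a class together with its inverse; the
  inverse of \<open>pure K A B a b\<close> is the pure tensor with \<ominus> a in place of
  \<open>a\<close>, so the generators are covered.\<close>

lemma tensor_induct_aux:
  assumes t: "t \<in> carrier (tensor_group K A B)"
    and pure: "\<And>a b. a \<in> carrier A \<Longrightarrow> b \<in> carrier B \<Longrightarrow> P (pure K A B a b)"
    and add: "\<And>s t. s \<in> carrier (tensor_group K A B) \<Longrightarrow> t \<in> carrier (tensor_group K A B) \<Longrightarrow>
                 P s \<Longrightarrow> P t \<Longrightarrow> P (s \<otimes>\<^bsub>tensor_group K A B\<^esub> t)"
  shows "P t"
proof -
  obtain x where x: "x \<in> carrier FAB" "t = NAB #>\<^bsub>FAB\<^esub> x"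
    using t by (auto simp: tensor_group_def carrier_FactGroup)
  let ?p = "\<lambda>x. NAB #>\<^bsub>FAB\<^esub> x"
  have "P (?p x) \<and> P (inv\<^bsub>tensor_group K A B\<^esub> ?p x)"
  proof (rule free_Abelian_group_induct[of x "carrier A \<times> carrier B"], goal_cases)
    case 1
    show ?case using x by simp
  next
    case 2
    have "?p 0 = pure K A B \<zero>\<^bsub>A\<^esub> \<zero>\<^bsub>B\<^esub>" using pure_zero_left proj.hom_one by simp
    then show ?case using pure[of "\<zero>\<^bsub>A\<^esub>" "\<zero>\<^bsub>B\<^esub>"] pure_zero_left[of "\<zero>\<^bsub>B\<^esub>"] by simp
  next
    case (3 x y)
    then have xy: "x \<in> carrier FAB" "y \<in> carrier FAB" by auto
    then have c: "?p x \<in> carrier (tensor_group K A B)" "?p y \<in> carrier (tensor_group K A B)"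
      by (auto intro!: proj.hom_closed)
    show ?case
      using add[of "?p x" "inv\<^bsub>tensor_group K A B\<^esub> ?p y"] add[of "inv\<^bsub>tensor_group K A B\<^esub> ?p x" "?p y"] 3 c
      by (simp only: proj_diff[OF xy] T.inv_mult T.inv_inv T.inv_closed)
  next
    case (4 z)
    then obtain a b where z: "z = (a, b)" "a \<in> carrier A" "b \<in> carrier B" by auto
    then show ?case
      using pure[of a b] pure[of "\<ominus>\<^bsub>A\<^esub> a" b] pure_minus_left[of a b] by (simp add: pure_def)
  qed
  with x show ?thesis by simp
qed

end

lemma tensor_induct [consumes 3, case_names pure add]:
  assumes "module K A" "module K B" "t \<in> carrier (tensor_group K A B)"
    and "\<And>a b. a \<in> carrier A \<Longrightarrow> b \<in> carrier B \<Longrightarrow> P (pure K A B a b)"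
    and "\<And>s t. s \<in> carrier (tensor_group K A B) \<Longrightarrow> t \<in> carrier (tensor_group K A B) \<Longrightarrow>
                 P s \<Longrightarrow> P t \<Longrightarrow> P (s \<otimes>\<^bsub>tensor_group K A B\<^esub> t)"
  shows "P t"
  using assms by (rule tensor_induct_aux)

text \<open>The target enters through its additive group, and linearity over \<open>K\<close> is
  replaced by moving a scalar from one argument to the other. The same notion thus serves maps into
  algebras, into tensor products and into the ground ring.\<close>

definition balanced ::
  "'k ring \<Rightarrow> ('k, 'a, 'm) module_scheme \<Rightarrow> ('k, 'b, 'n) module_scheme \<Rightarrow> ('c, 'l) ring_scheme \<Rightarrow>
   ('a \<Rightarrow> 'b \<Rightarrow> 'c) \<Rightarrow> bool" where
  "balanced K A B Z \<beta> \<longleftrightarrow> module K A \<and> module K B \<and> abelian_group Z \<and>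
     (\<forall>a\<in>carrier A. \<forall>b\<in>carrier B. \<beta> a b \<in> carrier Z) \<and>
     (\<forall>a\<in>carrier A. \<forall>a'\<in>carrier A. \<forall>b\<in>carrier B. \<beta> (a \<oplus>\<^bsub>A\<^esub> a') b = \<beta> a b \<oplus>\<^bsub>Z\<^esub> \<beta> a' b) \<and>
     (\<forall>a\<in>carrier A. \<forall>b\<in>carrier B. \<forall>b'\<in>carrier B. \<beta> a (b \<oplus>\<^bsub>B\<^esub> b') = \<beta> a b \<oplus>\<^bsub>Z\<^esub> \<beta> a b') \<and>
     (\<forall>r\<in>carrier K. \<forall>a\<in>carrier A. \<forall>b\<in>carrier B. \<beta> (r \<odot>\<^bsub>A\<^esub> a) b = \<beta> a (r \<odot>\<^bsub>B\<^esub> b))"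

lemma tensor_lift_all:
  assumes "balanced K A B Z \<beta>"
  shows "tensor_lift K A B (add_monoid Z) \<beta> \<in> extensional (carrier (tensor_group K A B)) \<and>
    tensor_lift K A B (add_monoid Z) \<beta> \<in> hom (tensor_group K A B) (add_monoid Z) \<and>
    (\<forall>a\<in>carrier A. \<forall>b\<in>carrier B. tensor_lift K A B (add_monoid Z) \<beta> (pure K A B a b) = \<beta> a b)"
  unfolding tensor_lift_def
  by (rule theI'[OF tensor_lift_ex1])
    (use assms in \<open>auto simp: balanced_def abelian_group.a_comm_group\<close>)

lemma tensor_lift_pure:
  "balanced K A B Z \<beta> \<Longrightarrow> a \<in> carrier A \<Longrightarrow> b \<in> carrier B \<Longrightarrow>
   tensor_lift K A B (add_monoid Z) \<beta> (pure K A B a b) = \<beta> a b"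
  using tensor_lift_all by blast

lemma tensor_lift_closed:
  "balanced K A B Z \<beta> \<Longrightarrow> t \<in> carrier (tensor K A B) \<Longrightarrow>
   tensor_lift K A B (add_monoid Z) \<beta> t \<in> carrier Z"
  using tensor_lift_all[of K A B Z \<beta>] by (auto simp: hom_def)

lemma tensor_lift_add:
  "balanced K A B Z \<beta> \<Longrightarrow> s \<in> carrier (tensor K A B) \<Longrightarrow> t \<in> carrier (tensor K A B) \<Longrightarrow>
   tensor_lift K A B (add_monoid Z) \<beta> (s \<oplus>\<^bsub>tensor K A B\<^esub> t) =
   tensor_lift K A B (add_monoid Z) \<beta> s \<oplus>\<^bsub>Z\<^esub> tensor_lift K A B (add_monoid Z) \<beta> t"
  using tensor_lift_all[of K A B Z \<beta>] by (auto simp: hom_def)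

lemma tensor_lift_extensional:
  "balanced K A B Z \<beta> \<Longrightarrow> tensor_lift K A B (add_monoid Z) \<beta> \<in> extensional (carrier (tensor K A B))"
  using tensor_lift_all[of K A B Z \<beta>] by simp

lemma tensor_lift_cong:
  assumes "\<And>a b. a \<in> carrier A \<Longrightarrow> b \<in> carrier B \<Longrightarrow> \<beta> a b = \<gamma> a b"
  shows "tensor_lift K A B G \<beta> = tensor_lift K A B G \<gamma>"
  unfolding tensor_lift_def using assms by (intro arg_cong[of _ _ The]) (auto simp: fun_eq_iff)

section \<open>The tensor product as a module\<close>

lemma tensor_abelian_group:
  assumes "module K A" "module K B"
  shows "abelian_group (tensor K A B)"
proof -
  interpret T: comm_group "tensor_group K A B" by (rule tensor_group_comm[OF assms])
  show ?thesis
    by (rule abelian_groupI) (simp_all add: T.m_ac T.l_inv_ex)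
qed

lemma balanced_tensorI:
  assumes "module K A" "module K B" "module K C" "module K D"
    and "\<And>a b. a \<in> carrier A \<Longrightarrow> b \<in> carrier B \<Longrightarrow> \<beta> a b \<in> carrier (tensor K C D)"
    and "\<And>a a' b. a \<in> carrier A \<Longrightarrow> a' \<in> carrier A \<Longrightarrow> b \<in> carrier B \<Longrightarrow>
       \<beta> (a \<oplus>\<^bsub>A\<^esub> a') b = \<beta> a b \<oplus>\<^bsub>tensor K C D\<^esub> \<beta> a' b"
    and "\<And>a b b'. a \<in> carrier A \<Longrightarrow> b \<in> carrier B \<Longrightarrow> b' \<in> carrier B \<Longrightarrow>
       \<beta> a (b \<oplus>\<^bsub>B\<^esub> b') = \<beta> a b \<oplus>\<^bsub>tensor K C D\<^esub> \<beta> a b'"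
    and "\<And>r a b. r \<in> carrier K \<Longrightarrow> a \<in> carrier A \<Longrightarrow> b \<in> carrier B \<Longrightarrow> \<beta> (r \<odot>\<^bsub>A\<^esub> a) b = \<beta> a (r \<odot>\<^bsub>B\<^esub> b)"
  shows "balanced K A B (tensor K C D) \<beta>"
  unfolding balanced_def using assms by (simp add: tensor_abelian_group)

lemma balanced_smult:
  assumes A: "module K A" and B: "module K B" and r: "r \<in> carrier K"
  shows "balanced K A B (tensor K A B) (\<lambda>a b. pure K A B (r \<odot>\<^bsub>A\<^esub> a) b)"
proof -
  interpret A: module K A by fact
  interpret B: module K B by fact
  show ?thesis
  proof (rule balanced_tensorI)
    fix s a b assume s: "s \<in> carrier K" "a \<in> carrier A" "b \<in> carrier B"
    \<comment> \<open>Commutativity of \<open>K\<close> brings \<open>s\<close> to the outside,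
      where it can be moved to the second argument.\<close>
    have "pure K A B (r \<odot>\<^bsub>A\<^esub> (s \<odot>\<^bsub>A\<^esub> a)) b = pure K A B (s \<odot>\<^bsub>A\<^esub> (r \<odot>\<^bsub>A\<^esub> a)) b"
      using r s by (metis A.smult_assoc1 A.R.m_comm)
    then show "pure K A B (r \<odot>\<^bsub>A\<^esub> (s \<odot>\<^bsub>A\<^esub> a)) b = pure K A B (r \<odot>\<^bsub>A\<^esub> a) (s \<odot>\<^bsub>B\<^esub> b)"
      using r s by (simp add: pure_balanced A B)
  qed (use r in \<open>auto simp: A B A.smult_r_distr pure_add_left pure_add_right\<close>)
qed

lemma tensor_smult_def:
  "r \<odot>\<^bsub>tensor K A B\<^esub> t = tensor_lift K A B (add_monoid (tensor K A B)) (\<lambda>a b. pure K A B (r \<odot>\<^bsub>A\<^esub> a) b) t"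
  by (simp only: tensor_lift_tensor_group[symmetric]) (simp add: tensor_def)

lemma tensor_mult_def:
  "s \<otimes>\<^bsub>tensor K A B\<^esub> t = tensor_lift K A B (add_monoid (tensor K A B))
     (\<lambda>a b. tensor_lift K A B (add_monoid (tensor K A B))
        (\<lambda>a' b'. pure K A B (a \<otimes>\<^bsub>A\<^esub> a') (b \<otimes>\<^bsub>B\<^esub> b')) t) s"
  by (simp only: tensor_lift_tensor_group[symmetric]) (simp add: tensor_def)

lemma smult_pure:
  assumes "module K A" "module K B" "r \<in> carrier K" "a \<in> carrier A" "b \<in> carrier B"
  shows "r \<odot>\<^bsub>tensor K A B\<^esub> pure K A B a b = pure K A B (r \<odot>\<^bsub>A\<^esub> a) b"
  unfolding tensor_smult_def using assms by (intro tensor_lift_pure balanced_smult) auto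

lemma tensor_module:
  assumes A: "module K A" and B: "module K B"
  shows "module K (tensor K A B)"
proof -
  interpret A: module K A by fact
  interpret B: module K B by fact
  interpret T: abelian_group "tensor K A B" by (rule tensor_abelian_group) fact+
  have cl: "r \<odot>\<^bsub>tensor K A B\<^esub> t \<in> carrier (tensor K A B)" if "r \<in> carrier K" "t \<in> carrier (tensor K A B)" for r t
    unfolding tensor_smult_def by (rule tensor_lift_closed) (use that balanced_smult A B in auto)
  have sadd: "r \<odot>\<^bsub>tensor K A B\<^esub> (s \<oplus>\<^bsub>tensor K A B\<^esub> t) = r \<odot>\<^bsub>tensor K A B\<^esub> s \<oplus>\<^bsub>tensor K A B\<^esub> r \<odot>\<^bsub>tensor K A B\<^esub> t"
    if "r \<in> carrier K" "s \<in> carrier (tensor K A B)" "t \<in> carrier (tensor K A B)" for r s t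
    using tensor_lift_add[OF balanced_smult[OF A B that(1)], of s t] that unfolding tensor_smult_def by simp
  show ?thesis
  proof (rule moduleI)
    fix r s t assume rs: "r \<in> carrier K" "s \<in> carrier K" and t: "t \<in> carrier (tensor K A B)"
    from A B t[simplified] show "(r \<oplus>\<^bsub>K\<^esub> s) \<odot>\<^bsub>tensor K A B\<^esub> t = r \<odot>\<^bsub>tensor K A B\<^esub> t \<oplus>\<^bsub>tensor K A B\<^esub> s \<odot>\<^bsub>tensor K A B\<^esub> t"
    proof (induction t rule: tensor_induct)
      case (pure a b)
      then show ?case using rs by (simp add: smult_pure A B A.smult_l_distr pure_add_left)
    next
      case (add u v)
      have c: "u \<in> carrier (tensor K A B)" "v \<in> carrier (tensor K A B)" using add by auto
      have "r \<odot>\<^bsub>tensor K A B\<^esub> u \<oplus>\<^bsub>tensor K A B\<^esub> s \<odot>\<^bsub>tensor K A B\<^esub> u \<oplus>\<^bsub>tensor K A B\<^esub> (r \<odot>\<^bsub>tensor K A B\<^esub> v \<oplus>\<^bsub>tensor K A B\<^esub> s \<odot>\<^bsub>tensor K A B\<^esub> v) =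
        r \<odot>\<^bsub>tensor K A B\<^esub> u \<oplus>\<^bsub>tensor K A B\<^esub> r \<odot>\<^bsub>tensor K A B\<^esub> v \<oplus>\<^bsub>tensor K A B\<^esub> (s \<odot>\<^bsub>tensor K A B\<^esub> u \<oplus>\<^bsub>tensor K A B\<^esub> s \<odot>\<^bsub>tensor K A B\<^esub> v)"
        using c rs by (simp only: T.a_ac cl T.a_closed)
      then show ?case
        using add(3,4) sadd[OF _ c, of r] sadd[OF _ c, of s] sadd[OF _ c, of "r \<oplus>\<^bsub>K\<^esub> s"] rs c by simp
    qed
    from A B t[simplified] show "(r \<otimes>\<^bsub>K\<^esub> s) \<odot>\<^bsub>tensor K A B\<^esub> t = r \<odot>\<^bsub>tensor K A B\<^esub> (s \<odot>\<^bsub>tensor K A B\<^esub> t)"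
    proof (induction t rule: tensor_induct)
      case (pure a b)
      then show ?case using rs by (simp add: smult_pure A B A.smult_assoc1)
    next
      case (add u v)
      have c: "u \<in> carrier (tensor K A B)" "v \<in> carrier (tensor K A B)" using add by auto
      show ?case
        using add(3,4) sadd[OF _ c, of s] sadd[OF _ c, of "r \<otimes>\<^bsub>K\<^esub> s"]
          sadd[OF _ cl[of s u] cl[of s v], of r] rs c by simp
    qed
  next
    fix t assume t: "t \<in> carrier (tensor K A B)"
    from A B t[simplified] show "\<one>\<^bsub>K\<^esub> \<odot>\<^bsub>tensor K A B\<^esub> t = t"
    proof (induction t rule: tensor_induct)
      case (pure a b)
      then show ?case by (simp add: smult_pure A B)
    next
      case (add u v)
      then show ?case using sadd[of "\<one>\<^bsub>K\<^esub>" u v] by simp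
    qed
  qed (use cl sadd A.R.cring_axioms T.abelian_group_axioms in auto)
qed

text \<open>The direction of simplification is reversed: so far facts were reduced to
  \<open>tensor_group\<close>, from here on they are phrased through the record
  \<open>tensor K A B\<close>, to which the rules for modules and rings apply.\<close>

declare tensor_simps [simp del]
declare tensor_simps(1-3) [symmetric, simp]
declare tensor_simps(4) [simp]
declare pure_closed [simp del]

section \<open>Algebra homomorphisms out of a tensor product of algebras\<close>

locale over =
  fixes K :: "'k ring"
begin

abbreviation Alg :: "('k, 'a, 'm) module_scheme \<Rightarrow> bool" where
  "Alg \<equiv> unital_algebra K"

abbreviation tens_alg ::
  "('k, 'a, 'm) module_scheme \<Rightarrow> ('k, 'b, 'n) module_scheme \<Rightarrow> ('k, ('a, 'b) tens) module"
  (infixl \<open>\<boxtimes>\<close> 75) where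
  "A \<boxtimes> B \<equiv> tensor K A B"

text \<open>Source and target are recorded as algebras, so that one premise supplies all that the
  rules for \<open>star\<close> ask for.\<close>

definition ahom ::
  "('k, 'a, 'm) module_scheme \<Rightarrow> ('k, 'b, 'n) module_scheme \<Rightarrow> ('a \<Rightarrow> 'b) \<Rightarrow> bool" where
  "ahom A B \<phi> \<longleftrightarrow> Alg A \<and> Alg B \<and> \<phi> \<in> algebra_hom K A B"

definition cpair ::
  "('k, 'a, 'm) module_scheme \<Rightarrow> ('k, 'b, 'n) module_scheme \<Rightarrow> ('k, 'z, 'l) module_scheme \<Rightarrow>
   ('a \<Rightarrow> 'z) \<Rightarrow> ('b \<Rightarrow> 'z) \<Rightarrow> bool" where
  "cpair A B Z \<phi> \<psi> \<longleftrightarrow> ahom A Z \<phi> \<and> ahom B Z \<psi> \<and>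
     (\<forall>a\<in>carrier A. \<forall>b\<in>carrier B. \<phi> a \<otimes>\<^bsub>Z\<^esub> \<psi> b = \<psi> b \<otimes>\<^bsub>Z\<^esub> \<phi> a)"

text \<open>
  The leg element \<open>T\<^sub>i\<^sub>j\<close> is obtained from \<open>T\<close> when \<open>\<phi>\<close> and
  \<open>\<psi>\<close> are the embeddings of the \<open>i\<close>-th and the \<open>j\<close>-th leg.
\<close>

definition star ::
  "('k, 'a, 'm) module_scheme \<Rightarrow> ('k, 'b, 'n) module_scheme \<Rightarrow> ('k, 'z, 'l) module_scheme \<Rightarrow>
   ('a \<Rightarrow> 'z) \<Rightarrow> ('b \<Rightarrow> 'z) \<Rightarrow> ('a, 'b) tens \<Rightarrow> 'z" where
  "star A B Z \<phi> \<psi> = tensor_lift K A B (add_monoid Z) (\<lambda>a b. \<phi> a \<otimes>\<^bsub>Z\<^esub> \<psi> b)"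

definition in1 :: "('k, 'a, 'm) module_scheme \<Rightarrow> ('k, 'b, 'n) module_scheme \<Rightarrow> 'a \<Rightarrow> ('a, 'b) tens" where
  "in1 A B a = pure K A B a \<one>\<^bsub>B\<^esub>"

definition in2 :: "('k, 'a, 'm) module_scheme \<Rightarrow> ('k, 'b, 'n) module_scheme \<Rightarrow> 'b \<Rightarrow> ('a, 'b) tens" where
  "in2 A B b = pure K A B \<one>\<^bsub>A\<^esub> b"

lemma Alg_module [simp]: "Alg A \<Longrightarrow> module K A"
  unfolding unital_algebra_def by blast

lemma Alg_ring [simp]: "Alg A \<Longrightarrow> ring A"
  unfolding unital_algebra_def by blast

lemma Alg_smult_left:
  "Alg A \<Longrightarrow> r \<in> carrier K \<Longrightarrow> a \<in> carrier A \<Longrightarrow> b \<in> carrier A \<Longrightarrow>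
   (r \<odot>\<^bsub>A\<^esub> a) \<otimes>\<^bsub>A\<^esub> b = r \<odot>\<^bsub>A\<^esub> (a \<otimes>\<^bsub>A\<^esub> b)"
  unfolding unital_algebra_def by blast

lemma Alg_smult_right:
  "Alg A \<Longrightarrow> r \<in> carrier K \<Longrightarrow> a \<in> carrier A \<Longrightarrow> b \<in> carrier A \<Longrightarrow>
   a \<otimes>\<^bsub>A\<^esub> (r \<odot>\<^bsub>A\<^esub> b) = r \<odot>\<^bsub>A\<^esub> (a \<otimes>\<^bsub>A\<^esub> b)"
  unfolding unital_algebra_def by blast

lemma ahomD:
  assumes "ahom A B \<phi>"
  shows "Alg A" "Alg B"
    "\<And>a. a \<in> carrier A \<Longrightarrow> \<phi> a \<in> carrier B"
    "\<And>a b. a \<in> carrier A \<Longrightarrow> b \<in> carrier A \<Longrightarrow> \<phi> (a \<otimes>\<^bsub>A\<^esub> b) = \<phi> a \<otimes>\<^bsub>B\<^esub> \<phi> b"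
    "\<And>a b. a \<in> carrier A \<Longrightarrow> b \<in> carrier A \<Longrightarrow> \<phi> (a \<oplus>\<^bsub>A\<^esub> b) = \<phi> a \<oplus>\<^bsub>B\<^esub> \<phi> b"
    "\<phi> \<one>\<^bsub>A\<^esub> = \<one>\<^bsub>B\<^esub>"
    "\<And>r a. r \<in> carrier K \<Longrightarrow> a \<in> carrier A \<Longrightarrow> \<phi> (r \<odot>\<^bsub>A\<^esub> a) = r \<odot>\<^bsub>B\<^esub> \<phi> a"
  using assms by (auto simp: ahom_def algebra_hom_def ring_hom_def)

lemma ahomI:
  assumes "Alg A" "Alg B"
    "\<And>a. a \<in> carrier A \<Longrightarrow> \<phi> a \<in> carrier B"
    "\<And>a b. a \<in> carrier A \<Longrightarrow> b \<in> carrier A \<Longrightarrow> \<phi> (a \<otimes>\<^bsub>A\<^esub> b) = \<phi> a \<otimes>\<^bsub>B\<^esub> \<phi> b"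
    "\<And>a b. a \<in> carrier A \<Longrightarrow> b \<in> carrier A \<Longrightarrow> \<phi> (a \<oplus>\<^bsub>A\<^esub> b) = \<phi> a \<oplus>\<^bsub>B\<^esub> \<phi> b"
    "\<phi> \<one>\<^bsub>A\<^esub> = \<one>\<^bsub>B\<^esub>"
    "\<And>r a. r \<in> carrier K \<Longrightarrow> a \<in> carrier A \<Longrightarrow> \<phi> (r \<odot>\<^bsub>A\<^esub> a) = r \<odot>\<^bsub>B\<^esub> \<phi> a"
  shows "ahom A B \<phi>"
  using assms by (auto simp: ahom_def algebra_hom_def ring_hom_def)

lemma ahom_comp [intro]: "ahom B C \<psi> \<Longrightarrow> ahom A B \<phi> \<Longrightarrow> ahom A C (\<psi> \<circ> \<phi>)"
  by (rule ahomI) (auto simp: ahomD)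

lemma ahom_id [intro]: "Alg A \<Longrightarrow> ahom A A (\<lambda>x. x)"
  by (rule ahomI) auto

lemma ahom_cong:
  assumes \<phi>: "ahom A B \<phi>" and eq: "\<And>x. x \<in> carrier A \<Longrightarrow> \<phi> x = \<psi> x"
  shows "ahom A B \<psi>"
proof -
  interpret A: ring A using ahomD(1)[OF \<phi>] by simp
  interpret M: module K A using ahomD(1)[OF \<phi>] by simp
  show ?thesis
    by (rule ahomI) (use ahomD[OF \<phi>] in \<open>auto simp: eq[symmetric]\<close>)
qed

lemma pure_carrier [simp, intro]:
  "Alg A \<Longrightarrow> Alg B \<Longrightarrow> a \<in> carrier A \<Longrightarrow> b \<in> carrier B \<Longrightarrow> pure K A B a b \<in> carrier (A \<boxtimes> B)"
  using pure_closed[of K A B a b] by simp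

lemma pure_add_l:
  "Alg A \<Longrightarrow> Alg B \<Longrightarrow> a \<in> carrier A \<Longrightarrow> a' \<in> carrier A \<Longrightarrow> b \<in> carrier B \<Longrightarrow>
   pure K A B (a \<oplus>\<^bsub>A\<^esub> a') b = pure K A B a b \<oplus>\<^bsub>A \<boxtimes> B\<^esub> pure K A B a' b"
  using pure_add_left[of K A B a a' b] by simp

lemma pure_add_r:
  "Alg A \<Longrightarrow> Alg B \<Longrightarrow> a \<in> carrier A \<Longrightarrow> b \<in> carrier B \<Longrightarrow> b' \<in> carrier B \<Longrightarrow>
   pure K A B a (b \<oplus>\<^bsub>B\<^esub> b') = pure K A B a b \<oplus>\<^bsub>A \<boxtimes> B\<^esub> pure K A B a b'"
  using pure_add_right[of K A B a b b'] by simp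

lemma star_balanced:
  fixes Z (structure)
  assumes \<phi>: "ahom A Z \<phi>" and \<psi>: "ahom B Z \<psi>"
  shows "balanced K A B Z (\<lambda>a b. \<phi> a \<otimes> \<psi> b)"
proof -
  note [simp] = ahomD[OF \<phi>] ahomD[OF \<psi>]
  interpret Z: ring Z by simp
  show ?thesis
    unfolding balanced_def
    by (auto simp: Z.abelian_group_axioms Z.l_distr Z.r_distr Alg_smult_left Alg_smult_right)
qed

lemma star_pure:
  "ahom A Z \<phi> \<Longrightarrow> ahom B Z \<psi> \<Longrightarrow> a \<in> carrier A \<Longrightarrow> b \<in> carrier B \<Longrightarrow>
   star A B Z \<phi> \<psi> (pure K A B a b) = \<phi> a \<otimes>\<^bsub>Z\<^esub> \<psi> b"
  unfolding star_def by (rule tensor_lift_pure[OF star_balanced])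

lemma star_closed:
  "ahom A Z \<phi> \<Longrightarrow> ahom B Z \<psi> \<Longrightarrow> t \<in> carrier (A \<boxtimes> B) \<Longrightarrow> star A B Z \<phi> \<psi> t \<in> carrier Z"
  unfolding star_def by (simp add: tensor_lift_closed[OF star_balanced])

lemma star_add:
  "ahom A Z \<phi> \<Longrightarrow> ahom B Z \<psi> \<Longrightarrow> s \<in> carrier (A \<boxtimes> B) \<Longrightarrow> t \<in> carrier (A \<boxtimes> B) \<Longrightarrow>
   star A B Z \<phi> \<psi> (s \<oplus>\<^bsub>A \<boxtimes> B\<^esub> t) = star A B Z \<phi> \<psi> s \<oplus>\<^bsub>Z\<^esub> star A B Z \<phi> \<psi> t"
  unfolding star_def by (simp add: tensor_lift_add[OF star_balanced])

lemma star_extensional: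
  "ahom A Z \<phi> \<Longrightarrow> ahom B Z \<psi> \<Longrightarrow> star A B Z \<phi> \<psi> \<in> extensional (carrier (A \<boxtimes> B))"
  unfolding star_def by (simp add: tensor_lift_extensional[OF star_balanced])

lemma star_cong:
  assumes "\<And>a. a \<in> carrier A \<Longrightarrow> \<phi> a = \<phi>' a" "\<And>b. b \<in> carrier B \<Longrightarrow> \<psi> b = \<psi>' b"
  shows "star A B Z \<phi> \<psi> = star A B Z \<phi>' \<psi>'"
  unfolding star_def by (rule tensor_lift_cong) (simp add: assms)

lemma tens_induct [consumes 3, case_names pure add]:
  assumes "Alg A" "Alg B" "t \<in> carrier (A \<boxtimes> B)"
    and "\<And>a b. a \<in> carrier A \<Longrightarrow> b \<in> carrier B \<Longrightarrow> P (pure K A B a b)"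
    and "\<And>s t. s \<in> carrier (A \<boxtimes> B) \<Longrightarrow> t \<in> carrier (A \<boxtimes> B) \<Longrightarrow> P s \<Longrightarrow> P t \<Longrightarrow> P (s \<oplus>\<^bsub>A \<boxtimes> B\<^esub> t)"
  shows "P t"
  using tensor_induct[of K A B t P] assms by simp

section \<open>The tensor product of two algebras is an algebra\<close>

lemma mult_balanced_inner:
  assumes A: "Alg A" and B: "Alg B" and a: "a \<in> carrier A" and b: "b \<in> carrier B"
  shows "balanced K A B (A \<boxtimes> B) (\<lambda>a' b'. pure K A B (a \<otimes>\<^bsub>A\<^esub> a') (b \<otimes>\<^bsub>B\<^esub> b'))"
proof -
  interpret A: ring A using A by simp
  interpret B: ring B using B by simp
  interpret AM: module K A using A by simp
  interpret BM: module K B using B by simp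
  show ?thesis
    by (rule balanced_tensorI)
      (use a b in \<open>auto simp: A B A.r_distr B.r_distr pure_add_l pure_add_r
         Alg_smult_right pure_balanced\<close>)
qed

abbreviation lmult where
  "lmult A B a b \<equiv> tensor_lift K A B (add_monoid (A \<boxtimes> B)) (\<lambda>a' b'. pure K A B (a \<otimes>\<^bsub>A\<^esub> a') (b \<otimes>\<^bsub>B\<^esub> b'))"

text \<open>Each of the three identities is additive in \<open>t\<close>. Induction over
  \<open>t\<close> therefore reduces them to pure tensors, where they are distributivity and
  compatibility with scalars in the two algebras.\<close>

lemma mult_balanced_outer:
  assumes A: "Alg A" and B: "Alg B" and t: "t \<in> carrier (A \<boxtimes> B)"
  shows "balanced K A B (A \<boxtimes> B) (\<lambda>a b. lmult A B a b t)"
proof -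
  interpret A: ring A using A by simp
  interpret B: ring B using B by simp
  interpret AM: module K A using A by simp
  interpret BM: module K B using B by simp
  interpret T: module K "A \<boxtimes> B" using A B by (simp add: tensor_module)
  note pl = tensor_lift_pure[OF mult_balanced_inner[OF A B]]
  note cl = tensor_lift_closed[OF mult_balanced_inner[OF A B], simplified]
  have ad: "lmult A B a b (s \<oplus>\<^bsub>A \<boxtimes> B\<^esub> u) = lmult A B a b s \<oplus>\<^bsub>A \<boxtimes> B\<^esub> lmult A B a b u"
    if "a \<in> carrier A" "b \<in> carrier B" "s \<in> carrier (A \<boxtimes> B)" "u \<in> carrier (A \<boxtimes> B)" for a b s u
    using tensor_lift_add[OF mult_balanced_inner[OF A B that(1,2)], of s u] that by simp
  have cl: "lmult A B a b s \<in> carrier (A \<boxtimes> B)"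
    if "a \<in> carrier A" "b \<in> carrier B" "s \<in> carrier (A \<boxtimes> B)" for a b s
    using tensor_lift_closed[OF mult_balanced_inner[OF A B that(1,2)], of s] that by simp
  have 1: "lmult A B (a \<oplus>\<^bsub>A\<^esub> a') b t = lmult A B a b t \<oplus>\<^bsub>A \<boxtimes> B\<^esub> lmult A B a' b t"
    if ab: "a \<in> carrier A" "a' \<in> carrier A" "b \<in> carrier B" for a a' b
    using A B t
  proof (induction t rule: tens_induct)
    case (pure c d)
    then show ?case using ab by (simp add: pl A.l_distr pure_add_l A B)
  next
    case (add s u)
    have "lmult A B (a \<oplus>\<^bsub>A\<^esub> a') b (s \<oplus>\<^bsub>A \<boxtimes> B\<^esub> u) =
       (lmult A B a b s \<oplus>\<^bsub>A \<boxtimes> B\<^esub> lmult A B a' b s) \<oplus>\<^bsub>A \<boxtimes> B\<^esub> (lmult A B a b u \<oplus>\<^bsub>A \<boxtimes> B\<^esub> lmult A B a' b u)"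
      using add ab by (simp only: ad A.a_closed)
    also have "\<dots> = (lmult A B a b s \<oplus>\<^bsub>A \<boxtimes> B\<^esub> lmult A B a b u) \<oplus>\<^bsub>A \<boxtimes> B\<^esub> (lmult A B a' b s \<oplus>\<^bsub>A \<boxtimes> B\<^esub> lmult A B a' b u)"
      using add ab by (simp only: T.a_ac cl T.a_closed)
    finally show ?case using add ab by (simp only: ad A.a_closed)
  qed
  have 2: "lmult A B a (b \<oplus>\<^bsub>B\<^esub> b') t = lmult A B a b t \<oplus>\<^bsub>A \<boxtimes> B\<^esub> lmult A B a b' t"
    if ab: "a \<in> carrier A" "b' \<in> carrier B" "b \<in> carrier B" for a b b'
    using A B t
  proof (induction t rule: tens_induct)
    case (pure c d)
    then show ?case using ab by (simp add: pl B.l_distr pure_add_r A B)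
  next
    case (add s u)
    have "lmult A B a (b \<oplus>\<^bsub>B\<^esub> b') (s \<oplus>\<^bsub>A \<boxtimes> B\<^esub> u) =
       (lmult A B a b s \<oplus>\<^bsub>A \<boxtimes> B\<^esub> lmult A B a b' s) \<oplus>\<^bsub>A \<boxtimes> B\<^esub> (lmult A B a b u \<oplus>\<^bsub>A \<boxtimes> B\<^esub> lmult A B a b' u)"
      using add ab by (simp only: ad B.a_closed)
    also have "\<dots> = (lmult A B a b s \<oplus>\<^bsub>A \<boxtimes> B\<^esub> lmult A B a b u) \<oplus>\<^bsub>A \<boxtimes> B\<^esub> (lmult A B a b' s \<oplus>\<^bsub>A \<boxtimes> B\<^esub> lmult A B a b' u)"
      using add ab by (simp only: T.a_ac cl T.a_closed)
    finally show ?case using add ab by (simp only: ad B.a_closed)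
  qed
  have 3: "lmult A B (r \<odot>\<^bsub>A\<^esub> a) b t = lmult A B a (r \<odot>\<^bsub>B\<^esub> b) t"
    if ab: "a \<in> carrier A" "b \<in> carrier B" "r \<in> carrier K" for a b r
    using A B t
  proof (induction t rule: tens_induct)
    case (pure c d)
    then show ?case using ab by (simp add: pl Alg_smult_left pure_balanced A B)
  next
    case (add s u)
    then show ?case using ab by (simp only: ad AM.smult_closed BM.smult_closed)
  qed
  show ?thesis
    by (rule balanced_tensorI) (assumption | rule cl 1 2 3 t A B Alg_module)+
qed

lemma mult_pure:
  assumes "Alg A" "Alg B" "a \<in> carrier A" "b \<in> carrier B" "a' \<in> carrier A" "b' \<in> carrier B"
  shows "pure K A B a b \<otimes>\<^bsub>A \<boxtimes> B\<^esub> pure K A B a' b' = pure K A B (a \<otimes>\<^bsub>A\<^esub> a') (b \<otimes>\<^bsub>B\<^esub> b')"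
  unfolding tensor_mult_def using assms
  by (simp only: tensor_lift_pure[OF mult_balanced_outer] tensor_lift_pure[OF mult_balanced_inner] pure_carrier)

lemma tens_mult_closed:
  assumes "Alg A" "Alg B" "s \<in> carrier (A \<boxtimes> B)" "t \<in> carrier (A \<boxtimes> B)"
  shows "s \<otimes>\<^bsub>A \<boxtimes> B\<^esub> t \<in> carrier (A \<boxtimes> B)"
  unfolding tensor_mult_def using assms tensor_lift_closed[OF mult_balanced_outer, of A B t s] by simp

lemma tens_l_distr:
  assumes "Alg A" "Alg B" "s \<in> carrier (A \<boxtimes> B)" "s' \<in> carrier (A \<boxtimes> B)" "t \<in> carrier (A \<boxtimes> B)"
  shows "(s \<oplus>\<^bsub>A \<boxtimes> B\<^esub> s') \<otimes>\<^bsub>A \<boxtimes> B\<^esub> t = s \<otimes>\<^bsub>A \<boxtimes> B\<^esub> t \<oplus>\<^bsub>A \<boxtimes> B\<^esub> s' \<otimes>\<^bsub>A \<boxtimes> B\<^esub> t"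
  unfolding tensor_mult_def using assms tensor_lift_add[OF mult_balanced_outer, of A B t s s'] by simp

lemma tens_r_distr:
  assumes A: "Alg A" and B: "Alg B" and s: "s \<in> carrier (A \<boxtimes> B)"
    and t: "t \<in> carrier (A \<boxtimes> B)" and u: "u \<in> carrier (A \<boxtimes> B)"
  shows "s \<otimes>\<^bsub>A \<boxtimes> B\<^esub> (t \<oplus>\<^bsub>A \<boxtimes> B\<^esub> u) = s \<otimes>\<^bsub>A \<boxtimes> B\<^esub> t \<oplus>\<^bsub>A \<boxtimes> B\<^esub> s \<otimes>\<^bsub>A \<boxtimes> B\<^esub> u"
proof -
  interpret T: module K "A \<boxtimes> B" using A B by (simp add: tensor_module)
  from A B s show ?thesis
  proof (induction s rule: tens_induct)
    case (pure a b)
    show ?case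
      unfolding tensor_mult_def
      using tensor_lift_add[OF mult_balanced_inner[OF A B pure], of t u] t u pure
        tensor_lift_pure[OF mult_balanced_outer[OF A B t] pure]
        tensor_lift_pure[OF mult_balanced_outer[OF A B u] pure]
        tensor_lift_pure[OF mult_balanced_outer[OF A B T.a_closed[OF t u]] pure]
      by simp
  next
    case (add s s')
    have "(s \<oplus>\<^bsub>A \<boxtimes> B\<^esub> s') \<otimes>\<^bsub>A \<boxtimes> B\<^esub> (t \<oplus>\<^bsub>A \<boxtimes> B\<^esub> u) =
      (s \<otimes>\<^bsub>A \<boxtimes> B\<^esub> t \<oplus>\<^bsub>A \<boxtimes> B\<^esub> s \<otimes>\<^bsub>A \<boxtimes> B\<^esub> u) \<oplus>\<^bsub>A \<boxtimes> B\<^esub> (s' \<otimes>\<^bsub>A \<boxtimes> B\<^esub> t \<oplus>\<^bsub>A \<boxtimes> B\<^esub> s' \<otimes>\<^bsub>A \<boxtimes> B\<^esub> u)"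
      using add t u by (simp only: tens_l_distr A B T.a_closed)
    also have "\<dots> = (s \<otimes>\<^bsub>A \<boxtimes> B\<^esub> t \<oplus>\<^bsub>A \<boxtimes> B\<^esub> s' \<otimes>\<^bsub>A \<boxtimes> B\<^esub> t) \<oplus>\<^bsub>A \<boxtimes> B\<^esub> (s \<otimes>\<^bsub>A \<boxtimes> B\<^esub> u \<oplus>\<^bsub>A \<boxtimes> B\<^esub> s' \<otimes>\<^bsub>A \<boxtimes> B\<^esub> u)"
      using add t u by (simp only: T.a_ac T.a_closed tens_mult_closed A B)
    finally show ?case using add t u by (simp only: tens_l_distr A B)
  qed
qed

lemma tens_m_assoc:
  assumes A: "Alg A" and B: "Alg B" and s: "s \<in> carrier (A \<boxtimes> B)"
    and t: "t \<in> carrier (A \<boxtimes> B)" and u: "u \<in> carrier (A \<boxtimes> B)"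
  shows "s \<otimes>\<^bsub>A \<boxtimes> B\<^esub> t \<otimes>\<^bsub>A \<boxtimes> B\<^esub> u = s \<otimes>\<^bsub>A \<boxtimes> B\<^esub> (t \<otimes>\<^bsub>A \<boxtimes> B\<^esub> u)"
proof -
  interpret A: ring A using A by simp
  interpret B: ring B using B by simp
  interpret T: module K "A \<boxtimes> B" using A B by (simp add: tensor_module)
  note mc = tens_mult_closed[OF A B] and ld = tens_l_distr[OF A B] and rd = tens_r_distr[OF A B]
  from A B s show ?thesis
  proof (induction s rule: tens_induct)
    case (pure a b)
    from A B t show ?case
    proof (induction t rule: tens_induct)
      case p2: (pure c d)
      from A B u show ?case
      proof (induction u rule: tens_induct)
        case p3: (pure e f)
        show ?case using pure p2 p3 by (simp add: mult_pure A B A.m_assoc B.m_assoc)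
      next
        case (add v w)
        then show ?case using pure p2 by (simp only: rd mc pure_carrier A B)
      qed
    next
      case (add v w)
      then show ?case using pure u by (simp only: rd ld mc pure_carrier A B)
    qed
  next
    case (add v w)
    then show ?case using t u by (simp only: rd ld mc)
  qed
qed

lemma tens_Alg [simp, intro]:
  assumes A: "Alg A" and B: "Alg B"
  shows "Alg (A \<boxtimes> B)"
proof -
  interpret A: ring A using A by simp
  interpret B: ring B using B by simp
  interpret AM: module K A using A by simp
  interpret BM: module K B using B by simp
  interpret T: module K "A \<boxtimes> B" using A B by (simp add: tensor_module)
  note mc = tens_mult_closed[OF A B] and ld = tens_l_distr[OF A B] and rd = tens_r_distr[OF A B]
  have one: "\<one>\<^bsub>A \<boxtimes> B\<^esub> \<in> carrier (A \<boxtimes> B)" by (simp add: A B)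
  have "ring (A \<boxtimes> B)"
  proof (rule ringI)
    show "abelian_group (A \<boxtimes> B)" by (rule T.abelian_group_axioms)
    show "monoid (A \<boxtimes> B)"
    proof (rule monoidI)
      fix s assume s: "s \<in> carrier (A \<boxtimes> B)"
      from A B s show "\<one>\<^bsub>A \<boxtimes> B\<^esub> \<otimes>\<^bsub>A \<boxtimes> B\<^esub> s = s"
      proof (induction s rule: tens_induct)
        case (pure a b)
        then show ?case by (simp add: mult_pure A B)
      next
        case (add s t)
        then show ?case using one by (simp only: rd)
      qed
      from A B s show "s \<otimes>\<^bsub>A \<boxtimes> B\<^esub> \<one>\<^bsub>A \<boxtimes> B\<^esub> = s"
      proof (induction s rule: tens_induct)
        case (pure a b)
        then show ?case by (simp add: mult_pure A B)
      next
        case (add s t)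
        then show ?case using one by (simp only: ld)
      qed
    qed (use one mc tens_m_assoc[OF A B] in auto)
  qed (use rd ld in auto)
  moreover have "(r \<odot>\<^bsub>A \<boxtimes> B\<^esub> s) \<otimes>\<^bsub>A \<boxtimes> B\<^esub> t = r \<odot>\<^bsub>A \<boxtimes> B\<^esub> (s \<otimes>\<^bsub>A \<boxtimes> B\<^esub> t) \<and>
      s \<otimes>\<^bsub>A \<boxtimes> B\<^esub> (r \<odot>\<^bsub>A \<boxtimes> B\<^esub> t) = r \<odot>\<^bsub>A \<boxtimes> B\<^esub> (s \<otimes>\<^bsub>A \<boxtimes> B\<^esub> t)"
    if r: "r \<in> carrier K" and s: "s \<in> carrier (A \<boxtimes> B)" and t: "t \<in> carrier (A \<boxtimes> B)" for r s t
    using A B s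
  proof (induction s rule: tens_induct)
    case (pure a b)
    from A B t show ?case
    proof (induction t rule: tens_induct)
      case p2: (pure c d)
      show ?case using pure p2 r by (simp add: mult_pure A B smult_pure Alg_smult_left Alg_smult_right)
    next
      case (add v w)
      then show ?case using pure r by (simp only: rd mc pure_carrier A B T.smult_r_distr T.smult_closed)
    qed
  next
    case (add v w)
    then show ?case using t r by (simp only: ld mc T.smult_r_distr T.smult_closed)
  qed
  ultimately show ?thesis
    unfolding unital_algebra_def using T.module_axioms by blast
qed

lemma star_smult:
  fixes Z (structure)
  assumes \<phi>: "ahom A Z \<phi>" and \<psi>: "ahom B Z \<psi>" and r: "r \<in> carrier K" and t: "t \<in> carrier (A \<boxtimes> B)"
  shows "star A B Z \<phi> \<psi> (r \<odot>\<^bsub>A \<boxtimes> B\<^esub> t) = r \<odot> star A B Z \<phi> \<psi> t"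
proof -
  note [simp] = ahomD[OF \<phi>] ahomD[OF \<psi>]
  interpret A: module K A by simp
  interpret T: module K "A \<boxtimes> B" using tens_Alg by simp
  interpret Z: module K Z by simp
  have "Alg A" "Alg B" by simp_all
  from this t show ?thesis
  proof (induction t rule: tens_induct)
    case (pure a b)
    then show ?case using r by (simp add: smult_pure star_pure[OF \<phi> \<psi>] Alg_smult_left)
  next
    case (add s t)
    then show ?case using r
      by (simp only: T.smult_r_distr star_add[OF \<phi> \<psi>] T.smult_closed Z.smult_r_distr star_closed[OF \<phi> \<psi>])
  qed
qed

section \<open>Commuting pairs of algebra maps\<close>

lemma cpairD:
  fixes Z (structure)
  assumes "cpair A B Z \<phi> \<psi>"
  shows "ahom A Z \<phi>" "ahom B Z \<psi>"
    "\<And>a b. a \<in> carrier A \<Longrightarrow> b \<in> carrier B \<Longrightarrow> \<phi> a \<otimes> \<psi> b = \<psi> b \<otimes> \<phi> a"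
  using assms by (auto simp: cpair_def)

lemma cpair_sym: "cpair A B Z \<phi> \<psi> \<Longrightarrow> cpair B A Z \<psi> \<phi>"
  by (auto simp: cpair_def)

text \<open>On pure tensors multiplicativity amounts to exchanging \<phi> c with \<psi> b, which is
  the commutation in \<open>cpair\<close>; additivity extends it to all tensors.\<close>

lemma star_hom [intro]:
  fixes Z (structure)
  assumes c: "cpair A B Z \<phi> \<psi>"
  shows "ahom (A \<boxtimes> B) Z (star A B Z \<phi> \<psi>)"
proof -
  note \<phi> = cpairD(1)[OF c] and \<psi> = cpairD(2)[OF c]
  have Alg: "Alg A" "Alg B" "Alg Z" using ahomD[OF \<phi>] ahomD[OF \<psi>] by auto
  interpret A: ring A using Alg by simp
  interpret B: ring B using Alg by simp
  interpret Z: ring Z using Alg by simp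
  interpret T: ring "A \<boxtimes> B" using Alg by simp
  note sc = star_closed[OF \<phi> \<psi>] and sa = star_add[OF \<phi> \<psi>] and sp = star_pure[OF \<phi> \<psi>]
  have m: "star A B Z \<phi> \<psi> (s \<otimes>\<^bsub>A \<boxtimes> B\<^esub> t) = star A B Z \<phi> \<psi> s \<otimes> star A B Z \<phi> \<psi> t"
    if s: "s \<in> carrier (A \<boxtimes> B)" and t: "t \<in> carrier (A \<boxtimes> B)" for s t
    using Alg(1,2) s
  proof (induction s rule: tens_induct)
    case (pure a b)
    from Alg(1,2) t show ?case
    proof (induction t rule: tens_induct)
      case p2: (pure c d)
      note cl = ahomD(3)[OF \<phi> pure(1)] ahomD(3)[OF \<psi> pure(2)] ahomD(3)[OF \<phi> p2(1)] ahomD(3)[OF \<psi> p2(2)]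
      have "\<phi> a \<otimes> \<phi> c \<otimes> (\<psi> b \<otimes> \<psi> d) = \<phi> a \<otimes> (\<phi> c \<otimes> \<psi> b) \<otimes> \<psi> d"
        using cl by (simp add: Z.m_assoc)
      also have "\<dots> = \<phi> a \<otimes> \<psi> b \<otimes> (\<phi> c \<otimes> \<psi> d)"
        unfolding cpairD(3)[OF c p2(1) pure(2)] using cl by (simp add: Z.m_assoc)
      finally show ?case
        using pure p2 by (simp add: mult_pure Alg sp ahomD[OF \<phi>] ahomD[OF \<psi>])
    next
      case (add v w)
      then show ?case using pure Alg
        by (simp only: T.r_distr T.m_closed pure_carrier sa sc Z.r_distr)
    qed
  next
    case (add v w)
    then show ?case using t by (simp only: T.l_distr T.m_closed sa sc Z.l_distr)
  qed
  show ?thesis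
  proof (rule ahomI)
    show "star A B Z \<phi> \<psi> \<one>\<^bsub>A \<boxtimes> B\<^esub> = \<one>"
      by (simp add: sp ahomD[OF \<phi>] ahomD[OF \<psi>])
  qed (use Alg sc sa m star_smult[OF \<phi> \<psi>] in auto)
qed

text \<open>Since \<chi> is additive and multiplicative, it passes inside the evaluation. A
  structure map written as a \<open>star\<close> can therefore be composed with an algebra map by
  composing its two components.\<close>

lemma comp_star:
  assumes \<chi>: "ahom Z W \<chi>" and \<phi>: "ahom A Z \<phi>" and \<psi>: "ahom B Z \<psi>" and t: "t \<in> carrier (A \<boxtimes> B)"
  shows "\<chi> (star A B Z \<phi> \<psi> t) = star A B W (\<chi> \<circ> \<phi>) (\<chi> \<circ> \<psi>) t"
proof -
  have "Alg A" "Alg B" using ahomD[OF \<phi>] ahomD[OF \<psi>] by auto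
  define \<phi>' \<psi>' where def: "\<phi>' = \<chi> \<circ> \<phi>" "\<psi>' = \<chi> \<circ> \<psi>"
  have h: "ahom A W \<phi>'" "ahom B W \<psi>'" unfolding def using \<chi> \<phi> \<psi> by blast+
  have app: "\<phi>' a = \<chi> (\<phi> a)" "\<psi>' b = \<chi> (\<psi> b)" for a b by (simp_all add: def)
  from \<open>Alg A\<close> \<open>Alg B\<close> t have "\<chi> (star A B Z \<phi> \<psi> t) = star A B W \<phi>' \<psi>' t"
  proof (induction t rule: tens_induct)
    case (pure a b)
    show ?case
      using star_pure[OF h pure] star_pure[OF \<phi> \<psi> pure]
        ahomD(4)[OF \<chi> ahomD(3)[OF \<phi> pure(1)] ahomD(3)[OF \<psi> pure(2)]] app(1)[of a] app(2)[of b]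
      by simp
  next
    case (add s t)
    then show ?case
      by (simp only: star_add \<phi> \<psi> h ahomD[OF \<chi>] star_closed)
  qed
  then show ?thesis by (simp only: def)
qed

section \<open>The universal commuting pair of embeddings\<close>

lemma in1_hom [intro]: assumes A: "Alg A" and B: "Alg B" shows "ahom A (A \<boxtimes> B) (in1 A B)"
proof -
  interpret A: ring A using A by simp
  interpret B: ring B using B by simp
  show ?thesis
    by (rule ahomI) (auto simp: in1_def A B mult_pure pure_add_l smult_pure)
qed

lemma in2_hom [intro]: assumes A: "Alg A" and B: "Alg B" shows "ahom B (A \<boxtimes> B) (in2 A B)"
proof -
  interpret A: ring A using A by simp
  interpret B: ring B using B by simp
  show ?thesis
    by (rule ahomI) (auto simp: in2_def A B mult_pure pure_add_r smult_pure pure_balanced)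
qed

lemma in_pure:
  assumes A: "Alg A" and B: "Alg B" and "a \<in> carrier A" "b \<in> carrier B"
  shows "in1 A B a \<otimes>\<^bsub>A \<boxtimes> B\<^esub> in2 A B b = pure K A B a b"
proof -
  interpret A: ring A using A by simp
  interpret B: ring B using B by simp
  show ?thesis using assms by (simp add: in1_def in2_def mult_pure)
qed

lemma in_cpair [intro]: assumes A: "Alg A" and B: "Alg B" shows "cpair A B (A \<boxtimes> B) (in1 A B) (in2 A B)"
proof -
  interpret A: ring A using A by simp
  interpret B: ring B using B by simp
  show ?thesis
    unfolding cpair_def using assms by (auto simp: in1_def in2_def mult_pure)
qed

lemma star_in:
  assumes A: "Alg A" and B: "Alg B" and "t \<in> carrier (A \<boxtimes> B)"
  shows "star A B (A \<boxtimes> B) (in1 A B) (in2 A B) t = t"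
  using assms
proof (induction t rule: tens_induct)
  case (pure a b)
  then show ?case by (simp add: star_pure in1_hom in2_hom A B in_pure)
next
  case (add s t)
  then show ?case by (simp only: star_add in1_hom in2_hom A B)
qed

text \<open>Together with \<open>star_hom\<close> this is the universal property of the tensor
  product algebra: its algebra maps correspond to commuting pairs, and a map is recovered from its
  two restrictions.\<close>

lemma ahom_tens_eq:
  assumes \<Phi>: "ahom (A \<boxtimes> B) Z \<Phi>" and A: "Alg A" and B: "Alg B" and t: "t \<in> carrier (A \<boxtimes> B)"
  shows "\<Phi> t = star A B Z (\<Phi> \<circ> in1 A B) (\<Phi> \<circ> in2 A B) t"
  using comp_star[OF \<Phi> in1_hom[OF A B] in2_hom[OF A B] t] star_in[OF A B t] by simp

lemma star_comp_in1:
  assumes "ahom A Z \<phi>" "ahom B Z \<psi>" "a \<in> carrier A"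
  shows "star A B Z \<phi> \<psi> (in1 A B a) = \<phi> a"
proof -
  have "Alg B" "Alg Z" using ahomD assms by blast+
  interpret B: ring B using \<open>Alg B\<close> by simp
  interpret Z: ring Z using \<open>Alg Z\<close> by simp
  show ?thesis using assms by (simp add: in1_def star_pure ahomD[of _ _ \<phi>] ahomD[of _ _ \<psi>])
qed

lemma star_comp_in2:
  assumes "ahom A Z \<phi>" "ahom B Z \<psi>" "b \<in> carrier B"
  shows "star A B Z \<phi> \<psi> (in2 A B b) = \<psi> b"
proof -
  have "Alg A" "Alg Z" using ahomD assms by blast+
  interpret A: ring A using \<open>Alg A\<close> by simp
  interpret Z: ring Z using \<open>Alg Z\<close> by simp
  show ?thesis using assms by (simp add: in2_def star_pure ahomD[of _ _ \<phi>] ahomD[of _ _ \<psi>])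
qed

lemma cpair_comp1: "cpair A B Z \<phi> \<psi> \<Longrightarrow> ahom A' A f \<Longrightarrow> cpair A' B Z (\<phi> \<circ> f) \<psi>"
  unfolding cpair_def by (auto simp: ahomD)

lemma cpair_comp2: "cpair A B Z \<phi> \<psi> \<Longrightarrow> ahom B' B f \<Longrightarrow> cpair A B' Z \<phi> (\<psi> \<circ> f)"
  unfolding cpair_def by (auto simp: ahomD)

lemma cpair_comp3:
  assumes "cpair A B Z \<phi> \<psi>" "ahom Z W \<chi>"
  shows "cpair A B W (\<chi> \<circ> \<phi>) (\<chi> \<circ> \<psi>)"
  unfolding cpair_def
proof (intro conjI ballI)
  fix a b assume ab: "a \<in> carrier A" "b \<in> carrier B"
  note cl = ahomD(3)[OF cpairD(1)[OF assms(1)] ab(1)] ahomD(3)[OF cpairD(2)[OF assms(1)] ab(2)]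
  show "(\<chi> \<circ> \<phi>) a \<otimes>\<^bsub>W\<^esub> (\<chi> \<circ> \<psi>) b = (\<chi> \<circ> \<psi>) b \<otimes>\<^bsub>W\<^esub> (\<chi> \<circ> \<phi>) a"
    using cpairD(3)[OF assms(1) ab] ahomD(4)[OF assms(2) cl] ahomD(4)[OF assms(2) cl(2) cl(1)] by simp
qed (use assms cpairD in blast)+

text \<open>Every move of one leg element past another is an instance of this.\<close>

lemma star_intertwine:
  fixes Z (structure)
  assumes \<phi>: "ahom A Z \<phi>" and \<psi>: "ahom B Z \<psi>" and \<phi>': "ahom A Z \<phi>'" and \<psi>': "ahom B Z \<psi>'"
    and c: "c \<in> carrier Z" and t: "t \<in> carrier (A \<boxtimes> B)"
    and 1: "\<And>a. a \<in> carrier A \<Longrightarrow> c \<otimes> \<phi> a = \<phi>' a \<otimes> c"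
    and 2: "\<And>b. b \<in> carrier B \<Longrightarrow> c \<otimes> \<psi> b = \<psi>' b \<otimes> c"
  shows "c \<otimes> star A B Z \<phi> \<psi> t = star A B Z \<phi>' \<psi>' t \<otimes> c"
proof -
  have Alg: "Alg A" "Alg B" "Alg Z" using ahomD[OF \<phi>] ahomD[OF \<psi>] by auto
  interpret Z: ring Z using Alg by simp
  from Alg(1,2) t show ?thesis
  proof (induction t rule: tens_induct)
    case (pure a b)
    note cl = ahomD(3)[OF \<phi> pure(1)] ahomD(3)[OF \<psi> pure(2)] ahomD(3)[OF \<phi>' pure(1)] ahomD(3)[OF \<psi>' pure(2)] c
    have "c \<otimes> (\<phi> a \<otimes> \<psi> b) = \<phi>' a \<otimes> (c \<otimes> \<psi> b)"
      using cl 1[OF pure(1)] by (simp add: Z.m_assoc[symmetric])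
    also have "\<dots> = \<phi>' a \<otimes> \<psi>' b \<otimes> c"
      using cl 2[OF pure(2)] by (simp add: Z.m_assoc[symmetric])
    finally show ?case using pure by (simp add: star_pure \<phi> \<psi> \<phi>' \<psi>')
  next
    case (add s t)
    then show ?case using c
      by (simp only: star_add \<phi> \<psi> \<phi>' \<psi>' star_closed Z.l_distr Z.r_distr)
  qed
qed

text \<open>An element that commutes with both images commutes with every value of
  \<open>star\<close>: the case of \<open>star_intertwine\<close> in which the maps on both sides
  coincide.\<close>

lemma cpair_star1:
  fixes Z (structure)
  assumes ab: "cpair A B Z \<phi> \<psi>" and ac: "cpair A C Z \<phi> \<chi>" and bc: "cpair B C Z \<psi> \<chi>"
  shows "cpair (A \<boxtimes> B) C Z (star A B Z \<phi> \<psi>) \<chi>"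
  unfolding cpair_def
proof (intro conjI ballI)
  show "ahom (A \<boxtimes> B) Z (star A B Z \<phi> \<psi>)" using ab by blast
  show "ahom C Z \<chi>" using ac cpairD by blast
  fix t c assume t: "t \<in> carrier (A \<boxtimes> B)" and c: "c \<in> carrier C"
  show "star A B Z \<phi> \<psi> t \<otimes> \<chi> c = \<chi> c \<otimes> star A B Z \<phi> \<psi> t"
    by (rule star_intertwine[symmetric])
      (use t c cpairD[OF ab] cpairD[OF ac] cpairD[OF bc] ahomD(3)[OF cpairD(2)[OF ac]] in auto)
qed

lemma cpair_star2:
  "cpair A B Z \<phi> \<psi> \<Longrightarrow> cpair C A Z \<chi> \<phi> \<Longrightarrow> cpair C B Z \<chi> \<psi> \<Longrightarrow> cpair C (A \<boxtimes> B) Z \<chi> (star A B Z \<phi> \<psi>)"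
  by (blast intro: cpair_sym cpair_star1)

section \<open>Structure maps of tensor products as algebra maps\<close>

text \<open>In this form the map is visibly an algebra map, and its composites can be computed on
  the two legs. The flip, the associator and the middle flip are brought into the same form
  below.\<close>

lemma tensor_map_star:
  assumes f: "ahom A C f" and g: "ahom B D g"
  shows "tensor_map K A B C D f g = star A B (C \<boxtimes> D) (in1 C D \<circ> f) (in2 C D \<circ> g)"
  unfolding tensor_map_def star_def tensor_lift_tensor_group
  by (rule tensor_lift_cong) (simp add: in_pure ahomD(2,3)[OF f] ahomD(2,3)[OF g])

lemma tensor_map_hom [intro]:
  assumes f: "ahom A C f" and g: "ahom B D g"
  shows "ahom (A \<boxtimes> B) (C \<boxtimes> D) (tensor_map K A B C D f g)"
  unfolding tensor_map_star[OF f g]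
  by (intro star_hom cpair_comp1[OF cpair_comp2[OF in_cpair]] f g ahomD(2)[OF f] ahomD(2)[OF g])

lemma star_tensor_map:
  assumes \<phi>: "ahom C Z \<phi>" and \<psi>: "ahom D Z \<psi>" and f: "ahom A C f" and g: "ahom B D g"
    and t: "t \<in> carrier (A \<boxtimes> B)"
  shows "star C D Z \<phi> \<psi> (tensor_map K A B C D f g t) = star A B Z (\<phi> \<circ> f) (\<psi> \<circ> g) t"
proof -
  note th = tensor_map_hom[OF f g]
  have Alg: "Alg A" "Alg B" "Alg C" "Alg D" using ahomD[OF f] ahomD[OF g] by auto
  have tp: "tensor_map K A B C D f g (pure K A B a b) = pure K C D (f a) (g b)"
    if "a \<in> carrier A" "b \<in> carrier B" for a b
    using that f g unfolding tensor_map_star[OF f g]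
    by (simp add: star_pure ahom_comp[OF in1_hom[OF Alg(3,4)] f] ahom_comp[OF in2_hom[OF Alg(3,4)] g] ahomD in_pure Alg)
  define \<phi>' \<psi>' where def: "\<phi>' = \<phi> \<circ> f" "\<psi>' = \<psi> \<circ> g"
  have h: "ahom A Z \<phi>'" "ahom B Z \<psi>'" unfolding def using \<phi> \<psi> f g by blast+
  have app: "\<phi>' a = \<phi> (f a)" "\<psi>' b = \<psi> (g b)" for a b by (simp_all add: def)
  from Alg(1,2) t have "star C D Z \<phi> \<psi> (tensor_map K A B C D f g t) = star A B Z \<phi>' \<psi>' t"
  proof (induction t rule: tens_induct)
    case (pure a b)
    then show ?case
      using star_pure[OF h pure] app(1)[of a] app(2)[of b]
        star_pure[OF \<phi> \<psi> ahomD(3)[OF f pure(1)] ahomD(3)[OF g pure(2)]]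
      by (simp add: tp)
  next
    case (add s t)
    then show ?case
      by (simp only: star_add \<phi> \<psi> h ahomD[OF th])
  qed
  then show ?thesis by (simp only: def)
qed

lemma tensor_flip_star:
  assumes A: "Alg A" and B: "Alg B"
  shows "tensor_flip K A B = star A B (B \<boxtimes> A) (in2 B A) (in1 B A)"
  unfolding tensor_flip_def star_def tensor_lift_tensor_group
  by (rule tensor_lift_cong) (use in_pure[OF B A] cpairD(3)[OF in_cpair[OF B A]] in simp)

lemma tensor_flip_hom [intro]:
  "Alg A \<Longrightarrow> Alg B \<Longrightarrow> ahom (A \<boxtimes> B) (B \<boxtimes> A) (tensor_flip K A B)"
  by (simp add: tensor_flip_star star_hom cpair_sym in_cpair)

lemma star_tensor_flip:
  assumes c: "cpair B A Z \<psi> \<phi>" and t: "t \<in> carrier (A \<boxtimes> B)"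
  shows "star B A Z \<psi> \<phi> (tensor_flip K A B t) = star A B Z \<phi> \<psi> t"
proof -
  note \<psi> = cpairD(1)[OF c] and \<phi> = cpairD(2)[OF c]
  have Alg: "Alg A" "Alg B" using ahomD[OF \<phi>] ahomD[OF \<psi>] by auto
  have "star B A Z \<psi> \<phi> (tensor_flip K A B t) =
    star A B Z (star B A Z \<psi> \<phi> \<circ> in2 B A) (star B A Z \<psi> \<phi> \<circ> in1 B A) t"
    unfolding tensor_flip_star[OF Alg] using c t Alg by (intro comp_star) auto
  also have "\<dots> = star A B Z \<phi> \<psi> t"
    by (rule fun_cong[OF star_cong]) (simp_all add: star_comp_in1 star_comp_in2 \<phi> \<psi>)
  finally show ?thesis .
qed

text \<open>The definition nests a lift over B \<otimes> C inside a lift over A. Pulling the image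
  of \<open>a\<close> out of the inner lift as a left factor exhibits the three leg embeddings of
  the target.\<close>

lemma tensor_assoc_star:
  assumes A: "Alg A" and B: "Alg B" and C: "Alg C"
  shows "tensor_assoc K A B C = star A (B \<boxtimes> C) (A \<boxtimes> B \<boxtimes> C) (in1 (A \<boxtimes> B) C \<circ> in1 A B)
     (star B C (A \<boxtimes> B \<boxtimes> C) (in1 (A \<boxtimes> B) C \<circ> in2 A B) (in2 (A \<boxtimes> B) C))"
  unfolding tensor_assoc_def tensor_lift_tensor_group star_def[of A "B \<boxtimes> C"]
proof (rule tensor_lift_cong)
  fix a t assume a: "a \<in> carrier A" and t: "t \<in> carrier (B \<boxtimes> C)"
  let ?Z = "A \<boxtimes> B \<boxtimes> C"
  interpret Z: ring ?Z using A B C by simp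
  let ?b = "\<lambda>b c. pure K (A \<boxtimes> B) C (pure K A B a b) c"
  define \<alpha> \<beta> where def: "\<alpha> = in1 (A \<boxtimes> B) C \<circ> in1 A B" "\<beta> = in1 (A \<boxtimes> B) C \<circ> in2 A B"
  have app: "\<alpha> a = in1 (A \<boxtimes> B) C (in1 A B a)" "\<beta> b = in1 (A \<boxtimes> B) C (in2 A B b)" for a b
    by (simp_all add: def)
  have h: "ahom A ?Z \<alpha>" "ahom B ?Z \<beta>" "ahom C ?Z (in2 (A \<boxtimes> B) C)"
    unfolding def using A B C by blast+
  interpret B: module K B using B by simp
  interpret C: module K C using C by simp
  have bl: "?b (r \<odot>\<^bsub>B\<^esub> b) c = ?b b (r \<odot>\<^bsub>C\<^esub> c)"
    if "r \<in> carrier K" "b \<in> carrier B" "c \<in> carrier C" for r b c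
    using that a A B C pure_balanced[of K "A \<boxtimes> B" C r "pure K A B a b" c]
    by (simp add: pure_balanced[of K A B, symmetric] smult_pure[of K A B])
  have bal: "balanced K B C ?Z ?b"
    by (rule balanced_tensorI)
      (use a A B C bl in \<open>simp_all add: pure_add_r pure_add_l\<close>)
  have "tensor_lift K B C (add_monoid ?Z) ?b t =
    \<alpha> a \<otimes>\<^bsub>?Z\<^esub> star B C ?Z \<beta> (in2 (A \<boxtimes> B) C) t"
    using B C t
  proof (induction t rule: tens_induct)
    case (pure b c)
    have "\<alpha> a \<otimes>\<^bsub>?Z\<^esub> (\<beta> b \<otimes>\<^bsub>?Z\<^esub> in2 (A \<boxtimes> B) C c)
      = in1 (A \<boxtimes> B) C (in1 A B a \<otimes>\<^bsub>A \<boxtimes> B\<^esub> in2 A B b) \<otimes>\<^bsub>?Z\<^esub> in2 (A \<boxtimes> B) C c"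
      using ahomD[OF in1_hom[OF tens_Alg[OF A B] C]] ahomD[OF in1_hom[OF A B]] ahomD[OF in2_hom[OF A B]]
        ahomD[OF h(3)] a pure by (simp add: app Z.m_assoc)
    also have "\<dots> = ?b b c" using a pure A B C by (simp add: in_pure)
    finally show ?case using pure by (simp add: star_pure h tensor_lift_pure[OF bal])
  next
    case (add s t)
    show ?case
      using add tensor_lift_add[OF bal, of s t] a ahomD(3)[OF h(1) a]
      by (simp only: star_add h star_closed Z.r_distr)
  qed
  then show "tensor_lift K B C (add_monoid ?Z) ?b t =
    (in1 (A \<boxtimes> B) C \<circ> in1 A B) a \<otimes>\<^bsub>?Z\<^esub> star B C ?Z (in1 (A \<boxtimes> B) C \<circ> in2 A B) (in2 (A \<boxtimes> B) C) t"
    by (simp only: def)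
qed

section \<open>Bialgebras and triangular structures through commuting algebra maps\<close>

text \<open>The left side is an algebra map applied to a \<open>star\<close>, so it is determined by
  its values on the three legs, and these are \<phi>1, \<phi>2 and \<phi>3.\<close>

lemma star_assoc:
  assumes 12: "cpair A B Z \<phi>1 \<phi>2" and 13: "cpair A C Z \<phi>1 \<phi>3" and 23: "cpair B C Z \<phi>2 \<phi>3"
    and t: "t \<in> carrier (A \<boxtimes> (B \<boxtimes> C))"
  shows "star (A \<boxtimes> B) C Z (star A B Z \<phi>1 \<phi>2) \<phi>3 (tensor_assoc K A B C t) =
    star A (B \<boxtimes> C) Z \<phi>1 (star B C Z \<phi>2 \<phi>3) t"
proof -
  note h = cpairD(1)[OF 12] cpairD(2)[OF 12] cpairD(2)[OF 13]
  note Alg = ahomD(1)[OF h(1)] ahomD(1)[OF h(2)] ahomD(1)[OF h(3)]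
  note AB = tens_Alg[OF Alg(1,2)]
  let ?O = "star (A \<boxtimes> B) C Z (star A B Z \<phi>1 \<phi>2) \<phi>3"
  let ?u1 = "in1 (A \<boxtimes> B) C \<circ> in1 A B" and ?u2 = "in1 (A \<boxtimes> B) C \<circ> in2 A B" and ?u3 = "in2 (A \<boxtimes> B) C"
  have c: "cpair (A \<boxtimes> B) C Z (star A B Z \<phi>1 \<phi>2) \<phi>3" by (rule cpair_star1) fact+
  have O: "ahom (A \<boxtimes> B \<boxtimes> C) Z ?O" by (rule star_hom[OF c])
  note i = in1_hom[OF Alg(1,2)] in2_hom[OF Alg(1,2)] in1_hom[OF AB Alg(3)] in2_hom[OF AB Alg(3)]
  have u: "ahom A (A \<boxtimes> B \<boxtimes> C) ?u1" "ahom B (A \<boxtimes> B \<boxtimes> C) ?u2" "ahom C (A \<boxtimes> B \<boxtimes> C) ?u3"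
    using i by blast+
  have cu: "cpair B C (A \<boxtimes> B \<boxtimes> C) ?u2 ?u3"
    by (intro cpair_comp1[OF in_cpair] AB Alg i)
  note uu = star_hom[OF cu]
  have 1: "?O (?u1 a) = \<phi>1 a" if "a \<in> carrier A" for a
    using that by (simp add: star_comp_in1 star_comp_in1[OF star_hom[OF 12]] h ahomD[OF i(1)])
  have 2: "?O (?u2 a) = \<phi>2 a" if "a \<in> carrier B" for a
    using that by (simp add: star_comp_in1 star_comp_in2 star_comp_in1[OF star_hom[OF 12]] h ahomD[OF i(2)])
  have 3: "?O (?u3 a) = \<phi>3 a" if "a \<in> carrier C" for a
    using that by (rule star_comp_in2[OF star_hom[OF 12] h(3)])
  have 4: "?O (star B C (A \<boxtimes> B \<boxtimes> C) ?u2 ?u3 s) = star B C Z \<phi>2 \<phi>3 s" if s: "s \<in> carrier (B \<boxtimes> C)" for s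
    unfolding comp_star[OF O u(2) u(3) s]
    by (rule fun_cong[OF star_cong]) (simp_all only: o_def 2[unfolded o_def] 3)
  show ?thesis
    unfolding tensor_assoc_star[OF Alg] comp_star[OF O u(1) uu t]
    by (rule fun_cong[OF star_cong]) (simp_all only: o_def 1[unfolded o_def] 4[unfolded o_def])
qed

text \<open>Evaluation at the three leg embeddings is the identity. An equation between triple
  tensors hence follows from its evaluation at this one commuting triple.\<close>

lemma star_univ3:
  assumes "Alg A" "Alg B" "Alg C" "t \<in> carrier (A \<boxtimes> B \<boxtimes> C)"
  shows "star (A \<boxtimes> B) C (A \<boxtimes> B \<boxtimes> C)
     (star A B (A \<boxtimes> B \<boxtimes> C) (in1 (A \<boxtimes> B) C \<circ> in1 A B) (in1 (A \<boxtimes> B) C \<circ> in2 A B)) (in2 (A \<boxtimes> B) C) t = t"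
proof -
  note AB = tens_Alg[OF assms(1,2)]
  have "star A B (A \<boxtimes> B \<boxtimes> C) (in1 (A \<boxtimes> B) C \<circ> in1 A B) (in1 (A \<boxtimes> B) C \<circ> in2 A B) s = in1 (A \<boxtimes> B) C s"
    if "s \<in> carrier (A \<boxtimes> B)" for s
    using ahom_tens_eq[OF in1_hom[OF AB assms(3)] assms(1,2) that] by simp
  then show ?thesis
    using star_in[OF AB assms(3,4)] by (simp cong: star_cong)
qed

lemma univ3_cpairs:
  assumes "Alg A" "Alg B" "Alg C"
  shows "cpair A B (A \<boxtimes> B \<boxtimes> C) (in1 (A \<boxtimes> B) C \<circ> in1 A B) (in1 (A \<boxtimes> B) C \<circ> in2 A B)"
    "cpair A C (A \<boxtimes> B \<boxtimes> C) (in1 (A \<boxtimes> B) C \<circ> in1 A B) (in2 (A \<boxtimes> B) C)"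
    "cpair B C (A \<boxtimes> B \<boxtimes> C) (in1 (A \<boxtimes> B) C \<circ> in2 A B) (in2 (A \<boxtimes> B) C)"
  using assms by (blast intro: cpair_comp3 cpair_comp1[OF in_cpair])+

lemma ahom_Units:
  assumes f: "ahom A B f" and u: "u \<in> Units A"
  shows "f u \<in> Units B" "f (inv\<^bsub>A\<^esub> u) = inv\<^bsub>B\<^esub> f u"
proof -
  interpret A: ring A using ahomD(1)[OF f] by simp
  interpret B: ring B using ahomD(2)[OF f] by simp
  have 1: "f u \<otimes>\<^bsub>B\<^esub> f (inv\<^bsub>A\<^esub> u) = \<one>\<^bsub>B\<^esub>" "f (inv\<^bsub>A\<^esub> u) \<otimes>\<^bsub>B\<^esub> f u = \<one>\<^bsub>B\<^esub>"
    using u ahomD(4)[OF f, of u "inv\<^bsub>A\<^esub> u"] ahomD(4)[OF f, of "inv\<^bsub>A\<^esub> u" u] ahomD(6)[OF f] by auto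
  have c: "f u \<in> carrier B" "f (inv\<^bsub>A\<^esub> u) \<in> carrier B" using u ahomD(3)[OF f] by auto
  show "f u \<in> Units B" using 1 c unfolding Units_def by blast
  show "f (inv\<^bsub>A\<^esub> u) = inv\<^bsub>B\<^esub> f u" using 1 c by (metis B.inv_unique')
qed

section \<open>Convolution of algebra maps and its unit\<close>

definition triv :: "('k, 'a) bialg \<Rightarrow> ('k, 'z, 'l) module_scheme \<Rightarrow> 'a \<Rightarrow> 'z" where
  "triv H Z x = counit H x \<odot>\<^bsub>Z\<^esub> \<one>\<^bsub>Z\<^esub>"

text \<open>The restriction to the carrier turns associativity, and the one instance of
  commutativity that is needed, into equations of functions, which can be rewritten inside the
  arguments of \<open>star\<close> and of another \<open>conv\<close>.\<close>

definition conv ::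
  "('k, 'a) bialg \<Rightarrow> ('k, 'z, 'l) module_scheme \<Rightarrow> ('a \<Rightarrow> 'z) \<Rightarrow> ('a \<Rightarrow> 'z) \<Rightarrow> 'a \<Rightarrow> 'z" where
  "conv H Z \<phi> \<psi> = restrict (\<lambda>x. star H H Z \<phi> \<psi> (comul H x)) (carrier H)"

abbreviation leg1 where "leg1 H \<equiv> in1 (H \<boxtimes> H) H \<circ> in1 H H"
abbreviation leg2 where "leg2 H \<equiv> in1 (H \<boxtimes> H) H \<circ> in2 H H"
abbreviation leg3 where "leg3 H \<equiv> in2 (H \<boxtimes> H) H"

lemma conv_apply: "x \<in> carrier H \<Longrightarrow> conv H Z \<phi> \<psi> x = star H H Z \<phi> \<psi> (comul H x)"
  by (simp add: conv_def)

lemma conv_cong: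
  assumes "\<And>a. a \<in> carrier H \<Longrightarrow> \<phi> a = \<phi>' a" "\<And>b. b \<in> carrier H \<Longrightarrow> \<psi> b = \<psi>' b"
  shows "conv H Z \<phi> \<psi> = conv H Z \<phi>' \<psi>'"
  unfolding conv_def using star_cong[of H \<phi> \<phi>' H \<psi> \<psi>' Z] assms by simp

text \<open>Comultiplication and counit are algebra maps, without coassociativity and the counit
  laws. This is enough for \<open>conv\<close> and \<open>triv\<close> to be algebra maps, and the
  remaining laws are then stated through them in \<open>bialgebraI\<close>.\<close>

definition coalg :: "('k, 'a) bialg \<Rightarrow> bool" where
  "coalg H \<longleftrightarrow> ahom H (H \<boxtimes> H) (comul H) \<and> counit H \<in> ring_hom H K \<and>
     (\<forall>r\<in>carrier K. \<forall>x\<in>carrier H. counit H (r \<odot>\<^bsub>H\<^esub> x) = r \<otimes>\<^bsub>K\<^esub> counit H x)"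

lemma coalgD:
  assumes "coalg H"
  shows "ahom H (H \<boxtimes> H) (comul H)" "Alg H"
    "\<And>x. x \<in> carrier H \<Longrightarrow> counit H x \<in> carrier K"
    "\<And>x y. x \<in> carrier H \<Longrightarrow> y \<in> carrier H \<Longrightarrow> counit H (x \<otimes>\<^bsub>H\<^esub> y) = counit H x \<otimes>\<^bsub>K\<^esub> counit H y"
    "\<And>x y. x \<in> carrier H \<Longrightarrow> y \<in> carrier H \<Longrightarrow> counit H (x \<oplus>\<^bsub>H\<^esub> y) = counit H x \<oplus>\<^bsub>K\<^esub> counit H y"
    "counit H \<one>\<^bsub>H\<^esub> = \<one>\<^bsub>K\<^esub>"
    "\<And>r x. r \<in> carrier K \<Longrightarrow> x \<in> carrier H \<Longrightarrow> counit H (r \<odot>\<^bsub>H\<^esub> x) = r \<otimes>\<^bsub>K\<^esub> counit H x"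
    "\<And>x. x \<in> carrier H \<Longrightarrow> comul H x \<in> carrier (H \<boxtimes> H)"
  using assms ahomD[of H "H \<boxtimes> H" "comul H"] by (auto simp: coalg_def ring_hom_def)

lemma bialgebra_coalg: "bialgebra K H \<Longrightarrow> coalg H"
  unfolding bialgebra_def coalg_def ahom_def by auto

lemma triv_hom [intro]:
  assumes H: "coalg H" and Z: "Alg Z"
  shows "ahom H Z (triv H Z)"
proof -
  note [simp] = coalgD[OF H]
  interpret Z: ring Z using Z by simp
  interpret ZM: module K Z using Z by simp
  show ?thesis
    by (rule ahomI) (use Z in \<open>auto simp: triv_def ZM.smult_l_distr ZM.smult_assoc1 Alg_smult_left\<close>)
qed

text \<open>The values of \<open>triv\<close> are scalar multiples of the unit, hence
  central.\<close>

lemma triv_cpair1: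
  assumes H: "coalg H" and \<psi>: "ahom B Z \<psi>"
  shows "cpair H B Z (triv H Z) \<psi>"
proof -
  interpret Z: ring Z using ahomD(2)[OF \<psi>] by simp
  show ?thesis
    unfolding cpair_def using H \<psi> ahomD(2)[OF \<psi>]
    by (auto simp: triv_def ahomD Alg_smult_left Alg_smult_right coalgD intro!: triv_hom)
qed

lemma triv_cpair2: "coalg H \<Longrightarrow> ahom B Z \<psi> \<Longrightarrow> cpair B H Z \<psi> (triv H Z)"
  by (rule cpair_sym[OF triv_cpair1])

lemma comp_triv:
  assumes "coalg H" "ahom Z W \<chi>" "x \<in> carrier H"
  shows "\<chi> (triv H Z x) = triv H W x"
proof -
  interpret Z: ring Z using ahomD(1)[OF assms(2)] by simp
  show ?thesis using assms by (simp add: triv_def ahomD[OF assms(2)] coalgD)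
qed

lemma conv_hom [intro]: "coalg H \<Longrightarrow> cpair H H Z \<phi> \<psi> \<Longrightarrow> ahom H Z (conv H Z \<phi> \<psi>)"
  by (rule ahom_cong[OF ahom_comp[OF star_hom coalgD(1)]]) (auto simp: conv_apply)

lemma cpair_cong:
  assumes "cpair A B Z \<phi> \<psi>" "\<And>a. a \<in> carrier A \<Longrightarrow> \<phi> a = \<phi>' a" "\<And>b. b \<in> carrier B \<Longrightarrow> \<psi> b = \<psi>' b"
  shows "cpair A B Z \<phi>' \<psi>'"
  using assms ahom_cong[of A Z \<phi> \<phi>'] ahom_cong[of B Z \<psi> \<psi>'] unfolding cpair_def by (metis (no_types))

lemma cpair_conv1:
  assumes "coalg H" "cpair H H Z \<phi> \<psi>" "cpair H C Z \<phi> \<chi>" "cpair H C Z \<psi> \<chi>"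
  shows "cpair H C Z (conv H Z \<phi> \<psi>) \<chi>"
  by (rule cpair_cong[OF cpair_comp1[OF cpair_star1[OF assms(2,3,4)] coalgD(1)[OF assms(1)]]])
    (auto simp: conv_apply)

lemma cpair_conv2:
  assumes "coalg H" "cpair H H Z \<phi> \<psi>" "cpair C H Z \<chi> \<phi>" "cpair C H Z \<chi> \<psi>"
  shows "cpair C H Z \<chi> (conv H Z \<phi> \<psi>)"
  using assms by (blast intro: cpair_conv1 cpair_sym)

lemma comp_conv:
  assumes "coalg H" "ahom Z W \<chi>" "ahom H Z \<phi>" "ahom H Z \<psi>" "x \<in> carrier H"
  shows "\<chi> (conv H Z \<phi> \<psi> x) = conv H W (\<chi> \<circ> \<phi>) (\<chi> \<circ> \<psi>) x"
  using assms by (simp add: conv_apply comp_star coalgD)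

text \<open>Applying the comultiplication to a leg becomes a convolution of the maps at which the
  resulting legs are evaluated. In this way identities with \<Delta> \<otimes> Id turn into
  identities between values on H \<otimes> H.\<close>

lemma star_comul_id:
  assumes H: "coalg H" and 12: "cpair H H Z \<phi>1 \<phi>2" and 3: "ahom H Z \<phi>3" and t: "t \<in> carrier (H \<boxtimes> H)"
  shows "star (H \<boxtimes> H) H Z (star H H Z \<phi>1 \<phi>2) \<phi>3 (comul_id K H t) = star H H Z (conv H Z \<phi>1 \<phi>2) \<phi>3 t"
proof -
  have "star (H \<boxtimes> H) H Z (star H H Z \<phi>1 \<phi>2) \<phi>3 (comul_id K H t) =
     star H H Z (star H H Z \<phi>1 \<phi>2 \<circ> comul H) (\<phi>3 \<circ> (\<lambda>x. x)) t"
    unfolding comul_id_def by (rule star_tensor_map) (use assms coalgD in blast)+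
  also have "\<dots> = star H H Z (conv H Z \<phi>1 \<phi>2) \<phi>3 t"
    by (rule fun_cong[OF star_cong]) (auto simp: conv_apply)
  finally show ?thesis .
qed

lemma star_id_comul:
  assumes H: "coalg H" and 1: "ahom H Z \<phi>1" and 23: "cpair H H Z \<phi>2 \<phi>3" and t: "t \<in> carrier (H \<boxtimes> H)"
  shows "star H (H \<boxtimes> H) Z \<phi>1 (star H H Z \<phi>2 \<phi>3) (id_comul K H t) = star H H Z \<phi>1 (conv H Z \<phi>2 \<phi>3) t"
proof -
  have "star H (H \<boxtimes> H) Z \<phi>1 (star H H Z \<phi>2 \<phi>3) (id_comul K H t) =
     star H H Z (\<phi>1 \<circ> (\<lambda>x. x)) (star H H Z \<phi>2 \<phi>3 \<circ> comul H) t"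
    unfolding id_comul_def by (rule star_tensor_map) (use assms coalgD in blast)+
  also have "\<dots> = star H H Z \<phi>1 (conv H Z \<phi>2 \<phi>3) t"
    by (rule fun_cong[OF star_cong]) (auto simp: conv_apply)
  finally show ?thesis .
qed

lemma id_comul_hom: "coalg H \<Longrightarrow> ahom (H \<boxtimes> H) (H \<boxtimes> (H \<boxtimes> H)) (id_comul K H)"
  unfolding id_comul_def by (intro tensor_map_hom ahom_id coalgD)

lemma comul_id_hom: "coalg H \<Longrightarrow> ahom (H \<boxtimes> H) (H \<boxtimes> H \<boxtimes> H) (comul_id K H)"
  unfolding comul_id_def by (intro tensor_map_hom ahom_id coalgD)

lemma tensor_assoc_hom: "Alg A \<Longrightarrow> Alg B \<Longrightarrow> Alg C \<Longrightarrow> ahom (A \<boxtimes> (B \<boxtimes> C)) (A \<boxtimes> B \<boxtimes> C) (tensor_assoc K A B C)"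
  unfolding tensor_assoc_star by (intro star_hom cpair_star2 univ3_cpairs)

lemma star_assoc_id_comul:
  assumes H: "coalg H" and c: "cpair H H Z \<phi>1 \<phi>2" "cpair H H Z \<phi>1 \<phi>3" "cpair H H Z \<phi>2 \<phi>3" and t: "t \<in> carrier (H \<boxtimes> H)"
  shows "star (H \<boxtimes> H) H Z (star H H Z \<phi>1 \<phi>2) \<phi>3 (tensor_assoc K H H H (id_comul K H t)) =
    star H H Z \<phi>1 (conv H Z \<phi>2 \<phi>3) t"
  using star_assoc[OF c ahomD(3)[OF id_comul_hom[OF H] t]]
    star_id_comul[OF H cpairD(1)[OF c(1)] c(3) t] by simp

section \<open>Leg embeddings, coassociativity and counit laws under evaluation\<close>

lemma star_legs:
  assumes "cpair H H Z \<phi>1 \<phi>2" "cpair H H Z \<phi>1 \<phi>3" "cpair H H Z \<phi>2 \<phi>3" and t: "t \<in> carrier (H \<boxtimes> H)"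
  shows "star (H \<boxtimes> H) H Z (star H H Z \<phi>1 \<phi>2) \<phi>3 (leg12 K H t) = star H H Z \<phi>1 \<phi>2 t"
    "star (H \<boxtimes> H) H Z (star H H Z \<phi>1 \<phi>2) \<phi>3 (leg13 K H t) = star H H Z \<phi>1 \<phi>3 t"
    "star (H \<boxtimes> H) H Z (star H H Z \<phi>1 \<phi>2) \<phi>3 (leg23 K H t) = star H H Z \<phi>2 \<phi>3 t"
proof -
  note h = cpairD(1)[OF assms(1)] cpairD(2)[OF assms(1)] cpairD(2)[OF assms(2)]
  note H = ahomD(1)[OF h(1)]
  note HH = tens_Alg[OF H H]
  let ?O = "star (H \<boxtimes> H) H Z (star H H Z \<phi>1 \<phi>2) \<phi>3"
  have c: "cpair (H \<boxtimes> H) H Z (star H H Z \<phi>1 \<phi>2) \<phi>3" by (rule cpair_star1) fact+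
  note O = star_hom[OF c]
  show "?O (leg12 K H t) = star H H Z \<phi>1 \<phi>2 t"
    using star_comp_in1[OF star_hom[OF assms(1)] h(3) t] by (simp add: leg12_def in1_def)
  interpret H: ring H using H by simp
  interpret H3: ring "H \<boxtimes> H \<boxtimes> H" using H HH by simp
  note pu = pure_carrier[OF H H]
  note u = univ3_cpairs[OF H H H]
  have 1: "?O (leg1 H a) = \<phi>1 a" if "a \<in> carrier H" for a
    using that by (simp add: star_comp_in1 star_comp_in1[OF star_hom[OF assms(1)]] h ahomD[OF in1_hom[OF H H]])
  have 2: "?O (leg2 H a) = \<phi>2 a" if "a \<in> carrier H" for a
    using that by (simp add: star_comp_in1 star_comp_in2 star_comp_in1[OF star_hom[OF assms(1)]] h ahomD[OF in2_hom[OF H H]])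
  have 3: "?O (leg3 H a) = \<phi>3 a" if "a \<in> carrier H" for a
    using that by (rule star_comp_in2[OF star_hom[OF assms(1)] h(3)])
  have "leg13 K H = star H H (H \<boxtimes> H \<boxtimes> H) (leg1 H) (leg3 H)"
    unfolding leg13_def star_def tensor_lift_tensor_group
    by (rule tensor_lift_cong) (simp add: in1_def in2_def mult_pure HH H)
  then have "?O (leg13 K H t) = star H H Z (?O \<circ> leg1 H) (?O \<circ> leg3 H) t"
    using comp_star[OF O cpairD(1)[OF u(2)] cpairD(2)[OF u(2)] t] by simp
  also have "\<dots> = star H H Z \<phi>1 \<phi>3 t"
    by (rule fun_cong[OF star_cong]) (simp_all only: o_def 1[unfolded o_def] 3)
  finally show "?O (leg13 K H t) = star H H Z \<phi>1 \<phi>3 t" .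
  have "leg23 K H = star H H (H \<boxtimes> H \<boxtimes> H) (leg2 H) (leg3 H)"
    unfolding leg23_def star_def tensor_lift_tensor_group
    by (rule tensor_lift_cong) (simp add: in1_def in2_def mult_pure HH H)
  then have "?O (leg23 K H t) = star H H Z (?O \<circ> leg2 H) (?O \<circ> leg3 H) t"
    using comp_star[OF O cpairD(1)[OF u(3)] cpairD(2)[OF u(3)] t] by simp
  also have "\<dots> = star H H Z \<phi>2 \<phi>3 t"
    by (rule fun_cong[OF star_cong]) (simp_all only: o_def 2[unfolded o_def] 3)
  finally show "?O (leg23 K H t) = star H H Z \<phi>2 \<phi>3 t" .
qed

lemma leg_closed:
  assumes H: "Alg H" and t: "t \<in> carrier (H \<boxtimes> H)"
  shows "leg12 K H t \<in> carrier (H \<boxtimes> H \<boxtimes> H)" "leg13 K H t \<in> carrier (H \<boxtimes> H \<boxtimes> H)"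
    "leg23 K H t \<in> carrier (H \<boxtimes> H \<boxtimes> H)"
proof -
  note u = univ3_cpairs[OF H H H]
  interpret H: ring H using H by simp
  note HH = tens_Alg[OF H H]
  show "leg12 K H t \<in> carrier (H \<boxtimes> H \<boxtimes> H)" using H HH t by (simp add: leg12_def)
  have "leg13 K H = star H H (H \<boxtimes> H \<boxtimes> H) (leg1 H) (leg3 H)"
    unfolding leg13_def star_def tensor_lift_tensor_group
    by (rule tensor_lift_cong) (simp add: in1_def in2_def mult_pure HH H)
  then show "leg13 K H t \<in> carrier (H \<boxtimes> H \<boxtimes> H)"
    using star_closed[OF cpairD(1,2)[OF u(2)] t] by simp
  have "leg23 K H = star H H (H \<boxtimes> H \<boxtimes> H) (leg2 H) (leg3 H)"
    unfolding leg23_def star_def tensor_lift_tensor_group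
    by (rule tensor_lift_cong) (simp add: in1_def in2_def mult_pure HH H)
  then show "leg23 K H t \<in> carrier (H \<boxtimes> H \<boxtimes> H)"
    using star_closed[OF cpairD(1,2)[OF u(3)] t] by simp
qed

text \<open>This is coassociativity evaluated at the three maps: one bracketing evaluates (\<Delta>
  \<otimes> Id) \<Delta>, the other the reassociated (Id \<otimes> \<Delta>) \<Delta>.\<close>

lemma conv_assoc:
  assumes H: "bialgebra K H" and c: "cpair H H Z \<phi>1 \<phi>2" "cpair H H Z \<phi>1 \<phi>3" "cpair H H Z \<phi>2 \<phi>3"
  shows "conv H Z (conv H Z \<phi>1 \<phi>2) \<phi>3 = conv H Z \<phi>1 (conv H Z \<phi>2 \<phi>3)"
proof (rule extensionalityI[of _ "carrier H"])
  fix x assume x: "x \<in> carrier H"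
  note co = bialgebra_coalg[OF H]
  note t = coalgD(8)[OF co x]
  have "comul_id K H (comul H x) = tensor_assoc K H H H (id_comul K H (comul H x))"
    using H x unfolding bialgebra_def by blast
  then show "conv H Z (conv H Z \<phi>1 \<phi>2) \<phi>3 x = conv H Z \<phi>1 (conv H Z \<phi>2 \<phi>3) x"
    using star_comul_id[OF co c(1) cpairD(2)[OF c(2)] t] star_assoc_id_comul[OF co c t] x
    by (simp add: conv_apply)
qed (simp_all add: conv_def)

lemma counit_id_star:
  assumes A: "coalg A" and B: "Alg B"
  shows "counit_id K A B = star A B B (triv A B) (\<lambda>b. b)"
proof -
  interpret B: ring B using B by simp
  show ?thesis
    unfolding counit_id_def star_def
    by (rule tensor_lift_cong) (simp add: triv_def Alg_smult_left B coalgD[OF A])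
qed

lemma id_counit_star:
  assumes A: "Alg A" and B: "coalg B"
  shows "id_counit K A B = star A B A (\<lambda>a. a) (triv B A)"
proof -
  interpret A: ring A using A by simp
  show ?thesis
    unfolding id_counit_def star_def
    by (rule tensor_lift_cong) (simp add: triv_def Alg_smult_right A coalgD[OF B])
qed

lemma counit_id_hom [intro]:
  assumes "coalg A" "Alg B" shows "ahom (A \<boxtimes> B) B (counit_id K A B)"
  unfolding counit_id_star[OF assms] by (intro star_hom triv_cpair1 ahom_id assms)

lemma id_counit_hom [intro]:
  assumes "Alg A" "coalg B" shows "ahom (A \<boxtimes> B) A (id_counit K A B)"
  unfolding id_counit_star[OF assms] by (intro star_hom triv_cpair2 ahom_id assms)

lemma comp_counit_id:
  assumes A: "coalg A" and B: "Alg B" and \<phi>: "ahom B Z \<phi>" and t: "t \<in> carrier (A \<boxtimes> B)"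
  shows "\<phi> (counit_id K A B t) = star A B Z (triv A Z) \<phi> t"
proof -
  have "\<phi> (counit_id K A B t) = star A B Z (\<phi> \<circ> triv A B) (\<phi> \<circ> (\<lambda>b. b)) t"
    unfolding counit_id_star[OF A B] by (intro comp_star \<phi> triv_hom A B ahom_id t)
  also have "\<dots> = star A B Z (triv A Z) \<phi> t"
    by (rule fun_cong[OF star_cong]) (auto simp: comp_triv[OF A \<phi>])
  finally show ?thesis .
qed

lemma comp_id_counit:
  assumes A: "Alg A" and B: "coalg B" and \<phi>: "ahom A Z \<phi>" and t: "t \<in> carrier (A \<boxtimes> B)"
  shows "\<phi> (id_counit K A B t) = star A B Z \<phi> (triv B Z) t"
proof -
  have "\<phi> (id_counit K A B t) = star A B Z (\<phi> \<circ> (\<lambda>b. b)) (\<phi> \<circ> triv B A) t"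
    unfolding id_counit_star[OF A B] by (intro comp_star \<phi> triv_hom A B ahom_id t)
  also have "\<dots> = star A B Z \<phi> (triv B Z) t"
    by (rule fun_cong[OF star_cong]) (auto simp: comp_triv[OF B \<phi>])
  finally show ?thesis .
qed

lemma conv_triv:
  assumes H: "bialgebra K H" and \<phi>: "ahom H Z \<phi>" and x: "x \<in> carrier H"
  shows "conv H Z (triv H Z) \<phi> x = \<phi> x" "conv H Z \<phi> (triv H Z) x = \<phi> x"
proof -
  note co = bialgebra_coalg[OF H]
  have "counit_id K H H (comul H x) = x" "id_counit K H H (comul H x) = x"
    using H x unfolding bialgebra_def by blast+
  then show "conv H Z (triv H Z) \<phi> x = \<phi> x" "conv H Z \<phi> (triv H Z) x = \<phi> x"
    using comp_counit_id[OF co coalgD(2)[OF co] \<phi> coalgD(8)[OF co x]]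
      comp_id_counit[OF coalgD(2)[OF co] co \<phi> coalgD(8)[OF co x]] x
    by (simp_all add: conv_apply)
qed

text \<open>The laws are asked for at the universal maps, the three leg embeddings and the identity,
  because evaluation there returns the tensors themselves.\<close>

lemma bialgebraI:
  assumes co: "coalg H"
    and assoc: "conv H (H \<boxtimes> H \<boxtimes> H) (conv H (H \<boxtimes> H \<boxtimes> H) (leg1 H) (leg2 H)) (leg3 H) =
       conv H (H \<boxtimes> H \<boxtimes> H) (leg1 H) (conv H (H \<boxtimes> H \<boxtimes> H) (leg2 H) (leg3 H))"
    and unit: "\<And>x. x \<in> carrier H \<Longrightarrow> conv H H (triv H H) (\<lambda>x. x) x = x"
      "\<And>x. x \<in> carrier H \<Longrightarrow> conv H H (\<lambda>x. x) (triv H H) x = x"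
  shows "bialgebra K H"
  unfolding bialgebra_def
proof (intro conjI ballI)
  note H = coalgD(2)[OF co]
  note u = univ3_cpairs[OF H H H]
  show "Alg H" "comul H \<in> algebra_hom K H (H \<boxtimes> H)" "counit H \<in> ring_hom H K"
    using co unfolding coalg_def ahom_def by blast+
  show "counit H (r \<odot>\<^bsub>H\<^esub> x) = r \<otimes>\<^bsub>K\<^esub> counit H x" if "r \<in> carrier K" "x \<in> carrier H" for r x
    using coalgD(7)[OF co] that by blast
  fix x assume x: "x \<in> carrier H"
  note t = coalgD(8)[OF co x]
  show "counit_id K H H (comul H x) = x" "id_counit K H H (comul H x) = x"
    using unit[OF x] x by (simp_all add: counit_id_star[OF co H] id_counit_star[OF H co] conv_apply)
  have "comul_id K H (comul H x) = conv H (H \<boxtimes> H \<boxtimes> H) (conv H (H \<boxtimes> H \<boxtimes> H) (leg1 H) (leg2 H)) (leg3 H) x"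
    using star_comul_id[OF co u(1) cpairD(2)[OF u(2)] t]
      star_univ3[OF H H H ahomD(3)[OF comul_id_hom[OF co] t]] x by (simp add: conv_apply)
  also have "\<dots> = conv H (H \<boxtimes> H \<boxtimes> H) (leg1 H) (conv H (H \<boxtimes> H \<boxtimes> H) (leg2 H) (leg3 H)) x"
    unfolding assoc ..
  also have "\<dots> = tensor_assoc K H H H (id_comul K H (comul H x))"
    using star_assoc_id_comul[OF co u t]
      star_univ3[OF H H H ahomD(3)[OF tensor_assoc_hom[OF H H H] ahomD(3)[OF id_comul_hom[OF co] t]]] x
    by (simp add: conv_apply)
  finally show "comul_id K H (comul H x) = tensor_assoc K H H H (id_comul K H (comul H x))" .
qed

lemma flip_univ:
  assumes "Alg A" "t \<in> carrier (A \<boxtimes> A)"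
  shows "star A A (A \<boxtimes> A) (in2 A A) (in1 A A) t = tensor_flip K A A t"
  using assms by (simp add: tensor_flip_star)

text \<open>Conjugation by a unit is traded for an intertwining equation, in which no inverse has to
  be evaluated.\<close>

lemma Units_conj_iff:
  fixes Z (structure)
  assumes "Alg Z" "u \<in> Units Z" "x \<in> carrier Z" "y \<in> carrier Z"
  shows "y = u \<otimes> x \<otimes> inv u \<longleftrightarrow> y \<otimes> u = u \<otimes> x"
proof -
  interpret Z: ring Z using assms by simp
  have [simp]: "u \<in> carrier Z" "inv u \<in> carrier Z" using assms by auto
  show ?thesis
  proof
    assume "y = u \<otimes> x \<otimes> inv u"
    then show "y \<otimes> u = u \<otimes> x" using assms by (simp add: Z.m_assoc)
  next
    assume "y \<otimes> u = u \<otimes> x"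
    then have "y \<otimes> u \<otimes> inv u = u \<otimes> x \<otimes> inv u" by simp
    then show "y = u \<otimes> x \<otimes> inv u" using assms by (simp add: Z.m_assoc)
  qed
qed

section \<open>The axioms of a triangular bialgebra as identities between evaluations\<close>

lemma triangularD:
  assumes "triangular_bialgebra K (H, R)"
  shows "bialgebra K H" "R \<in> Units (H \<boxtimes> H)" "R \<in> carrier (H \<boxtimes> H)"
    "\<And>x. x \<in> carrier H \<Longrightarrow>
       tensor_flip K H H (comul H x) = R \<otimes>\<^bsub>H \<boxtimes> H\<^esub> comul H x \<otimes>\<^bsub>H \<boxtimes> H\<^esub> inv\<^bsub>H \<boxtimes> H\<^esub> R"
    "tensor_assoc K H H H (id_comul K H R) = leg13 K H R \<otimes>\<^bsub>H \<boxtimes> H \<boxtimes> H\<^esub> leg12 K H R"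
    "comul_id K H R = leg13 K H R \<otimes>\<^bsub>H \<boxtimes> H \<boxtimes> H\<^esub> leg23 K H R"
    "inv\<^bsub>H \<boxtimes> H\<^esub> R = tensor_flip K H H R"
    "coalg H" "Alg H"
  using assms unfolding triangular_bialgebra_def Let_def
  by (auto simp: Units_def dest: bialgebra_coalg coalgD)

lemma R_Units:
  "triangular_bialgebra K (H, R) \<Longrightarrow> cpair H H Z \<phi> \<psi> \<Longrightarrow> star H H Z \<phi> \<psi> R \<in> Units Z"
  by (rule ahom_Units(1)[OF star_hom triangularD(2)])

text \<open>The flip of R evaluated at (\<phi>, \<psi>) is R evaluated at (\<psi>, \<phi>), and by
  triangularity the flip is the inverse.\<close>

lemma R_inverse:
  fixes Z (structure)
  assumes T: "triangular_bialgebra K (H, R)" and c: "cpair H H Z \<phi> \<psi>"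
  shows "star H H Z \<phi> \<psi> R \<otimes> star H H Z \<psi> \<phi> R = \<one>"
proof -
  interpret Z: ring Z using ahomD(2)[OF cpairD(1)[OF c]] by simp
  have "star H H Z \<psi> \<phi> R = inv star H H Z \<phi> \<psi> R"
    using star_tensor_flip[OF c triangularD(3)[OF T]] ahom_Units(2)[OF star_hom[OF c] triangularD(2)[OF T]]
      triangularD(7)[OF T] by simp
  then show ?thesis using R_Units[OF T c] by simp
qed

lemma R_quasi:
  fixes Z (structure)
  assumes T: "triangular_bialgebra K (H, R)" and c: "cpair H H Z \<phi> \<psi>" and x: "x \<in> carrier H"
  shows "star H H Z \<phi> \<psi> R \<otimes> conv H Z \<phi> \<psi> x = conv H Z \<psi> \<phi> x \<otimes> star H H Z \<phi> \<psi> R"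
proof -
  note t = triangularD[OF T]
  note dx = coalgD(8)[OF t(8) x]
  interpret HH: ring "H \<boxtimes> H" using t by simp
  note s = star_hom[OF c]
  have "tensor_flip K H H (comul H x) \<otimes>\<^bsub>H \<boxtimes> H\<^esub> R = R \<otimes>\<^bsub>H \<boxtimes> H\<^esub> comul H x"
    using Units_conj_iff[of "H \<boxtimes> H" R "comul H x" "tensor_flip K H H (comul H x)"] t(2,4,9) x dx
      ahomD(3)[OF tensor_flip_hom[OF t(9) t(9)] dx] by blast
  then have "star H H Z \<phi> \<psi> (tensor_flip K H H (comul H x)) \<otimes> star H H Z \<phi> \<psi> R =
      star H H Z \<phi> \<psi> R \<otimes> star H H Z \<phi> \<psi> (comul H x)"
    using ahomD(4)[OF s _ t(3)] ahomD(4)[OF s t(3)] dx ahomD(3)[OF tensor_flip_hom[OF t(9) t(9)] dx] by metis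
  then show ?thesis using star_tensor_flip[OF c dx] x by (simp add: conv_apply)
qed

lemma R_hex1:
  fixes Z (structure)
  assumes T: "triangular_bialgebra K (H, R)"
    and c: "cpair H H Z \<phi>1 \<phi>2" "cpair H H Z \<phi>1 \<phi>3" "cpair H H Z \<phi>2 \<phi>3"
  shows "star H H Z \<phi>1 (conv H Z \<phi>2 \<phi>3) R = star H H Z \<phi>1 \<phi>3 R \<otimes> star H H Z \<phi>1 \<phi>2 R"
  using star_assoc_id_comul[OF triangularD(8)[OF T] c triangularD(3)[OF T]] triangularD(5)[OF T]
    ahomD(4)[OF star_hom[OF cpair_star1[OF c]] leg_closed(2,1)[OF triangularD(9,3)[OF T]]]
    star_legs[OF c triangularD(3)[OF T]] by simp

lemma R_hex2:
  fixes Z (structure)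
  assumes T: "triangular_bialgebra K (H, R)"
    and c: "cpair H H Z \<phi>1 \<phi>2" "cpair H H Z \<phi>1 \<phi>3" "cpair H H Z \<phi>2 \<phi>3"
  shows "star H H Z (conv H Z \<phi>1 \<phi>2) \<phi>3 R = star H H Z \<phi>1 \<phi>3 R \<otimes> star H H Z \<phi>2 \<phi>3 R"
  using star_comul_id[OF triangularD(8)[OF T] c(1) cpairD(2)[OF c(2)] triangularD(3)[OF T]] triangularD(6)[OF T]
    ahomD(4)[OF star_hom[OF cpair_star1[OF c]] leg_closed(2)[OF triangularD(9,3)[OF T]] leg_closed(3)[OF triangularD(9,3)[OF T]]]
    star_legs[OF c triangularD(3)[OF T]] by simp

lemma Units_idem:
  fixes Z (structure)
  assumes "Alg Z" "u \<in> Units Z" "u = u \<otimes> u"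
  shows "u = \<one>"
proof -
  interpret Z: ring Z using assms by simp
  have "u \<in> carrier Z" using assms by auto
  then show ?thesis using assms Z.Units_l_cancel[of u u "\<one>"] by simp
qed

text \<open>The convolution of \<open>triv\<close> with itself is \<open>triv\<close>. The hexagon
  identities thus make these values of R idempotent, and an invertible idempotent is the
  unit.\<close>

lemma R_triv:
  fixes Z (structure)
  assumes T: "triangular_bialgebra K (H, R)" and \<phi>: "ahom H Z \<phi>"
  shows "star H H Z (triv H Z) \<phi> R = \<one>" "star H H Z \<phi> (triv H Z) R = \<one>"
proof -
  note co = triangularD(8)[OF T] and Z = ahomD(2)[OF \<phi>]
  note th = triv_hom[OF co Z]
  note c = triv_cpair1[OF co th] triv_cpair1[OF co \<phi>] triv_cpair2[OF co \<phi>]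
  have *: "star H H Z (conv H Z (triv H Z) (triv H Z)) \<phi> = star H H Z (triv H Z) \<phi>"
     "star H H Z \<phi> (conv H Z (triv H Z) (triv H Z)) = star H H Z \<phi> (triv H Z)"
    by (rule star_cong; simp add: conv_triv[OF triangularD(1)[OF T] th])+
  show "star H H Z (triv H Z) \<phi> R = \<one>"
    by (rule Units_idem[OF Z R_Units[OF T c(2)]]) (use R_hex2[OF T c(1,2,2)] * in simp)
  show "star H H Z \<phi> (triv H Z) R = \<one>"
    by (rule Units_idem[OF Z R_Units[OF T c(3)]]) (use R_hex1[OF T c(3,3,1)] * in simp)
qed

text \<open>A premise cannot range over target types, so the conditions speak of commuting maps into
  the two algebras H \<otimes> H and H \<otimes> H \<otimes> H. The universal maps take values
  there, and instantiating with them gives back the axioms.\<close>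

lemma triangularI:
  assumes H: "bialgebra K H" and R: "R \<in> carrier (H \<boxtimes> H)"
    and inv: "\<And>\<phi> \<psi>. cpair H H (H \<boxtimes> H) \<phi> \<psi> \<Longrightarrow>
      star H H (H \<boxtimes> H) \<phi> \<psi> R \<otimes>\<^bsub>H \<boxtimes> H\<^esub> star H H (H \<boxtimes> H) \<psi> \<phi> R = \<one>\<^bsub>H \<boxtimes> H\<^esub>"
    and quasi: "\<And>\<phi> \<psi> x. cpair H H (H \<boxtimes> H) \<phi> \<psi> \<Longrightarrow> x \<in> carrier H \<Longrightarrow>
      star H H (H \<boxtimes> H) \<phi> \<psi> R \<otimes>\<^bsub>H \<boxtimes> H\<^esub> conv H (H \<boxtimes> H) \<phi> \<psi> x =
      conv H (H \<boxtimes> H) \<psi> \<phi> x \<otimes>\<^bsub>H \<boxtimes> H\<^esub> star H H (H \<boxtimes> H) \<phi> \<psi> R"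
    and hex1: "\<And>\<phi>1 \<phi>2 \<phi>3. cpair H H (H \<boxtimes> H \<boxtimes> H) \<phi>1 \<phi>2 \<Longrightarrow> cpair H H (H \<boxtimes> H \<boxtimes> H) \<phi>1 \<phi>3 \<Longrightarrow>
        cpair H H (H \<boxtimes> H \<boxtimes> H) \<phi>2 \<phi>3 \<Longrightarrow>
        star H H (H \<boxtimes> H \<boxtimes> H) \<phi>1 (conv H (H \<boxtimes> H \<boxtimes> H) \<phi>2 \<phi>3) R =
        star H H (H \<boxtimes> H \<boxtimes> H) \<phi>1 \<phi>3 R \<otimes>\<^bsub>H \<boxtimes> H \<boxtimes> H\<^esub> star H H (H \<boxtimes> H \<boxtimes> H) \<phi>1 \<phi>2 R"
    and hex2: "\<And>\<phi>1 \<phi>2 \<phi>3. cpair H H (H \<boxtimes> H \<boxtimes> H) \<phi>1 \<phi>2 \<Longrightarrow> cpair H H (H \<boxtimes> H \<boxtimes> H) \<phi>1 \<phi>3 \<Longrightarrow>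
        cpair H H (H \<boxtimes> H \<boxtimes> H) \<phi>2 \<phi>3 \<Longrightarrow>
        star H H (H \<boxtimes> H \<boxtimes> H) (conv H (H \<boxtimes> H \<boxtimes> H) \<phi>1 \<phi>2) \<phi>3 R =
        star H H (H \<boxtimes> H \<boxtimes> H) \<phi>1 \<phi>3 R \<otimes>\<^bsub>H \<boxtimes> H \<boxtimes> H\<^esub> star H H (H \<boxtimes> H \<boxtimes> H) \<phi>2 \<phi>3 R"
  shows "triangular_bialgebra K (H, R)"
proof -
  note co = bialgebra_coalg[OF H]
  note A = coalgD(2)[OF co]
  note HH = tens_Alg[OF A A]
  interpret HH: ring "H \<boxtimes> H" using A by simp
  note c = in_cpair[OF A A]
  note u = univ3_cpairs[OF A A A]
  note R' = ahomD(3)[OF tensor_flip_hom[OF A A] R]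
  \<comment> \<open>The exchanged pair of embeddings evaluates R to its flip, which yields the
    inverse on the other side.\<close>
  have 1: "R \<otimes>\<^bsub>H \<boxtimes> H\<^esub> tensor_flip K H H R = \<one>\<^bsub>H \<boxtimes> H\<^esub>" "tensor_flip K H H R \<otimes>\<^bsub>H \<boxtimes> H\<^esub> R = \<one>\<^bsub>H \<boxtimes> H\<^esub>"
    using inv[OF c] inv[OF cpair_sym[OF c]] by (simp_all only: star_in[OF A A R] flip_univ[OF A R])
  have U: "R \<in> Units (H \<boxtimes> H)" using 1 R R' unfolding Units_def by blast
  have inv': "inv\<^bsub>H \<boxtimes> H\<^esub> R = tensor_flip K H H R" using 1 R R' HH.inv_char by blast
  have q: "tensor_flip K H H (comul H x) = R \<otimes>\<^bsub>H \<boxtimes> H\<^esub> comul H x \<otimes>\<^bsub>H \<boxtimes> H\<^esub> inv\<^bsub>H \<boxtimes> H\<^esub> R" if x: "x \<in> carrier H" for x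
  proof -
    note dx = coalgD(8)[OF co x]
    show ?thesis
      using quasi[OF c x] x Units_conj_iff[OF HH U dx ahomD(3)[OF tensor_flip_hom[OF A A] dx]]
      by (simp only: conv_apply star_in[OF A A R] star_in[OF A A dx] flip_univ[OF A dx])
  qed
  note s3 = star_univ3[OF A A A]
  interpret H3: ring "H \<boxtimes> H \<boxtimes> H" using A HH by simp
  have h1: "tensor_assoc K H H H (id_comul K H R) = leg13 K H R \<otimes>\<^bsub>H \<boxtimes> H \<boxtimes> H\<^esub> leg12 K H R"
    using hex1[OF u] star_assoc_id_comul[OF co u R] star_legs[OF u R]
    by (simp only: s3 leg_closed[OF A R] ahomD(3)[OF tensor_assoc_hom[OF A A A] ahomD(3)[OF id_comul_hom[OF co] R]])
  have h2: "comul_id K H R = leg13 K H R \<otimes>\<^bsub>H \<boxtimes> H \<boxtimes> H\<^esub> leg23 K H R"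
    using hex2[OF u] star_comul_id[OF co u(1) cpairD(2)[OF u(2)] R] star_legs[OF u R]
    by (simp only: s3 leg_closed[OF A R] ahomD(3)[OF comul_id_hom[OF co] R])
  show ?thesis
    unfolding triangular_bialgebra_def Let_def using H U q h1 h2 inv' by simp
qed

section \<open>Twists and the cells of \<open>TwTr\<close> through commuting algebra maps\<close>

lemma twistD:
  assumes "is_twist K H F"
  shows "F \<in> Units (H \<boxtimes> H)" "F \<in> carrier (H \<boxtimes> H)"
    "pure K (H \<boxtimes> H) H F \<one>\<^bsub>H\<^esub> \<otimes>\<^bsub>H \<boxtimes> H \<boxtimes> H\<^esub> comul_id K H F =
       tensor_assoc K H H H (pure K H (H \<boxtimes> H) \<one>\<^bsub>H\<^esub> F \<otimes>\<^bsub>H \<boxtimes> (H \<boxtimes> H)\<^esub> id_comul K H F)"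
    "counit_id K H H F = \<one>\<^bsub>H\<^esub>" "id_counit K H H F = \<one>\<^bsub>H\<^esub>"
  using assms unfolding is_twist_def by (auto simp: Units_def)

lemma star_cocycle_left:
  fixes Z (structure)
  assumes co: "coalg H" and F: "F \<in> carrier (H \<boxtimes> H)"
    and c: "cpair H H Z \<phi>1 \<phi>2" "cpair H H Z \<phi>1 \<phi>3" "cpair H H Z \<phi>2 \<phi>3"
  shows "star (H \<boxtimes> H) H Z (star H H Z \<phi>1 \<phi>2) \<phi>3 (pure K (H \<boxtimes> H) H F \<one>\<^bsub>H\<^esub> \<otimes>\<^bsub>H \<boxtimes> H \<boxtimes> H\<^esub> comul_id K H F) =
    star H H Z \<phi>1 \<phi>2 F \<otimes> star H H Z (conv H Z \<phi>1 \<phi>2) \<phi>3 F"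
  using ahomD(4)[OF star_hom[OF cpair_star1[OF c]] leg_closed(1)[OF coalgD(2)[OF co] F] ahomD(3)[OF comul_id_hom[OF co] F]]
    star_legs(1)[OF c F] star_comul_id[OF co c(1) cpairD(2)[OF c(2)] F]
  by (simp add: leg12_def)

lemma star_cocycle_right:
  fixes Z (structure)
  assumes co: "coalg H" and F: "F \<in> carrier (H \<boxtimes> H)"
    and c: "cpair H H Z \<phi>1 \<phi>2" "cpair H H Z \<phi>1 \<phi>3" "cpair H H Z \<phi>2 \<phi>3"
  shows "star (H \<boxtimes> H) H Z (star H H Z \<phi>1 \<phi>2) \<phi>3
      (tensor_assoc K H H H (pure K H (H \<boxtimes> H) \<one>\<^bsub>H\<^esub> F \<otimes>\<^bsub>H \<boxtimes> (H \<boxtimes> H)\<^esub> id_comul K H F)) =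
    star H H Z \<phi>2 \<phi>3 F \<otimes> star H H Z \<phi>1 (conv H Z \<phi>2 \<phi>3) F"
proof -
  note A = coalgD(2)[OF co] and p = cpair_star2[OF c(3) c(1) c(2)]
  note HH = tens_Alg[OF A A]
  interpret H: ring H using A by simp
  interpret T: ring "H \<boxtimes> (H \<boxtimes> H)" using A HH by simp
  have 1: "pure K H (H \<boxtimes> H) \<one>\<^bsub>H\<^esub> F \<in> carrier (H \<boxtimes> (H \<boxtimes> H))" using A HH F by simp
  note 2 = ahomD(3)[OF id_comul_hom[OF co] F]
  have 3: "star H (H \<boxtimes> H) Z \<phi>1 (star H H Z \<phi>2 \<phi>3) (pure K H (H \<boxtimes> H) \<one>\<^bsub>H\<^esub> F) = star H H Z \<phi>2 \<phi>3 F"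
    using star_comp_in2[OF cpairD(1)[OF c(1)] star_hom[OF c(3)] F] by (simp add: in2_def)
  show ?thesis
    unfolding star_assoc[OF c T.m_closed[OF 1 2]] ahomD(4)[OF star_hom[OF p] 1 2] 3
      star_id_comul[OF co cpairD(1)[OF c(1)] c(3) F] ..
qed

lemma twist_cocycle:
  fixes Z (structure)
  assumes "coalg H" "is_twist K H F"
    and "cpair H H Z \<phi>1 \<phi>2" "cpair H H Z \<phi>1 \<phi>3" "cpair H H Z \<phi>2 \<phi>3"
  shows "star H H Z \<phi>1 \<phi>2 F \<otimes> star H H Z (conv H Z \<phi>1 \<phi>2) \<phi>3 F =
    star H H Z \<phi>2 \<phi>3 F \<otimes> star H H Z \<phi>1 (conv H Z \<phi>2 \<phi>3) F"
  using star_cocycle_left[OF assms(1) twistD(2)[OF assms(2)] assms(3-5)]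
    star_cocycle_right[OF assms(1) twistD(2)[OF assms(2)] assms(3-5)] twistD(3)[OF assms(2)] by simp

lemma twist_triv:
  fixes Z (structure)
  assumes co: "coalg H" and F: "is_twist K H F" and \<phi>: "ahom H Z \<phi>"
  shows "star H H Z (triv H Z) \<phi> F = \<one>" "star H H Z \<phi> (triv H Z) F = \<one>"
  using comp_counit_id[OF co coalgD(2)[OF co] \<phi> twistD(2)[OF F]]
    comp_id_counit[OF coalgD(2)[OF co] co \<phi> twistD(2)[OF F]] twistD(4,5)[OF F] ahomD(6)[OF \<phi>] by simp_all

text \<open>As for \<open>triangularI\<close>, the cocycle condition is recovered from the leg
  embeddings and the counit conditions from the identity of \<open>H\<close>.\<close>

lemma twistI:
  assumes co: "coalg H" and F: "F \<in> Units (H \<boxtimes> H)"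
    and coc: "\<And>\<phi>1 \<phi>2 \<phi>3. cpair H H (H \<boxtimes> H \<boxtimes> H) \<phi>1 \<phi>2 \<Longrightarrow> cpair H H (H \<boxtimes> H \<boxtimes> H) \<phi>1 \<phi>3 \<Longrightarrow>
        cpair H H (H \<boxtimes> H \<boxtimes> H) \<phi>2 \<phi>3 \<Longrightarrow>
        star H H (H \<boxtimes> H \<boxtimes> H) \<phi>1 \<phi>2 F \<otimes>\<^bsub>H \<boxtimes> H \<boxtimes> H\<^esub> star H H (H \<boxtimes> H \<boxtimes> H) (conv H (H \<boxtimes> H \<boxtimes> H) \<phi>1 \<phi>2) \<phi>3 F =
        star H H (H \<boxtimes> H \<boxtimes> H) \<phi>2 \<phi>3 F \<otimes>\<^bsub>H \<boxtimes> H \<boxtimes> H\<^esub> star H H (H \<boxtimes> H \<boxtimes> H) \<phi>1 (conv H (H \<boxtimes> H \<boxtimes> H) \<phi>2 \<phi>3) F"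
    and triv: "\<And>\<phi>. ahom H H \<phi> \<Longrightarrow> star H H H (triv H H) \<phi> F = \<one>\<^bsub>H\<^esub>"
      "\<And>\<phi>. ahom H H \<phi> \<Longrightarrow> star H H H \<phi> (triv H H) F = \<one>\<^bsub>H\<^esub>"
  shows "is_twist K H F"
proof -
  note A = coalgD(2)[OF co]
  note HH = tens_Alg[OF A A]
  interpret H: ring H using A by simp
  interpret T: ring "H \<boxtimes> (H \<boxtimes> H)" using A HH by simp
  interpret T3: ring "H \<boxtimes> H \<boxtimes> H" using A HH by simp
  have F': "F \<in> carrier (H \<boxtimes> H)" using F by (simp add: Units_def)
  note u = univ3_cpairs[OF A A A]
  note s3 = star_univ3[OF A A A]
  have cl: "pure K (H \<boxtimes> H) H F \<one>\<^bsub>H\<^esub> \<otimes>\<^bsub>H \<boxtimes> H \<boxtimes> H\<^esub> comul_id K H F \<in> carrier (H \<boxtimes> H \<boxtimes> H)"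
    "tensor_assoc K H H H (pure K H (H \<boxtimes> H) \<one>\<^bsub>H\<^esub> F \<otimes>\<^bsub>H \<boxtimes> (H \<boxtimes> H)\<^esub> id_comul K H F) \<in> carrier (H \<boxtimes> H \<boxtimes> H)"
    by (intro T3.m_closed T.m_closed ahomD(3)[OF comul_id_hom[OF co]] ahomD(3)[OF id_comul_hom[OF co]]
        ahomD(3)[OF tensor_assoc_hom[OF A A A]] pure_carrier A HH F' H.one_closed)+
  have "pure K (H \<boxtimes> H) H F \<one>\<^bsub>H\<^esub> \<otimes>\<^bsub>H \<boxtimes> H \<boxtimes> H\<^esub> comul_id K H F =
       tensor_assoc K H H H (pure K H (H \<boxtimes> H) \<one>\<^bsub>H\<^esub> F \<otimes>\<^bsub>H \<boxtimes> (H \<boxtimes> H)\<^esub> id_comul K H F)"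
    using star_cocycle_left[OF co F' u] star_cocycle_right[OF co F' u] coc[OF u] unfolding s3[OF cl(1)] s3[OF cl(2)]
    by simp
  then show ?thesis
    unfolding is_twist_def using F triv[OF ahom_id[OF A]]
    by (simp add: counit_id_star[OF co A] id_counit_star[OF A co])
qed

section \<open>The tensor product bialgebra\<close>

text \<open>
  \<open>tensor_bialgebra K A B\<close>, \<open>tensor K A B\<close> and twisted bialgebras have different record types or fields,
  whereas tensor products see only the algebra part.
\<close>

definition same_alg :: "('k, 'a, 'm) module_scheme \<Rightarrow> ('k, 'a, 'n) module_scheme \<Rightarrow> bool" where
  "same_alg A A' \<longleftrightarrow> carrier A = carrier A' \<and> monoid.mult A = monoid.mult A' \<and> one A = one A' \<and>
     ring.zero A = ring.zero A' \<and> ring.add A = ring.add A' \<and> smult A = smult A'"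

lemma same_alg_refl [simp]: "same_alg A A"
  by (simp add: same_alg_def)

lemma same_alg_sym: "same_alg A A' \<Longrightarrow> same_alg A' A"
  by (simp add: same_alg_def)

lemma tensor_same:
  assumes "same_alg A A'" "same_alg B B'"
  shows "pure K A B = pure K A' B'" "tensor_group K A B = tensor_group K A' B'"
    "tensor_lift K A B = tensor_lift K A' B'" "A \<boxtimes> B = A' \<boxtimes> B'"
proof -
  have 1: "tensor_kernel K A B = tensor_kernel K A' B'"
    using assms unfolding tensor_kernel_def tensor_relations_def same_alg_def by simp
  show 2: "pure K A B = pure K A' B'"
    using assms 1 unfolding pure_def same_alg_def fun_eq_iff by simp
  show 3: "tensor_group K A B = tensor_group K A' B'"
    using assms 1 unfolding tensor_group_def same_alg_def by simp
  show 4: "tensor_lift K A B = tensor_lift K A' B'"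
    using assms unfolding tensor_lift_def 2 3 same_alg_def fun_eq_iff by simp
  show "A \<boxtimes> B = A' \<boxtimes> B'"
    using assms unfolding tensor_def 2 3 4 same_alg_def by simp
qed

lemma same_alg_Alg:
  assumes A: "Alg A" and s: "same_alg A A'"
  shows "Alg A'"
proof -
  interpret A: ring A using A by simp
  interpret M: module K A using A by simp
  note e = s[unfolded same_alg_def, THEN conjunct1, symmetric]
    s[unfolded same_alg_def, THEN conjunct2, THEN conjunct1, symmetric]
    s[unfolded same_alg_def, THEN conjunct2, THEN conjunct2, THEN conjunct1, symmetric]
    s[unfolded same_alg_def, THEN conjunct2, THEN conjunct2, THEN conjunct2, THEN conjunct1, symmetric]
    s[unfolded same_alg_def, THEN conjunct2, THEN conjunct2, THEN conjunct2, THEN conjunct2, THEN conjunct1, symmetric]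
    s[unfolded same_alg_def, THEN conjunct2, THEN conjunct2, THEN conjunct2, THEN conjunct2, THEN conjunct2, symmetric]
  have ab: "abelian_group A'"
    by (rule abelian_groupI) (simp_all add: e A.a_ac A.add.l_inv_ex)
  have "ring A'"
    by (rule ringI[OF ab], rule monoidI) (simp_all add: e A.m_assoc A.l_distr A.r_distr)
  moreover have "module K A'"
    by (rule moduleI[OF M.R.cring_axioms ab])
      (simp_all add: e M.smult_l_distr M.smult_r_distr M.smult_assoc1)
  ultimately show ?thesis
    using A unfolding unital_algebra_def e by blast
qed

lemma ahom_same:
  assumes "same_alg A A'" "same_alg B B'" "ahom A B \<phi>"
  shows "ahom A' B' \<phi>"
  using assms(3) same_alg_Alg[OF _ assms(1)] same_alg_Alg[OF _ assms(2)] assms(1,2)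
  unfolding ahom_def algebra_hom_def ring_hom_def same_alg_def by auto

lemma cpair_same:
  assumes "same_alg A A'" "same_alg B B'" "same_alg Z Z'" "cpair A B Z \<phi> \<psi>"
  shows "cpair A' B' Z' \<phi> \<psi>"
  using assms(4) ahom_same[OF assms(1,3)] ahom_same[OF assms(2,3)] assms(1-3)
  unfolding cpair_def same_alg_def by simp

lemma star_same:
  assumes "same_alg A A'" "same_alg B B'" "same_alg Z Z'"
  shows "star A B Z = star A' B' Z'"
  using assms(3) unfolding star_def tensor_same(3)[OF assms(1,2)] same_alg_def fun_eq_iff
  by (simp add: tensor_lift_def hom_def)

text \<open>This and its mirror image serve the nested lifts of \<open>tensor_middle_flip\<close>:
  the inner lift carries a fixed factor on the left, and the outer one then carries the finished
  inner value on the right.\<close>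

lemma star_lmult:
  fixes Z (structure)
  assumes \<gamma>: "ahom C Z \<gamma>" and \<delta>: "ahom D Z \<delta>" and m: "m \<in> carrier Z" and t: "t \<in> carrier (C \<boxtimes> D)"
  shows "tensor_lift K C D (add_monoid Z) (\<lambda>c d. m \<otimes> (\<gamma> c \<otimes> \<delta> d)) t = m \<otimes> star C D Z \<gamma> \<delta> t"
proof -
  note [simp] = ahomD(1,2)[OF \<gamma>] ahomD(1)[OF \<delta>] ahomD(3)[OF \<gamma>] ahomD(3)[OF \<delta>]
  interpret Z: ring Z by simp
  have bal: "balanced K C D Z (\<lambda>c d. m \<otimes> (\<gamma> c \<otimes> \<delta> d))"
    using star_balanced[OF \<gamma> \<delta>] m unfolding balanced_def by (auto simp: Z.r_distr)
  have "Alg C" "Alg D" by simp_all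
  from this t show ?thesis
  proof (induction t rule: tens_induct)
    case (pure a b)
    then show ?case by (simp add: tensor_lift_pure[OF bal] star_pure[OF \<gamma> \<delta>])
  next
    case (add s t)
    then show ?case using m
      by (simp only: tensor_lift_add[OF bal] star_add[OF \<gamma> \<delta>] star_closed[OF \<gamma> \<delta>] Z.r_distr)
  qed
qed

lemma star_rmult:
  fixes Z (structure)
  assumes \<gamma>: "ahom C Z \<gamma>" and \<delta>: "ahom D Z \<delta>" and m: "m \<in> carrier Z" and t: "t \<in> carrier (C \<boxtimes> D)"
  shows "tensor_lift K C D (add_monoid Z) (\<lambda>c d. (\<gamma> c \<otimes> \<delta> d) \<otimes> m) t = star C D Z \<gamma> \<delta> t \<otimes> m"
proof -
  note [simp] = ahomD(1,2)[OF \<gamma>] ahomD(1)[OF \<delta>] ahomD(3)[OF \<gamma>] ahomD(3)[OF \<delta>]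
  interpret Z: ring Z by simp
  have bal: "balanced K C D Z (\<lambda>c d. (\<gamma> c \<otimes> \<delta> d) \<otimes> m)"
    using star_balanced[OF \<gamma> \<delta>] m unfolding balanced_def by (auto simp: Z.l_distr)
  have "Alg C" "Alg D" by simp_all
  from this t show ?thesis
  proof (induction t rule: tens_induct)
    case (pure a b)
    then show ?case by (simp add: tensor_lift_pure[OF bal] star_pure[OF \<gamma> \<delta>])
  next
    case (add s t)
    then show ?case using m
      by (simp only: tensor_lift_add[OF bal] star_add[OF \<gamma> \<delta>] star_closed[OF \<gamma> \<delta>] Z.l_distr)
  qed
qed

section \<open>The middle flip as an algebra map\<close>

lemma in_cpairs4:
  assumes A: "Alg A" and B: "Alg B" and C: "Alg C" and D: "Alg D"
  shows "cpair A B (A \<boxtimes> C \<boxtimes> (B \<boxtimes> D)) (in1 (A \<boxtimes> C) (B \<boxtimes> D) \<circ> in1 A C) (in2 (A \<boxtimes> C) (B \<boxtimes> D) \<circ> in1 B D)"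
    "cpair A C (A \<boxtimes> C \<boxtimes> (B \<boxtimes> D)) (in1 (A \<boxtimes> C) (B \<boxtimes> D) \<circ> in1 A C) (in1 (A \<boxtimes> C) (B \<boxtimes> D) \<circ> in2 A C)"
    "cpair A D (A \<boxtimes> C \<boxtimes> (B \<boxtimes> D)) (in1 (A \<boxtimes> C) (B \<boxtimes> D) \<circ> in1 A C) (in2 (A \<boxtimes> C) (B \<boxtimes> D) \<circ> in2 B D)"
    "cpair B C (A \<boxtimes> C \<boxtimes> (B \<boxtimes> D)) (in2 (A \<boxtimes> C) (B \<boxtimes> D) \<circ> in1 B D) (in1 (A \<boxtimes> C) (B \<boxtimes> D) \<circ> in2 A C)"
    "cpair B D (A \<boxtimes> C \<boxtimes> (B \<boxtimes> D)) (in2 (A \<boxtimes> C) (B \<boxtimes> D) \<circ> in1 B D) (in2 (A \<boxtimes> C) (B \<boxtimes> D) \<circ> in2 B D)"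
    "cpair C D (A \<boxtimes> C \<boxtimes> (B \<boxtimes> D)) (in1 (A \<boxtimes> C) (B \<boxtimes> D) \<circ> in2 A C) (in2 (A \<boxtimes> C) (B \<boxtimes> D) \<circ> in2 B D)"
  using assms
  by (blast intro: cpair_comp3[OF in_cpair] cpair_comp1[OF cpair_comp2[OF in_cpair]]
      cpair_comp1[OF cpair_comp2[OF cpair_sym[OF in_cpair]]])+

lemma tensor_middle_flip_star:
  assumes A: "Alg A" and B: "Alg B" and C: "Alg C" and D: "Alg D"
  defines "Z \<equiv> A \<boxtimes> C \<boxtimes> (B \<boxtimes> D)"
  shows "tensor_middle_flip K A B C D = star (A \<boxtimes> B) (C \<boxtimes> D) Z
     (star A B Z (in1 (A \<boxtimes> C) (B \<boxtimes> D) \<circ> in1 A C) (in2 (A \<boxtimes> C) (B \<boxtimes> D) \<circ> in1 B D))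
     (star C D Z (in1 (A \<boxtimes> C) (B \<boxtimes> D) \<circ> in2 A C) (in2 (A \<boxtimes> C) (B \<boxtimes> D) \<circ> in2 B D))"
proof -
  define \<alpha> \<beta> \<gamma> \<delta> where def: "\<alpha> = in1 (A \<boxtimes> C) (B \<boxtimes> D) \<circ> in1 A C" "\<beta> = in2 (A \<boxtimes> C) (B \<boxtimes> D) \<circ> in1 B D"
    "\<gamma> = in1 (A \<boxtimes> C) (B \<boxtimes> D) \<circ> in2 A C" "\<delta> = in2 (A \<boxtimes> C) (B \<boxtimes> D) \<circ> in2 B D"
  note c = in_cpairs4[OF assms(1-4), folded def Z_def]
  note h = cpairD(1,2)[OF c(1)] cpairD(1,2)[OF c(6)]
  have Z: "Alg Z" using assms by simp
  interpret A: ring A using A by simp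
  interpret B: ring B using B by simp
  interpret C: ring C using C by simp
  interpret D: ring D using D by simp
  interpret Z: ring Z by (rule Alg_ring[OF Z])
  have p: "pure K (A \<boxtimes> C) (B \<boxtimes> D) (pure K A C a c) (pure K B D b d) =
      (\<alpha> a \<otimes>\<^bsub>Z\<^esub> \<beta> b) \<otimes>\<^bsub>Z\<^esub> (\<gamma> c \<otimes>\<^bsub>Z\<^esub> \<delta> d)"
    if "a \<in> carrier A" "b \<in> carrier B" "c \<in> carrier C" "d \<in> carrier D" for a b c d
    using that by (simp add: def Z_def in1_def in2_def mult_pure A B C D)
  have 1: "tensor_lift K C D (add_monoid Z)
       (\<lambda>c d. pure K (A \<boxtimes> C) (B \<boxtimes> D) (pure K A C a c) (pure K B D b d)) t =
      (\<alpha> a \<otimes>\<^bsub>Z\<^esub> \<beta> b) \<otimes>\<^bsub>Z\<^esub> star C D Z \<gamma> \<delta> t"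
    if "a \<in> carrier A" "b \<in> carrier B" "t \<in> carrier (C \<boxtimes> D)" for a b t
    using star_lmult[OF h(3,4) _ that(3), of "\<alpha> a \<otimes>\<^bsub>Z\<^esub> \<beta> b"] that ahomD(3)[OF h(1)] ahomD(3)[OF h(2)]
    by (simp add: p cong: tensor_lift_cong)
  have 2: "tensor_lift K A B (add_monoid Z) (\<lambda>a b. tensor_lift K C D (add_monoid Z)
       (\<lambda>c d. pure K (A \<boxtimes> C) (B \<boxtimes> D) (pure K A C a c) (pure K B D b d)) t) s =
      star A B Z \<alpha> \<beta> s \<otimes>\<^bsub>Z\<^esub> star C D Z \<gamma> \<delta> t"
    if "s \<in> carrier (A \<boxtimes> B)" "t \<in> carrier (C \<boxtimes> D)" for s t
    using star_rmult[OF h(1,2) star_closed[OF h(3,4) that(2)] that(1)] that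
    by (simp add: 1 cong: tensor_lift_cong)
  show ?thesis
    unfolding tensor_middle_flip_def Let_def tensor_lift_tensor_group def[symmetric] Z_def[symmetric]
      star_def[of "A \<boxtimes> B" "C \<boxtimes> D"]
    by (rule tensor_lift_cong) (simp add: 2)
qed

lemma tensor_middle_flip_hom:
  assumes "Alg A" "Alg B" "Alg C" "Alg D"
  shows "ahom (A \<boxtimes> B \<boxtimes> (C \<boxtimes> D)) (A \<boxtimes> C \<boxtimes> (B \<boxtimes> D)) (tensor_middle_flip K A B C D)"
  unfolding tensor_middle_flip_star[OF assms]
  by (intro star_hom cpair_star1 cpair_star2 in_cpairs4 assms)

text \<open>Both sides multiply the images of the four legs, and the swap of the middle legs is
  absorbed because \<open>b\<close> and \<open>c\<close> commute. Formally, the two algebra maps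
  agree on each leg.\<close>

lemma star_middle_flip:
  assumes ab: "cpair A B Z a b" and ac: "cpair A C Z a c" and ad: "cpair A D Z a d"
    and bc: "cpair B C Z b c" and bd: "cpair B D Z b d" and cd: "cpair C D Z c d"
    and s: "s \<in> carrier (A \<boxtimes> B \<boxtimes> (C \<boxtimes> D))"
  shows "star (A \<boxtimes> C) (B \<boxtimes> D) Z (star A C Z a c) (star B D Z b d) (tensor_middle_flip K A B C D s) =
    star (A \<boxtimes> B) (C \<boxtimes> D) Z (star A B Z a b) (star C D Z c d) s"
proof -
  note Al = ahomD(1)[OF cpairD(1)[OF ab]] ahomD(1)[OF cpairD(1)[OF bc]]
     ahomD(1)[OF cpairD(1)[OF cd]] ahomD(1)[OF cpairD(2)[OF cd]]
  note h = cpairD(1,2)[OF ab] cpairD(1,2)[OF cd]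
  note AC = tens_Alg[OF Al(1,3)] and BD = tens_Alg[OF Al(2,4)]
  let ?W = "A \<boxtimes> C \<boxtimes> (B \<boxtimes> D)"
  note c4 = in_cpairs4[OF Al]
  have p: "cpair (A \<boxtimes> C) (B \<boxtimes> D) Z (star A C Z a c) (star B D Z b d)"
    by (intro cpair_star1 cpair_star2 ab ac ad bd cd cpair_sym[OF bc])
  note O = star_hom[OF p]
  let ?O = "star (A \<boxtimes> C) (B \<boxtimes> D) Z (star A C Z a c) (star B D Z b d)"
  note i = in1_hom[OF Al(1,3)] in2_hom[OF Al(1,3)] in1_hom[OF Al(2,4)] in2_hom[OF Al(2,4)]
  note si = star_comp_in1[OF star_hom[OF ac] star_hom[OF bd]] star_comp_in2[OF star_hom[OF ac] star_hom[OF bd]]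
  have e: "x \<in> carrier A \<Longrightarrow> ?O ((in1 (A \<boxtimes> C) (B \<boxtimes> D) \<circ> in1 A C) x) = a x"
    "y \<in> carrier B \<Longrightarrow> ?O ((in2 (A \<boxtimes> C) (B \<boxtimes> D) \<circ> in1 B D) y) = b y"
    "z \<in> carrier C \<Longrightarrow> ?O ((in1 (A \<boxtimes> C) (B \<boxtimes> D) \<circ> in2 A C) z) = c z"
    "w \<in> carrier D \<Longrightarrow> ?O ((in2 (A \<boxtimes> C) (B \<boxtimes> D) \<circ> in2 B D) w) = d w" for x y z w
    by (simp_all add: si ahomD(3)[OF i(1)] ahomD(3)[OF i(2)] ahomD(3)[OF i(3)] ahomD(3)[OF i(4)] h
       star_comp_in1[OF h(1,3)] star_comp_in2[OF h(1,3)] star_comp_in1[OF h(2,4)] star_comp_in2[OF h(2,4)])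
  have 1: "?O (star A B ?W (in1 (A \<boxtimes> C) (B \<boxtimes> D) \<circ> in1 A C) (in2 (A \<boxtimes> C) (B \<boxtimes> D) \<circ> in1 B D) u) = star A B Z a b u"
    if "u \<in> carrier (A \<boxtimes> B)" for u
    unfolding comp_star[OF O cpairD(1,2)[OF c4(1)] that]
    by (rule fun_cong[OF star_cong]) (simp_all only: o_def e[unfolded o_def])
  have 2: "?O (star C D ?W (in1 (A \<boxtimes> C) (B \<boxtimes> D) \<circ> in2 A C) (in2 (A \<boxtimes> C) (B \<boxtimes> D) \<circ> in2 B D) u) = star C D Z c d u"
    if "u \<in> carrier (C \<boxtimes> D)" for u
    unfolding comp_star[OF O cpairD(1,2)[OF c4(6)] that]
    by (rule fun_cong[OF star_cong]) (simp_all only: o_def e[unfolded o_def])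
  show ?thesis
    unfolding tensor_middle_flip_star[OF Al] comp_star[OF O star_hom[OF c4(1)] star_hom[OF c4(6)] s]
    by (rule fun_cong[OF star_cong]) (simp_all only: o_def 1[unfolded o_def] 2[unfolded o_def])
qed

text \<open>With this target the counit is an algebra map, so that it can be composed with \<open>star\<close>.\<close>

definition Kalg :: "('k, 'k) module" where
  "Kalg = \<lparr>carrier = carrier K, monoid.mult = monoid.mult K, one = one K, ring.zero = ring.zero K,
     ring.add = ring.add K, smult = monoid.mult K\<rparr>"

lemma Kalg_simps [simp]:
  "carrier Kalg = carrier K" "monoid.mult Kalg = monoid.mult K" "one Kalg = one K"
  "ring.zero Kalg = ring.zero K" "ring.add Kalg = ring.add K" "smult Kalg = monoid.mult K"
  by (simp_all add: Kalg_def)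

lemma Kalg_Alg:
  assumes "Alg A"
  shows "Alg Kalg"
proof -
  interpret A: module K A using assms by simp
  have ab: "abelian_group Kalg"
    by (rule abelian_groupI) (simp_all add: A.R.a_ac A.R.add.l_inv_ex)
  have "ring Kalg"
    by (rule ringI[OF ab], rule monoidI) (simp_all add: A.R.m_assoc A.R.l_distr A.R.r_distr)
  moreover have "module K Kalg"
    by (rule moduleI[OF A.R.cring_axioms ab]) (simp_all add: A.R.m_assoc A.R.l_distr A.R.r_distr)
  ultimately show ?thesis
    unfolding unital_algebra_def by (simp add: A.R.m_ac)
qed

lemma counit_hom: "coalg H \<Longrightarrow> ahom H Kalg (counit H)"
  by (rule ahomI) (auto simp: coalgD Kalg_Alg[OF coalgD(2)])

text \<open>Composed with the counit, seen as a map into \<open>Kalg\<close>, this is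
  \<open>triv\<close>. Facts on the counit of a tensor product thereby pass to \<open>triv\<close>
  through \<open>comp_star\<close>.\<close>

lemma Kunit_hom:
  fixes Z (structure)
  assumes Z: "Alg Z"
  shows "ahom Kalg Z (\<lambda>r. r \<odot> \<one>)"
proof -
  interpret Z: ring Z using Z by simp
  interpret ZM: module K Z using Z by simp
  show ?thesis
    by (rule ahomI) (use Z Kalg_Alg[OF Z] in \<open>auto simp: ZM.smult_l_distr ZM.smult_assoc1 Alg_smult_left\<close>)
qed

lemma counit_cpair:
  assumes "coalg A" "coalg B"
  shows "cpair A B Kalg (counit A) (counit B)"
proof -
  interpret A: module K A using coalgD(2)[OF assms(1)] by simp
  show ?thesis using assms unfolding cpair_def by (auto simp: counit_hom coalgD A.R.m_comm)
qed

section \<open>The bialgebra structure of the tensor product\<close>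

abbreviation tb :: "('k, 'a) bialg \<Rightarrow> ('k, 'b) bialg \<Rightarrow> ('k, ('a, 'b) tens) bialg" where
  "tb A B \<equiv> tensor_bialgebra K A B"

lemma tb_same: "same_alg (tb A B) (A \<boxtimes> B)"
  by (simp add: same_alg_def tensor_bialgebra_def)

lemmas tb_same' = same_alg_sym[OF tb_same]

lemma tb_carrier [simp]: "carrier (tb A B) = carrier (A \<boxtimes> B)"
  by (simp add: tensor_bialgebra_def)

lemma tb_tens: "tb A B \<boxtimes> tb A B = A \<boxtimes> B \<boxtimes> (A \<boxtimes> B)"
  by (rule tensor_same(4)[OF tb_same tb_same])

lemma tb_in_cpair: "Alg A \<Longrightarrow> Alg B \<Longrightarrow> cpair A B (tb A B) (in1 A B) (in2 A B)"
  by (rule cpair_same[OF same_alg_refl same_alg_refl tb_same' in_cpair])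

lemma tb_star_hom: "cpair A B Z \<phi> \<psi> \<Longrightarrow> ahom (tb A B) Z (star A B Z \<phi> \<psi>)"
  by (rule ahom_same[OF tb_same' same_alg_refl star_hom])

lemma tb_restrict:
  assumes \<Phi>: "ahom (tb A B) Z \<Phi>" and "Alg A" "Alg B"
  shows "cpair A B Z (\<Phi> \<circ> in1 A B) (\<Phi> \<circ> in2 A B)"
    "t \<in> carrier (A \<boxtimes> B) \<Longrightarrow> \<Phi> t = star A B Z (\<Phi> \<circ> in1 A B) (\<Phi> \<circ> in2 A B) t"
  using cpair_comp3[OF tb_in_cpair[OF assms(2,3)] \<Phi>]
    ahom_tens_eq[OF ahom_same[OF tb_same same_alg_refl \<Phi>] assms(2,3)] by blast+

lemma tb_star_split:
  assumes A: "Alg A" and B: "Alg B" and \<Phi>: "ahom (tb A B) Z \<Phi>" and \<Psi>: "ahom (tb A B) Z \<Psi>"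
  shows "star (tb A B) (tb A B) Z \<Phi> \<Psi> = star (A \<boxtimes> B) (A \<boxtimes> B) Z
     (star A B Z (\<Phi> \<circ> in1 A B) (\<Phi> \<circ> in2 A B)) (star A B Z (\<Psi> \<circ> in1 A B) (\<Psi> \<circ> in2 A B))"
  unfolding star_same[OF tb_same tb_same same_alg_refl, of A B A B Z]
  by (rule star_cong) (simp_all add: tb_restrict(2)[OF \<Phi> A B] tb_restrict(2)[OF \<Psi> A B])

lemma tb_star_middle_flip:
  assumes A: "Alg A" and B: "Alg B" and c: "cpair (tb A B) (tb A B) Z \<Phi> \<Psi>"
    and s: "s \<in> carrier (A \<boxtimes> A \<boxtimes> (B \<boxtimes> B))"
  shows "star (tb A B) (tb A B) Z \<Phi> \<Psi> (tensor_middle_flip K A A B B s) =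
    star (A \<boxtimes> A) (B \<boxtimes> B) Z (star A A Z (\<Phi> \<circ> in1 A B) (\<Psi> \<circ> in1 A B)) (star B B Z (\<Phi> \<circ> in2 A B) (\<Psi> \<circ> in2 A B)) s"
  unfolding tb_star_split[OF A B cpairD(1,2)[OF c]]
  by (intro star_middle_flip s tb_restrict(1)[OF cpairD(1)[OF c] A B] tb_restrict(1)[OF cpairD(2)[OF c] A B]
     cpair_comp1[OF cpair_comp2[OF c]] cpair_comp1[OF cpair_comp2[OF cpair_sym[OF c]]] cpairD[OF tb_in_cpair[OF A B]])

lemma tb_comul_hom:
  assumes A: "coalg A" and B: "coalg B"
  shows "ahom (A \<boxtimes> B) (A \<boxtimes> B \<boxtimes> (A \<boxtimes> B)) (comul (tb A B))"
proof -
  have "comul (tb A B) = tensor_middle_flip K A A B B \<circ> tensor_map K A B (A \<boxtimes> A) (B \<boxtimes> B) (comul A) (comul B)"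
    by (simp add: tensor_bialgebra_def fun_eq_iff)
  then show ?thesis
    using ahom_comp[OF tensor_middle_flip_hom tensor_map_hom] coalgD(1,2)[OF A] coalgD(1,2)[OF B] by metis
qed

lemma tb_counit:
  assumes A: "coalg A" and B: "coalg B"
  shows "counit (tb A B) = star A B Kalg (counit A) (counit B)"
  by (simp add: tensor_bialgebra_def star_def tensor_lift_def hom_def)

lemma tb_coalg:
  assumes A: "coalg A" and B: "coalg B"
  shows "coalg (tb A B)"
proof -
  have 1: "ahom (tb A B) (tb A B \<boxtimes> tb A B) (comul (tb A B))"
    unfolding tb_tens by (rule ahom_same[OF tb_same' same_alg_refl tb_comul_hom[OF A B]])
  have 2: "ahom (tb A B) Kalg (counit (tb A B))"
    unfolding tb_counit[OF A B] by (rule tb_star_hom[OF counit_cpair[OF A B]])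
  show ?thesis
    unfolding coalg_def using 1 ahomD(3-7)[OF 2] by (auto simp: ring_hom_def)
qed

lemma tb_triv:
  fixes Z (structure)
  assumes A: "coalg A" and B: "coalg B" and Z: "Alg Z" and t: "t \<in> carrier (A \<boxtimes> B)"
  shows "triv (tb A B) Z t = star A B Z (triv A Z) (triv B Z) t"
proof -
  have "triv (tb A B) Z t = star A B Z ((\<lambda>r. r \<odot> \<one>) \<circ> counit A) ((\<lambda>r. r \<odot> \<one>) \<circ> counit B) t"
    unfolding triv_def tb_counit[OF A B]
    by (rule comp_star[OF Kunit_hom[OF Z] counit_hom[OF A] counit_hom[OF B] t])
  also have "\<dots> = star A B Z (triv A Z) (triv B Z) t"
    by (rule fun_cong[OF star_cong]) (simp_all add: triv_def)
  finally show ?thesis .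
qed

lemma tb_triv_in:
  assumes A: "coalg A" and B: "coalg B" and Z: "Alg Z"
  shows "a \<in> carrier A \<Longrightarrow> triv (tb A B) Z (in1 A B a) = triv A Z a"
    "b \<in> carrier B \<Longrightarrow> triv (tb A B) Z (in2 A B b) = triv B Z b"
  using tb_triv[OF A B Z] star_comp_in1[OF triv_hom[OF A Z] triv_hom[OF B Z]] star_comp_in2[OF triv_hom[OF A Z] triv_hom[OF B Z]]
    ahomD(3)[OF in1_hom[OF coalgD(2)[OF A] coalgD(2)[OF B]]] ahomD(3)[OF in2_hom[OF coalgD(2)[OF A] coalgD(2)[OF B]]]
  by simp_all

text \<open>The middle flip in the comultiplication regroups the four images by factor, after which
  each factor is convolved on its own.\<close>

lemma tb_conv:
  assumes A: "coalg A" and B: "coalg B" and c: "cpair (tb A B) (tb A B) Z \<Phi> \<Psi>" and t: "t \<in> carrier (A \<boxtimes> B)"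
  shows "conv (tb A B) Z \<Phi> \<Psi> t =
    star A B Z (conv A Z (\<Phi> \<circ> in1 A B) (\<Psi> \<circ> in1 A B)) (conv B Z (\<Phi> \<circ> in2 A B) (\<Psi> \<circ> in2 A B)) t"
proof -
  note Al = coalgD(2)[OF A] coalgD(2)[OF B]
  note h = coalgD(1)[OF A] coalgD(1)[OF B]
  note i = cpairD(1,2)[OF tb_in_cpair[OF Al]]
  have c': "cpair A A Z (\<Phi> \<circ> in1 A B) (\<Psi> \<circ> in1 A B)" "cpair B B Z (\<Phi> \<circ> in2 A B) (\<Psi> \<circ> in2 A B)"
    by (intro cpair_comp1[OF cpair_comp2[OF c]] i)+
  have "conv (tb A B) Z \<Phi> \<Psi> t = star (tb A B) (tb A B) Z \<Phi> \<Psi>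
      (tensor_middle_flip K A A B B (tensor_map K A B (A \<boxtimes> A) (B \<boxtimes> B) (comul A) (comul B) t))"
    using t by (simp add: conv_apply) (simp add: tensor_bialgebra_def)
  also have "\<dots> = star (A \<boxtimes> A) (B \<boxtimes> B) Z (star A A Z (\<Phi> \<circ> in1 A B) (\<Psi> \<circ> in1 A B)) (star B B Z (\<Phi> \<circ> in2 A B) (\<Psi> \<circ> in2 A B))
      (tensor_map K A B (A \<boxtimes> A) (B \<boxtimes> B) (comul A) (comul B) t)"
    by (rule tb_star_middle_flip[OF Al c ahomD(3)[OF tensor_map_hom[OF h] t]])
  also have "\<dots> = star A B Z (star A A Z (\<Phi> \<circ> in1 A B) (\<Psi> \<circ> in1 A B) \<circ> comul A) (star B B Z (\<Phi> \<circ> in2 A B) (\<Psi> \<circ> in2 A B) \<circ> comul B) t"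
    by (rule star_tensor_map[OF star_hom[OF c'(1)] star_hom[OF c'(2)] h t])
  also have "\<dots> = star A B Z (conv A Z (\<Phi> \<circ> in1 A B) (\<Psi> \<circ> in1 A B)) (conv B Z (\<Phi> \<circ> in2 A B) (\<Psi> \<circ> in2 A B)) t"
    by (rule fun_cong[OF star_cong]) (simp_all add: conv_apply)
  finally show ?thesis .
qed

lemma tb_conv_in:
  assumes A: "coalg A" and B: "coalg B" and c: "cpair (tb A B) (tb A B) Z \<Phi> \<Psi>"
  shows "a \<in> carrier A \<Longrightarrow> conv (tb A B) Z \<Phi> \<Psi> (in1 A B a) = conv A Z (\<Phi> \<circ> in1 A B) (\<Psi> \<circ> in1 A B) a"
    "b \<in> carrier B \<Longrightarrow> conv (tb A B) Z \<Phi> \<Psi> (in2 A B b) = conv B Z (\<Phi> \<circ> in2 A B) (\<Psi> \<circ> in2 A B) b"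
proof -
  note Al = coalgD(2)[OF A] coalgD(2)[OF B]
  note i = cpairD(1,2)[OF tb_in_cpair[OF Al]]
  have c': "cpair A A Z (\<Phi> \<circ> in1 A B) (\<Psi> \<circ> in1 A B)" "cpair B B Z (\<Phi> \<circ> in2 A B) (\<Psi> \<circ> in2 A B)"
    by (intro cpair_comp1[OF cpair_comp2[OF c]] i)+
  note h = conv_hom[OF A c'(1)] conv_hom[OF B c'(2)]
  show "a \<in> carrier A \<Longrightarrow> conv (tb A B) Z \<Phi> \<Psi> (in1 A B a) = conv A Z (\<Phi> \<circ> in1 A B) (\<Psi> \<circ> in1 A B) a"
    "b \<in> carrier B \<Longrightarrow> conv (tb A B) Z \<Phi> \<Psi> (in2 A B b) = conv B Z (\<Phi> \<circ> in2 A B) (\<Psi> \<circ> in2 A B) b"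
    using tb_conv[OF A B c] star_comp_in1[OF h] star_comp_in2[OF h]
      ahomD(3)[OF in1_hom[OF Al]] ahomD(3)[OF in2_hom[OF Al]] by simp_all
qed

lemma tb_eqI:
  assumes \<Phi>: "ahom (tb A B) Z \<Phi>" and \<Psi>: "ahom (tb A B) Z \<Psi>" and A: "Alg A" and B: "Alg B"
    and 1: "\<And>a. a \<in> carrier A \<Longrightarrow> \<Phi> (in1 A B a) = \<Psi> (in1 A B a)"
    and 2: "\<And>b. b \<in> carrier B \<Longrightarrow> \<Phi> (in2 A B b) = \<Psi> (in2 A B b)"
    and t: "t \<in> carrier (A \<boxtimes> B)"
  shows "\<Phi> t = \<Psi> t"
  unfolding tb_restrict(2)[OF \<Phi> A B t] tb_restrict(2)[OF \<Psi> A B t]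
  by (rule fun_cong[OF star_cong]) (simp_all add: 1 2)

lemma tb_bialgebra:
  assumes HA: "bialgebra K A" and HB: "bialgebra K B"
  shows "bialgebra K (tb A B)"
proof (rule bialgebraI)
  note A = bialgebra_coalg[OF HA] and B = bialgebra_coalg[OF HB]
  note Al = coalgD(2)[OF A] coalgD(2)[OF B]
  let ?P = "tb A B"
  show P: "coalg ?P" by (rule tb_coalg[OF A B])
  note PA = coalgD(2)[OF P]
  note i = cpairD(1,2)[OF tb_in_cpair[OF Al]]
  show "conv ?P ?P (triv ?P ?P) (\<lambda>x. x) x = x" "conv ?P ?P (\<lambda>x. x) (triv ?P ?P) x = x" if x: "x \<in> carrier ?P" for x
  proof -
    note c = triv_cpair1[OF P ahom_id[OF PA]] triv_cpair2[OF P ahom_id[OF PA]]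
    show "conv ?P ?P (triv ?P ?P) (\<lambda>x. x) x = x"
      by (rule tb_eqI[OF conv_hom[OF P c(1)] ahom_id[OF PA] Al])
        (use x in \<open>simp_all add: tb_conv_in[OF A B c(1)] conv_triv(1)[OF HA i(1)] conv_triv(1)[OF HB i(2)]
          tb_triv_in[OF A B PA] o_def cong: conv_cong\<close>)
    show "conv ?P ?P (\<lambda>x. x) (triv ?P ?P) x = x"
      by (rule tb_eqI[OF conv_hom[OF P c(2)] ahom_id[OF PA] Al])
        (use x in \<open>simp_all add: tb_conv_in[OF A B c(2)] conv_triv(2)[OF HA i(1)] conv_triv(2)[OF HB i(2)]
          tb_triv_in[OF A B PA] o_def cong: conv_cong\<close>)
  qed
  let ?Z = "?P \<boxtimes> ?P \<boxtimes> ?P"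
  note u = univ3_cpairs[OF PA PA PA]
  define \<phi>1 \<phi>2 \<phi>3 where def: "\<phi>1 = leg1 ?P" "\<phi>2 = leg2 ?P" "\<phi>3 = leg3 ?P"
  note u = u[folded def]
  have cL: "cpair ?P ?P ?Z (conv ?P ?Z \<phi>1 \<phi>2) \<phi>3" and cR: "cpair ?P ?P ?Z \<phi>1 (conv ?P ?Z \<phi>2 \<phi>3)"
    by (intro cpair_conv1 cpair_conv2 P u)+
  have uA: "cpair A A ?Z (\<phi>1 \<circ> in1 A B) (\<phi>2 \<circ> in1 A B)" "cpair A A ?Z (\<phi>1 \<circ> in1 A B) (\<phi>3 \<circ> in1 A B)"
    "cpair A A ?Z (\<phi>2 \<circ> in1 A B) (\<phi>3 \<circ> in1 A B)"
    using cpair_comp1[OF cpair_comp2[OF _ i(1)] i(1)] u by blast+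
  have uB: "cpair B B ?Z (\<phi>1 \<circ> in2 A B) (\<phi>2 \<circ> in2 A B)" "cpair B B ?Z (\<phi>1 \<circ> in2 A B) (\<phi>3 \<circ> in2 A B)"
    "cpair B B ?Z (\<phi>2 \<circ> in2 A B) (\<phi>3 \<circ> in2 A B)"
    using cpair_comp1[OF cpair_comp2[OF _ i(2)] i(2)] u by blast+
  \<comment> \<open>Restricted to the first factor, the inner convolutions over the tensor product
    become convolutions over \<open>A\<close>, where coassociativity of \<open>A\<close> applies.
    The second factor is treated alike in \<open>e2\<close>.\<close>
  have e1: "conv A ?Z (conv ?P ?Z \<phi>1 \<phi>2 \<circ> in1 A B) (\<phi>3 \<circ> in1 A B) = conv A ?Z (\<phi>1 \<circ> in1 A B) (conv ?P ?Z \<phi>2 \<phi>3 \<circ> in1 A B)"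
  proof -
    have "conv A ?Z (conv ?P ?Z \<phi>1 \<phi>2 \<circ> in1 A B) (\<phi>3 \<circ> in1 A B) =
       conv A ?Z (conv A ?Z (\<phi>1 \<circ> in1 A B) (\<phi>2 \<circ> in1 A B)) (\<phi>3 \<circ> in1 A B)"
      by (rule conv_cong) (simp_all add: tb_conv_in(1)[OF A B u(1)])
    also have "\<dots> = conv A ?Z (\<phi>1 \<circ> in1 A B) (conv A ?Z (\<phi>2 \<circ> in1 A B) (\<phi>3 \<circ> in1 A B))"
      by (rule conv_assoc[OF HA uA])
    also have "\<dots> = conv A ?Z (\<phi>1 \<circ> in1 A B) (conv ?P ?Z \<phi>2 \<phi>3 \<circ> in1 A B)"
      by (rule conv_cong) (simp_all add: tb_conv_in(1)[OF A B u(3)])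
    finally show ?thesis .
  qed
  have e2: "conv B ?Z (conv ?P ?Z \<phi>1 \<phi>2 \<circ> in2 A B) (\<phi>3 \<circ> in2 A B) = conv B ?Z (\<phi>1 \<circ> in2 A B) (conv ?P ?Z \<phi>2 \<phi>3 \<circ> in2 A B)"
  proof -
    have "conv B ?Z (conv ?P ?Z \<phi>1 \<phi>2 \<circ> in2 A B) (\<phi>3 \<circ> in2 A B) =
       conv B ?Z (conv B ?Z (\<phi>1 \<circ> in2 A B) (\<phi>2 \<circ> in2 A B)) (\<phi>3 \<circ> in2 A B)"
      by (rule conv_cong) (simp_all add: tb_conv_in(2)[OF A B u(1)])
    also have "\<dots> = conv B ?Z (\<phi>1 \<circ> in2 A B) (conv B ?Z (\<phi>2 \<circ> in2 A B) (\<phi>3 \<circ> in2 A B))"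
      by (rule conv_assoc[OF HB uB])
    also have "\<dots> = conv B ?Z (\<phi>1 \<circ> in2 A B) (conv ?P ?Z \<phi>2 \<phi>3 \<circ> in2 A B)"
      by (rule conv_cong) (simp_all add: tb_conv_in(2)[OF A B u(3)])
    finally show ?thesis .
  qed
  have "conv ?P ?Z (conv ?P ?Z \<phi>1 \<phi>2) \<phi>3 = conv ?P ?Z \<phi>1 (conv ?P ?Z \<phi>2 \<phi>3)"
  proof (rule extensionalityI[of _ "carrier ?P"])
    fix x assume x: "x \<in> carrier ?P"
    show "conv ?P ?Z (conv ?P ?Z \<phi>1 \<phi>2) \<phi>3 x = conv ?P ?Z \<phi>1 (conv ?P ?Z \<phi>2 \<phi>3) x"
      by (rule tb_eqI[OF conv_hom[OF P cL] conv_hom[OF P cR] Al])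
        (use x in \<open>simp_all add: tb_conv_in[OF A B cL] tb_conv_in[OF A B cR] e1 e2\<close>)
  qed (simp_all add: conv_def)
  then show "conv ?P ?Z (conv ?P ?Z (leg1 ?P) (leg2 ?P)) (leg3 ?P) = conv ?P ?Z (leg1 ?P) (conv ?P ?Z (leg2 ?P) (leg3 ?P))"
    unfolding def .
qed

lemma tb_cpairs:
  assumes c: "cpair (tb A B) (tb A B) Z \<Phi> \<Psi>" and A: "Alg A" and B: "Alg B"
  shows "cpair A A Z (\<Phi> \<circ> in1 A B) (\<Psi> \<circ> in1 A B)" "cpair A B Z (\<Phi> \<circ> in1 A B) (\<Psi> \<circ> in2 A B)"
    "cpair B A Z (\<Phi> \<circ> in2 A B) (\<Psi> \<circ> in1 A B)" "cpair B B Z (\<Phi> \<circ> in2 A B) (\<Psi> \<circ> in2 A B)"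
    "cpair A B Z (\<Phi> \<circ> in1 A B) (\<Phi> \<circ> in2 A B)" "cpair A B Z (\<Psi> \<circ> in1 A B) (\<Psi> \<circ> in2 A B)"
proof -
  note i = cpairD(1,2)[OF tb_in_cpair[OF A B]]
  show "cpair A A Z (\<Phi> \<circ> in1 A B) (\<Psi> \<circ> in1 A B)" "cpair A B Z (\<Phi> \<circ> in1 A B) (\<Psi> \<circ> in2 A B)"
    "cpair B A Z (\<Phi> \<circ> in2 A B) (\<Psi> \<circ> in1 A B)" "cpair B B Z (\<Phi> \<circ> in2 A B) (\<Psi> \<circ> in2 A B)"
    using cpair_comp1[OF cpair_comp2[OF c]] i by blast+
  show "cpair A B Z (\<Phi> \<circ> in1 A B) (\<Phi> \<circ> in2 A B)" "cpair A B Z (\<Psi> \<circ> in1 A B) (\<Psi> \<circ> in2 A B)"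
    using tb_restrict(1)[OF cpairD(1)[OF c] A B] tb_restrict(1)[OF cpairD(2)[OF c] A B] by blast+
qed

section \<open>Commutation and rearrangement of evaluated tensors\<close>

lemma cpair_star4:
  assumes "cpair A B Z a b" "cpair C D Z c d" "cpair A C Z a c" "cpair A D Z a d" "cpair B C Z b c" "cpair B D Z b d"
  shows "cpair (A \<boxtimes> B) (C \<boxtimes> D) Z (star A B Z a b) (star C D Z c d)"
  by (intro cpair_star1 cpair_star2 assms)

text \<open>The typical rearrangement of four evaluated tensors: \<open>c\<close> is pulled to the
  left through \<open>b\<close> and may change to \<open>c'\<close> on the way, as happens when a
  twist passes a convolution.\<close>

lemma mult_exchange:
  fixes Z (structure)
  assumes "Alg Z" "a \<in> carrier Z" "b \<in> carrier Z" "c \<in> carrier Z" "c' \<in> carrier Z" "d \<in> carrier Z"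
    and "b \<otimes> c = c' \<otimes> b"
  shows "(a \<otimes> b) \<otimes> (c \<otimes> d) = (a \<otimes> c') \<otimes> (b \<otimes> d)"
proof -
  interpret Z: ring Z using assms by simp
  have "(a \<otimes> b) \<otimes> (c \<otimes> d) = a \<otimes> (b \<otimes> c) \<otimes> d" using assms(2-6) by (simp add: Z.m_assoc)
  also have "\<dots> = (a \<otimes> c') \<otimes> (b \<otimes> d)" using assms(2-6) unfolding assms(7) by (simp add: Z.m_assoc)
  finally show ?thesis .
qed

lemma mult_swap:
  fixes Z (structure)
  assumes "Alg Z" "a \<in> carrier Z" "b \<in> carrier Z" "c \<in> carrier Z" "d \<in> carrier Z" "b \<otimes> c = c \<otimes> b"
  shows "(a \<otimes> b) \<otimes> (c \<otimes> d) = (a \<otimes> c) \<otimes> (b \<otimes> d)"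
  by (rule mult_exchange[OF assms(1-4,4-6)])

text \<open>Intertwiners compose: \<open>b\<close> carries \<open>x\<close> to \<open>y\<close>, and
  \<open>a\<close> carries \<open>y\<close> to \<open>z\<close>. When one of the two merely
  commutes, the corresponding elements coincide.\<close>

lemma intertwine_mult:
  fixes Z (structure)
  assumes "Alg Z" "a \<in> carrier Z" "b \<in> carrier Z" "x \<in> carrier Z" "y \<in> carrier Z" "z \<in> carrier Z"
    and "a \<otimes> y = z \<otimes> a" "b \<otimes> x = y \<otimes> b"
  shows "a \<otimes> b \<otimes> x = z \<otimes> (a \<otimes> b)"
proof -
  interpret Z: ring Z using assms by simp
  have "a \<otimes> b \<otimes> x = a \<otimes> y \<otimes> b"
    using assms(2-6,8) by (simp add: Z.m_assoc)
  then show ?thesis using assms(2-6) unfolding assms(7) by (simp add: Z.m_assoc)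
qed

section \<open>The R-matrix of the tensor product\<close>

definition tbR where
  "tbR A RA B RB = tensor_middle_flip K A A B B (pure K (A \<boxtimes> A) (B \<boxtimes> B) RA RB)"

lemma tensor_triangular_tb:
  "tensor_triangular K (A, RA) (B, RB) = (tb A B, tbR A RA B RB)"
  by (simp add: tensor_triangular_def tbR_def)

lemma tbR_closed:
  assumes "Alg A" "Alg B" "RA \<in> carrier (A \<boxtimes> A)" "RB \<in> carrier (B \<boxtimes> B)"
  shows "tbR A RA B RB \<in> carrier (tb A B \<boxtimes> tb A B)"
  unfolding tbR_def tb_tens using assms
  by (intro ahomD(3)[OF tensor_middle_flip_hom] pure_carrier tens_Alg)

lemma star_tbR:
  fixes Z (structure)
  assumes A: "Alg A" and B: "Alg B" and RA: "RA \<in> carrier (A \<boxtimes> A)" and RB: "RB \<in> carrier (B \<boxtimes> B)"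
    and c: "cpair (tb A B) (tb A B) Z \<Phi> \<Psi>"
  shows "star (tb A B) (tb A B) Z \<Phi> \<Psi> (tbR A RA B RB) =
    star A A Z (\<Phi> \<circ> in1 A B) (\<Psi> \<circ> in1 A B) RA \<otimes> star B B Z (\<Phi> \<circ> in2 A B) (\<Psi> \<circ> in2 A B) RB"
proof -
  note p = tb_cpairs[OF c A B]
  have "pure K (A \<boxtimes> A) (B \<boxtimes> B) RA RB \<in> carrier (A \<boxtimes> A \<boxtimes> (B \<boxtimes> B))"
    using assms by (intro pure_carrier tens_Alg)
  then show ?thesis
    unfolding tbR_def tb_star_middle_flip[OF A B c]
    by (simp add: tb_star_middle_flip[OF A B c] star_pure[OF star_hom[OF p(1)] star_hom[OF p(4)] RA RB])
qed

text \<open>Evaluated R-matrices of the two factors commute, because all images of \<open>A\<close>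
  commute with all images of \<open>B\<close>. Each axiom therefore splits into the axiom for
  \<open>A\<close> and the axiom for \<open>B\<close>.\<close>

lemma tb_triangular:
  assumes TA: "triangular_bialgebra K (A, RA)" and TB: "triangular_bialgebra K (B, RB)"
  shows "triangular_bialgebra K (tb A B, tbR A RA B RB)"
proof (rule triangularI)
  note A = triangularD[OF TA] and B = triangularD[OF TB]
  note cA = A(8) and cB = B(8)
  note rR = star_tbR[OF A(9) B(9) A(3) B(3)]
  show "bialgebra K (tb A B)" by (rule tb_bialgebra[OF A(1) B(1)])
  note co = bialgebra_coalg[OF this]
  note PA = coalgD(2)[OF co]
  show "tbR A RA B RB \<in> carrier (tb A B \<boxtimes> tb A B)" by (rule tbR_closed[OF A(9) B(9) A(3) B(3)])
  note i = cpairD(1,2)[OF tb_in_cpair[OF A(9) B(9)]]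
  {
    fix \<Phi> \<Psi> assume c: "cpair (tb A B) (tb A B) (tb A B \<boxtimes> tb A B) \<Phi> \<Psi>"
    let ?Z = "tb A B \<boxtimes> tb A B"
    have Z: "Alg ?Z" using ahomD(2)[OF cpairD(1)[OF c]] .
    interpret Z: ring ?Z using Z by simp
    note p = tb_cpairs[OF c A(9) B(9)]
    note RAc = star_closed[OF cpairD(1,2)[OF p(1)] A(3)] star_closed[OF cpairD(2,1)[OF p(1)] A(3)]
    note RBc = star_closed[OF cpairD(1,2)[OF p(4)] B(3)] star_closed[OF cpairD(2,1)[OF p(4)] B(3)]
    have cc: "cpair (B \<boxtimes> B) (A \<boxtimes> A) ?Z (star B B ?Z (\<Phi> \<circ> in2 A B) (\<Psi> \<circ> in2 A B)) (star A A ?Z (\<Psi> \<circ> in1 A B) (\<Phi> \<circ> in1 A B))"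
      by (intro cpair_star4 p p[THEN cpair_sym])
    show "star (tb A B) (tb A B) ?Z \<Phi> \<Psi> (tbR A RA B RB) \<otimes>\<^bsub>?Z\<^esub> star (tb A B) (tb A B) ?Z \<Psi> \<Phi> (tbR A RA B RB) = \<one>\<^bsub>?Z\<^esub>"
      unfolding rR[OF c] rR[OF cpair_sym[OF c]] mult_swap[OF Z RAc(1) RBc(1) RAc(2) RBc(2) cpairD(3)[OF cc B(3) A(3)]]
        R_inverse[OF TA p(1)] R_inverse[OF TB p(4)] by (simp del: tensor_simps)
    fix x assume x: "x \<in> carrier (tb A B)"
    then have x': "x \<in> carrier (A \<boxtimes> B)" by simp
    have cv: "cpair A A ?Z (\<Psi> \<circ> in1 A B) (\<Phi> \<circ> in1 A B)" "cpair B B ?Z (\<Psi> \<circ> in2 A B) (\<Phi> \<circ> in2 A B)"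
      by (intro p[THEN cpair_sym])+
    note hv = conv_hom[OF cA p(1)] conv_hom[OF cB p(4)] conv_hom[OF cA cv(1)] conv_hom[OF cB cv(2)]
    let ?RA = "star A A ?Z (\<Phi> \<circ> in1 A B) (\<Psi> \<circ> in1 A B) RA"
    let ?RB = "star B B ?Z (\<Phi> \<circ> in2 A B) (\<Psi> \<circ> in2 A B) RB"
    have c1: "cpair (B \<boxtimes> B) A ?Z (star B B ?Z (\<Phi> \<circ> in2 A B) (\<Psi> \<circ> in2 A B)) (conv A ?Z (\<Phi> \<circ> in1 A B) (\<Psi> \<circ> in1 A B))"
      by (intro cpair_star1 cpair_conv2 cA p p[THEN cpair_sym])
    have c2: "cpair (A \<boxtimes> A) B ?Z (star A A ?Z (\<Phi> \<circ> in1 A B) (\<Psi> \<circ> in1 A B)) (conv B ?Z (\<Psi> \<circ> in2 A B) (\<Phi> \<circ> in2 A B))"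
      by (intro cpair_star1 cpair_conv2 cB p p[THEN cpair_sym])
    have 1: "?RA \<otimes>\<^bsub>?Z\<^esub> ?RB \<otimes>\<^bsub>?Z\<^esub> conv A ?Z (\<Phi> \<circ> in1 A B) (\<Psi> \<circ> in1 A B) a =
        conv A ?Z (\<Psi> \<circ> in1 A B) (\<Phi> \<circ> in1 A B) a \<otimes>\<^bsub>?Z\<^esub> (?RA \<otimes>\<^bsub>?Z\<^esub> ?RB)" if a: "a \<in> carrier A" for a
      by (rule intertwine_mult[OF Z RAc(1) RBc(1) ahomD(3)[OF hv(1) a] ahomD(3)[OF hv(1) a] ahomD(3)[OF hv(3) a]
           R_quasi[OF TA p(1) a] cpairD(3)[OF c1 B(3) a]])
    have 2: "?RA \<otimes>\<^bsub>?Z\<^esub> ?RB \<otimes>\<^bsub>?Z\<^esub> conv B ?Z (\<Phi> \<circ> in2 A B) (\<Psi> \<circ> in2 A B) b =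
        conv B ?Z (\<Psi> \<circ> in2 A B) (\<Phi> \<circ> in2 A B) b \<otimes>\<^bsub>?Z\<^esub> (?RA \<otimes>\<^bsub>?Z\<^esub> ?RB)" if b: "b \<in> carrier B" for b
      by (rule intertwine_mult[OF Z RAc(1) RBc(1) ahomD(3)[OF hv(2) b] ahomD(3)[OF hv(4) b] ahomD(3)[OF hv(4) b]
           cpairD(3)[OF c2 A(3) b] R_quasi[OF TB p(4) b]])
    show "star (tb A B) (tb A B) ?Z \<Phi> \<Psi> (tbR A RA B RB) \<otimes>\<^bsub>?Z\<^esub> conv (tb A B) ?Z \<Phi> \<Psi> x =
        conv (tb A B) ?Z \<Psi> \<Phi> x \<otimes>\<^bsub>?Z\<^esub> star (tb A B) (tb A B) ?Z \<Phi> \<Psi> (tbR A RA B RB)"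
      unfolding rR[OF c] tb_conv[OF cA cB c x'] tb_conv[OF cA cB cpair_sym[OF c] x']
      by (rule star_intertwine[OF hv(1) hv(2) hv(3) hv(4) Z.m_closed[OF RAc(1) RBc(1)] x' 1 2])
  next
    let ?P = "tb A B"
    let ?Z = "?P \<boxtimes> ?P \<boxtimes> ?P"
    fix \<phi>1 \<phi>2 \<phi>3 assume u: "cpair ?P ?P ?Z \<phi>1 \<phi>2" "cpair ?P ?P ?Z \<phi>1 \<phi>3" "cpair ?P ?P ?Z \<phi>2 \<phi>3"
    have Z: "Alg ?Z" using ahomD(2)[OF cpairD(1)[OF u(1)]] .
    note p = tb_cpairs[OF u(1) A(9) B(9)] tb_cpairs[OF u(2) A(9) B(9)] tb_cpairs[OF u(3) A(9) B(9)]
    note a = p(1) p(7) p(13) and b = p(4) p(10) p(16)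
    have cL: "cpair ?P ?P ?Z (conv ?P ?Z \<phi>1 \<phi>2) \<phi>3" and cR: "cpair ?P ?P ?Z \<phi>1 (conv ?P ?Z \<phi>2 \<phi>3)"
      by (intro cpair_conv1 cpair_conv2 co u)+
    have ccR: "cpair (A \<boxtimes> A) (B \<boxtimes> B) ?Z (star A A ?Z (\<phi>1 \<circ> in1 A B) (\<phi>2 \<circ> in1 A B)) (star B B ?Z (\<phi>1 \<circ> in2 A B) (\<phi>3 \<circ> in2 A B))"
      by (intro cpair_star4 p p[THEN cpair_sym])
    have ccL: "cpair (A \<boxtimes> A) (B \<boxtimes> B) ?Z (star A A ?Z (\<phi>2 \<circ> in1 A B) (\<phi>3 \<circ> in1 A B)) (star B B ?Z (\<phi>1 \<circ> in2 A B) (\<phi>3 \<circ> in2 A B))"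
      by (intro cpair_star4 p p[THEN cpair_sym])
    note sc = a[THEN star_hom, THEN ahomD(3), OF A(3)] b[THEN star_hom, THEN ahomD(3), OF B(3)]
    have e1: "star A A ?Z (\<phi>1 \<circ> in1 A B) (conv ?P ?Z \<phi>2 \<phi>3 \<circ> in1 A B) =
       star A A ?Z (\<phi>1 \<circ> in1 A B) (conv A ?Z (\<phi>2 \<circ> in1 A B) (\<phi>3 \<circ> in1 A B))"
      "star B B ?Z (\<phi>1 \<circ> in2 A B) (conv ?P ?Z \<phi>2 \<phi>3 \<circ> in2 A B) =
       star B B ?Z (\<phi>1 \<circ> in2 A B) (conv B ?Z (\<phi>2 \<circ> in2 A B) (\<phi>3 \<circ> in2 A B))"
      by (rule star_cong; simp add: tb_conv_in[OF cA cB u(3)])+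
    have e2: "star A A ?Z (conv ?P ?Z \<phi>1 \<phi>2 \<circ> in1 A B) (\<phi>3 \<circ> in1 A B) =
       star A A ?Z (conv A ?Z (\<phi>1 \<circ> in1 A B) (\<phi>2 \<circ> in1 A B)) (\<phi>3 \<circ> in1 A B)"
      "star B B ?Z (conv ?P ?Z \<phi>1 \<phi>2 \<circ> in2 A B) (\<phi>3 \<circ> in2 A B) =
       star B B ?Z (conv B ?Z (\<phi>1 \<circ> in2 A B) (\<phi>2 \<circ> in2 A B)) (\<phi>3 \<circ> in2 A B)"
      by (rule star_cong; simp add: tb_conv_in[OF cA cB u(1)])+
    show "star ?P ?P ?Z \<phi>1 (conv ?P ?Z \<phi>2 \<phi>3) (tbR A RA B RB) =
      star ?P ?P ?Z \<phi>1 \<phi>3 (tbR A RA B RB) \<otimes>\<^bsub>?Z\<^esub> star ?P ?P ?Z \<phi>1 \<phi>2 (tbR A RA B RB)"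
      unfolding rR[OF cR] rR[OF u(1)] rR[OF u(2)] e1 R_hex1[OF TA a] R_hex1[OF TB b]
      by (rule mult_swap[OF Z sc(2) sc(1) sc(5) sc(4) cpairD(3)[OF ccR A(3) B(3)]])
    show "star ?P ?P ?Z (conv ?P ?Z \<phi>1 \<phi>2) \<phi>3 (tbR A RA B RB) =
      star ?P ?P ?Z \<phi>1 \<phi>3 (tbR A RA B RB) \<otimes>\<^bsub>?Z\<^esub> star ?P ?P ?Z \<phi>2 \<phi>3 (tbR A RA B RB)"
      unfolding rR[OF cL] rR[OF u(2)] rR[OF u(3)] e2 R_hex2[OF TA a] R_hex2[OF TB b]
      by (rule mult_swap[OF Z sc(2) sc(3) sc(5) sc(6) cpairD(3)[OF ccL A(3) B(3)]])
  }
qed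

section \<open>Cells and their composition\<close>

lemma tensor_map_same:
  assumes "same_alg C C'" "same_alg D D'"
  shows "tensor_map K A B C D = tensor_map K A B C' D'"
  unfolding tensor_map_def tensor_same(1,2)[OF assms] ..

text \<open>Twisting replaces the comultiplication and leaves the algebra untouched, so algebra maps
  and tensor maps into the twisted bialgebra are those into \<open>H'\<close>. This removes the
  twisted record from the later arguments.\<close>

lemma cell1_iff:
  "(f, F) \<in> twtr_1cells K (H, R) (H', R') \<longleftrightarrow>
     is_twist K H' F \<and> f \<in> extensional (carrier H) \<and> f \<in> algebra_hom K H H' \<and>
     (\<forall>x\<in>carrier H. F \<otimes>\<^bsub>H' \<boxtimes> H'\<^esub> comul H' (f x) \<otimes>\<^bsub>H' \<boxtimes> H'\<^esub> inv\<^bsub>H' \<boxtimes> H'\<^esub> F =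
        tensor_map K H H H' H' f f (comul H x) \<and> counit H' (f x) = counit H x) \<and>
     tensor_map K H H H' H' f f R = tensor_flip K H' H' F \<otimes>\<^bsub>H' \<boxtimes> H'\<^esub> R' \<otimes>\<^bsub>H' \<boxtimes> H'\<^esub> inv\<^bsub>H' \<boxtimes> H'\<^esub> F"
proof -
  define Ht where "Ht = H'\<lparr>comul := (\<lambda>x. F \<otimes>\<^bsub>H' \<boxtimes> H'\<^esub> comul H' x \<otimes>\<^bsub>H' \<boxtimes> H'\<^esub> inv\<^bsub>H' \<boxtimes> H'\<^esub> F)\<rparr>"
  have s: "same_alg Ht H'" by (simp add: Ht_def same_alg_def)
  have 1: "algebra_hom K H Ht = algebra_hom K H H'"
    by (simp add: Ht_def algebra_hom_def ring_hom_def)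
  have 2: "comul Ht = (\<lambda>x. F \<otimes>\<^bsub>H' \<boxtimes> H'\<^esub> comul H' x \<otimes>\<^bsub>H' \<boxtimes> H'\<^esub> inv\<^bsub>H' \<boxtimes> H'\<^esub> F)" "counit Ht = counit H'"
    by (simp_all add: Ht_def)
  show ?thesis
    unfolding twtr_1cells_def twisted_def triangular_hom_def bialgebra_hom_def Let_def
    by (simp add: Ht_def[symmetric] 1 2 tensor_map_same[OF s s])
qed

lemma cell1D:
  assumes T: "triangular_bialgebra K (H, R)" and T': "triangular_bialgebra K (H', R')"
    and c: "(f, F) \<in> twtr_1cells K (H, R) (H', R')"
  shows "is_twist K H' F" "f \<in> extensional (carrier H)" "ahom H H' f"
    "\<And>x. x \<in> carrier H \<Longrightarrow> counit H' (f x) = counit H x"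
    "\<And>x. x \<in> carrier H \<Longrightarrow> triv H' Z (f x) = triv H Z x"
  using c triangularD(9)[OF T] triangularD(9)[OF T'] unfolding cell1_iff ahom_def triv_def by auto

text \<open>The comultiplication condition, read as an intertwining property: \<open>F\<close>
  passes a convolution formed over \<open>H'\<close> and turns it into one formed over
  \<open>H\<close>.\<close>

lemma cell1_conv:
  fixes Z (structure)
  assumes T: "triangular_bialgebra K (H, R)" and T': "triangular_bialgebra K (H', R')"
    and c: "(f, F) \<in> twtr_1cells K (H, R) (H', R')" and u: "cpair H' H' Z u v" and x: "x \<in> carrier H"
  shows "star H' H' Z u v F \<otimes> conv H' Z u v (f x) = conv H Z (u \<circ> f) (v \<circ> f) x \<otimes> star H' H' Z u v F"
proof -
  note d = cell1D[OF T T' c]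
  note H = triangularD(8,9)[OF T] and H' = triangularD(8,9)[OF T']
  note fx = ahomD(3)[OF d(3) x]
  note dx = coalgD(8)[OF H(1) x] and dfx = coalgD(8)[OF H'(1) fx]
  note tm = ahomD(3)[OF tensor_map_hom[OF d(3) d(3)] dx]
  have "tensor_map K H H H' H' f f (comul H x) \<otimes>\<^bsub>H' \<boxtimes> H'\<^esub> F = F \<otimes>\<^bsub>H' \<boxtimes> H'\<^esub> comul H' (f x)"
    using Units_conj_iff[OF tens_Alg[OF H'(2) H'(2)] twistD(1)[OF d(1)] dfx tm] c x unfolding cell1_iff by auto
  then have "star H' H' Z u v (tensor_map K H H H' H' f f (comul H x)) \<otimes> star H' H' Z u v F =
      star H' H' Z u v F \<otimes> star H' H' Z u v (comul H' (f x))"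
    using ahomD(4)[OF star_hom[OF u] tm twistD(2)[OF d(1)]] ahomD(4)[OF star_hom[OF u] twistD(2)[OF d(1)] dfx] by simp
  then show ?thesis
    using star_tensor_map[OF cpairD(1,2)[OF u] d(3) d(3) dx] x fx by (simp add: conv_apply)
qed

text \<open>The condition on R-matrices with the inverse of \<open>F\<close> cleared. The flipped
  twist evaluated at \<open>(u, v)\<close> is the twist at \<open>(v, u)\<close>.\<close>

lemma cell1_R:
  fixes Z (structure)
  assumes T: "triangular_bialgebra K (H, R)" and T': "triangular_bialgebra K (H', R')"
    and c: "(f, F) \<in> twtr_1cells K (H, R) (H', R')" and u: "cpair H' H' Z u v"
  shows "star H H Z (u \<circ> f) (v \<circ> f) R \<otimes> star H' H' Z u v F = star H' H' Z v u F \<otimes> star H' H' Z u v R'"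
proof -
  note d = cell1D[OF T T' c]
  note H = triangularD(3,9)[OF T] and H' = triangularD(3,9)[OF T']
  note tm = ahomD(3)[OF tensor_map_hom[OF d(3) d(3)] H(1)]
  note F = twistD(1,2)[OF d(1)]
  note fl = ahomD(3)[OF tensor_flip_hom[OF H'(2) H'(2)] F(2)]
  interpret HH: ring "H' \<boxtimes> H'" using H' by simp
  have "tensor_map K H H H' H' f f R = tensor_flip K H' H' F \<otimes>\<^bsub>H' \<boxtimes> H'\<^esub> R' \<otimes>\<^bsub>H' \<boxtimes> H'\<^esub> inv\<^bsub>H' \<boxtimes> H'\<^esub> F"
    using c unfolding cell1_iff by blast
  then have "tensor_map K H H H' H' f f R \<otimes>\<^bsub>H' \<boxtimes> H'\<^esub> F = tensor_flip K H' H' F \<otimes>\<^bsub>H' \<boxtimes> H'\<^esub> R'"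
    using fl H'(1) F by (simp add: HH.m_assoc del: tensor_simps)
  then have "star H' H' Z u v (tensor_map K H H H' H' f f R) \<otimes> star H' H' Z u v F =
      star H' H' Z u v (tensor_flip K H' H' F) \<otimes> star H' H' Z u v R'"
    using ahomD(4)[OF star_hom[OF u] tm F(2)] ahomD(4)[OF star_hom[OF u] fl H'(1)] by simp
  then show ?thesis
    using star_tensor_map[OF cpairD(1,2)[OF u] d(3) d(3) H(1)] star_tensor_flip[OF u F(2)] by simp
qed

lemma cell1I:
  assumes T: "triangular_bialgebra K (H, R)" and T': "triangular_bialgebra K (H', R')"
    and F: "is_twist K H' F" and ext: "f \<in> extensional (carrier H)" and f: "ahom H H' f"
    and eps: "\<And>x. x \<in> carrier H \<Longrightarrow> counit H' (f x) = counit H x"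
    and cv: "\<And>u v x. cpair H' H' (H' \<boxtimes> H') u v \<Longrightarrow> x \<in> carrier H \<Longrightarrow>
       star H' H' (H' \<boxtimes> H') u v F \<otimes>\<^bsub>H' \<boxtimes> H'\<^esub> conv H' (H' \<boxtimes> H') u v (f x) =
       conv H (H' \<boxtimes> H') (u \<circ> f) (v \<circ> f) x \<otimes>\<^bsub>H' \<boxtimes> H'\<^esub> star H' H' (H' \<boxtimes> H') u v F"
    and R: "\<And>u v. cpair H' H' (H' \<boxtimes> H') u v \<Longrightarrow>
       star H H (H' \<boxtimes> H') (u \<circ> f) (v \<circ> f) R \<otimes>\<^bsub>H' \<boxtimes> H'\<^esub> star H' H' (H' \<boxtimes> H') u v F =
       star H' H' (H' \<boxtimes> H') v u F \<otimes>\<^bsub>H' \<boxtimes> H'\<^esub> star H' H' (H' \<boxtimes> H') u v R'"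
  shows "(f, F) \<in> twtr_1cells K (H, R) (H', R')"
proof -
  note H = triangularD(3,8,9)[OF T] and H' = triangularD(3,8,9)[OF T']
  note HH = tens_Alg[OF H'(3) H'(3)]
  interpret HH: ring "H' \<boxtimes> H'" using HH by simp
  note Fu = twistD(1,2)[OF F]
  note fl = ahomD(3)[OF tensor_flip_hom[OF H'(3) H'(3)] Fu(2)]
  note p = in_cpair[OF H'(3) H'(3)]
  have ts: "star H H (H' \<boxtimes> H') (in1 H' H' \<circ> f) (in2 H' H' \<circ> f) t = tensor_map K H H H' H' f f t" for t
    unfolding tensor_map_star[OF f f] ..
  note si = star_in[OF H'(3) H'(3)]
  have 1: "F \<otimes>\<^bsub>H' \<boxtimes> H'\<^esub> comul H' (f x) \<otimes>\<^bsub>H' \<boxtimes> H'\<^esub> inv\<^bsub>H' \<boxtimes> H'\<^esub> F = tensor_map K H H H' H' f f (comul H x)"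
    if x: "x \<in> carrier H" for x
  proof -
    note fx = ahomD(3)[OF f x]
    note dx = coalgD(8)[OF H(2) x] and dfx = coalgD(8)[OF H'(2) fx]
    note tm = ahomD(3)[OF tensor_map_hom[OF f f] dx]
    show ?thesis
      using cv[OF p x] Units_conj_iff[OF HH Fu(1) dfx tm] x fx
      by (simp only: conv_apply ts si Fu(2) dfx) metis
  qed
  note tm = ahomD(3)[OF tensor_map_hom[OF f f] H(1)]
  have "tensor_map K H H H' H' f f R \<otimes>\<^bsub>H' \<boxtimes> H'\<^esub> F = tensor_flip K H' H' F \<otimes>\<^bsub>H' \<boxtimes> H'\<^esub> R'"
    using R[OF p] by (simp only: ts si Fu(2) H'(1) flip_univ[OF H'(3) Fu(2)])
  then have "tensor_map K H H H' H' f f R \<otimes>\<^bsub>H' \<boxtimes> H'\<^esub> F \<otimes>\<^bsub>H' \<boxtimes> H'\<^esub> inv\<^bsub>H' \<boxtimes> H'\<^esub> F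
     = tensor_flip K H' H' F \<otimes>\<^bsub>H' \<boxtimes> H'\<^esub> R' \<otimes>\<^bsub>H' \<boxtimes> H'\<^esub> inv\<^bsub>H' \<boxtimes> H'\<^esub> F" by simp
  then have "tensor_map K H H H' H' f f R = tensor_flip K H' H' F \<otimes>\<^bsub>H' \<boxtimes> H'\<^esub> R' \<otimes>\<^bsub>H' \<boxtimes> H'\<^esub> inv\<^bsub>H' \<boxtimes> H'\<^esub> F"
    using tm Fu by (simp add: HH.m_assoc del: tensor_simps)
  then show ?thesis
    unfolding cell1_iff using 1 F ext f eps by (simp add: ahom_def)
qed

lemma cell2D:
  assumes T': "triangular_bialgebra K (H', R')"
    and a: "a \<in> twtr_2cells K (H, R) (H', R') (f, F) (f', F')"
  shows "a \<in> carrier H'" "counit H' a = \<one>\<^bsub>K\<^esub>" "\<And>x. x \<in> carrier H \<Longrightarrow> a \<otimes>\<^bsub>H'\<^esub> f x = f' x \<otimes>\<^bsub>H'\<^esub> a"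
  using a unfolding twtr_2cells_def by (auto simp: Let_def)

lemma cell2_twist:
  fixes Z (structure)
  assumes T': "triangular_bialgebra K (H', R')" and F: "is_twist K H' F" and F': "is_twist K H' F'"
    and a: "a \<in> twtr_2cells K (H, R) (H', R') (f, F) (f', F')" and u: "cpair H' H' Z u v"
  shows "u a \<otimes> v a \<otimes> star H' H' Z u v F = star H' H' Z u v F' \<otimes> conv H' Z u v a"
proof -
  note d = cell2D[OF T' a] and H' = triangularD(8,9)[OF T']
  have "pure K H' H' a a \<otimes>\<^bsub>H' \<boxtimes> H'\<^esub> F = F' \<otimes>\<^bsub>H' \<boxtimes> H'\<^esub> comul H' a"
    using a unfolding twtr_2cells_def by (auto simp: Let_def)
  then have "star H' H' Z u v (pure K H' H' a a) \<otimes> star H' H' Z u v F =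
      star H' H' Z u v F' \<otimes> star H' H' Z u v (comul H' a)"
    using ahomD(4)[OF star_hom[OF u] pure_carrier[OF H'(2) H'(2) d(1) d(1)] twistD(2)[OF F]]
      ahomD(4)[OF star_hom[OF u] twistD(2)[OF F'] coalgD(8)[OF H'(1) d(1)]] by simp
  then show ?thesis using d(1) by (simp add: conv_apply star_pure[OF cpairD(1,2)[OF u]])
qed

lemma cell2I:
  assumes T': "triangular_bialgebra K (H', R')" and F: "is_twist K H' F" and F': "is_twist K H' F'"
    and a: "a \<in> carrier H'" and eps: "counit H' a = \<one>\<^bsub>K\<^esub>"
    and tw: "\<And>u v. cpair H' H' (H' \<boxtimes> H') u v \<Longrightarrow> u a \<otimes>\<^bsub>H' \<boxtimes> H'\<^esub> v a \<otimes>\<^bsub>H' \<boxtimes> H'\<^esub> star H' H' (H' \<boxtimes> H') u v F =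
       star H' H' (H' \<boxtimes> H') u v F' \<otimes>\<^bsub>H' \<boxtimes> H'\<^esub> conv H' (H' \<boxtimes> H') u v a"
    and nat: "\<And>x. x \<in> carrier H \<Longrightarrow> a \<otimes>\<^bsub>H'\<^esub> f x = f' x \<otimes>\<^bsub>H'\<^esub> a"
  shows "a \<in> twtr_2cells K (H, R) (H', R') (f, F) (f', F')"
proof -
  note H' = triangularD(8,9)[OF T']
  have "pure K H' H' a a \<otimes>\<^bsub>H' \<boxtimes> H'\<^esub> F = F' \<otimes>\<^bsub>H' \<boxtimes> H'\<^esub> comul H' a"
    using tw[OF in_cpair[OF H'(2) H'(2)]] a
    by (simp only: in_pure[OF H'(2) H'(2)] conv_apply star_in[OF H'(2) H'(2)] twistD(2)[OF F] twistD(2)[OF F'] coalgD(8)[OF H'(1)])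
  then show ?thesis using a eps nat unfolding twtr_2cells_def by (simp add: Let_def)
qed

lemma conv_intertwine:
  fixes Z (structure)
  assumes H: "coalg H" and \<phi>: "ahom H Z \<phi>" and \<psi>: "ahom H Z \<psi>" and \<phi>': "ahom H Z \<phi>'" and \<psi>': "ahom H Z \<psi>'"
    and c: "c \<in> carrier Z" and x: "x \<in> carrier H"
    and 1: "\<And>a. a \<in> carrier H \<Longrightarrow> c \<otimes> \<phi> a = \<phi>' a \<otimes> c"
    and 2: "\<And>b. b \<in> carrier H \<Longrightarrow> c \<otimes> \<psi> b = \<psi>' b \<otimes> c"
  shows "c \<otimes> conv H Z \<phi> \<psi> x = conv H Z \<phi>' \<psi>' x \<otimes> c"
  using star_intertwine[OF \<phi> \<psi> \<phi>' \<psi>' c coalgD(8)[OF H x] 1 2] x by (simp add: conv_apply)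

section \<open>Composition, whiskering and inverses of cells\<close>

lemma star_twist_mult:
  fixes Z (structure)
  assumes g: "ahom H' H'' g" and F: "F \<in> carrier (H' \<boxtimes> H')" and G: "G \<in> carrier (H'' \<boxtimes> H'')"
    and u: "cpair H'' H'' Z u v"
  shows "star H'' H'' Z u v (tensor_map K H' H' H'' H'' g g F \<otimes>\<^bsub>H'' \<boxtimes> H''\<^esub> G) =
    star H' H' Z (u \<circ> g) (v \<circ> g) F \<otimes> star H'' H'' Z u v G"
  using ahomD(4)[OF star_hom[OF u] ahomD(3)[OF tensor_map_hom[OF g g] F] G]
    star_tensor_map[OF cpairD(1,2)[OF u] g g F] by simp

text \<open>This makes the pairing functor well defined on objects. The cocycle condition of the
  composite separates into those of \<open>F\<close> and \<open>G\<close> once \<open>G\<close> has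
  been moved past the values of \<open>F\<close>.\<close>

lemma cell1_comp:
  assumes T: "triangular_bialgebra K (H, R)" and T': "triangular_bialgebra K (H', R')"
    and T'': "triangular_bialgebra K (H'', R'')"
    and c: "(f, F) \<in> twtr_1cells K (H, R) (H', R')" and c': "(g, G) \<in> twtr_1cells K (H', R') (H'', R'')"
  shows "twtr_comp1 K (H, R) (H', R') (H'', R'') (g, G) (f, F) \<in> twtr_1cells K (H, R) (H'', R'')"
proof -
  note d = cell1D[OF T T' c] and d' = cell1D[OF T' T'' c']
  note H = triangularD[OF T] and H' = triangularD[OF T'] and H'' = triangularD[OF T'']
  note F = twistD(1,2)[OF d(1)] and G = twistD(1,2)[OF d'(1)]
  note f = d(3) and g = d'(3)
  define E where "E = tensor_map K H' H' H'' H'' g g F \<otimes>\<^bsub>H'' \<boxtimes> H''\<^esub> G"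
  define h where "h = compose (carrier H) g f"
  have happ: "h x = g (f x)" if "x \<in> carrier H" for x using that by (simp add: h_def compose_def)
  note sE = star_twist_mult[OF g F(2) G(2), folded E_def]
  have h: "ahom H H'' h" by (rule ahom_cong[OF ahom_comp[OF g f]]) (simp add: happ)
  interpret HH: ring "H'' \<boxtimes> H''" using H'' by simp
  have "E \<in> Units (H'' \<boxtimes> H'')"
    unfolding E_def by (intro HH.Units_m_closed G ahom_Units(1)[OF tensor_map_hom[OF g g] F(1)])
  then have E: "is_twist K H'' E"
  proof (rule twistI[OF H''(8)])
    let ?Z = "H'' \<boxtimes> H'' \<boxtimes> H''"
    fix \<phi>1 \<phi>2 \<phi>3 assume u: "cpair H'' H'' ?Z \<phi>1 \<phi>2" "cpair H'' H'' ?Z \<phi>1 \<phi>3" "cpair H'' H'' ?Z \<phi>2 \<phi>3"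
    note Z = ahomD(2)[OF cpairD(1)[OF u(1)]]
    have ug: "cpair H' H' ?Z (\<phi>1 \<circ> g) (\<phi>2 \<circ> g)" "cpair H' H' ?Z (\<phi>1 \<circ> g) (\<phi>3 \<circ> g)" "cpair H' H' ?Z (\<phi>2 \<circ> g) (\<phi>3 \<circ> g)"
      using cpair_comp1[OF cpair_comp2[OF _ g] g] u by blast+
    have cL: "cpair H'' H'' ?Z (conv H'' ?Z \<phi>1 \<phi>2) \<phi>3" and cR: "cpair H'' H'' ?Z \<phi>1 (conv H'' ?Z \<phi>2 \<phi>3)"
      by (intro cpair_conv1 cpair_conv2 H'' u)+
    have cLg: "cpair H' H' ?Z (conv H' ?Z (\<phi>1 \<circ> g) (\<phi>2 \<circ> g)) (\<phi>3 \<circ> g)"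
      and cRg: "cpair H' H' ?Z (\<phi>1 \<circ> g) (conv H' ?Z (\<phi>2 \<circ> g) (\<phi>3 \<circ> g))"
      by (intro cpair_conv1 cpair_conv2 H' ug)+
    have cLg': "cpair H' H' ?Z (conv H'' ?Z \<phi>1 \<phi>2 \<circ> g) (\<phi>3 \<circ> g)" and cRg': "cpair H' H' ?Z (\<phi>1 \<circ> g) (conv H'' ?Z \<phi>2 \<phi>3 \<circ> g)"
      using cpair_comp1[OF cpair_comp2[OF _ g] g] cL cR by blast+
    have k3: "cpair (H'' \<boxtimes> H'') H'' ?Z (star H'' H'' ?Z \<phi>1 \<phi>2) \<phi>3" by (intro cpair_star1 u)
    have k1: "cpair (H'' \<boxtimes> H'') H'' ?Z (star H'' H'' ?Z \<phi>2 \<phi>3) \<phi>1" by (intro cpair_star1 u u[THEN cpair_sym])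
    note sF = ahomD(3)[OF star_hom F(2)] and sG = ahomD(3)[OF star_hom G(2)]
    \<comment> \<open>Here \<phi>1, \<phi>2 are convolved over \<open>H''\<close> before restriction
      along \<open>g\<close>. Passing \<open>G\<close> converts this into the convolution over
      \<open>H'\<close> of the restricted maps, as the cocycle condition of \<open>F\<close>
      requires.\<close>
    have w1: "star H'' H'' ?Z \<phi>1 \<phi>2 G \<otimes>\<^bsub>?Z\<^esub> star H' H' ?Z (conv H'' ?Z \<phi>1 \<phi>2 \<circ> g) (\<phi>3 \<circ> g) F =
      star H' H' ?Z (conv H' ?Z (\<phi>1 \<circ> g) (\<phi>2 \<circ> g)) (\<phi>3 \<circ> g) F \<otimes>\<^bsub>?Z\<^esub> star H'' H'' ?Z \<phi>1 \<phi>2 G"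
      by (rule star_intertwine[OF cpairD(1,2)[OF cLg'] cpairD(1,2)[OF cLg] sG[OF u(1)] F(2)])
        (use cell1_conv[OF T' T'' c' u(1)] cpairD(3)[OF k3 G(2) ahomD(3)[OF g]] in simp_all)
    have w2: "star H'' H'' ?Z \<phi>2 \<phi>3 G \<otimes>\<^bsub>?Z\<^esub> star H' H' ?Z (\<phi>1 \<circ> g) (conv H'' ?Z \<phi>2 \<phi>3 \<circ> g) F =
      star H' H' ?Z (\<phi>1 \<circ> g) (conv H' ?Z (\<phi>2 \<circ> g) (\<phi>3 \<circ> g)) F \<otimes>\<^bsub>?Z\<^esub> star H'' H'' ?Z \<phi>2 \<phi>3 G"
      by (rule star_intertwine[OF cpairD(1,2)[OF cRg'] cpairD(1,2)[OF cRg] sG[OF u(3)] F(2)])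
        (use cell1_conv[OF T' T'' c' u(3)] cpairD(3)[OF k1 G(2) ahomD(3)[OF g]] in simp_all)
    show "star H'' H'' ?Z \<phi>1 \<phi>2 E \<otimes>\<^bsub>?Z\<^esub> star H'' H'' ?Z (conv H'' ?Z \<phi>1 \<phi>2) \<phi>3 E =
       star H'' H'' ?Z \<phi>2 \<phi>3 E \<otimes>\<^bsub>?Z\<^esub> star H'' H'' ?Z \<phi>1 (conv H'' ?Z \<phi>2 \<phi>3) E"
      unfolding sE[OF u(1)] sE[OF u(3)] sE[OF cL] sE[OF cR]
        mult_exchange[OF Z sF[OF ug(1)] sG[OF u(1)] sF[OF cLg'] sF[OF cLg] sG[OF cL] w1]
        mult_exchange[OF Z sF[OF ug(3)] sG[OF u(3)] sF[OF cRg'] sF[OF cRg] sG[OF cR] w2]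
        twist_cocycle[OF H'(8) d(1) ug] twist_cocycle[OF H''(8) d'(1) u] ..
  next
    fix \<phi> assume p: "ahom H'' H'' \<phi>"
    interpret W: ring H'' using H''(9) by simp
    have 1: "star H' H' H'' (triv H'' H'' \<circ> g) (\<phi> \<circ> g) = star H' H' H'' (triv H' H'') (\<phi> \<circ> g)"
      "star H' H' H'' (\<phi> \<circ> g) (triv H'' H'' \<circ> g) = star H' H' H'' (\<phi> \<circ> g) (triv H' H'')"
      by (rule star_cong; simp add: d'(5))+
    show "star H'' H'' H'' (triv H'' H'') \<phi> E = \<one>\<^bsub>H''\<^esub>" "star H'' H'' H'' \<phi> (triv H'' H'') E = \<one>\<^bsub>H''\<^esub>"
      unfolding sE[OF triv_cpair1[OF H''(8) p]] sE[OF triv_cpair2[OF H''(8) p]] 1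
        twist_triv[OF H'(8) d(1) ahom_comp[OF p g]] twist_triv[OF H''(8) d'(1) p] by simp_all
  qed
  have "(h, E) \<in> twtr_1cells K (H, R) (H'', R'')"
  proof (rule cell1I[OF T T'' E _ h])
    show "h \<in> extensional (carrier H)" by (simp add: h_def)
    show "counit H'' (h x) = counit H x" if "x \<in> carrier H" for x
      using that d(4) d'(4) ahomD(3)[OF f] by (simp add: happ)
    let ?Z = "H'' \<boxtimes> H''"
    fix u v assume u: "cpair H'' H'' ?Z u v"
    note Z = ahomD(2)[OF cpairD(1)[OF u]]
    have ug: "cpair H' H' ?Z (u \<circ> g) (v \<circ> g)" by (intro cpair_comp1[OF cpair_comp2[OF u g] g])
    have ugf: "cpair H H ?Z (u \<circ> g \<circ> f) (v \<circ> g \<circ> f)" by (intro cpair_comp1[OF cpair_comp2[OF ug f] f])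
    note sF = ahomD(3)[OF star_hom F(2)] and sG = ahomD(3)[OF star_hom G(2)]
    show "star H'' H'' ?Z u v E \<otimes>\<^bsub>?Z\<^esub> conv H'' ?Z u v (h x) = conv H ?Z (u \<circ> h) (v \<circ> h) x \<otimes>\<^bsub>?Z\<^esub> star H'' H'' ?Z u v E"
      if x: "x \<in> carrier H" for x
    proof -
      note fx = ahomD(3)[OF f x]
      note gfx = ahomD(3)[OF g fx]
      have e: "conv H ?Z (u \<circ> h) (v \<circ> h) = conv H ?Z (u \<circ> g \<circ> f) (v \<circ> g \<circ> f)"
        by (rule conv_cong) (simp_all add: happ)
      show ?thesis
        unfolding sE[OF u] e happ[OF x]
        by (rule intertwine_mult[OF Z sF[OF ug] sG[OF u] ahomD(3)[OF conv_hom[OF H''(8) u] gfx]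
             ahomD(3)[OF conv_hom[OF H'(8) ug] fx] ahomD(3)[OF conv_hom[OF H(8) ugf] x]
             cell1_conv[OF T T' c ug x] cell1_conv[OF T' T'' c' u fx]])
    qed
    have e: "star H H ?Z (u \<circ> h) (v \<circ> h) = star H H ?Z (u \<circ> g \<circ> f) (v \<circ> g \<circ> f)"
      by (rule star_cong) (simp_all add: happ)
    have cl: "star H H ?Z (u \<circ> g \<circ> f) (v \<circ> g \<circ> f) R \<in> carrier ?Z" "star H' H' ?Z (u \<circ> g) (v \<circ> g) F \<in> carrier ?Z"
      "star H' H' ?Z (v \<circ> g) (u \<circ> g) F \<in> carrier ?Z" "star H' H' ?Z (u \<circ> g) (v \<circ> g) R' \<in> carrier ?Z"
      "star H'' H'' ?Z u v G \<in> carrier ?Z" "star H'' H'' ?Z v u G \<in> carrier ?Z" "star H'' H'' ?Z u v R'' \<in> carrier ?Z"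
      using star_closed[OF cpairD(1,2)[OF ugf] H(3)] sF[OF ug] sF[OF cpair_sym[OF ug]]
        star_closed[OF cpairD(1,2)[OF ug] H'(3)] sG[OF u] sG[OF cpair_sym[OF u]]
        star_closed[OF cpairD(1,2)[OF u] H''(3)] by blast+
    have "star H H ?Z (u \<circ> g \<circ> f) (v \<circ> g \<circ> f) R \<otimes>\<^bsub>?Z\<^esub> (star H' H' ?Z (u \<circ> g) (v \<circ> g) F \<otimes>\<^bsub>?Z\<^esub> star H'' H'' ?Z u v G)
      = star H' H' ?Z (v \<circ> g) (u \<circ> g) F \<otimes>\<^bsub>?Z\<^esub> (star H' H' ?Z (u \<circ> g) (v \<circ> g) R' \<otimes>\<^bsub>?Z\<^esub> star H'' H'' ?Z u v G)"
      using cell1_R[OF T T' c ug] cl by (simp only: HH.m_assoc[symmetric])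
    also have "\<dots> = star H' H' ?Z (v \<circ> g) (u \<circ> g) F \<otimes>\<^bsub>?Z\<^esub> star H'' H'' ?Z v u G \<otimes>\<^bsub>?Z\<^esub> star H'' H'' ?Z u v R''"
      using cell1_R[OF T' T'' c' u] cl by (simp only: HH.m_assoc)
    finally show "star H H ?Z (u \<circ> h) (v \<circ> h) R \<otimes>\<^bsub>?Z\<^esub> star H'' H'' ?Z u v E =
        star H'' H'' ?Z v u E \<otimes>\<^bsub>?Z\<^esub> star H'' H'' ?Z u v R''"
      unfolding sE[OF u] sE[OF cpair_sym[OF u]] e .
  qed
  then show ?thesis by (simp add: twtr_comp1_def E_def h_def)
qed

text \<open>The horizontal composite of \<open>b\<close> with the identity of \<open>(g, G)\<close>
  is \<open>g b\<close>, so this is the action of the pairing functor on 2-cells.\<close>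

lemma cell2_whisker:
  assumes T: "triangular_bialgebra K (H, R)" and T': "triangular_bialgebra K (H', R')"
    and T'': "triangular_bialgebra K (H'', R'')"
    and c1: "(f, F) \<in> twtr_1cells K (H, R) (H', R')" and c2: "(f', F') \<in> twtr_1cells K (H, R) (H', R')"
    and c': "(g, G) \<in> twtr_1cells K (H', R') (H'', R'')"
    and b: "b \<in> twtr_2cells K (H, R) (H', R') (f, F) (f', F')"
  shows "g b \<in> twtr_2cells K (H, R) (H'', R'')
    (twtr_comp1 K (H, R) (H', R') (H'', R'') (g, G) (f, F)) (twtr_comp1 K (H, R) (H', R') (H'', R'') (g, G) (f', F'))"
proof -
  note d1 = cell1D[OF T T' c1] and d2 = cell1D[OF T T' c2] and d' = cell1D[OF T' T'' c']
  note H' = triangularD[OF T'] and H'' = triangularD[OF T'']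
  note F1 = twistD(1,2)[OF d1(1)] and F2 = twistD(1,2)[OF d2(1)] and G = twistD(1,2)[OF d'(1)]
  note g = d'(3) and db = cell2D[OF T' b]
  note gb = ahomD(3)[OF g db(1)]
  note k1 = cell1_comp[OF T T' T'' c1 c', unfolded twtr_comp1_def prod.case fst_conv]
    and k2 = cell1_comp[OF T T' T'' c2 c', unfolded twtr_comp1_def prod.case fst_conv]
  show ?thesis
    unfolding twtr_comp1_def prod.case fst_conv
  proof (rule cell2I[OF T'' cell1D(1)[OF T T'' k1] cell1D(1)[OF T T'' k2] gb])
    show "counit H'' (g b) = \<one>\<^bsub>K\<^esub>" using d'(4) db by simp
    show "g b \<otimes>\<^bsub>H''\<^esub> compose (carrier H) g f x = compose (carrier H) g f' x \<otimes>\<^bsub>H''\<^esub> g b" if x: "x \<in> carrier H" for x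
      using x db(3)[OF x] ahomD(4)[OF g db(1) ahomD(3)[OF d1(3) x]] ahomD(4)[OF g ahomD(3)[OF d2(3) x] db(1)]
      by (simp add: compose_def)
    let ?Z = "H'' \<boxtimes> H''"
    fix u v assume u: "cpair H'' H'' ?Z u v"
    note Z = ahomD(2)[OF cpairD(1)[OF u]]
    interpret Z: ring ?Z using Z by simp
    have ug: "cpair H' H' ?Z (u \<circ> g) (v \<circ> g)" by (intro cpair_comp1[OF cpair_comp2[OF u g] g])
    note s1 = star_twist_mult[OF g F1(2) G(2) u] and s2 = star_twist_mult[OF g F2(2) G(2) u]
    have cl: "u (g b) \<in> carrier ?Z" "v (g b) \<in> carrier ?Z" "star H' H' ?Z (u \<circ> g) (v \<circ> g) F \<in> carrier ?Z"
      "star H' H' ?Z (u \<circ> g) (v \<circ> g) F' \<in> carrier ?Z" "star H'' H'' ?Z u v G \<in> carrier ?Z"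
      "conv H' ?Z (u \<circ> g) (v \<circ> g) b \<in> carrier ?Z" "conv H'' ?Z u v (g b) \<in> carrier ?Z"
      using star_closed[OF cpairD(1,2)[OF ug] F1(2)] star_closed[OF cpairD(1,2)[OF ug] F2(2)]
         star_closed[OF cpairD(1,2)[OF u] G(2)] ahomD(3)[OF cpairD(1)[OF u] gb] ahomD(3)[OF cpairD(2)[OF u] gb]
         ahomD(3)[OF conv_hom[OF H'(8) ug] db(1)] ahomD(3)[OF conv_hom[OF H''(8) u] gb] by blast+
    have "u (g b) \<otimes>\<^bsub>?Z\<^esub> v (g b) \<otimes>\<^bsub>?Z\<^esub> (star H' H' ?Z (u \<circ> g) (v \<circ> g) F \<otimes>\<^bsub>?Z\<^esub> star H'' H'' ?Z u v G) =
       u (g b) \<otimes>\<^bsub>?Z\<^esub> v (g b) \<otimes>\<^bsub>?Z\<^esub> star H' H' ?Z (u \<circ> g) (v \<circ> g) F \<otimes>\<^bsub>?Z\<^esub> star H'' H'' ?Z u v G"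
      using cl by (simp only: Z.m_assoc Z.m_closed)
    also have "\<dots> = star H' H' ?Z (u \<circ> g) (v \<circ> g) F' \<otimes>\<^bsub>?Z\<^esub> conv H' ?Z (u \<circ> g) (v \<circ> g) b \<otimes>\<^bsub>?Z\<^esub> star H'' H'' ?Z u v G"
      using cell2_twist[OF T' d1(1) d2(1) b ug] by simp
    also have "\<dots> = star H' H' ?Z (u \<circ> g) (v \<circ> g) F' \<otimes>\<^bsub>?Z\<^esub> star H'' H'' ?Z u v G \<otimes>\<^bsub>?Z\<^esub> conv H'' ?Z u v (g b)"
      using cell1_conv[OF T' T'' c' u db(1)] cl by (simp only: Z.m_assoc Z.m_closed)
    finally show "u (g b) \<otimes>\<^bsub>?Z\<^esub> v (g b) \<otimes>\<^bsub>?Z\<^esub> star H'' H'' ?Z u v (tensor_map K H' H' H'' H'' g g F \<otimes>\<^bsub>?Z\<^esub> G) =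
      star H'' H'' ?Z u v (tensor_map K H' H' H'' H'' g g F' \<otimes>\<^bsub>?Z\<^esub> G) \<otimes>\<^bsub>?Z\<^esub> conv H'' ?Z u v (g b)"
      unfolding s1 s2 .
  qed
qed

lemma cell2_id:
  assumes T: "triangular_bialgebra K (H, R)" and T': "triangular_bialgebra K (H', R')"
    and c: "c \<in> twtr_1cells K (H, R) (H', R')"
  shows "\<one>\<^bsub>H'\<^esub> \<in> twtr_2cells K (H, R) (H', R') c c"
proof (cases c)
  case (Pair f F)
  note d = cell1D[OF T T' c[unfolded Pair]]
  note H' = triangularD[OF T']
  interpret W: ring H' using H'(9) by simp
  show ?thesis
    unfolding Pair
  proof (rule cell2I[OF T' d(1) d(1)])
    fix u v assume u: "cpair H' H' (H' \<boxtimes> H') u v"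
    interpret Z: ring "H' \<boxtimes> H'" using H' by simp
    show "u \<one>\<^bsub>H'\<^esub> \<otimes>\<^bsub>H' \<boxtimes> H'\<^esub> v \<one>\<^bsub>H'\<^esub> \<otimes>\<^bsub>H' \<boxtimes> H'\<^esub> star H' H' (H' \<boxtimes> H') u v F =
        star H' H' (H' \<boxtimes> H') u v F \<otimes>\<^bsub>H' \<boxtimes> H'\<^esub> conv H' (H' \<boxtimes> H') u v \<one>\<^bsub>H'\<^esub>"
      using ahomD(6)[OF conv_hom[OF H'(8) u]] ahomD(6)[OF cpairD(1)[OF u]] ahomD(6)[OF cpairD(2)[OF u]]
        star_closed[OF cpairD(1,2)[OF u] twistD(2)[OF d(1)]]
      by (simp del: tensor_simps)
  qed (use ahomD(3)[OF d(3)] coalgD(6)[OF H'(8)] in auto)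
qed

lemma cell2_vcomp:
  assumes T: "triangular_bialgebra K (H, R)" and T': "triangular_bialgebra K (H', R')"
    and c: "c1 \<in> twtr_1cells K (H, R) (H', R')" "c2 \<in> twtr_1cells K (H, R) (H', R')" "c3 \<in> twtr_1cells K (H, R) (H', R')"
    and a: "a \<in> twtr_2cells K (H, R) (H', R') c1 c2" and b: "b \<in> twtr_2cells K (H, R) (H', R') c2 c3"
  shows "b \<otimes>\<^bsub>H'\<^esub> a \<in> twtr_2cells K (H, R) (H', R') c1 c3"
proof -
  obtain f1 F1 f2 F2 f3 F3 where cc: "c1 = (f1, F1)" "c2 = (f2, F2)" "c3 = (f3, F3)"
    by (cases c1, cases c2, cases c3)
  note a = a[unfolded cc] and b = b[unfolded cc]
  note d1 = cell1D[OF T T' c(1)[unfolded cc]] and d2 = cell1D[OF T T' c(2)[unfolded cc]] and d3 = cell1D[OF T T' c(3)[unfolded cc]]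
  note H' = triangularD[OF T']
  note da = cell2D[OF T' a] and db = cell2D[OF T' b]
  interpret W: ring H' using H'(9) by simp
  interpret KM: module K H' using H'(9) by simp
  show ?thesis
    unfolding cc
  proof (rule cell2I[OF T' d1(1) d3(1)])
    show "b \<otimes>\<^bsub>H'\<^esub> a \<in> carrier H'" using da db by simp
    show "counit H' (b \<otimes>\<^bsub>H'\<^esub> a) = \<one>\<^bsub>K\<^esub>" using da db by (simp add: coalgD(4)[OF H'(8)])
    show "b \<otimes>\<^bsub>H'\<^esub> a \<otimes>\<^bsub>H'\<^esub> f1 x = f3 x \<otimes>\<^bsub>H'\<^esub> (b \<otimes>\<^bsub>H'\<^esub> a)" if x: "x \<in> carrier H" for x
      by (rule intertwine_mult[OF H'(9) db(1) da(1) ahomD(3)[OF d1(3) x] ahomD(3)[OF d2(3) x] ahomD(3)[OF d3(3) x]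
           db(3)[OF x] da(3)[OF x]])
    let ?Z = "H' \<boxtimes> H'"
    fix u v assume u: "cpair H' H' ?Z u v"
    interpret Z: ring ?Z using H' by simp
    note Z = ahomD(2)[OF cpairD(1)[OF u]]
    note hu = cpairD(1)[OF u] and hv = cpairD(2)[OF u] and hc = conv_hom[OF H'(8) u]
    note cl = ahomD(3)[OF hu da(1)] ahomD(3)[OF hv da(1)] ahomD(3)[OF hu db(1)] ahomD(3)[OF hv db(1)]
      star_closed[OF hu hv twistD(2)[OF d1(1)]] star_closed[OF hu hv twistD(2)[OF d2(1)]] star_closed[OF hu hv twistD(2)[OF d3(1)]]
      ahomD(3)[OF hc da(1)] ahomD(3)[OF hc db(1)]
    have s: "(u b \<otimes>\<^bsub>?Z\<^esub> u a) \<otimes>\<^bsub>?Z\<^esub> (v b \<otimes>\<^bsub>?Z\<^esub> v a) = (u b \<otimes>\<^bsub>?Z\<^esub> v b) \<otimes>\<^bsub>?Z\<^esub> (u a \<otimes>\<^bsub>?Z\<^esub> v a)"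
      by (rule mult_swap[OF Z cl(3,1,4,2) cpairD(3)[OF u da(1) db(1)]])
    have "u b \<otimes>\<^bsub>?Z\<^esub> v b \<otimes>\<^bsub>?Z\<^esub> (u a \<otimes>\<^bsub>?Z\<^esub> v a) \<otimes>\<^bsub>?Z\<^esub> star H' H' ?Z u v F1 =
       (u b \<otimes>\<^bsub>?Z\<^esub> v b) \<otimes>\<^bsub>?Z\<^esub> (star H' H' ?Z u v F2 \<otimes>\<^bsub>?Z\<^esub> conv H' ?Z u v a)"
      using cl cell2_twist[OF T' d1(1) d2(1) a u] by (simp only: Z.m_assoc Z.m_closed)
    also have "\<dots> = star H' H' ?Z u v F3 \<otimes>\<^bsub>?Z\<^esub> conv H' ?Z u v b \<otimes>\<^bsub>?Z\<^esub> conv H' ?Z u v a"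
      using cl cell2_twist[OF T' d2(1) d3(1) b u] by (simp only: Z.m_assoc[symmetric] Z.m_closed)
    finally show "u (b \<otimes>\<^bsub>H'\<^esub> a) \<otimes>\<^bsub>?Z\<^esub> v (b \<otimes>\<^bsub>H'\<^esub> a) \<otimes>\<^bsub>?Z\<^esub> star H' H' ?Z u v F1 =
        star H' H' ?Z u v F3 \<otimes>\<^bsub>?Z\<^esub> conv H' ?Z u v (b \<otimes>\<^bsub>H'\<^esub> a)"
      using cl unfolding ahomD(4)[OF hu db(1) da(1)] ahomD(4)[OF hv db(1) da(1)] ahomD(4)[OF hc db(1) da(1)] s
      by (simp only: Z.m_assoc)
  qed
qed

lemma cell2_inv:
  assumes T: "triangular_bialgebra K (H, R)" and T': "triangular_bialgebra K (H', R')"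
    and c: "c1 \<in> twtr_1cells K (H, R) (H', R')" "c2 \<in> twtr_1cells K (H, R) (H', R')"
    and a: "a \<in> twtr_2cells K (H, R) (H', R') c1 c2" and U: "a \<in> Units H'"
  shows "inv\<^bsub>H'\<^esub> a \<in> twtr_2cells K (H, R) (H', R') c2 c1"
proof -
  obtain f1 F1 f2 F2 where cc: "c1 = (f1, F1)" "c2 = (f2, F2)"
    by (cases c1, cases c2)
  note a = a[unfolded cc]
  note d1 = cell1D[OF T T' c(1)[unfolded cc]] and d2 = cell1D[OF T T' c(2)[unfolded cc]]
  note H' = triangularD[OF T']
  note da = cell2D[OF T' a]
  interpret W: ring H' using H'(9) by simp
  interpret KM: module K H' using H'(9) by simp
  have i: "inv\<^bsub>H'\<^esub> a \<in> carrier H'" using U by simp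
  \<comment> \<open>Reverses an intertwining equation by a left inverse \<open>i\<close> and a right
    inverse \<open>j\<close>. It serves both the naturality and the twist condition, for which
    \<open>b\<close> and \<open>c\<close> are different elements.\<close>
  have flip: "i \<otimes>\<^bsub>Z\<^esub> y = x \<otimes>\<^bsub>Z\<^esub> j"
    if "Alg Z" "b \<otimes>\<^bsub>Z\<^esub> x = y \<otimes>\<^bsub>Z\<^esub> c" "i \<otimes>\<^bsub>Z\<^esub> b = \<one>\<^bsub>Z\<^esub>" "c \<otimes>\<^bsub>Z\<^esub> j = \<one>\<^bsub>Z\<^esub>"
      "i \<in> carrier Z" "j \<in> carrier Z" "b \<in> carrier Z" "c \<in> carrier Z" "x \<in> carrier Z" "y \<in> carrier Z"
    for Z :: "('k, 'z, 'l) module_scheme" and i b x y c j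
  proof -
    interpret Z: ring Z using that(1) by simp
    have "i \<otimes>\<^bsub>Z\<^esub> y = i \<otimes>\<^bsub>Z\<^esub> (y \<otimes>\<^bsub>Z\<^esub> c) \<otimes>\<^bsub>Z\<^esub> j" using that by (simp add: Z.m_assoc)
    also have "\<dots> = (i \<otimes>\<^bsub>Z\<^esub> b) \<otimes>\<^bsub>Z\<^esub> x \<otimes>\<^bsub>Z\<^esub> j" using that(5-) unfolding that(2)[symmetric] by (simp add: Z.m_assoc)
    finally show ?thesis using that by simp
  qed
  show ?thesis
    unfolding cc
  proof (rule cell2I[OF T' d2(1) d1(1) i])
    have "counit H' (inv\<^bsub>H'\<^esub> a) \<otimes>\<^bsub>K\<^esub> counit H' a = \<one>\<^bsub>K\<^esub>"
      using U coalgD(4)[OF H'(8) i da(1)] coalgD(6)[OF H'(8)] by simp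
    then show "counit H' (inv\<^bsub>H'\<^esub> a) = \<one>\<^bsub>K\<^esub>" using da coalgD(3)[OF H'(8) i] by simp
    show "inv\<^bsub>H'\<^esub> a \<otimes>\<^bsub>H'\<^esub> f2 x = f1 x \<otimes>\<^bsub>H'\<^esub> inv\<^bsub>H'\<^esub> a" if x: "x \<in> carrier H" for x
      by (rule flip[OF H'(9) da(3)[OF x]])
        (use U i da ahomD(3)[OF d1(3) x] ahomD(3)[OF d2(3) x] in simp_all)
    let ?Z = "H' \<boxtimes> H'"
    fix u v assume u: "cpair H' H' ?Z u v"
    interpret Z: ring ?Z using H' by simp
    note Z = ahomD(2)[OF cpairD(1)[OF u]]
    note hu = cpairD(1)[OF u] and hv = cpairD(2)[OF u] and hc = conv_hom[OF H'(8) u]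
    note cl = ahomD(3)[OF hu da(1)] ahomD(3)[OF hv da(1)] ahomD(3)[OF hu i] ahomD(3)[OF hv i]
      star_closed[OF hu hv twistD(2)[OF d1(1)]] star_closed[OF hu hv twistD(2)[OF d2(1)]]
      ahomD(3)[OF hc da(1)] ahomD(3)[OF hc i]
    have s: "(u (inv\<^bsub>H'\<^esub> a) \<otimes>\<^bsub>?Z\<^esub> v (inv\<^bsub>H'\<^esub> a)) \<otimes>\<^bsub>?Z\<^esub> (u a \<otimes>\<^bsub>?Z\<^esub> v a) = \<one>\<^bsub>?Z\<^esub>"
      unfolding mult_swap[OF Z cl(3,4,1,2) cpairD(3)[OF u da(1) i, symmetric]]
        ahomD(4)[OF hu i da(1), symmetric] ahomD(4)[OF hv i da(1), symmetric]
      using U ahomD(6)[OF hu] ahomD(6)[OF hv] by (simp del: tensor_simps)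
    show "u (inv\<^bsub>H'\<^esub> a) \<otimes>\<^bsub>?Z\<^esub> v (inv\<^bsub>H'\<^esub> a) \<otimes>\<^bsub>?Z\<^esub> star H' H' ?Z u v F2 =
        star H' H' ?Z u v F1 \<otimes>\<^bsub>?Z\<^esub> conv H' ?Z u v (inv\<^bsub>H'\<^esub> a)"
    proof (rule flip[OF Z cell2_twist[OF T' d1(1) d2(1) a u] s])
      show "conv H' ?Z u v a \<otimes>\<^bsub>?Z\<^esub> conv H' ?Z u v (inv\<^bsub>H'\<^esub> a) = \<one>\<^bsub>?Z\<^esub>"
        unfolding ahomD(4)[OF hc da(1) i, symmetric] using U ahomD(6)[OF hc] by (simp del: tensor_simps)
    qed (use cl in \<open>simp_all del: tensor_simps\<close>)
  qed
qed

section \<open>Hom-categories and their products\<close>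

lemma hom_cat_category:
  assumes T: "triangular_bialgebra K X" and T': "triangular_bialgebra K Y"
  shows "is_category (twtr_hom_cat K X Y)"
proof -
  obtain H R H' R' where XY: "X = (H, R)" "Y = (H', R')" by (cases X, cases Y)
  note T = T[unfolded XY] and T' = T'[unfolded XY]
  interpret W: ring H' using triangularD(9)[OF T'] by simp
  have cl: "a \<in> carrier H'" if "a \<in> twtr_2cells K (H, R) (H', R') c1 c2" for a c1 c2
    using that unfolding twtr_2cells_def by (auto simp: Let_def split: prod.splits)
  show ?thesis
    unfolding is_category_def XY
    using cell2_id[OF T T'] cell2_vcomp[OF T T'] cl
    by (simp add: twtr_hom_cat_def twtr_vcomp_def twtr_id2_def W.m_assoc)
qed

lemma prod_cat_category:
  assumes "is_category C" "is_category D"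
  shows "is_category (prod_cat C D)"
  using assms unfolding is_category_def prod_cat_def by auto

text \<open>
  The pairing of \<open>(f, F)\<close> and \<open>(g, G)\<close> is \<open>(f \<otimes> g) \<Delta>\<close>, with the twist that first permutes the two
  middle legs by \<open>R\<^sup>-\<^sup>1\<close> and then applies \<open>F\<close> and \<open>G\<close>. Triangularity turns \<open>R\<^sup>-\<^sup>1\<close> into \<open>R\<close> with
  its arguments exchanged.
\<close>

definition pair_map where
  "pair_map H A B f g = conv H (tb A B) (in1 A B \<circ> f) (in2 A B \<circ> g)"

definition pair_twist where
  "pair_twist H R A B f F g G = (let P = tb A B; PP = P \<boxtimes> P in
     star H H PP (in2 P P \<circ> in1 A B \<circ> f) (in1 P P \<circ> in2 A B \<circ> g) R \<otimes>\<^bsub>PP\<^esub>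
     (star A A PP (in1 P P \<circ> in1 A B) (in2 P P \<circ> in1 A B) F \<otimes>\<^bsub>PP\<^esub>
      star B B PP (in1 P P \<circ> in2 A B) (in2 P P \<circ> in2 A B) G))"

section \<open>The trivial twist, the projections on the embedded factors, and cocycles on four
  legs\<close>

lemma one_twist:
  assumes co: "coalg H" shows "is_twist K H \<one>\<^bsub>H \<boxtimes> H\<^esub>"
proof (rule twistI[OF co])
  note H = coalgD(2)[OF co]
  interpret HH: ring "H \<boxtimes> H" using H by simp
  show "\<one>\<^bsub>H \<boxtimes> H\<^esub> \<in> Units (H \<boxtimes> H)" by (simp del: tensor_simps)
  let ?Z = "H \<boxtimes> H \<boxtimes> H"
  fix \<phi>1 \<phi>2 \<phi>3 assume u: "cpair H H ?Z \<phi>1 \<phi>2" "cpair H H ?Z \<phi>1 \<phi>3" "cpair H H ?Z \<phi>2 \<phi>3"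
  have cL: "cpair H H ?Z (conv H ?Z \<phi>1 \<phi>2) \<phi>3" and cR: "cpair H H ?Z \<phi>1 (conv H ?Z \<phi>2 \<phi>3)"
    by (intro cpair_conv1 cpair_conv2 co u)+
  show "star H H ?Z \<phi>1 \<phi>2 \<one>\<^bsub>H \<boxtimes> H\<^esub> \<otimes>\<^bsub>?Z\<^esub> star H H ?Z (conv H ?Z \<phi>1 \<phi>2) \<phi>3 \<one>\<^bsub>H \<boxtimes> H\<^esub> =
     star H H ?Z \<phi>2 \<phi>3 \<one>\<^bsub>H \<boxtimes> H\<^esub> \<otimes>\<^bsub>?Z\<^esub> star H H ?Z \<phi>1 (conv H ?Z \<phi>2 \<phi>3) \<one>\<^bsub>H \<boxtimes> H\<^esub>"
    unfolding ahomD(6)[OF star_hom[OF u(1)]] ahomD(6)[OF star_hom[OF u(3)]] ahomD(6)[OF star_hom[OF cL]] ahomD(6)[OF star_hom[OF cR]] ..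
next
  fix \<phi> assume p: "ahom H H \<phi>"
  show "star H H H (triv H H) \<phi> \<one>\<^bsub>H \<boxtimes> H\<^esub> = \<one>\<^bsub>H\<^esub>" "star H H H \<phi> (triv H H) \<one>\<^bsub>H \<boxtimes> H\<^esub> = \<one>\<^bsub>H\<^esub>"
    by (rule ahomD(6)[OF star_hom[OF triv_cpair1[OF co p]]] ahomD(6)[OF star_hom[OF triv_cpair2[OF co p]]])+
qed

lemma id_counit_in:
  assumes A: "Alg A" and B: "coalg B"
  shows "a \<in> carrier A \<Longrightarrow> id_counit K A B (in1 A B a) = a"
    "b \<in> carrier B \<Longrightarrow> id_counit K A B (in2 A B b) = triv B A b"
  unfolding id_counit_star[OF assms]
  by (simp_all add: star_comp_in1[OF ahom_id[OF A] triv_hom[OF B A]] star_comp_in2[OF ahom_id[OF A] triv_hom[OF B A]])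

lemma counit_id_in:
  assumes A: "coalg A" and B: "Alg B"
  shows "a \<in> carrier A \<Longrightarrow> counit_id K A B (in1 A B a) = triv A B a"
    "b \<in> carrier B \<Longrightarrow> counit_id K A B (in2 A B b) = b"
  unfolding counit_id_star[OF assms]
  by (simp_all add: star_comp_in1[OF triv_hom[OF A B] ahom_id[OF B]] star_comp_in2[OF triv_hom[OF A B] ahom_id[OF B]])

lemma Kalg_triv: "coalg H \<Longrightarrow> x \<in> carrier H \<Longrightarrow> triv H Kalg x = counit H x"
proof -
  assume a: "coalg H" "x \<in> carrier H"
  interpret KM: module K H using coalgD(2)[OF a(1)] by simp
  show ?thesis using coalgD(3)[OF a] by (simp add: triv_def)
qed

text \<open>
  This is used twice, the second time with \<open>\<phi>2\<close> and \<open>\<phi>3\<close> exchanged; comparing the right-hand sides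
  shows that \<open>(p \<otimes> q)(F)\<close> is a gauge transformation.
\<close>

lemma twist_four:
  fixes Z (structure)
  assumes H: "bialgebra K H" and F: "is_twist K H F"
    and c: "cpair H H Z \<phi>1 \<phi>2" "cpair H H Z \<phi>1 \<phi>3" "cpair H H Z \<phi>1 \<phi>4"
      "cpair H H Z \<phi>2 \<phi>3" "cpair H H Z \<phi>2 \<phi>4" "cpair H H Z \<phi>3 \<phi>4"
  shows "star H H Z \<phi>1 \<phi>2 F \<otimes> star H H Z \<phi>3 \<phi>4 F \<otimes> star H H Z (conv H Z \<phi>1 \<phi>2) (conv H Z \<phi>3 \<phi>4) F =
    star H H Z \<phi>2 \<phi>3 F \<otimes> (star H H Z \<phi>1 (conv H Z \<phi>2 \<phi>3) F \<otimes> star H H Z (conv H Z \<phi>1 (conv H Z \<phi>2 \<phi>3)) \<phi>4 F)"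
proof -
  note co = bialgebra_coalg[OF H]
  note Z = ahomD(2)[OF cpairD(1)[OF c(1)]]
  interpret Z: ring Z using Z by simp
  have d: "cpair H H Z (conv H Z \<phi>1 \<phi>2) \<phi>3" "cpair H H Z (conv H Z \<phi>1 \<phi>2) \<phi>4" "cpair H H Z \<phi>1 (conv H Z \<phi>2 \<phi>3)"
    by (intro cpair_conv1 cpair_conv2 co c)+
  have e: "cpair H H Z (conv H Z \<phi>1 \<phi>2) (conv H Z \<phi>3 \<phi>4)" "cpair H H Z (conv H Z (conv H Z \<phi>1 \<phi>2) \<phi>3) \<phi>4"
    by (intro cpair_conv1 cpair_conv2 co c d)+
  note cl = ahomD(3)[OF star_hom twistD(2)[OF F]]
  note k = cl[OF c(1)] cl[OF c(6)] cl[OF c(4)] cl[OF d(1)] cl[OF d(3)] cl[OF e(1)] cl[OF e(2)]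
  have "star H H Z \<phi>1 \<phi>2 F \<otimes> star H H Z \<phi>3 \<phi>4 F \<otimes> star H H Z (conv H Z \<phi>1 \<phi>2) (conv H Z \<phi>3 \<phi>4) F =
     star H H Z \<phi>1 \<phi>2 F \<otimes> star H H Z (conv H Z \<phi>1 \<phi>2) \<phi>3 F \<otimes> star H H Z (conv H Z (conv H Z \<phi>1 \<phi>2) \<phi>3) \<phi>4 F"
    using k twist_cocycle[OF co F d(1,2) c(6)] by (simp add: Z.m_assoc)
  also have "\<dots> = star H H Z \<phi>2 \<phi>3 F \<otimes> (star H H Z \<phi>1 (conv H Z \<phi>2 \<phi>3) F \<otimes> star H H Z (conv H Z (conv H Z \<phi>1 \<phi>2) \<phi>3) \<phi>4 F)"
    unfolding twist_cocycle[OF co F c(1,2,4)] using k by (simp add: Z.m_assoc)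
  finally show ?thesis unfolding conv_assoc[OF H c(1,2,4)] .
qed

lemma cell2_carrier: "a \<in> twtr_2cells K X (H, R) c c' \<Longrightarrow> a \<in> carrier H"
  unfolding twtr_2cells_def by (auto simp: Let_def split: prod.splits)

end

section \<open>The projections\<close>

locale tribialg_pair = over K for K :: "'k ring" +
  fixes A :: "('k, 'a) bialg" and RA :: "('a, 'a) tens" and B :: "('k, 'b) bialg" and RB :: "('b, 'b) tens"
  assumes TA: "triangular_bialgebra K (A, RA)" and TB: "triangular_bialgebra K (B, RB)"
begin

abbreviation (input) pr1 where "pr1 \<equiv> id_counit K A B"
abbreviation (input) pr2 where "pr2 \<equiv> counit_id K A B"
abbreviation (input) RP where "RP \<equiv> tbR A RA B RB"

lemmas TP = tb_triangular[OF TA TB]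
lemmas dA = triangularD[OF TA]
lemmas dB = triangularD[OF TB]
lemmas dP = triangularD[OF TP]
lemmas d_in = cpairD(1,2)[OF tb_in_cpair[OF dA(9) dB(9)]]

lemma proj_hom: "ahom (tb A B) A (id_counit K A B)" "ahom (tb A B) B (counit_id K A B)"
  using dA(8,9) dB(8,9)
  by (blast intro: ahom_same[OF tb_same' same_alg_refl id_counit_hom] ahom_same[OF tb_same' same_alg_refl counit_id_hom])+

lemma proj_comp_in:
  assumes u: "ahom A Z u" and v: "ahom B Z v"
  shows "a \<in> carrier A \<Longrightarrow> u (id_counit K A B (in1 A B a)) = u a"
    "b \<in> carrier B \<Longrightarrow> u (id_counit K A B (in2 A B b)) = triv B Z b"
    "a \<in> carrier A \<Longrightarrow> v (counit_id K A B (in1 A B a)) = triv A Z a"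
    "b \<in> carrier B \<Longrightarrow> v (counit_id K A B (in2 A B b)) = v b"
  using id_counit_in[OF dA(9) dB(8)] counit_id_in[OF dA(8) dB(9)]
    comp_triv[OF dB(8) u] comp_triv[OF dA(8) v] by simp_all

text \<open>Restricted to \<open>B\<close>, both maps are \<open>triv\<close>, and so is their
  convolution; only the convolution over \<open>A\<close> remains. This is compatibility of the
  projection with the comultiplications.\<close>

lemma conv_proj1:
  assumes u: "cpair A A Z u v" and t: "t \<in> carrier (A \<boxtimes> B)"
  shows "conv (tb A B) Z (u \<circ> id_counit K A B) (v \<circ> id_counit K A B) t = conv A Z u v (id_counit K A B t)"
proof -
  note A = dA and B = dB
  note Z = ahomD(2)[OF cpairD(1)[OF u]]
  let ?p = "id_counit K A B"
  note pu = proj_comp_in(1,2)[OF cpairD(1)[OF u] triv_hom[OF B(8) Z]] proj_comp_in(1,2)[OF cpairD(2)[OF u] triv_hom[OF B(8) Z]]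
  have c: "cpair (tb A B) (tb A B) Z (u \<circ> ?p) (v \<circ> ?p)" by (intro cpair_comp1[OF cpair_comp2[OF u]] proj_hom)
  have e: "conv A Z (u \<circ> ?p \<circ> in1 A B) (v \<circ> ?p \<circ> in1 A B) = conv A Z u v"
    by (rule conv_cong) (simp_all add: pu)
  have e2: "conv B Z (u \<circ> ?p \<circ> in2 A B) (v \<circ> ?p \<circ> in2 A B) = conv B Z (triv B Z) (triv B Z)"
    by (rule conv_cong) (simp_all add: pu)
  have "star A B Z (conv A Z u v) (conv B Z (triv B Z) (triv B Z)) = star A B Z (conv A Z u v) (triv B Z)"
    by (rule star_cong) (simp_all add: conv_triv[OF B(1) triv_hom[OF B(8) Z]])
  then show ?thesis
    unfolding tb_conv[OF A(8) B(8) c t] e e2 comp_id_counit[OF A(9) B(8) conv_hom[OF A(8) u] t] by simp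
qed

lemma conv_proj2:
  assumes u: "cpair B B Z u v" and t: "t \<in> carrier (A \<boxtimes> B)"
  shows "conv (tb A B) Z (u \<circ> counit_id K A B) (v \<circ> counit_id K A B) t = conv B Z u v (counit_id K A B t)"
proof -
  note A = dA and B = dB
  note Z = ahomD(2)[OF cpairD(1)[OF u]]
  let ?p = "counit_id K A B"
  note pu = proj_comp_in(3,4)[OF triv_hom[OF A(8) Z] cpairD(1)[OF u]] proj_comp_in(3,4)[OF triv_hom[OF A(8) Z] cpairD(2)[OF u]]
  have c: "cpair (tb A B) (tb A B) Z (u \<circ> ?p) (v \<circ> ?p)" by (intro cpair_comp1[OF cpair_comp2[OF u]] proj_hom)
  have e: "conv B Z (u \<circ> ?p \<circ> in2 A B) (v \<circ> ?p \<circ> in2 A B) = conv B Z u v"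
    by (rule conv_cong) (simp_all add: pu)
  have e2: "conv A Z (u \<circ> ?p \<circ> in1 A B) (v \<circ> ?p \<circ> in1 A B) = conv A Z (triv A Z) (triv A Z)"
    by (rule conv_cong) (simp_all add: pu)
  have "star A B Z (conv A Z (triv A Z) (triv A Z)) (conv B Z u v) = star A B Z (triv A Z) (conv B Z u v)"
    by (rule star_cong) (simp_all add: conv_triv[OF A(1) triv_hom[OF A(8) Z]])
  then show ?thesis
    unfolding tb_conv[OF A(8) B(8) c t] e e2 comp_counit_id[OF A(8) B(9) conv_hom[OF B(8) u] t] by simp
qed

lemma counit_proj:
  assumes t: "t \<in> carrier (A \<boxtimes> B)"
  shows "counit A (id_counit K A B t) = counit (tb A B) t" "counit B (counit_id K A B t) = counit (tb A B) t"
proof -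
  note A = dA and B = dB
  have 1: "star A B Kalg (counit A) (triv B Kalg) = counit (tb A B)" "star A B Kalg (triv A Kalg) (counit B) = counit (tb A B)"
    unfolding tb_counit[OF A(8) B(8)] by (rule star_cong; simp add: Kalg_triv A B)+
  show "counit A (id_counit K A B t) = counit (tb A B) t" "counit B (counit_id K A B t) = counit (tb A B) t"
    using comp_id_counit[OF A(9) B(8) counit_hom[OF A(8)] t] comp_counit_id[OF A(8) B(9) counit_hom[OF B(8)] t]
    unfolding 1 by simp_all
qed

text \<open>With the trivial twist the claim is that the projections are morphisms of triangular
  bialgebras. In the R-matrix of the product, the factor that is projected away is evaluated at
  \<open>triv\<close> twice and contributes 1.\<close>

lemma proj_cell1:
  "(id_counit K A B, \<one>\<^bsub>A \<boxtimes> A\<^esub>) \<in> twtr_1cells K (tb A B, tbR A RA B RB) (A, RA)"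
  "(counit_id K A B, \<one>\<^bsub>B \<boxtimes> B\<^esub>) \<in> twtr_1cells K (tb A B, tbR A RA B RB) (B, RB)"
proof -
  note A = dA and B = dB
  let ?P = "tb A B"
  show "(id_counit K A B, \<one>\<^bsub>A \<boxtimes> A\<^esub>) \<in> twtr_1cells K (?P, tbR A RA B RB) (A, RA)"
  proof (rule cell1I[OF TP TA one_twist[OF A(8)] _ proj_hom(1)])
    let ?p = "id_counit K A B"
    show "?p \<in> extensional (carrier ?P)"
      unfolding id_counit_star[OF A(9) B(8)] using star_extensional[OF ahom_id[OF A(9)] triv_hom[OF B(8) A(9)]] by simp
    show "counit A (?p x) = counit ?P x" if "x \<in> carrier ?P" for x using counit_proj(1) that by simp
    let ?Z = "A \<boxtimes> A"
    interpret Z: ring ?Z using A by simp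
    fix u v assume u: "cpair A A ?Z u v"
    note Z = ahomD(2)[OF cpairD(1)[OF u]]
    have c: "cpair ?P ?P ?Z (u \<circ> ?p) (v \<circ> ?p)" by (intro cpair_comp1[OF cpair_comp2[OF u]] proj_hom)
    note o = ahomD(6)[OF star_hom[OF u]] ahomD(6)[OF star_hom[OF cpair_sym[OF u]]]
    show "star A A ?Z u v \<one>\<^bsub>?Z\<^esub> \<otimes>\<^bsub>?Z\<^esub> conv A ?Z u v (?p x) = conv ?P ?Z (u \<circ> ?p) (v \<circ> ?p) x \<otimes>\<^bsub>?Z\<^esub> star A A ?Z u v \<one>\<^bsub>?Z\<^esub>"
      if x: "x \<in> carrier ?P" for x
      using ahomD(3)[OF conv_hom[OF A(8) u] ahomD(3)[OF proj_hom(1) x]] conv_proj1[OF u, of x] x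
      unfolding o by (simp del: tensor_simps)
    note pu = proj_comp_in(1,2)[OF cpairD(1)[OF u] triv_hom[OF B(8) Z]] proj_comp_in(1,2)[OF cpairD(2)[OF u] triv_hom[OF B(8) Z]]
    have e: "star A A ?Z (u \<circ> ?p \<circ> in1 A B) (v \<circ> ?p \<circ> in1 A B) = star A A ?Z u v"
      "star B B ?Z (u \<circ> ?p \<circ> in2 A B) (v \<circ> ?p \<circ> in2 A B) = star B B ?Z (triv B ?Z) (triv B ?Z)"
      by (rule star_cong; simp add: pu)+
    show "star ?P ?P ?Z (u \<circ> ?p) (v \<circ> ?p) (tbR A RA B RB) \<otimes>\<^bsub>?Z\<^esub> star A A ?Z u v \<one>\<^bsub>?Z\<^esub> =
       star A A ?Z v u \<one>\<^bsub>?Z\<^esub> \<otimes>\<^bsub>?Z\<^esub> star A A ?Z u v RA"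
      unfolding star_tbR[OF A(9) B(9) A(3) B(3) c] e R_triv[OF TB triv_hom[OF B(8) Z]] o
      using star_closed[OF cpairD(1,2)[OF u] A(3)] by (simp del: tensor_simps)
  qed
  show "(counit_id K A B, \<one>\<^bsub>B \<boxtimes> B\<^esub>) \<in> twtr_1cells K (?P, tbR A RA B RB) (B, RB)"
  proof (rule cell1I[OF TP TB one_twist[OF B(8)] _ proj_hom(2)])
    let ?p = "counit_id K A B"
    show "?p \<in> extensional (carrier ?P)"
      unfolding counit_id_star[OF A(8) B(9)] using star_extensional[OF triv_hom[OF A(8) B(9)] ahom_id[OF B(9)]] by simp
    show "counit B (?p x) = counit ?P x" if "x \<in> carrier ?P" for x using counit_proj(2) that by simp
    let ?Z = "B \<boxtimes> B"
    interpret Z: ring ?Z using B by simp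
    fix u v assume u: "cpair B B ?Z u v"
    note Z = ahomD(2)[OF cpairD(1)[OF u]]
    have c: "cpair ?P ?P ?Z (u \<circ> ?p) (v \<circ> ?p)" by (intro cpair_comp1[OF cpair_comp2[OF u]] proj_hom)
    note o = ahomD(6)[OF star_hom[OF u]] ahomD(6)[OF star_hom[OF cpair_sym[OF u]]]
    show "star B B ?Z u v \<one>\<^bsub>?Z\<^esub> \<otimes>\<^bsub>?Z\<^esub> conv B ?Z u v (?p x) = conv ?P ?Z (u \<circ> ?p) (v \<circ> ?p) x \<otimes>\<^bsub>?Z\<^esub> star B B ?Z u v \<one>\<^bsub>?Z\<^esub>"
      if x: "x \<in> carrier ?P" for x
      using ahomD(3)[OF conv_hom[OF B(8) u] ahomD(3)[OF proj_hom(2) x]] conv_proj2[OF u, of x] x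
      unfolding o by (simp del: tensor_simps)
    note pu = proj_comp_in(3,4)[OF triv_hom[OF A(8) Z] cpairD(1)[OF u]] proj_comp_in(3,4)[OF triv_hom[OF A(8) Z] cpairD(2)[OF u]]
    have e: "star B B ?Z (u \<circ> ?p \<circ> in2 A B) (v \<circ> ?p \<circ> in2 A B) = star B B ?Z u v"
      "star A A ?Z (u \<circ> ?p \<circ> in1 A B) (v \<circ> ?p \<circ> in1 A B) = star A A ?Z (triv A ?Z) (triv A ?Z)"
      by (rule star_cong; simp add: pu)+
    show "star ?P ?P ?Z (u \<circ> ?p) (v \<circ> ?p) (tbR A RA B RB) \<otimes>\<^bsub>?Z\<^esub> star B B ?Z u v \<one>\<^bsub>?Z\<^esub> =
       star B B ?Z v u \<one>\<^bsub>?Z\<^esub> \<otimes>\<^bsub>?Z\<^esub> star B B ?Z u v RB"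
      unfolding star_tbR[OF A(9) B(9) A(3) B(3) c] e R_triv[OF TA triv_hom[OF A(8) Z]] o
      using star_closed[OF cpairD(1,2)[OF u] B(3)] by (simp del: tensor_simps)
  qed
qed

section \<open>The gauge transformation comparing a 1-cell with the pairing of its
  projections\<close>

definition gauge where "gauge F = tensor_map K (tb A B) (tb A B) A B pr1 pr2 F"

lemma gauge_star: "gauge F = star (tb A B) (tb A B) (tb A B) (in1 A B \<circ> pr1) (in2 A B \<circ> pr2) F"
  unfolding gauge_def tensor_map_star[OF proj_hom] star_same[OF same_alg_refl same_alg_refl tb_same] ..

lemma gauge_cpair: "cpair (tb A B) (tb A B) (tb A B) (in1 A B \<circ> pr1) (in2 A B \<circ> pr2)"
  by (intro cpair_comp1[OF cpair_comp2[OF tb_in_cpair]] proj_hom dA dB)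

lemma comp_gauge:
  assumes \<Phi>: "ahom (tb A B) Z \<Phi>" and F: "F \<in> carrier (tb A B \<boxtimes> tb A B)"
  shows "\<Phi> (gauge F) = star (tb A B) (tb A B) Z (\<Phi> \<circ> in1 A B \<circ> pr1) (\<Phi> \<circ> in2 A B \<circ> pr2) F"
  unfolding gauge_star comp_star[OF \<Phi> cpairD(1,2)[OF gauge_cpair] F] o_assoc ..

text \<open>This is \<open>(p \<otimes> q) \<Delta> = Id\<close>.\<close>

lemma conv_proj:
  assumes \<Phi>: "ahom (tb A B) Z \<Phi>" and t: "t \<in> carrier (A \<boxtimes> B)"
  shows "conv (tb A B) Z (\<Phi> \<circ> in1 A B \<circ> pr1) (\<Phi> \<circ> in2 A B \<circ> pr2) t = \<Phi> t"
proof -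
  note r = tb_restrict(1)[OF \<Phi> dA(9) dB(9)]
  note h = cpairD(1,2)[OF r]
  note Z = ahomD(2)[OF \<Phi>]
  have c: "cpair (tb A B) (tb A B) Z (\<Phi> \<circ> in1 A B \<circ> pr1) (\<Phi> \<circ> in2 A B \<circ> pr2)"
    by (intro cpair_comp1[OF cpair_comp2[OF r]] proj_hom)
  note pu = proj_comp_in[OF h, unfolded o_apply]
  have e1: "conv A Z (\<Phi> \<circ> in1 A B \<circ> pr1 \<circ> in1 A B) (\<Phi> \<circ> in2 A B \<circ> pr2 \<circ> in1 A B) = conv A Z (\<Phi> \<circ> in1 A B) (triv A Z)"
    by (rule conv_cong) (simp_all add: pu)
  have e2: "conv B Z (\<Phi> \<circ> in1 A B \<circ> pr1 \<circ> in2 A B) (\<Phi> \<circ> in2 A B \<circ> pr2 \<circ> in2 A B) = conv B Z (triv B Z) (\<Phi> \<circ> in2 A B)"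
    by (rule conv_cong) (simp_all add: pu)
  show ?thesis
    by (rule tb_eqI[OF conv_hom[OF dP(8) c] \<Phi> dA(9) dB(9) _ _ t])
      (simp_all add: tb_conv_in[OF dA(8) dB(8) c] e1 e2 conv_triv[OF dA(1) h(1)] conv_triv[OF dB(1) h(2)])
qed

end

section \<open>Pairing of 1-cells\<close>

locale tribialg_span = tribialg_pair K A RA B RB
  for K :: "'k ring" and A :: "('k, 'a) bialg" and RA and B :: "('k, 'b) bialg" and RB +
  fixes H :: "('k, 'h) bialg" and R :: "('h, 'h) tens"
  assumes T: "triangular_bialgebra K (H, R)"
begin

lemmas dH = triangularD[OF T]

lemma pair_twist_closed:
  assumes f: "ahom H A f" and g: "ahom H B g" and F: "F \<in> Units (A \<boxtimes> A)" and G: "G \<in> Units (B \<boxtimes> B)"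
  shows "pair_twist H R A B f F g G \<in> Units (tb A B \<boxtimes> tb A B)"
proof -
  let ?P = "tb A B"
  let ?Z = "?P \<boxtimes> ?P"
  interpret Z: ring ?Z using dP(9) by simp
  note p = tb_cpairs[OF in_cpair[OF dP(9) dP(9)] dA(9) dB(9)]
  have c: "cpair H H ?Z (in2 ?P ?P \<circ> in1 A B \<circ> f) (in1 ?P ?P \<circ> in2 A B \<circ> g)"
    by (intro cpair_comp1[OF cpair_comp2[OF _ g] f] p[THEN cpair_sym])
  show ?thesis
    unfolding pair_twist_def Let_def
    by (intro Z.Units_m_closed R_Units[OF T c] ahom_Units(1)[OF star_hom[OF p(1)] F] ahom_Units(1)[OF star_hom[OF p(4)] G])
qed

text \<open>The definition is the formula at the two embeddings of the product. Evaluation at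
  (\<Phi>, \<Psi>) is an algebra map that replaces these embeddings by \<Phi> and \<Psi>.\<close>

lemma star_pair_twist:
  fixes Z (structure)
  assumes f: "ahom H A f" and g: "ahom H B g" and F: "F \<in> carrier (A \<boxtimes> A)" and G: "G \<in> carrier (B \<boxtimes> B)"
    and c: "cpair (tb A B) (tb A B) Z \<Phi> \<Psi>"
  shows "star (tb A B) (tb A B) Z \<Phi> \<Psi> (pair_twist H R A B f F g G) =
    star H H Z (\<Psi> \<circ> in1 A B \<circ> f) (\<Phi> \<circ> in2 A B \<circ> g) R \<otimes>
    (star A A Z (\<Phi> \<circ> in1 A B) (\<Psi> \<circ> in1 A B) F \<otimes> star B B Z (\<Phi> \<circ> in2 A B) (\<Psi> \<circ> in2 A B) G)"
proof -
  let ?P = "tb A B"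
  let ?W = "?P \<boxtimes> ?P"
  let ?O = "star ?P ?P Z \<Phi> \<Psi>"
  note O = star_hom[OF c]
  interpret W: ring ?W using dP(9) by simp
  note p = tb_cpairs[OF in_cpair[OF dP(9) dP(9)] dA(9) dB(9)]
  have cR: "cpair H H ?W (in2 ?P ?P \<circ> in1 A B \<circ> f) (in1 ?P ?P \<circ> in2 A B \<circ> g)"
    by (intro cpair_comp1[OF cpair_comp2[OF _ g] f] p[THEN cpair_sym])
  note cl = star_closed[OF cpairD(1,2)[OF cR] dH(3)] star_closed[OF cpairD(1,2)[OF p(1)] F] star_closed[OF cpairD(1,2)[OF p(4)] G]
  have o1: "?O (in1 ?P ?P x) = \<Phi> x" if "x \<in> carrier ?P" for x
    by (rule star_comp_in1[OF cpairD(1,2)[OF c] that])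
  have o2: "?O (in2 ?P ?P x) = \<Psi> x" if "x \<in> carrier ?P" for x
    by (rule star_comp_in2[OF cpairD(1,2)[OF c] that])
  note i1 = ahomD(3)[OF d_in(1)] and i2 = ahomD(3)[OF d_in(2)]
  have e: "star H H Z (?O \<circ> (in2 ?P ?P \<circ> in1 A B \<circ> f)) (?O \<circ> (in1 ?P ?P \<circ> in2 A B \<circ> g)) =
     star H H Z (\<Psi> \<circ> in1 A B \<circ> f) (\<Phi> \<circ> in2 A B \<circ> g)"
    "star A A Z (?O \<circ> (in1 ?P ?P \<circ> in1 A B)) (?O \<circ> (in2 ?P ?P \<circ> in1 A B)) = star A A Z (\<Phi> \<circ> in1 A B) (\<Psi> \<circ> in1 A B)"
    "star B B Z (?O \<circ> (in1 ?P ?P \<circ> in2 A B)) (?O \<circ> (in2 ?P ?P \<circ> in2 A B)) = star B B Z (\<Phi> \<circ> in2 A B) (\<Psi> \<circ> in2 A B)"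
    by (rule star_cong; simp only: o_apply o1 o2 i1 i2 ahomD(3)[OF f] ahomD(3)[OF g])+
  show ?thesis
    unfolding pair_twist_def Let_def ahomD(4)[OF O cl(1) W.m_closed[OF cl(2,3)]] ahomD(4)[OF O cl(2,3)]
      comp_star[OF O cpairD(1,2)[OF cR] dH(3)] comp_star[OF O cpairD(1,2)[OF p(1)] F] comp_star[OF O cpairD(1,2)[OF p(4)] G] e ..
qed

text \<open>Moving \<open>F\<close> and \<open>G\<close> to the right past R leaves, on either side,
  three values of R followed by the cocycle expressions of \<open>F\<close> and of \<open>G\<close>.
  The latter agree by the cocycle conditions, and the values of R agree up to exchanging two
  commuting ones.\<close>

lemma pair_twist_cocycle:
  fixes Z (structure)
  assumes cf: "(f, F) \<in> twtr_1cells K (H, R) (A, RA)" and cg: "(g, G) \<in> twtr_1cells K (H, R) (B, RB)"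
    and a: "cpair A A Z a1 a2" "cpair A A Z a1 a3" "cpair A A Z a2 a3"
    and b: "cpair B B Z b1 b2" "cpair B B Z b1 b3" "cpair B B Z b2 b3"
    and ab: "cpair A B Z a1 b1" "cpair A B Z a1 b2" "cpair A B Z a1 b3"
      "cpair A B Z a2 b1" "cpair A B Z a2 b2" "cpair A B Z a2 b3"
      "cpair A B Z a3 b1" "cpair A B Z a3 b2" "cpair A B Z a3 b3"
  shows "(star H H Z (a2 \<circ> f) (b1 \<circ> g) R \<otimes> (star A A Z a1 a2 F \<otimes> star B B Z b1 b2 G)) \<otimes>
      (star H H Z (a3 \<circ> f) (conv B Z b1 b2 \<circ> g) R \<otimes>
       (star A A Z (conv A Z a1 a2) a3 F \<otimes> star B B Z (conv B Z b1 b2) b3 G)) =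
    (star H H Z (a3 \<circ> f) (b2 \<circ> g) R \<otimes> (star A A Z a2 a3 F \<otimes> star B B Z b2 b3 G)) \<otimes>
      (star H H Z (conv A Z a2 a3 \<circ> f) (b1 \<circ> g) R \<otimes>
       (star A A Z a1 (conv A Z a2 a3) F \<otimes> star B B Z b1 (conv B Z b2 b3) G))"
proof -
  note df = cell1D[OF T TA cf] and dg = cell1D[OF T TB cg]
  note f = df(3) and g = dg(3)
  note Z = ahomD(2)[OF cpairD(1)[OF a(1)]]
  interpret Z: ring Z using Z by simp
  note s = a b ab a[THEN cpair_sym] b[THEN cpair_sym] ab[THEN cpair_sym]
  have cc: "cpair A A Z (conv A Z a1 a2) a3" "cpair A A Z a1 (conv A Z a2 a3)"
    "cpair B B Z (conv B Z b1 b2) b3" "cpair B B Z b1 (conv B Z b2 b3)"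
    "cpair A B Z a3 (conv B Z b1 b2)" "cpair A B Z (conv A Z a2 a3) b1"
    by (intro cpair_conv1 cpair_conv2 dA dB s)+
  have af: "cpair H H Z (a3 \<circ> f) (b1 \<circ> g)" "cpair H H Z (a3 \<circ> f) (b2 \<circ> g)" "cpair H H Z (b1 \<circ> g) (b2 \<circ> g)"
    "cpair H H Z (a2 \<circ> f) (a3 \<circ> f)" "cpair H H Z (a2 \<circ> f) (b1 \<circ> g)"
    "cpair H H Z (a3 \<circ> f) (conv B Z b1 b2 \<circ> g)" "cpair H H Z (conv A Z a2 a3 \<circ> f) (b1 \<circ> g)"
    by (intro cpair_comp1[OF cpair_comp2[OF _ g] f] cpair_comp1[OF cpair_comp2[OF _ f] f] cpair_comp1[OF cpair_comp2[OF _ g] g] s cc)+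
  have ac: "cpair H H Z (a3 \<circ> f) (conv H Z (b1 \<circ> g) (b2 \<circ> g))" "cpair H H Z (conv H Z (a2 \<circ> f) (a3 \<circ> f)) (b1 \<circ> g)"
    by (intro cpair_conv1 cpair_conv2 dH af)+
  note Fc = twistD(2)[OF df(1)] and Gc = twistD(2)[OF dg(1)]
  note clR = ahomD(3)[OF star_hom dH(3)] and clF = ahomD(3)[OF star_hom Fc] and clG = ahomD(3)[OF star_hom Gc]
  note cl = clR[OF af(5)] clR[OF af(2)] clR[OF af(1)] clR[OF af(6)] clR[OF af(7)] clR[OF ac(1)] clR[OF ac(2)]
    clF[OF a(1)] clF[OF a(3)] clF[OF cc(1)] clF[OF cc(2)] clG[OF b(1)] clG[OF b(3)] clG[OF cc(3)] clG[OF cc(4)]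
  let ?r21 = "star H H Z (a2 \<circ> f) (b1 \<circ> g) R" and ?r32 = "star H H Z (a3 \<circ> f) (b2 \<circ> g) R" and ?r31 = "star H H Z (a3 \<circ> f) (b1 \<circ> g) R"
  let ?x12 = "star A A Z a1 a2 F" and ?x23 = "star A A Z a2 a3 F" and ?y12 = "star B B Z b1 b2 G" and ?y23 = "star B B Z b2 b3 G"
  have k1: "cpair (B \<boxtimes> B) A Z (star B B Z b1 b2) a3" by (intro cpair_star1 s)
  \<comment> \<open>\<open>G\<close> passes the second argument of R and splits it: the convolution
    of \<open>b1\<close> and \<open>b2\<close> restricted along \<open>g\<close> becomes the
    convolution of the restrictions. The first argument commutes with \<open>G\<close>.\<close>
  have L1: "?y12 \<otimes> star H H Z (a3 \<circ> f) (conv B Z b1 b2 \<circ> g) R = star H H Z (a3 \<circ> f) (conv H Z (b1 \<circ> g) (b2 \<circ> g)) R \<otimes> ?y12"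
    by (rule star_intertwine[OF cpairD(1,2)[OF af(6)] cpairD(1,2)[OF ac(1)] cl(12) dH(3)])
      (use cell1_conv[OF T TB cg b(1)] cpairD(3)[OF k1 Gc ahomD(3)[OF f]] in simp_all)
  have k2: "cpair (A \<boxtimes> A) (H \<boxtimes> H) Z (star A A Z a1 a2) (star H H Z (a3 \<circ> f) (conv H Z (b1 \<circ> g) (b2 \<circ> g)))"
    by (intro cpair_star4 cpair_conv2 cpair_comp2[OF _ f] cpair_comp2[OF _ g] dH s af ac)
  \<comment> \<open>The hexagon identity breaks R at a convolution into two values; \<open>F\<close>
    contributes only a commutation.\<close>
  have L2: "(?x12 \<otimes> ?y12) \<otimes> star H H Z (a3 \<circ> f) (conv B Z b1 b2 \<circ> g) R = (?r32 \<otimes> ?r31) \<otimes> (?x12 \<otimes> ?y12)"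
    unfolding R_hex1[OF T af(1,2,3), symmetric]
    by (rule intertwine_mult[OF Z cl(8,12) cl(4) cl(6) cl(6) cpairD(3)[OF k2 Fc dH(3)] L1])
  have k3: "cpair (A \<boxtimes> A) B Z (star A A Z a2 a3) b1" by (intro cpair_star1 s)
  have R1: "?x23 \<otimes> star H H Z (conv A Z a2 a3 \<circ> f) (b1 \<circ> g) R = star H H Z (conv H Z (a2 \<circ> f) (a3 \<circ> f)) (b1 \<circ> g) R \<otimes> ?x23"
    by (rule star_intertwine[OF cpairD(1,2)[OF af(7)] cpairD(1,2)[OF ac(2)] cl(9) dH(3)])
      (use cell1_conv[OF T TA cf a(3)] cpairD(3)[OF k3 Fc ahomD(3)[OF g]] in simp_all)
  have k4: "cpair (B \<boxtimes> B) (H \<boxtimes> H) Z (star B B Z b2 b3) (star H H Z (conv A Z a2 a3 \<circ> f) (b1 \<circ> g))"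
    by (intro cpair_star4 cpair_comp2[OF _ f] cpair_comp2[OF _ g] cpair_conv2 dA s af)
  have R2: "(?x23 \<otimes> ?y23) \<otimes> star H H Z (conv A Z a2 a3 \<circ> f) (b1 \<circ> g) R = (?r21 \<otimes> ?r31) \<otimes> (?x23 \<otimes> ?y23)"
    unfolding R_hex2[OF T af(4,5,1), symmetric]
    by (rule intertwine_mult[OF Z cl(9,13) cl(5) cl(5) cl(7) R1 cpairD(3)[OF k4 Gc dH(3)]])
  have k5: "cpair (B \<boxtimes> B) (A \<boxtimes> A) Z (star B B Z b1 b2) (star A A Z (conv A Z a1 a2) a3)"
    "cpair (B \<boxtimes> B) (A \<boxtimes> A) Z (star B B Z b2 b3) (star A A Z a1 (conv A Z a2 a3))"
    by (intro cpair_star4 cpair_conv1 cpair_conv2 dA s)+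
  have k6: "cpair (H \<boxtimes> H) (H \<boxtimes> H) Z (star H H Z (a2 \<circ> f) (b1 \<circ> g)) (star H H Z (a3 \<circ> f) (b2 \<circ> g))"
    by (intro cpair_star4 cpair_comp1[OF cpair_comp2[OF _ g] f] cpair_comp1[OF cpair_comp2[OF _ f] f]
       cpair_comp1[OF cpair_comp2[OF _ f] g] cpair_comp1[OF cpair_comp2[OF _ g] g] s)
  note mc = Z.m_closed
  \<comment> \<open>These two values of R come from disjoint legs, \<open>a2\<close> with
    \<open>b1\<close> and \<open>a3\<close> with \<open>b2\<close>, hence they commute.\<close>
  have r: "?r21 \<otimes> (?r32 \<otimes> ?r31) = ?r32 \<otimes> (?r21 \<otimes> ?r31)"
    using cpairD(3)[OF k6 dH(3) dH(3)] cl by (simp only: Z.m_assoc[symmetric])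
  show ?thesis
    unfolding mult_exchange[OF Z cl(1) mc[OF cl(8,12)] cl(4) mc[OF cl(2,3)] mc[OF cl(10,14)] L2]
      mult_exchange[OF Z cl(2) mc[OF cl(9,13)] cl(5) mc[OF cl(1,3)] mc[OF cl(11,15)] R2]
      mult_swap[OF Z cl(8,12,10,14) cpairD(3)[OF k5(1) Gc Fc]]
      mult_swap[OF Z cl(9,13,11,15) cpairD(3)[OF k5(2) Gc Fc]]
      twist_cocycle[OF dA(8) df(1) a] twist_cocycle[OF dB(8) dg(1) b] r ..
qed

lemma pair_map_hom:
  assumes f: "ahom H A f" and g: "ahom H B g"
  shows "ahom H (tb A B) (pair_map H A B f g)"
  unfolding pair_map_def by (intro conv_hom dH cpair_comp1[OF cpair_comp2[OF _ g] f] tb_in_cpair dA dB)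

lemma comp_pair_map:
  assumes f: "ahom H A f" and g: "ahom H B g" and \<Phi>: "ahom (tb A B) Z \<Phi>" and x: "x \<in> carrier H"
  shows "\<Phi> (pair_map H A B f g x) = conv H Z (\<Phi> \<circ> in1 A B \<circ> f) (\<Phi> \<circ> in2 A B \<circ> g) x"
  unfolding pair_map_def
  using comp_conv[OF dH(8) \<Phi> ahom_comp[OF d_in(1) f] ahom_comp[OF d_in(2) g] x] by (simp only: o_assoc)

text \<open>\<open>F\<close> and \<open>G\<close> rearrange the comultiplications of
  \<open>A\<close> and \<open>B\<close> into iterated comultiplications of \<open>H\<close>, with
  the order a1, a2, b1, b2 of the factors. R then exchanges the two middle ones by
  quasi-cocommutativity, giving the order a1, b1, a2, b2 demanded by the pairing.\<close>

lemma pair_twist_conv: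
  fixes Z (structure)
  assumes cf: "(f, F) \<in> twtr_1cells K (H, R) (A, RA)" and cg: "(g, G) \<in> twtr_1cells K (H, R) (B, RB)"
    and a: "cpair A A Z a1 a2" and b: "cpair B B Z b1 b2"
    and ab: "cpair A B Z a1 b1" "cpair A B Z a1 b2" "cpair A B Z a2 b1" "cpair A B Z a2 b2"
    and x: "x \<in> carrier H"
  shows "(star H H Z (a2 \<circ> f) (b1 \<circ> g) R \<otimes> (star A A Z a1 a2 F \<otimes> star B B Z b1 b2 G)) \<otimes>
      conv H Z (conv A Z a1 a2 \<circ> f) (conv B Z b1 b2 \<circ> g) x =
    conv H Z (conv H Z (a1 \<circ> f) (b1 \<circ> g)) (conv H Z (a2 \<circ> f) (b2 \<circ> g)) x \<otimes>
      (star H H Z (a2 \<circ> f) (b1 \<circ> g) R \<otimes> (star A A Z a1 a2 F \<otimes> star B B Z b1 b2 G))"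
proof -
  note df = cell1D[OF T TA cf] and dg = cell1D[OF T TB cg]
  note f = df(3) and g = dg(3)
  note Z = ahomD(2)[OF cpairD(1)[OF a(1)]]
  interpret Z: ring Z using Z by simp
  note s = a b ab a[THEN cpair_sym] b[THEN cpair_sym] ab[THEN cpair_sym]
  note Fc = twistD(2)[OF df(1)] and Gc = twistD(2)[OF dg(1)]
  let ?a1 = "a1 \<circ> f" and ?a2 = "a2 \<circ> f" and ?b1 = "b1 \<circ> g" and ?b2 = "b2 \<circ> g"
  have h: "cpair H H Z ?a1 ?a2" "cpair H H Z ?a1 ?b1" "cpair H H Z ?a1 ?b2" "cpair H H Z ?a2 ?b1" "cpair H H Z ?a2 ?b2" "cpair H H Z ?b1 ?b2"
    by (intro cpair_comp1[OF cpair_comp2[OF _ g] f] cpair_comp1[OF cpair_comp2[OF _ f] f] cpair_comp1[OF cpair_comp2[OF _ g] g] s)+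
  note hs = h h[THEN cpair_sym]
  have c: "cpair A B Z (conv A Z a1 a2) (conv B Z b1 b2)" by (intro cpair_conv1 cpair_conv2 dA dB s)
  have cf': "cpair H H Z (conv A Z a1 a2 \<circ> f) (conv B Z b1 b2 \<circ> g)" by (intro cpair_comp1[OF cpair_comp2[OF _ g] f] c)
  have q: "cpair H H Z (conv H Z ?a1 ?a2) (conv H Z ?b1 ?b2)" by (intro cpair_conv1 cpair_conv2 dH hs)
  have q1: "cpair H H Z (conv H Z ?a2 ?b1) ?b2" "cpair H H Z (conv H Z ?b1 ?a2) ?b2"
    "cpair H H Z ?a1 (conv H Z ?a2 ?b1)" "cpair H H Z ?a1 (conv H Z ?b1 ?a2)" by (intro cpair_conv1 cpair_conv2 dH hs)+
  have q2: "cpair H H Z ?a1 (conv H Z (conv H Z ?a2 ?b1) ?b2)" "cpair H H Z ?a1 (conv H Z (conv H Z ?b1 ?a2) ?b2)"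
    by (intro cpair_conv2 dH hs q1)+
  have q3: "cpair H H Z ?a2 (conv H Z ?b1 ?b2)" "cpair H H Z ?a1 (conv H Z ?b1 ?b2)" by (intro cpair_conv2 dH hs)+
  have q4: "cpair H H Z ?a1 (conv H Z ?a2 ?b2)" "cpair H H Z ?b1 (conv H Z ?a2 ?b2)" by (intro cpair_conv2 dH hs)+
  have q5: "cpair H H Z (conv H Z ?a1 ?b1) (conv H Z ?a2 ?b2)" by (intro cpair_conv1 dH hs q4)
  \<comment> \<open>Coassociativity is used to bracket the two middle factors together, so that
    quasi-cocommutativity applies to them; \<open>e2\<close> restores the bracketing by pairs after
    the exchange.\<close>
  have e1: "conv H Z (conv H Z ?a1 ?a2) (conv H Z ?b1 ?b2) = conv H Z ?a1 (conv H Z (conv H Z ?a2 ?b1) ?b2)"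
    by (simp only: conv_assoc[OF dH(1) h(1) q3(2,1)] conv_assoc[OF dH(1) hs(4,5,6)])
  have e2: "conv H Z ?a1 (conv H Z (conv H Z ?b1 ?a2) ?b2) = conv H Z (conv H Z ?a1 ?b1) (conv H Z ?a2 ?b2)"
    by (simp only: conv_assoc[OF dH(1) h(2) q4] conv_assoc[OF dH(1) hs(10,6,5)])
  let ?r = "star H H Z ?a2 ?b1 R" and ?x = "star A A Z a1 a2 F" and ?y = "star B B Z b1 b2 G"
  note cl = star_closed[OF cpairD(1,2)[OF h(4)] dH(3)] star_closed[OF cpairD(1,2)[OF a(1)] Fc] star_closed[OF cpairD(1,2)[OF b(1)] Gc]
  note xy = Z.m_closed[OF cl(2,3)]
  note ch = conv_hom[OF dA(8) a] conv_hom[OF dB(8) b] conv_hom[OF dH(8) h(1)] conv_hom[OF dH(8) h(6)]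
  have k1: "cpair (B \<boxtimes> B) A Z (star B B Z b1 b2) (conv A Z a1 a2)" by (intro cpair_star1 cpair_conv2 dA s)
  have k2: "cpair (A \<boxtimes> A) H Z (star A A Z a1 a2) (conv H Z ?b1 ?b2)"
    by (intro cpair_star1 cpair_conv2 dH cpair_comp2[OF _ g] s hs)
  have w1: "?x \<otimes> ?y \<otimes> (conv A Z a1 a2 \<circ> f) z = conv H Z ?a1 ?a2 z \<otimes> (?x \<otimes> ?y)" if z: "z \<in> carrier H" for z
    unfolding o_apply[of "conv A Z a1 a2" f]
    by (rule intertwine_mult[OF Z cl(2,3) ahomD(3)[OF ch(1) ahomD(3)[OF f z]] ahomD(3)[OF ch(1) ahomD(3)[OF f z]]
        ahomD(3)[OF ch(3) z] cell1_conv[OF T TA cf a z] cpairD(3)[OF k1 Gc ahomD(3)[OF f z]]])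
  have w2: "?x \<otimes> ?y \<otimes> (conv B Z b1 b2 \<circ> g) z = conv H Z ?b1 ?b2 z \<otimes> (?x \<otimes> ?y)" if z: "z \<in> carrier H" for z
    unfolding o_apply[of "conv B Z b1 b2" g]
    by (rule intertwine_mult[OF Z cl(2,3) ahomD(3)[OF ch(2) ahomD(3)[OF g z]] ahomD(3)[OF ch(4) z]
        ahomD(3)[OF ch(4) z] cpairD(3)[OF k2 Fc z] cell1_conv[OF T TB cg b z]])
  have 1: "?x \<otimes> ?y \<otimes> conv H Z (conv A Z a1 a2 \<circ> f) (conv B Z b1 b2 \<circ> g) x =
     conv H Z (conv H Z ?a1 ?a2) (conv H Z ?b1 ?b2) x \<otimes> (?x \<otimes> ?y)"
    by (rule conv_intertwine[OF dH(8) cpairD(1,2)[OF cf'] cpairD(1,2)[OF q] xy x w1 w2])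
  have k3: "cpair (H \<boxtimes> H) H Z (star H H Z ?a2 ?b1) ?a1" "cpair (H \<boxtimes> H) H Z (star H H Z ?a2 ?b1) ?b2"
    by (intro cpair_star1 hs)+
  have w3: "?r \<otimes> conv H Z (conv H Z ?a2 ?b1) ?b2 z = conv H Z (conv H Z ?b1 ?a2) ?b2 z \<otimes> ?r" if z: "z \<in> carrier H" for z
    by (rule conv_intertwine[OF dH(8) cpairD(1,2)[OF q1(1)] cpairD(1,2)[OF q1(2)] cl(1) z
        R_quasi[OF T h(4)] cpairD(3)[OF k3(2) dH(3)]])
  have 2: "?r \<otimes> conv H Z ?a1 (conv H Z (conv H Z ?a2 ?b1) ?b2) x = conv H Z ?a1 (conv H Z (conv H Z ?b1 ?a2) ?b2) x \<otimes> ?r"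
    by (rule conv_intertwine[OF dH(8) cpairD(1,2)[OF q2(1)] cpairD(1,2)[OF q2(2)] cl(1) x
        cpairD(3)[OF k3(1) dH(3)] w3])
  show ?thesis
    by (rule intertwine_mult[OF Z cl(1) xy ahomD(3)[OF conv_hom[OF dH(8) cf'] x] ahomD(3)[OF conv_hom[OF dH(8) q] x]
       ahomD(3)[OF conv_hom[OF dH(8) q5] x] 2[folded e1, unfolded e2] 1])
qed

text \<open>The hexagon identities split R at the two pairs into four values. One of them cancels
  the R of the twist, one is the R of the twist with exchanged arguments, and the other two are
  converted by \<open>F\<close> and \<open>G\<close> into the R-matrices of \<open>A\<close> and
  \<open>B\<close>.\<close>

lemma pair_twist_R:
  fixes Z (structure)
  assumes cf: "(f, F) \<in> twtr_1cells K (H, R) (A, RA)" and cg: "(g, G) \<in> twtr_1cells K (H, R) (B, RB)"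
    and a: "cpair A A Z a1 a2" and b: "cpair B B Z b1 b2"
    and ab: "cpair A B Z a1 b1" "cpair A B Z a1 b2" "cpair A B Z a2 b1" "cpair A B Z a2 b2"
  shows "star H H Z (conv H Z (a1 \<circ> f) (b1 \<circ> g)) (conv H Z (a2 \<circ> f) (b2 \<circ> g)) R \<otimes>
     (star H H Z (a2 \<circ> f) (b1 \<circ> g) R \<otimes> (star A A Z a1 a2 F \<otimes> star B B Z b1 b2 G)) =
    (star H H Z (a1 \<circ> f) (b2 \<circ> g) R \<otimes> (star A A Z a2 a1 F \<otimes> star B B Z b2 b1 G)) \<otimes>
      (star A A Z a1 a2 RA \<otimes> star B B Z b1 b2 RB)"
proof -
  note df = cell1D[OF T TA cf] and dg = cell1D[OF T TB cg]
  note f = df(3) and g = dg(3)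
  note Z = ahomD(2)[OF cpairD(1)[OF a(1)]]
  interpret Z: ring Z using Z by simp
  note s = a b ab a[THEN cpair_sym] b[THEN cpair_sym] ab[THEN cpair_sym]
  note Fc = twistD(2)[OF df(1)] and Gc = twistD(2)[OF dg(1)]
  let ?a1 = "a1 \<circ> f" and ?a2 = "a2 \<circ> f" and ?b1 = "b1 \<circ> g" and ?b2 = "b2 \<circ> g"
  have h: "cpair H H Z ?a1 ?a2" "cpair H H Z ?a1 ?b1" "cpair H H Z ?a1 ?b2" "cpair H H Z ?a2 ?b1" "cpair H H Z ?a2 ?b2" "cpair H H Z ?b1 ?b2"
    by (intro cpair_comp1[OF cpair_comp2[OF _ g] f] cpair_comp1[OF cpair_comp2[OF _ f] f] cpair_comp1[OF cpair_comp2[OF _ g] g] s)+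
  note hs = h h[THEN cpair_sym]
  have q4: "cpair H H Z ?a1 (conv H Z ?a2 ?b2)" "cpair H H Z ?b1 (conv H Z ?a2 ?b2)" by (intro cpair_conv2 dH hs)+
  have hex: "star H H Z (conv H Z ?a1 ?b1) (conv H Z ?a2 ?b2) R =
     (star H H Z ?a1 ?b2 R \<otimes> star H H Z ?a1 ?a2 R) \<otimes> (star H H Z ?b1 ?b2 R \<otimes> star H H Z ?b1 ?a2 R)"
    unfolding R_hex2[OF T h(2) q4] R_hex1[OF T h(1,3,5)] R_hex1[OF T hs(10,6,5)] ..
  let ?x12 = "star A A Z a1 a2 F" and ?x21 = "star A A Z a2 a1 F" and ?y12 = "star B B Z b1 b2 G" and ?y21 = "star B B Z b2 b1 G"
  let ?rab = "star H H Z ?a1 ?b2 R" and ?raa = "star H H Z ?a1 ?a2 R" and ?rbb = "star H H Z ?b1 ?b2 R"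
    and ?rba = "star H H Z ?b1 ?a2 R" and ?r = "star H H Z ?a2 ?b1 R" and ?RA = "star A A Z a1 a2 RA" and ?RB = "star B B Z b1 b2 RB"
  note clR = ahomD(3)[OF star_hom dH(3)] and clF = ahomD(3)[OF star_hom Fc] and clG = ahomD(3)[OF star_hom Gc]
  note cl = clR[OF h(3)] clR[OF h(1)] clR[OF h(6)] clR[OF hs(10)] clR[OF h(4)] clF[OF a] clF[OF cpair_sym[OF a]]
    clG[OF b] clG[OF cpair_sym[OF b]] ahomD(3)[OF star_hom[OF a] dA(3)] ahomD(3)[OF star_hom[OF b] dB(3)]
  note mc = Z.m_closed
  have k1: "cpair (H \<boxtimes> H) (A \<boxtimes> A) Z (star H H Z ?b1 ?b2) (star A A Z a1 a2)"
    by (intro cpair_star4 cpair_comp1[OF _ g] s hs)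
  have k2: "cpair (B \<boxtimes> B) (A \<boxtimes> A) Z (star B B Z b2 b1) (star A A Z a1 a2)"
    by (intro cpair_star4 s)
  have "star H H Z (conv H Z ?a1 ?b1) (conv H Z ?a2 ?b2) R \<otimes> (?r \<otimes> (?x12 \<otimes> ?y12)) =
      ?rab \<otimes> ((?raa \<otimes> ?rbb) \<otimes> ((?rba \<otimes> ?r) \<otimes> (?x12 \<otimes> ?y12)))"
    unfolding hex using cl by (simp only: Z.m_assoc mc)
  \<comment> \<open>Triangularity of \<open>H\<close> enters here: \<open>?rba\<close> and
    \<open>?r\<close> are R at exchanged arguments and cancel.\<close>
  also have "\<dots> = ?rab \<otimes> ((?raa \<otimes> ?rbb) \<otimes> (?x12 \<otimes> ?y12))"
    unfolding R_inverse[OF T hs(10)] using cl by simp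
  also have "\<dots> = ?rab \<otimes> ((?x21 \<otimes> ?RA) \<otimes> (?y21 \<otimes> ?RB))"
    unfolding mult_swap[OF Z cl(2,3,6,8) cpairD(3)[OF k1 dH(3) Fc]] cell1_R[OF T TA cf a] cell1_R[OF T TB cg b] ..
  also have "\<dots> = ?rab \<otimes> ((?x21 \<otimes> ?y21) \<otimes> (?RA \<otimes> ?RB))"
    unfolding mult_swap[OF Z cl(7,9,10,11) cpairD(3)[OF k2 Gc dA(3)]] ..
  finally show ?thesis using cl by (simp only: Z.m_assoc mc)
qed

text \<open>The four values of \<open>t\<close> and \<open>w\<close> are regrouped. The pair
  \<open>a2 t\<close>, \<open>b1 w\<close> passes R and changes \<open>f\<close>, \<open>g\<close>
  into \<open>f'\<close>, \<open>g'\<close>; the pair \<open>a1 t\<close>, \<open>b2 w\<close>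
  commutes with R. What remains are the twist conditions of \<open>t\<close> and
  \<open>w\<close>.\<close>

lemma pair_twist_2cell:
  fixes Z (structure)
  assumes cf: "(f, F) \<in> twtr_1cells K (H, R) (A, RA)" and cg: "(g, G) \<in> twtr_1cells K (H, R) (B, RB)"
    and cf': "(f', F') \<in> twtr_1cells K (H, R) (A, RA)" and cg': "(g', G') \<in> twtr_1cells K (H, R) (B, RB)"
    and t: "t \<in> twtr_2cells K (H, R) (A, RA) (f, F) (f', F')" and w: "w \<in> twtr_2cells K (H, R) (B, RB) (g, G) (g', G')"
    and a: "cpair A A Z a1 a2" and b: "cpair B B Z b1 b2"
    and ab: "cpair A B Z a1 b1" "cpair A B Z a1 b2" "cpair A B Z a2 b1" "cpair A B Z a2 b2"
  shows "(a1 t \<otimes> b1 w) \<otimes> (a2 t \<otimes> b2 w) \<otimes>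
      (star H H Z (a2 \<circ> f) (b1 \<circ> g) R \<otimes> (star A A Z a1 a2 F \<otimes> star B B Z b1 b2 G)) =
    (star H H Z (a2 \<circ> f') (b1 \<circ> g') R \<otimes> (star A A Z a1 a2 F' \<otimes> star B B Z b1 b2 G')) \<otimes>
      (conv A Z a1 a2 t \<otimes> conv B Z b1 b2 w)"
proof -
  note df = cell1D[OF T TA cf] and dg = cell1D[OF T TB cg] and df' = cell1D[OF T TA cf'] and dg' = cell1D[OF T TB cg']
  note f = df(3) and g = dg(3) and f' = df'(3) and g' = dg'(3)
  note dt = cell2D[OF TA t] and dw = cell2D[OF TB w]
  note Z = ahomD(2)[OF cpairD(1)[OF a(1)]]
  interpret Z: ring Z using Z by simp
  note s = a b ab a[THEN cpair_sym] b[THEN cpair_sym] ab[THEN cpair_sym]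
  have h: "cpair H H Z (a2 \<circ> f) (b1 \<circ> g)" "cpair H H Z (a2 \<circ> f') (b1 \<circ> g')"
    by (intro cpair_comp1[OF cpair_comp2[OF _ g] f] cpair_comp1[OF cpair_comp2[OF _ g'] f'] s)+
  note ha = cpairD(1,2)[OF a] and hb = cpairD(1,2)[OF b]
  let ?r = "star H H Z (a2 \<circ> f) (b1 \<circ> g) R" and ?r' = "star H H Z (a2 \<circ> f') (b1 \<circ> g') R"
  let ?x = "star A A Z a1 a2 F" and ?y = "star B B Z b1 b2 G" and ?x' = "star A A Z a1 a2 F'" and ?y' = "star B B Z b1 b2 G'"
  note cl = ahomD(3)[OF ha(1) dt(1)] ahomD(3)[OF ha(2) dt(1)] ahomD(3)[OF hb(1) dw(1)] ahomD(3)[OF hb(2) dw(1)]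
    ahomD(3)[OF star_hom[OF h(1)] dH(3)] ahomD(3)[OF star_hom[OF h(2)] dH(3)]
    ahomD(3)[OF star_hom[OF a] twistD(2)[OF df(1)]] ahomD(3)[OF star_hom[OF b] twistD(2)[OF dg(1)]]
    ahomD(3)[OF star_hom[OF a] twistD(2)[OF df'(1)]] ahomD(3)[OF star_hom[OF b] twistD(2)[OF dg'(1)]]
    ahomD(3)[OF conv_hom[OF dA(8) a] dt(1)] ahomD(3)[OF conv_hom[OF dB(8) b] dw(1)]
  note mc = Z.m_closed
  \<comment> \<open>Naturality of \<open>t\<close> acts on the first argument of R and naturality of
    \<open>w\<close> on the second; each commutes with the other argument.\<close>
  have r: "(a2 t \<otimes> b1 w) \<otimes> ?r = ?r' \<otimes> (a2 t \<otimes> b1 w)"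
  proof (rule star_intertwine[OF cpairD(1,2)[OF h(1)] cpairD(1,2)[OF h(2)] mc[OF cl(2,3)] dH(3)])
    fix z assume z: "z \<in> carrier H"
    note fz = ahomD(3)[OF f z] and f'z = ahomD(3)[OF f' z] and gz = ahomD(3)[OF g z] and g'z = ahomD(3)[OF g' z]
    have 1: "a2 t \<otimes> a2 (f z) = a2 (f' z) \<otimes> a2 t"
      unfolding ahomD(4)[OF ha(2) dt(1) fz, symmetric] ahomD(4)[OF ha(2) f'z dt(1), symmetric] dt(3)[OF z] ..
    have 2: "b1 w \<otimes> b1 (g z) = b1 (g' z) \<otimes> b1 w"
      unfolding ahomD(4)[OF hb(1) dw(1) gz, symmetric] ahomD(4)[OF hb(1) g'z dw(1), symmetric] dw(3)[OF z] ..
    show "(a2 t \<otimes> b1 w) \<otimes> (a2 \<circ> f) z = (a2 \<circ> f') z \<otimes> (a2 t \<otimes> b1 w)"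
      unfolding o_apply
      by (rule intertwine_mult[OF Z cl(2,3) ahomD(3)[OF ha(2) fz] ahomD(3)[OF ha(2) fz] ahomD(3)[OF ha(2) f'z] 1
          cpairD(3)[OF ab(3) fz dw(1), symmetric]])
    show "(a2 t \<otimes> b1 w) \<otimes> (b1 \<circ> g) z = (b1 \<circ> g') z \<otimes> (a2 t \<otimes> b1 w)"
      unfolding o_apply
      by (rule intertwine_mult[OF Z cl(2,3) ahomD(3)[OF hb(1) gz] ahomD(3)[OF hb(1) g'z] ahomD(3)[OF hb(1) g'z]
          cpairD(3)[OF ab(3) dt(1) g'z] 2])
  qed
  have k: "cpair A (H \<boxtimes> H) Z a1 (star H H Z (a2 \<circ> f') (b1 \<circ> g'))" "cpair B (H \<boxtimes> H) Z b2 (star H H Z (a2 \<circ> f') (b1 \<circ> g'))"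
    by (intro cpair_star2 cpair_comp2[OF _ f'] cpair_comp2[OF _ g'] s h)+
  have r2: "(a1 t \<otimes> b2 w) \<otimes> ?r' = ?r' \<otimes> (a1 t \<otimes> b2 w)"
    by (rule intertwine_mult[OF Z cl(1,4,6,6,6) cpairD(3)[OF k(1) dt(1) dH(3)] cpairD(3)[OF k(2) dw(1) dH(3)]])
  have sw: "b1 w \<otimes> (a2 t \<otimes> b2 w) = b2 w \<otimes> (a2 t \<otimes> b1 w)"
  proof -
    have "b1 w \<otimes> (a2 t \<otimes> b2 w) = (b1 w \<otimes> a2 t) \<otimes> b2 w" using cl by (simp add: Z.m_assoc)
    also have "\<dots> = a2 t \<otimes> (b1 w \<otimes> b2 w)" unfolding cpairD(3)[OF ab(3) dt(1) dw(1), symmetric] using cl by (simp add: Z.m_assoc)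
    also have "\<dots> = (a2 t \<otimes> b2 w) \<otimes> b1 w" unfolding cpairD(3)[OF b dw(1) dw(1)] using cl by (simp add: Z.m_assoc)
    also have "\<dots> = b2 w \<otimes> (a2 t \<otimes> b1 w)" unfolding cpairD(3)[OF ab(4) dt(1) dw(1)] using cl by (simp add: Z.m_assoc)
    finally show ?thesis .
  qed
  have k3: "cpair B (A \<boxtimes> A) Z b1 (star A A Z a1 a2)" "cpair B (A \<boxtimes> A) Z b2 (star A A Z a1 a2)"
    by (intro cpair_star2 s)+
  have k4: "(b1 w \<otimes> b2 w) \<otimes> ?x = ?x \<otimes> (b1 w \<otimes> b2 w)"
    by (rule intertwine_mult[OF Z cl(3,4,7,7,7) cpairD(3)[OF k3(1) dw(1) twistD(2)[OF df(1)]] cpairD(3)[OF k3(2) dw(1) twistD(2)[OF df(1)]]])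
  have k5: "cpair (B \<boxtimes> B) A Z (star B B Z b1 b2) (conv A Z a1 a2)" by (intro cpair_star1 cpair_conv2 dA s)
  have sw2: "(a1 t \<otimes> b2 w) \<otimes> (a2 t \<otimes> b1 w) = (a1 t \<otimes> a2 t) \<otimes> (b1 w \<otimes> b2 w)"
    unfolding mult_swap[OF Z cl(1,4,2,3) cpairD(3)[OF ab(4) dt(1) dw(1), symmetric]]
      cpairD(3)[OF b dw(1) dw(1)] ..
  have "(a1 t \<otimes> b1 w) \<otimes> (a2 t \<otimes> b2 w) \<otimes> (?r \<otimes> (?x \<otimes> ?y)) =
     (a1 t \<otimes> b2 w) \<otimes> ((a2 t \<otimes> b1 w) \<otimes> ?r) \<otimes> (?x \<otimes> ?y)"
  proof -
    have "(a1 t \<otimes> b1 w) \<otimes> (a2 t \<otimes> b2 w) = (a1 t \<otimes> b2 w) \<otimes> (a2 t \<otimes> b1 w)"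
      using sw cl by (simp add: Z.m_assoc)
    then show ?thesis using cl by (simp add: Z.m_assoc)
  qed
  also have "\<dots> = ((a1 t \<otimes> b2 w) \<otimes> ?r') \<otimes> (a2 t \<otimes> b1 w) \<otimes> (?x \<otimes> ?y)"
    unfolding r using cl by (simp only: Z.m_assoc mc)
  also have "\<dots> = ?r' \<otimes> (((a1 t \<otimes> b2 w) \<otimes> (a2 t \<otimes> b1 w)) \<otimes> (?x \<otimes> ?y))"
    unfolding r2 using cl by (simp only: Z.m_assoc mc)
  also have "\<dots> = ?r' \<otimes> ((?x' \<otimes> conv A Z a1 a2 t) \<otimes> (?y' \<otimes> conv B Z b1 b2 w))"
    unfolding sw2 mult_swap[OF Z mc[OF cl(1,2)] mc[OF cl(3,4)] cl(7,8) k4]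
      cell2_twist[OF TA df(1) df'(1) t a] cell2_twist[OF TB dg(1) dg'(1) w b] ..
  also have "\<dots> = ?r' \<otimes> ((?x' \<otimes> ?y') \<otimes> (conv A Z a1 a2 t \<otimes> conv B Z b1 b2 w))"
    unfolding mult_swap[OF Z cl(9,11,10,12) cpairD(3)[OF k5 twistD(2)[OF dg'(1)] dt(1), symmetric]] ..
  finally show ?thesis using cl by (simp only: Z.m_assoc mc)
qed

section \<open>The pairing on 1-cells and on 2-cells\<close>

lemma pair_cell1:
  assumes cf: "(f, F) \<in> twtr_1cells K (H, R) (A, RA)" and cg: "(g, G) \<in> twtr_1cells K (H, R) (B, RB)"
  shows "(pair_map H A B f g, pair_twist H R A B f F g G) \<in> twtr_1cells K (H, R) (tb A B, tbR A RA B RB)"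
proof -
  let ?P = "tb A B" and ?E = "pair_twist H R A B f F g G" and ?h = "pair_map H A B f g"
  note X = dH and A = dA and B = dB
  note P = dP
  note df = cell1D[OF T TA cf] and dg = cell1D[OF T TB cg]
  note f = df(3) and g = dg(3)
  note F = twistD(1,2)[OF df(1)] and G = twistD(1,2)[OF dg(1)]
  note sE = star_pair_twist[OF f g F(2) G(2)]
  note i = cpairD(1,2)[OF tb_in_cpair[OF A(9) B(9)]]
  note h = pair_map_hom[OF f g]
  have E: "is_twist K ?P ?E"
  proof (rule twistI[OF P(8) pair_twist_closed[OF f g F(1) G(1)]])
    let ?Z = "?P \<boxtimes> ?P \<boxtimes> ?P"
    fix \<phi>1 \<phi>2 \<phi>3 assume u: "cpair ?P ?P ?Z \<phi>1 \<phi>2" "cpair ?P ?P ?Z \<phi>1 \<phi>3" "cpair ?P ?P ?Z \<phi>2 \<phi>3"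
    have cL: "cpair ?P ?P ?Z (conv ?P ?Z \<phi>1 \<phi>2) \<phi>3" and cR: "cpair ?P ?P ?Z \<phi>1 (conv ?P ?Z \<phi>2 \<phi>3)"
      by (intro cpair_conv1 cpair_conv2 P u)+
    note p = tb_cpairs[OF u(1) A(9) B(9)] tb_cpairs[OF u(2) A(9) B(9)] tb_cpairs[OF u(3) A(9) B(9)]
    note cv = tb_conv_in[OF A(8) B(8)]
    \<comment> \<open>Restriction to the factors replaces convolution over the product by
      convolution over \<open>A\<close> or \<open>B\<close>, which is the form in which the
      identities for the pairing twist were proved.\<close>
    have e: "star H H ?Z (\<phi>3 \<circ> in1 A B \<circ> f) (conv ?P ?Z \<phi>1 \<phi>2 \<circ> in2 A B \<circ> g) =
        star H H ?Z (\<phi>3 \<circ> in1 A B \<circ> f) (conv B ?Z (\<phi>1 \<circ> in2 A B) (\<phi>2 \<circ> in2 A B) \<circ> g)"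
      "star A A ?Z (conv ?P ?Z \<phi>1 \<phi>2 \<circ> in1 A B) (\<phi>3 \<circ> in1 A B) = star A A ?Z (conv A ?Z (\<phi>1 \<circ> in1 A B) (\<phi>2 \<circ> in1 A B)) (\<phi>3 \<circ> in1 A B)"
      "star B B ?Z (conv ?P ?Z \<phi>1 \<phi>2 \<circ> in2 A B) (\<phi>3 \<circ> in2 A B) = star B B ?Z (conv B ?Z (\<phi>1 \<circ> in2 A B) (\<phi>2 \<circ> in2 A B)) (\<phi>3 \<circ> in2 A B)"
      by (rule star_cong; simp add: cv[OF u(1)] ahomD(3)[OF g])+
    have e': "star H H ?Z (conv ?P ?Z \<phi>2 \<phi>3 \<circ> in1 A B \<circ> f) (\<phi>1 \<circ> in2 A B \<circ> g) =
        star H H ?Z (conv A ?Z (\<phi>2 \<circ> in1 A B) (\<phi>3 \<circ> in1 A B) \<circ> f) (\<phi>1 \<circ> in2 A B \<circ> g)"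
      "star A A ?Z (\<phi>1 \<circ> in1 A B) (conv ?P ?Z \<phi>2 \<phi>3 \<circ> in1 A B) = star A A ?Z (\<phi>1 \<circ> in1 A B) (conv A ?Z (\<phi>2 \<circ> in1 A B) (\<phi>3 \<circ> in1 A B))"
      "star B B ?Z (\<phi>1 \<circ> in2 A B) (conv ?P ?Z \<phi>2 \<phi>3 \<circ> in2 A B) = star B B ?Z (\<phi>1 \<circ> in2 A B) (conv B ?Z (\<phi>2 \<circ> in2 A B) (\<phi>3 \<circ> in2 A B))"
      by (rule star_cong; simp add: cv[OF u(3)] ahomD(3)[OF f])+
    show "star ?P ?P ?Z \<phi>1 \<phi>2 ?E \<otimes>\<^bsub>?Z\<^esub> star ?P ?P ?Z (conv ?P ?Z \<phi>1 \<phi>2) \<phi>3 ?E =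
       star ?P ?P ?Z \<phi>2 \<phi>3 ?E \<otimes>\<^bsub>?Z\<^esub> star ?P ?P ?Z \<phi>1 (conv ?P ?Z \<phi>2 \<phi>3) ?E"
      unfolding sE[OF u(1)] sE[OF u(3)] sE[OF cL] sE[OF cR] e e'
      by (rule pair_twist_cocycle[OF cf cg p(1,7,13) p(4,10,16) p(5,2,8) p(3)[THEN cpair_sym] p(6,14) p(9)[THEN cpair_sym] p(15)[THEN cpair_sym] p(12)])
  next
    fix \<phi> assume p: "ahom ?P ?P \<phi>"
    interpret P: ring ?P using P(9) by simp
    note c1 = triv_cpair1[OF P(8) p] and c2 = triv_cpair2[OF P(8) p]
    note tr = tb_triv_in[OF A(8) B(8) P(9)]
    note pf = ahom_comp[OF ahom_comp[OF p i(1)] f] and pg = ahom_comp[OF ahom_comp[OF p i(2)] g]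
    have e: "star H H ?P (\<phi> \<circ> in1 A B \<circ> f) (triv ?P ?P \<circ> in2 A B \<circ> g) = star H H ?P (\<phi> \<circ> in1 A B \<circ> f) (triv H ?P)"
      "star A A ?P (triv ?P ?P \<circ> in1 A B) (\<phi> \<circ> in1 A B) = star A A ?P (triv A ?P) (\<phi> \<circ> in1 A B)"
      "star B B ?P (triv ?P ?P \<circ> in2 A B) (\<phi> \<circ> in2 A B) = star B B ?P (triv B ?P) (\<phi> \<circ> in2 A B)"
      "star H H ?P (triv ?P ?P \<circ> in1 A B \<circ> f) (\<phi> \<circ> in2 A B \<circ> g) = star H H ?P (triv H ?P) (\<phi> \<circ> in2 A B \<circ> g)"
      "star A A ?P (\<phi> \<circ> in1 A B) (triv ?P ?P \<circ> in1 A B) = star A A ?P (\<phi> \<circ> in1 A B) (triv A ?P)"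
      "star B B ?P (\<phi> \<circ> in2 A B) (triv ?P ?P \<circ> in2 A B) = star B B ?P (\<phi> \<circ> in2 A B) (triv B ?P)"
      by (rule star_cong; simp add: tr ahomD(3)[OF f] ahomD(3)[OF g] df(5) dg(5))+
    show "star ?P ?P ?P (triv ?P ?P) \<phi> ?E = \<one>\<^bsub>?P\<^esub>" "star ?P ?P ?P \<phi> (triv ?P ?P) ?E = \<one>\<^bsub>?P\<^esub>"
      unfolding sE[OF c1] sE[OF c2] e R_triv(1)[OF T pg] R_triv(2)[OF T pf]
        twist_triv[OF A(8) df(1) ahom_comp[OF p i(1)]] twist_triv[OF B(8) dg(1) ahom_comp[OF p i(2)]]
      by (simp_all del: tb_carrier)
  qed
  show ?thesis
  proof (rule cell1I[OF T TP E _ h])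
    show "?h \<in> extensional (carrier H)" by (simp add: pair_map_def conv_def)
    show "counit ?P (?h x) = counit H x" if x: "x \<in> carrier H" for x
    proof -
      \<comment> \<open>As an algebra map into \<open>Kalg\<close>, the counit of the product turns
        \<open>pair_map\<close> into a convolution of two counits of \<open>H\<close>. One of them
        is rewritten as \<open>triv\<close>, the unit of convolution.\<close>
      note ch = counit_hom[OF P(8)]
      have "counit ?P (?h x) = conv H Kalg (counit ?P \<circ> in1 A B \<circ> f) (counit ?P \<circ> in2 A B \<circ> g) x"
        by (rule comp_pair_map[OF f g ch x])
      also have "conv H Kalg (counit ?P \<circ> in1 A B \<circ> f) (counit ?P \<circ> in2 A B \<circ> g) = conv H Kalg (counit H) (triv H Kalg)"
      proof (rule conv_cong)
        fix z assume z: "z \<in> carrier H"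
        note k = counit_hom[OF A(8)] counit_hom[OF B(8)]
        interpret KM: module K H using X by simp
        show "(counit ?P \<circ> in1 A B \<circ> f) z = counit H z"
          using z ahomD(3)[OF f z] df(4) by (simp add: tb_counit[OF A(8) B(8)] star_comp_in1[OF k])
        show "(counit ?P \<circ> in2 A B \<circ> g) z = triv H Kalg z"
          using z ahomD(3)[OF g z] dg(4) coalgD(3)[OF X(8) z] by (simp add: tb_counit[OF A(8) B(8)] star_comp_in2[OF k] triv_def)
      qed
      also have "conv H Kalg (counit H) (triv H Kalg) x = counit H x"
        by (rule conv_triv(2)[OF X(1) counit_hom[OF X(8)] x])
      finally show ?thesis .
    qed
    let ?Z = "?P \<boxtimes> ?P"
    fix u v assume u: "cpair ?P ?P ?Z u v"
    note p = tb_cpairs[OF u A(9) B(9)]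
    show "star ?P ?P ?Z u v ?E \<otimes>\<^bsub>?Z\<^esub> conv ?P ?Z u v (?h x) = conv H ?Z (u \<circ> ?h) (v \<circ> ?h) x \<otimes>\<^bsub>?Z\<^esub> star ?P ?P ?Z u v ?E"
      if x: "x \<in> carrier H" for x
    proof -
      have e1: "conv ?P ?Z u v (?h x) = conv H ?Z (conv ?P ?Z u v \<circ> in1 A B \<circ> f) (conv ?P ?Z u v \<circ> in2 A B \<circ> g) x"
        by (rule comp_pair_map[OF f g conv_hom[OF P(8) u] x])
      have e2: "conv H ?Z (conv ?P ?Z u v \<circ> in1 A B \<circ> f) (conv ?P ?Z u v \<circ> in2 A B \<circ> g) =
        conv H ?Z (conv A ?Z (u \<circ> in1 A B) (v \<circ> in1 A B) \<circ> f) (conv B ?Z (u \<circ> in2 A B) (v \<circ> in2 A B) \<circ> g)"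
        by (rule conv_cong) (simp_all add: tb_conv_in[OF A(8) B(8) u] ahomD(3)[OF f] ahomD(3)[OF g])
      have e3: "conv H ?Z (u \<circ> ?h) (v \<circ> ?h) = conv H ?Z (conv H ?Z (u \<circ> in1 A B \<circ> f) (u \<circ> in2 A B \<circ> g)) (conv H ?Z (v \<circ> in1 A B \<circ> f) (v \<circ> in2 A B \<circ> g))"
        by (rule conv_cong) (simp_all add: comp_pair_map[OF f g cpairD(1)[OF u]] comp_pair_map[OF f g cpairD(2)[OF u]])
      show ?thesis
        unfolding sE[OF u] e1 e2 e3
        by (rule pair_twist_conv[OF cf cg p(1,4,5,2) cpair_sym[OF p(3)] p(6) x])
    qed
    have e3: "star H H ?Z (u \<circ> ?h) (v \<circ> ?h) = star H H ?Z (conv H ?Z (u \<circ> in1 A B \<circ> f) (u \<circ> in2 A B \<circ> g)) (conv H ?Z (v \<circ> in1 A B \<circ> f) (v \<circ> in2 A B \<circ> g))"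
      by (rule star_cong) (simp_all add: comp_pair_map[OF f g cpairD(1)[OF u]] comp_pair_map[OF f g cpairD(2)[OF u]])
    show "star H H ?Z (u \<circ> ?h) (v \<circ> ?h) R \<otimes>\<^bsub>?Z\<^esub> star ?P ?P ?Z u v ?E = star ?P ?P ?Z v u ?E \<otimes>\<^bsub>?Z\<^esub> star ?P ?P ?Z u v (tbR A RA B RB)"
      unfolding sE[OF u] sE[OF cpair_sym[OF u]] e3 star_tbR[OF A(9) B(9) A(3) B(3) u]
      by (rule pair_twist_R[OF cf cg p(1,4,5,2) cpair_sym[OF p(3)] p(6)])
  qed
qed

lemma pair_cell2:
  assumes cf: "(f, F) \<in> twtr_1cells K (H, R) (A, RA)" and cg: "(g, G) \<in> twtr_1cells K (H, R) (B, RB)"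
    and cf': "(f', F') \<in> twtr_1cells K (H, R) (A, RA)" and cg': "(g', G') \<in> twtr_1cells K (H, R) (B, RB)"
    and t: "t \<in> twtr_2cells K (H, R) (A, RA) (f, F) (f', F')" and w: "w \<in> twtr_2cells K (H, R) (B, RB) (g, G) (g', G')"
  shows "pure K A B t w \<in> twtr_2cells K (H, R) (tb A B, tbR A RA B RB)
     (pair_map H A B f g, pair_twist H R A B f F g G) (pair_map H A B f' g', pair_twist H R A B f' F' g' G')"
proof -
  let ?P = "tb A B"
  note X = dH and A = dA and B = dB
  note P = dP
  note df = cell1D[OF T TA cf] and dg = cell1D[OF T TB cg] and df' = cell1D[OF T TA cf'] and dg' = cell1D[OF T TB cg']
  note c = pair_cell1[OF cf cg] and c' = pair_cell1[OF cf' cg']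
  note dt = cell2D[OF TA t] and dw = cell2D[OF TB w]
  note ic = tb_in_cpair[OF A(9) B(9)]
  note i = cpairD(1,2)[OF ic]
  note i1 = ahomD(3)[OF i(1)] and i2 = ahomD(3)[OF i(2)]
  interpret P: ring ?P using P(9) by simp
  have mP: "monoid.mult ?P = monoid.mult (A \<boxtimes> B)" by (simp add: tensor_bialgebra_def)
  \<comment> \<open>As a product of two embedded elements it can be moved past each convolution
    factor separately: \<open>t\<close> acts on the factor coming from \<open>f\<close>,
    \<open>w\<close> on the one coming from \<open>g\<close>.\<close>
  have pt: "pure K A B t w = in1 A B t \<otimes>\<^bsub>?P\<^esub> in2 A B w"
    using in_pure[OF A(9) B(9) dt(1) dw(1)] by (simp add: mP)
  show ?thesis
  proof (rule cell2I[OF TP cell1D(1)[OF T TP c] cell1D(1)[OF T TP c']])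
    show cl: "pure K A B t w \<in> carrier ?P" unfolding pt by (intro P.m_closed i1 i2 dt dw)
    interpret KM: module K A using A by simp
    show "counit ?P (pure K A B t w) = \<one>\<^bsub>K\<^esub>"
      using star_pure[OF counit_hom[OF A(8)] counit_hom[OF B(8)] dt(1) dw(1)] dt(2) dw(2)
      by (simp add: tb_counit[OF A(8) B(8)])
    show "pure K A B t w \<otimes>\<^bsub>?P\<^esub> pair_map H A B f g x = pair_map H A B f' g' x \<otimes>\<^bsub>?P\<^esub> pure K A B t w"
      if x: "x \<in> carrier H" for x
      unfolding pair_map_def
    proof (rule conv_intertwine[OF X(8) ahom_comp[OF i(1) df(3)] ahom_comp[OF i(2) dg(3)] ahom_comp[OF i(1) df'(3)] ahom_comp[OF i(2) dg'(3)] cl x])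
      fix z assume z: "z \<in> carrier H"
      note fz = ahomD(3)[OF df(3) z] and f'z = ahomD(3)[OF df'(3) z] and gz = ahomD(3)[OF dg(3) z] and g'z = ahomD(3)[OF dg'(3) z]
      have 1: "in1 A B t \<otimes>\<^bsub>?P\<^esub> in1 A B (f z) = in1 A B (f' z) \<otimes>\<^bsub>?P\<^esub> in1 A B t"
        unfolding ahomD(4)[OF i(1) dt(1) fz, symmetric] ahomD(4)[OF i(1) f'z dt(1), symmetric] dt(3)[OF z] ..
      have 2: "in2 A B w \<otimes>\<^bsub>?P\<^esub> in2 A B (g z) = in2 A B (g' z) \<otimes>\<^bsub>?P\<^esub> in2 A B w"
        unfolding ahomD(4)[OF i(2) dw(1) gz, symmetric] ahomD(4)[OF i(2) g'z dw(1), symmetric] dw(3)[OF z] ..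
      show "pure K A B t w \<otimes>\<^bsub>?P\<^esub> (in1 A B \<circ> f) z = (in1 A B \<circ> f') z \<otimes>\<^bsub>?P\<^esub> pure K A B t w"
        unfolding pt o_apply
        by (rule intertwine_mult[OF P(9) i1[OF dt(1)] i2[OF dw(1)] i1[OF fz] i1[OF fz] i1[OF f'z] 1 cpairD(3)[OF ic fz dw(1), symmetric]])
      show "pure K A B t w \<otimes>\<^bsub>?P\<^esub> (in2 A B \<circ> g) z = (in2 A B \<circ> g') z \<otimes>\<^bsub>?P\<^esub> pure K A B t w"
        unfolding pt o_apply
        by (rule intertwine_mult[OF P(9) i1[OF dt(1)] i2[OF dw(1)] i2[OF gz] i2[OF g'z] i2[OF g'z] cpairD(3)[OF ic dt(1) g'z] 2])
    qed
    let ?Z = "?P \<boxtimes> ?P"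
    fix u v assume u: "cpair ?P ?P ?Z u v"
    note p = tb_cpairs[OF u A(9) B(9)]
    note hu = cpairD(1)[OF u] and hv = cpairD(2)[OF u] and hc = conv_hom[OF P(8) u]
    have e: "u (pure K A B t w) = (u \<circ> in1 A B) t \<otimes>\<^bsub>?Z\<^esub> (u \<circ> in2 A B) w"
       "v (pure K A B t w) = (v \<circ> in1 A B) t \<otimes>\<^bsub>?Z\<^esub> (v \<circ> in2 A B) w"
       "conv ?P ?Z u v (pure K A B t w) = conv A ?Z (u \<circ> in1 A B) (v \<circ> in1 A B) t \<otimes>\<^bsub>?Z\<^esub> conv B ?Z (u \<circ> in2 A B) (v \<circ> in2 A B) w"
      unfolding pt ahomD(4)[OF hu i1[OF dt(1)] i2[OF dw(1)]] ahomD(4)[OF hv i1[OF dt(1)] i2[OF dw(1)]]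
        ahomD(4)[OF hc i1[OF dt(1)] i2[OF dw(1)]] tb_conv_in(1)[OF A(8) B(8) u dt(1)] tb_conv_in(2)[OF A(8) B(8) u dw(1)]
      by simp_all
    note sE = star_pair_twist[OF df(3) dg(3) twistD(2)[OF df(1)] twistD(2)[OF dg(1)] u]
      star_pair_twist[OF df'(3) dg'(3) twistD(2)[OF df'(1)] twistD(2)[OF dg'(1)] u]
    show "u (pure K A B t w) \<otimes>\<^bsub>?Z\<^esub> v (pure K A B t w) \<otimes>\<^bsub>?Z\<^esub> star ?P ?P ?Z u v (pair_twist H R A B f F g G) =
        star ?P ?P ?Z u v (pair_twist H R A B f' F' g' G') \<otimes>\<^bsub>?Z\<^esub> conv ?P ?Z u v (pure K A B t w)"
      unfolding e sE
      by (rule pair_twist_2cell[OF cf cg cf' cg' t w p(1,4,5,2) cpair_sym[OF p(3)] p(6)])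
  qed
qed

section \<open>The universal property\<close>

lemma proj_comp1:
  assumes c: "(h, F) \<in> twtr_1cells K (H, R) (tb A B, RP)"
  shows "(compose (carrier H) pr1 h, tensor_map K (tb A B) (tb A B) A A pr1 pr1 F \<otimes>\<^bsub>A \<boxtimes> A\<^esub> \<one>\<^bsub>A \<boxtimes> A\<^esub>) \<in> twtr_1cells K (H, R) (A, RA)"
    "(compose (carrier H) pr2 h, tensor_map K (tb A B) (tb A B) B B pr2 pr2 F \<otimes>\<^bsub>B \<boxtimes> B\<^esub> \<one>\<^bsub>B \<boxtimes> B\<^esub>) \<in> twtr_1cells K (H, R) (B, RB)"
  using cell1_comp[OF T TP TA c proj_cell1(1)] cell1_comp[OF T TP TB c proj_cell1(2)]
  by (simp_all add: twtr_comp1_def del: tensor_simps)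

text \<open>Evaluating at \<open>u\<close> and \<open>v\<close> and splitting each of them through
  the two projections reduces the twist condition to an identity on four legs, in which the inner
  two appear in different orders on the two sides.\<close>

lemma gauge_cell2:
  assumes c: "(h, F) \<in> twtr_1cells K (H, R) (tb A B, RP)"
  defines "f \<equiv> compose (carrier H) pr1 h" and "F1 \<equiv> tensor_map K (tb A B) (tb A B) A A pr1 pr1 F \<otimes>\<^bsub>A \<boxtimes> A\<^esub> \<one>\<^bsub>A \<boxtimes> A\<^esub>"
    and "g \<equiv> compose (carrier H) pr2 h" and "F2 \<equiv> tensor_map K (tb A B) (tb A B) B B pr2 pr2 F \<otimes>\<^bsub>B \<boxtimes> B\<^esub> \<one>\<^bsub>B \<boxtimes> B\<^esub>"
  shows "gauge F \<in> twtr_2cells K (H, R) (tb A B, RP) (h, F) (pair_map H A B f g, pair_twist H R A B f F1 g F2)"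
    "gauge F \<in> Units (tb A B)"
proof -
  let ?P = "tb A B"
  note d = cell1D[OF T TP c]
  note F = twistD(1,2)[OF d(1)]
  note cf = proj_comp1(1)[OF c, folded f_def F1_def] and cg = proj_comp1(2)[OF c, folded g_def F2_def]
  note df = cell1D[OF T TA cf] and dg = cell1D[OF T TB cg]
  note i = d_in
  interpret P: ring ?P using dP(9) by simp
  show U: "gauge F \<in> Units ?P"
    unfolding gauge_star by (rule ahom_Units(1)[OF star_hom[OF gauge_cpair] F(1)])
  have fa: "f x = pr1 (h x)" "g x = pr2 (h x)" if "x \<in> carrier H" for x using that by (simp_all add: f_def g_def compose_def)
  show "gauge F \<in> twtr_2cells K (H, R) (?P, RP) (h, F) (pair_map H A B f g, pair_twist H R A B f F1 g F2)"
  proof (rule cell2I[OF TP d(1) cell1D(1)[OF T TP pair_cell1[OF cf cg]]])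
    show J: "gauge F \<in> carrier ?P" using U by (rule P.Units_closed)
    \<comment> \<open>Both maps in this evaluation are the counit of \<open>?P\<close>; writing the
      first as \<open>triv\<close> makes the normalisation of the twist applicable.\<close>
    have "counit ?P (gauge F) = star ?P ?P Kalg (counit ?P \<circ> in1 A B \<circ> pr1) (counit ?P \<circ> in2 A B \<circ> pr2) F"
      by (rule comp_gauge[OF counit_hom[OF dP(8)] F(2)])
    also have "star ?P ?P Kalg (counit ?P \<circ> in1 A B \<circ> pr1) (counit ?P \<circ> in2 A B \<circ> pr2) = star ?P ?P Kalg (triv ?P Kalg) (counit ?P)"
    proof (rule star_cong)
      fix t assume t: "t \<in> carrier ?P"
      then have t': "t \<in> carrier (A \<boxtimes> B)" by simp
      note k = counit_hom[OF dA(8)] counit_hom[OF dB(8)]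
      show "(counit ?P \<circ> in1 A B \<circ> pr1) t = triv ?P Kalg t" "(counit ?P \<circ> in2 A B \<circ> pr2) t = counit ?P t"
        using ahomD(3)[OF proj_hom(1) t] ahomD(3)[OF proj_hom(2) t] counit_proj[OF t'] Kalg_triv[OF dP(8) t]
          star_comp_in1[OF k] star_comp_in2[OF k] by (simp_all add: tb_counit[OF dA(8) dB(8)])
    qed
    also have "star ?P ?P Kalg (triv ?P Kalg) (counit ?P) F = \<one>\<^bsub>Kalg\<^esub>"
      by (rule twist_triv(1)[OF dP(8) d(1) counit_hom[OF dP(8)]])
    finally show "counit ?P (gauge F) = \<one>\<^bsub>K\<^esub>" by simp
    show "gauge F \<otimes>\<^bsub>?P\<^esub> h x = pair_map H A B f g x \<otimes>\<^bsub>?P\<^esub> gauge F" if x: "x \<in> carrier H" for x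
    proof -
      \<comment> \<open>At the pair defining \<open>gauge\<close>, the convolution over
        \<open>?P\<close> is the identity, and the one over \<open>H\<close> is
        \<open>pair_map\<close>; the comultiplication condition of \<open>(h, F)\<close> is then the
        claim.\<close>
      note hx = ahomD(3)[OF d(3) x]
      have "conv H ?P (in1 A B \<circ> pr1 \<circ> h) (in2 A B \<circ> pr2 \<circ> h) = pair_map H A B f g"
        unfolding pair_map_def by (rule conv_cong) (simp_all add: fa)
      moreover have "conv ?P ?P (in1 A B \<circ> pr1) (in2 A B \<circ> pr2) (h x) = h x"
        using conv_proj[OF ahom_id[OF dP(9)], of "h x"] hx by (simp add: o_def)
      ultimately show ?thesis
        using cell1_conv[OF T TP c gauge_cpair x] unfolding gauge_star by simp
    qed
    let ?Z = "?P \<boxtimes> ?P"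
    fix u v assume u: "cpair ?P ?P ?Z u v"
    note Z = ahomD(2)[OF cpairD(1)[OF u]]
    interpret Z: ring ?Z using Z by simp
    note p = tb_cpairs[OF u dA(9) dB(9)]
    \<comment> \<open>The A-part and the B-part of \<open>u\<close>, then those of \<open>v\<close>.
      By \<open>conv_proj\<close>, \<open>u\<close> is the convolution of \<open>a\<close> and
      \<open>b\<close>, and \<open>v\<close> that of \<open>c'\<close> and
      \<open>d'\<close>.\<close>
    define a b c' d' where def: "a = u \<circ> in1 A B \<circ> pr1" "b = u \<circ> in2 A B \<circ> pr2" "c' = v \<circ> in1 A B \<circ> pr1" "d' = v \<circ> in2 A B \<circ> pr2"
    have q: "cpair ?P ?P ?Z a b" "cpair ?P ?P ?Z a c'" "cpair ?P ?P ?Z a d'" "cpair ?P ?P ?Z b c'" "cpair ?P ?P ?Z b d'" "cpair ?P ?P ?Z c' d'"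
      unfolding def
      by (intro cpair_comp1[OF cpair_comp2[OF _ proj_hom(2)] proj_hom(1)] cpair_comp1[OF cpair_comp2[OF _ proj_hom(1)] proj_hom(1)]
        cpair_comp1[OF cpair_comp2[OF _ proj_hom(2)] proj_hom(2)] cpair_comp1[OF cpair_comp2[OF _ proj_hom(1)] proj_hom(2)] p)+
    have qs: "cpair ?P ?P ?Z c' b" by (rule cpair_sym[OF q(4)])
    have cuv: "cpair ?P ?P ?Z (conv ?P ?Z a b) (conv ?P ?Z c' d')" "cpair ?P ?P ?Z (conv ?P ?Z a c') (conv ?P ?Z b d')"
      by (intro cpair_conv1 cpair_conv2 dP q qs)+
    note hu = cpairD(1)[OF u] and hv = cpairD(2)[OF u] and hc = conv_hom[OF dP(8) u]
    have Ju: "u (gauge F) = star ?P ?P ?Z a b F" "v (gauge F) = star ?P ?P ?Z c' d' F"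
      unfolding def by (rule comp_gauge[OF _ F(2)], rule hu hv)+
    have eu: "star ?P ?P ?Z u v F = star ?P ?P ?Z (conv ?P ?Z a b) (conv ?P ?Z c' d') F"
      by (rule fun_cong[OF star_cong]) (simp_all add: def conv_proj[OF hu] conv_proj[OF hv])
    \<comment> \<open>On the side of the pairing the legs are grouped by factor: the A-part of the
      convolution of \<open>u\<close> and \<open>v\<close> combines \<open>a\<close> with
      \<open>c'\<close>, the B-part \<open>b\<close> with \<open>d'\<close>.\<close>
    have ec: "conv ?P ?Z u v (gauge F) = star ?P ?P ?Z (conv ?P ?Z a c') (conv ?P ?Z b d') F"
      unfolding comp_gauge[OF hc F(2)]
    proof (rule fun_cong[OF star_cong])
      fix t assume t: "t \<in> carrier ?P"
      then have t': "t \<in> carrier (A \<boxtimes> B)" by simp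
      show "(conv ?P ?Z u v \<circ> in1 A B \<circ> pr1) t = conv ?P ?Z a c' t"
        using tb_conv_in(1)[OF dA(8) dB(8) u ahomD(3)[OF proj_hom(1) t]] conv_proj1[OF p(1) t']
        unfolding def by simp
      show "(conv ?P ?Z u v \<circ> in2 A B \<circ> pr2) t = conv ?P ?Z b d' t"
        using tb_conv_in(2)[OF dA(8) dB(8) u ahomD(3)[OF proj_hom(2) t]] conv_proj2[OF p(4) t']
        unfolding def by simp
    qed
    have one: "star A A ?Z (u \<circ> in1 A B) (v \<circ> in1 A B) F1 = star ?P ?P ?Z a c' F"
      "star B B ?Z (u \<circ> in2 A B) (v \<circ> in2 A B) F2 = star ?P ?P ?Z b d' F"
      unfolding F1_def F2_def def
        star_twist_mult[OF proj_hom(1) F(2) twistD(2)[OF one_twist[OF dA(8)]] p(1)]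
        star_twist_mult[OF proj_hom(2) F(2) twistD(2)[OF one_twist[OF dB(8)]] p(4)]
        ahomD(6)[OF star_hom[OF p(1)]] ahomD(6)[OF star_hom[OF p(4)]]
      using ahomD(3)[OF star_hom[OF q(2)] F(2)] ahomD(3)[OF star_hom[OF q(5)] F(2)] unfolding def
      by (simp_all del: tensor_simps)
    have er: "star H H ?Z (v \<circ> in1 A B \<circ> f) (u \<circ> in2 A B \<circ> g) R = star H H ?Z (c' \<circ> h) (b \<circ> h) R"
      by (rule fun_cong[OF star_cong]) (simp_all add: fa def)
    \<comment> \<open>\<open>c'\<close> factors through the first projection and \<open>b\<close>
      through the second, so each of the two R-matrices has one argument equal to
      \<open>triv\<close>.\<close>
    have RPone: "star ?P ?P ?Z c' b RP = \<one>\<^bsub>?Z\<^esub>"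
    proof -
      note h1 = cpairD(1,2)[OF p(3)[THEN cpair_sym]]
      note pu = proj_comp_in[OF h1, unfolded o_apply]
      have "star A A ?Z (c' \<circ> in1 A B) (b \<circ> in1 A B) = star A A ?Z (v \<circ> in1 A B) (triv A ?Z)"
        "star B B ?Z (c' \<circ> in2 A B) (b \<circ> in2 A B) = star B B ?Z (triv B ?Z) (u \<circ> in2 A B)"
        by (rule star_cong; simp add: def pu)+
      then show ?thesis
        unfolding star_tbR[OF dA(9) dB(9) dA(3) dB(3) qs]
        using R_triv(2)[OF TA h1(1)] R_triv(1)[OF TB h1(2)] by (simp del: tensor_simps)
    qed
    have cl: "star ?P ?P ?Z b c' F \<in> carrier ?Z" "star ?P ?P ?Z c' b F \<in> carrier ?Z"
      using ahomD(3)[OF star_hom[OF q(4)] F(2)] ahomD(3)[OF star_hom[OF qs] F(2)] by blast+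
    have hcb: "ahom H ?Z (c' \<circ> h)" "ahom H ?Z (b \<circ> h)"
      using ahom_comp[OF cpairD(1)[OF qs] d(3)] ahom_comp[OF cpairD(2)[OF qs] d(3)] by blast+
    \<comment> \<open>With the R-matrix of the target equal to 1 here, compatibility of
      \<open>(h, F)\<close> with the R-matrices says that R of \<open>H\<close> exchanges the two
      arguments of \<open>F\<close>.\<close>
    have rr: "star H H ?Z (c' \<circ> h) (b \<circ> h) R \<otimes>\<^bsub>?Z\<^esub> star ?P ?P ?Z c' b F = star ?P ?P ?Z b c' F"
      using cell1_R[OF T TP c qs] cl unfolding RPone by (simp del: tensor_simps)
    \<comment> \<open>For the same reason quasi-cocommutativity of \<open>?P\<close> becomes plain
      commutativity at these two maps.\<close>
    have cv: "conv ?P ?Z c' b = conv ?P ?Z b c'"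
    proof (rule extensionalityI[of _ "carrier ?P"])
      fix t assume t: "t \<in> carrier ?P"
      note h2 = ahomD(3)[OF conv_hom[OF dP(8) qs] t] ahomD(3)[OF conv_hom[OF dP(8) q(4)] t]
      show "conv ?P ?Z c' b t = conv ?P ?Z b c' t"
        using R_quasi[OF TP qs t] h2 unfolding RPone by (simp del: tensor_simps)
    qed (simp_all add: conv_def)
    \<comment> \<open>The two instances differ by exchanging \<open>b\<close> and \<open>c'\<close>.
      By \<open>cv\<close> their right-hand sides differ only in the leading factor, and
      \<open>rr\<close> converts one leading factor into the other.\<close>
    note four1 = twist_four[OF dP(1) d(1) q] and four2 = twist_four[OF dP(1) d(1) q(2,1,3) qs q(6,5)]
    have cl2: "star ?P ?P ?Z a c' F \<in> carrier ?Z" "star ?P ?P ?Z b d' F \<in> carrier ?Z" "star ?P ?P ?Z (conv ?P ?Z a c') (conv ?P ?Z b d') F \<in> carrier ?Z"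
      "star H H ?Z (c' \<circ> h) (b \<circ> h) R \<in> carrier ?Z"
      "star ?P ?P ?Z a (conv ?P ?Z b c') F \<in> carrier ?Z" "star ?P ?P ?Z (conv ?P ?Z a (conv ?P ?Z b c')) d' F \<in> carrier ?Z"
    proof -
      have k: "cpair ?P ?P ?Z a (conv ?P ?Z b c')" "cpair ?P ?P ?Z (conv ?P ?Z b c') d'" by (intro cpair_conv1 cpair_conv2 dP q)+
      have k2: "cpair ?P ?P ?Z (conv ?P ?Z a (conv ?P ?Z b c')) d'" by (intro cpair_conv1[OF dP(8)] k q)
      show "star ?P ?P ?Z a c' F \<in> carrier ?Z" "star ?P ?P ?Z b d' F \<in> carrier ?Z" "star ?P ?P ?Z (conv ?P ?Z a c') (conv ?P ?Z b d') F \<in> carrier ?Z"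
        "star H H ?Z (c' \<circ> h) (b \<circ> h) R \<in> carrier ?Z"
        "star ?P ?P ?Z a (conv ?P ?Z b c') F \<in> carrier ?Z" "star ?P ?P ?Z (conv ?P ?Z a (conv ?P ?Z b c')) d' F \<in> carrier ?Z"
        using ahomD(3)[OF star_hom[OF q(2)] F(2)] ahomD(3)[OF star_hom[OF q(5)] F(2)] ahomD(3)[OF star_hom[OF cuv(2)] F(2)]
          star_closed[OF hcb dH(3)] ahomD(3)[OF star_hom[OF k(1)] F(2)] ahomD(3)[OF star_hom[OF k2] F(2)] by blast+
    qed
    have "star H H ?Z (c' \<circ> h) (b \<circ> h) R \<otimes>\<^bsub>?Z\<^esub> (star ?P ?P ?Z a c' F \<otimes>\<^bsub>?Z\<^esub> star ?P ?P ?Z b d' F) \<otimes>\<^bsub>?Z\<^esub>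
        star ?P ?P ?Z (conv ?P ?Z a c') (conv ?P ?Z b d') F =
      star H H ?Z (c' \<circ> h) (b \<circ> h) R \<otimes>\<^bsub>?Z\<^esub> (star ?P ?P ?Z a c' F \<otimes>\<^bsub>?Z\<^esub> star ?P ?P ?Z b d' F \<otimes>\<^bsub>?Z\<^esub>
        star ?P ?P ?Z (conv ?P ?Z a c') (conv ?P ?Z b d') F)"
      using cl2 by (simp only: Z.m_assoc Z.m_closed)
    also have "\<dots> = (star H H ?Z (c' \<circ> h) (b \<circ> h) R \<otimes>\<^bsub>?Z\<^esub> star ?P ?P ?Z c' b F) \<otimes>\<^bsub>?Z\<^esub>
        (star ?P ?P ?Z a (conv ?P ?Z b c') F \<otimes>\<^bsub>?Z\<^esub> star ?P ?P ?Z (conv ?P ?Z a (conv ?P ?Z b c')) d' F)"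
      unfolding four2 cv using cl2 cl by (simp only: Z.m_assoc Z.m_closed)
    also have "\<dots> = star ?P ?P ?Z a b F \<otimes>\<^bsub>?Z\<^esub> star ?P ?P ?Z c' d' F \<otimes>\<^bsub>?Z\<^esub> star ?P ?P ?Z (conv ?P ?Z a b) (conv ?P ?Z c' d') F"
      unfolding rr four1 ..
    finally show "u (gauge F) \<otimes>\<^bsub>?Z\<^esub> v (gauge F) \<otimes>\<^bsub>?Z\<^esub> star ?P ?P ?Z u v F =
        star ?P ?P ?Z u v (pair_twist H R A B f F1 g F2) \<otimes>\<^bsub>?Z\<^esub> conv ?P ?Z u v (gauge F)"
      unfolding star_pair_twist[OF df(3) dg(3) twistD(2)[OF df(1)] twistD(2)[OF dg(1)] u] one er Ju eu ec
      by (rule sym)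
  qed
qed

text \<open>The twist condition of \<open>a\<close> at the pair that defines \<open>gauge\<close>:
  the convolution evaluated at \<open>a\<close> is \<open>a\<close> itself, since the projections
  recombine to the identity.\<close>

lemma gauge_natural:
  assumes c: "(h, F) \<in> twtr_1cells K (H, R) (tb A B, RP)" and c': "(h', F') \<in> twtr_1cells K (H, R) (tb A B, RP)"
    and a: "a \<in> twtr_2cells K (H, R) (tb A B, RP) (h, F) (h', F')"
  shows "gauge F' \<otimes>\<^bsub>tb A B\<^esub> a = pure K A B (pr1 a) (pr2 a) \<otimes>\<^bsub>tb A B\<^esub> gauge F"
proof -
  let ?P = "tb A B"
  note d = cell2D[OF TP a]
  have mP: "monoid.mult ?P = monoid.mult (A \<boxtimes> B)" by (simp add: tensor_bialgebra_def)
  have "conv ?P ?P (in1 A B \<circ> pr1) (in2 A B \<circ> pr2) a = a"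
    using conv_proj[OF ahom_id[OF dP(9)], of a] d(1) by (simp add: o_def)
  then show ?thesis
    using cell2_twist[OF TP cell1D(1)[OF T TP c] cell1D(1)[OF T TP c'] a gauge_cpair]
      in_pure[OF dA(9) dB(9) ahomD(3)[OF proj_hom(1) d(1)] ahomD(3)[OF proj_hom(2) d(1)]]
    by (simp add: gauge_star[symmetric] mP)
qed

text \<open>A projection sends the other leg to \<open>triv\<close>. This makes R and the other
  twist equal to 1 and cancels the other convolution factor, so the original 1-cell comes back on
  the nose.\<close>

lemma proj_pair:
  assumes cf: "(f, F) \<in> twtr_1cells K (H, R) (A, RA)" and cg: "(g, G) \<in> twtr_1cells K (H, R) (B, RB)"
  shows "twtr_comp1 K (H, R) (tb A B, RP) (A, RA) (pr1, \<one>\<^bsub>A \<boxtimes> A\<^esub>) (pair_map H A B f g, pair_twist H R A B f F g G) = (f, F)"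
    "twtr_comp1 K (H, R) (tb A B, RP) (B, RB) (pr2, \<one>\<^bsub>B \<boxtimes> B\<^esub>) (pair_map H A B f g, pair_twist H R A B f F g G) = (g, G)"
proof -
  let ?P = "tb A B" and ?E = "pair_twist H R A B f F g G"
  note df = cell1D[OF T TA cf] and dg = cell1D[OF T TB cg]
  note f = df(3) and g = dg(3)
  note F = twistD(1,2)[OF df(1)] and G = twistD(1,2)[OF dg(1)]
  note E = twistD(2)[OF cell1D(1)[OF T TP pair_cell1[OF cf cg]]]
  note sE = star_pair_twist[OF f g F(2) G(2)]
  interpret AA: ring "A \<boxtimes> A" using dA(9) by simp
  interpret BB: ring "B \<boxtimes> B" using dB(9) by simp
  have "compose (carrier H) pr1 (pair_map H A B f g) = f"
  proof (rule extensionalityI[of _ "carrier H"])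
    fix x assume x: "x \<in> carrier H"
    note pu = proj_comp_in(1,2)[OF ahom_id[OF dA(9)] triv_hom[OF dB(8) dA(9)]]
    have "pr1 (pair_map H A B f g x) = conv H A (pr1 \<circ> in1 A B \<circ> f) (pr1 \<circ> in2 A B \<circ> g) x"
      by (rule comp_pair_map[OF f g proj_hom(1) x])
    also have "conv H A (pr1 \<circ> in1 A B \<circ> f) (pr1 \<circ> in2 A B \<circ> g) = conv H A f (triv H A)"
      by (rule conv_cong) (simp_all add: pu ahomD(3)[OF f] ahomD(3)[OF g] dg(5))
    also have "\<dots> x = f x" by (rule conv_triv(2)[OF dH(1) f x])
    finally show "compose (carrier H) pr1 (pair_map H A B f g) x = f x" using x by (simp add: compose_def)
  qed (simp_all add: df(2))
  moreover have "tensor_map K ?P ?P A A pr1 pr1 ?E = F"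
  proof -
    let ?Z = "A \<boxtimes> A"
    note ci = in_cpair[OF dA(9) dA(9)]
    have c: "cpair ?P ?P ?Z (in1 A A \<circ> pr1) (in2 A A \<circ> pr1)" by (intro cpair_comp1[OF cpair_comp2[OF ci]] proj_hom)
    note Z = ahomD(2)[OF cpairD(1)[OF ci]]
    note pu = proj_comp_in(1,2)[OF cpairD(1)[OF ci] triv_hom[OF dB(8) Z]] proj_comp_in(1,2)[OF cpairD(2)[OF ci] triv_hom[OF dB(8) Z]]
    have e: "star H H ?Z (in2 A A \<circ> pr1 \<circ> in1 A B \<circ> f) (in1 A A \<circ> pr1 \<circ> in2 A B \<circ> g) = star H H ?Z (in2 A A \<circ> f) (triv H ?Z)"
      "star A A ?Z (in1 A A \<circ> pr1 \<circ> in1 A B) (in2 A A \<circ> pr1 \<circ> in1 A B) = star A A ?Z (in1 A A) (in2 A A)"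
      "star B B ?Z (in1 A A \<circ> pr1 \<circ> in2 A B) (in2 A A \<circ> pr1 \<circ> in2 A B) = star B B ?Z (triv B ?Z) (triv B ?Z)"
      by (rule star_cong; simp add: pu ahomD(3)[OF f] ahomD(3)[OF g] dg(5))+
    show ?thesis
      unfolding tensor_map_star[OF proj_hom(1) proj_hom(1)] sE[OF c] e R_triv(2)[OF T ahom_comp[OF cpairD(2)[OF ci] f]]
        star_in[OF dA(9) dA(9) F(2)] twist_triv(1)[OF dB(8) dg(1) triv_hom[OF dB(8) Z]]
      using F(2) by (simp del: tensor_simps)
  qed
  ultimately show "twtr_comp1 K (H, R) (?P, RP) (A, RA) (pr1, \<one>\<^bsub>A \<boxtimes> A\<^esub>) (pair_map H A B f g, ?E) = (f, F)"
    using F(2) by (simp add: twtr_comp1_def del: tensor_simps)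
  have "compose (carrier H) pr2 (pair_map H A B f g) = g"
  proof (rule extensionalityI[of _ "carrier H"])
    fix x assume x: "x \<in> carrier H"
    note pu = proj_comp_in(3,4)[OF triv_hom[OF dA(8) dB(9)] ahom_id[OF dB(9)]]
    have "pr2 (pair_map H A B f g x) = conv H B (pr2 \<circ> in1 A B \<circ> f) (pr2 \<circ> in2 A B \<circ> g) x"
      by (rule comp_pair_map[OF f g proj_hom(2) x])
    also have "conv H B (pr2 \<circ> in1 A B \<circ> f) (pr2 \<circ> in2 A B \<circ> g) = conv H B (triv H B) g"
      by (rule conv_cong) (simp_all add: pu ahomD(3)[OF f] ahomD(3)[OF g] df(5))
    also have "\<dots> x = g x" by (rule conv_triv(1)[OF dH(1) g x])
    finally show "compose (carrier H) pr2 (pair_map H A B f g) x = g x" using x by (simp add: compose_def)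
  qed (simp_all add: dg(2))
  moreover have "tensor_map K ?P ?P B B pr2 pr2 ?E = G"
  proof -
    let ?Z = "B \<boxtimes> B"
    note ci = in_cpair[OF dB(9) dB(9)]
    have c: "cpair ?P ?P ?Z (in1 B B \<circ> pr2) (in2 B B \<circ> pr2)" by (intro cpair_comp1[OF cpair_comp2[OF ci]] proj_hom)
    note Z = ahomD(2)[OF cpairD(1)[OF ci]]
    note pu = proj_comp_in(3,4)[OF triv_hom[OF dA(8) Z] cpairD(1)[OF ci]] proj_comp_in(3,4)[OF triv_hom[OF dA(8) Z] cpairD(2)[OF ci]]
    have e: "star H H ?Z (in2 B B \<circ> pr2 \<circ> in1 A B \<circ> f) (in1 B B \<circ> pr2 \<circ> in2 A B \<circ> g) = star H H ?Z (triv H ?Z) (in1 B B \<circ> g)"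
      "star B B ?Z (in1 B B \<circ> pr2 \<circ> in2 A B) (in2 B B \<circ> pr2 \<circ> in2 A B) = star B B ?Z (in1 B B) (in2 B B)"
      "star A A ?Z (in1 B B \<circ> pr2 \<circ> in1 A B) (in2 B B \<circ> pr2 \<circ> in1 A B) = star A A ?Z (triv A ?Z) (triv A ?Z)"
      by (rule star_cong; simp add: pu ahomD(3)[OF f] ahomD(3)[OF g] df(5))+
    show ?thesis
      unfolding tensor_map_star[OF proj_hom(2) proj_hom(2)] sE[OF c] e R_triv(1)[OF T ahom_comp[OF cpairD(1)[OF ci] g]]
        star_in[OF dB(9) dB(9) G(2)] twist_triv(1)[OF dA(8) df(1) triv_hom[OF dA(8) Z]]
      using G(2) by (simp del: tensor_simps)
  qed
  ultimately show "twtr_comp1 K (H, R) (?P, RP) (B, RB) (pr2, \<one>\<^bsub>B \<boxtimes> B\<^esub>) (pair_map H A B f g, ?E) = (g, G)"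
    using G(2) by (simp add: twtr_comp1_def del: tensor_simps)
qed

section \<open>The equivalence of categories\<close>

lemma pairing_equivalence:
  "is_equivalence (twtr_hom_cat K (H, R) (tb A B, tbR A RA B RB))
     (prod_cat (twtr_hom_cat K (H, R) (A, RA)) (twtr_hom_cat K (H, R) (B, RB)))
     (twtr_pairing K (H, R) (tb A B, tbR A RA B RB) (A, RA) (B, RB)
        (id_counit K A B, \<one>\<^bsub>A \<boxtimes> A\<^esub>) (counit_id K A B, \<one>\<^bsub>B \<boxtimes> B\<^esub>))"
proof -
  let ?P = "tb A B" and ?RP = "tbR A RA B RB"
  let ?p = "id_counit K A B" and ?q = "counit_id K A B"
  let ?X = "(H, R)"
  let ?C = "twtr_hom_cat K ?X (?P, ?RP)"
  let ?D = "prod_cat (twtr_hom_cat K ?X (A, RA)) (twtr_hom_cat K ?X (B, RB))"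
  let ?cp = "twtr_comp1 K ?X (?P, ?RP) (A, RA) (?p, \<one>\<^bsub>A \<boxtimes> A\<^esub>)"
  let ?cq = "twtr_comp1 K ?X (?P, ?RP) (B, RB) (?q, \<one>\<^bsub>B \<boxtimes> B\<^esub>)"
  let ?F = "twtr_pairing K ?X (?P, ?RP) (A, RA) (B, RB) (?p, \<one>\<^bsub>A \<boxtimes> A\<^esub>) (?q, \<one>\<^bsub>B \<boxtimes> B\<^esub>)"
  define S where "S c d = (pair_map H A B (fst c) (fst d), pair_twist H R A B (fst c) (snd c) (fst d) (snd d))" for c d
  define J where "J c = gauge (snd c)" for c :: "('h, ('a, 'b) tens) cell1"
  define G where "G = \<lparr>on_ob = (\<lambda>c. S (fst c) (snd c)), on_hom = (\<lambda>_ _ a. pure K A B (fst a) (snd a))\<rparr>"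
  note A = dA and B = dB
  note P = dP
  note pc = proj_cell1 and ph = proj_hom
  interpret A: ring A using A(9) by simp
  interpret B: ring B using B(9) by simp
  interpret P: ring ?P using P(9) by simp
  have mP: "monoid.mult ?P = monoid.mult (A \<boxtimes> B)" and oneP: "\<one>\<^bsub>?P\<^esub> = pure K A B \<one>\<^bsub>A\<^esub> \<one>\<^bsub>B\<^esub>"
    by (simp_all add: tensor_bialgebra_def)
  note tensor_simps(4) [simp del]
  note cl = cell2_carrier
  have pcl: "?p a \<in> carrier A" "?q a \<in> carrier B" if "a \<in> carrier ?P" for a
    using ahomD(3)[OF ph(1) that] ahomD(3)[OF ph(2) that] by blast+
  have cp: "?cp c \<in> twtr_1cells K ?X (A, RA)" "?cq c \<in> twtr_1cells K ?X (B, RB)"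
    if "c \<in> twtr_1cells K ?X (?P, ?RP)" for c
    using that cell1_comp[OF T TP TA _ pc(1)] cell1_comp[OF T TP TB _ pc(2)] by (cases c; simp)+
  have c2: "?p a \<in> twtr_2cells K ?X (A, RA) (?cp c) (?cp c')" "?q a \<in> twtr_2cells K ?X (B, RB) (?cq c) (?cq c')"
    if "c \<in> twtr_1cells K ?X (?P, ?RP)" "c' \<in> twtr_1cells K ?X (?P, ?RP)" "a \<in> twtr_2cells K ?X (?P, ?RP) c c'" for c c' a
    using that cell2_whisker[OF T TP TA _ _ pc(1)] cell2_whisker[OF T TP TB _ _ pc(2)] by (cases c; cases c'; simp)+
  have S1: "S c d \<in> twtr_1cells K ?X (?P, ?RP)"
    if "c \<in> twtr_1cells K ?X (A, RA)" "d \<in> twtr_1cells K ?X (B, RB)" for c d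
    using that pair_cell1 by (cases c; cases d; simp add: S_def)
  have S2: "pure K A B a b \<in> twtr_2cells K ?X (?P, ?RP) (S c d) (S c' d')"
    if "c \<in> twtr_1cells K ?X (A, RA)" "d \<in> twtr_1cells K ?X (B, RB)" "c' \<in> twtr_1cells K ?X (A, RA)" "d' \<in> twtr_1cells K ?X (B, RB)"
      "a \<in> twtr_2cells K ?X (A, RA) c c'" "b \<in> twtr_2cells K ?X (B, RB) d d'" for c d c' d' a b
    using that pair_cell2 by (cases c; cases d; cases c'; cases d'; simp add: S_def)
  have pS: "?cp (S c d) = c" "?cq (S c d) = d"
    if "c \<in> twtr_1cells K ?X (A, RA)" "d \<in> twtr_1cells K ?X (B, RB)" for c d
    using that proj_pair by (cases c; cases d; simp add: S_def)+
  have J: "J c \<in> twtr_2cells K ?X (?P, ?RP) c (S (?cp c) (?cq c))" "J c \<in> Units ?P"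
    if "c \<in> twtr_1cells K ?X (?P, ?RP)" for c
    using that gauge_cell2 by (cases c; simp add: J_def S_def twtr_comp1_def del: tensor_simps)+
  have Jn: "J c' \<otimes>\<^bsub>?P\<^esub> a = pure K A B (?p a) (?q a) \<otimes>\<^bsub>?P\<^esub> J c"
    if "c \<in> twtr_1cells K ?X (?P, ?RP)" "c' \<in> twtr_1cells K ?X (?P, ?RP)" "a \<in> twtr_2cells K ?X (?P, ?RP) c c'" for c c' a
    using that gauge_natural by (cases c; cases c'; simp add: J_def)
  have Jinv: "inv\<^bsub>?P\<^esub> J c \<in> twtr_2cells K ?X (?P, ?RP) (S (?cp c) (?cq c)) c"
    if c: "c \<in> twtr_1cells K ?X (?P, ?RP)" for c
    by (rule cell2_inv[OF T TP c S1[OF cp[OF c]] J[OF c]])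
  \<comment> \<open>The condition that 2-cells have counit 1 is what lets the projections recover
    \<open>a\<close> and \<open>b\<close> from their tensor product.\<close>
  have pp: "?p (pure K A B a b) = a" "?q (pure K A B a b) = b"
    if a: "a \<in> twtr_2cells K ?X (A, RA) c c'" and b: "b \<in> twtr_2cells K ?X (B, RB) d d'"  for c c' d d' a b
  proof -
    note ac = cl[OF a] and bc = cl[OF b]
    have e: "counit A a = \<one>\<^bsub>K\<^esub>" "counit B b = \<one>\<^bsub>K\<^esub>"
      using a b unfolding twtr_2cells_def by (auto simp: Let_def split: prod.splits)
    interpret AM: module K A using A(9) by simp
    interpret BM: module K B using B(9) by simp
    show "?p (pure K A B a b) = a" "?q (pure K A B a b) = b"
      unfolding id_counit_star[OF A(9) B(8)] counit_id_star[OF A(8) B(9)]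
      using star_pure[OF ahom_id[OF A(9)] triv_hom[OF B(8) A(9)] ac bc] star_pure[OF triv_hom[OF A(8) B(9)] ahom_id[OF B(9)] ac bc]
        ac bc e by (simp_all add: triv_def)
  qed
  have CD: "is_category ?C" "is_category ?D"
    by (intro prod_cat_category hom_cat_category T TP TA TB)+
  note defs = twtr_hom_cat_def prod_cat_def twtr_pairing_def twtr_hcomp_def twtr_id2_def twtr_vcomp_def
  have obC: "Ob ?C = twtr_1cells K ?X (?P, ?RP)" and homC: "Hom ?C = twtr_2cells K ?X (?P, ?RP)"
    and obD: "Ob ?D = twtr_1cells K ?X (A, RA) \<times> twtr_1cells K ?X (B, RB)"
    by (simp_all add: defs)
  have obF: "on_ob ?F c = (?cp c, ?cq c)" for c by (simp add: defs)
  have homF: "on_hom ?F c c' a = (?p a, ?q a)" if "a \<in> carrier ?P" for c c' a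
    using pcl[OF that] by (simp add: defs)
  have FF: "is_functor ?C ?D ?F"
    unfolding is_functor_def
  proof (intro conjI ballI)
    fix x assume x: "x \<in> Ob ?C"
    show "on_ob ?F x \<in> Ob ?D" using cp x by (simp add: obF obC obD)
    show "on_hom ?F x x (Ident ?C x) = Ident ?D (on_ob ?F x)"
      using ahomD(6)[OF ph(1)] ahomD(6)[OF ph(2)] homF[OF P.one_closed] by (simp add: defs obF)
  next
    fix x y a assume xy: "x \<in> Ob ?C" "y \<in> Ob ?C" and a: "a \<in> Hom ?C x y"
    have ac: "a \<in> carrier ?P" by (rule cl[OF a[unfolded homC]])
    show "on_hom ?F x y a \<in> Hom ?D (on_ob ?F x) (on_ob ?F y)"
      unfolding homF[OF ac] obF using c2[of x y a] xy a by (simp add: obC homC) (simp add: defs)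
  next
    fix x y z a b assume "x \<in> Ob ?C" "y \<in> Ob ?C" "z \<in> Ob ?C" and a: "a \<in> Hom ?C x y" and b: "b \<in> Hom ?C y z"
    have ac: "a \<in> carrier ?P" "b \<in> carrier ?P" by (rule cl[OF a[unfolded homC]] cl[OF b[unfolded homC]])+
    have "Comp ?C x y z b a = b \<otimes>\<^bsub>?P\<^esub> a" by (simp add: defs)
    then show "on_hom ?F x z (Comp ?C x y z b a) = Comp ?D (on_ob ?F x) (on_ob ?F y) (on_ob ?F z) (on_hom ?F y z b) (on_hom ?F x y a)"
      using ahomD(4)[OF ph(1) ac(2,1)] ahomD(4)[OF ph(2) ac(2,1)] P.m_closed[OF ac(2,1)]
      by (simp only: homF[OF ac(1)] homF[OF ac(2)] homF[OF P.m_closed[OF ac(2,1)]] obF) (simp add: defs)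
  qed
  have FG: "is_functor ?D ?C G"
    unfolding is_functor_def
  proof (intro conjI ballI)
    fix x assume x: "x \<in> Ob ?D"
    show "on_ob G x \<in> Ob ?C" using S1 x by (auto simp: obC obD G_def)
    show "on_hom G x x (Ident ?D x) = Ident ?C (on_ob G x)"
      by (simp add: G_def defs oneP split: prod.splits)
  next
    fix x y a assume "x \<in> Ob ?D" "y \<in> Ob ?D" "a \<in> Hom ?D x y"
    then show "on_hom G x y a \<in> Hom ?C (on_ob G x) (on_ob G y)"
      using S2 by (auto simp: obD homC G_def) (auto simp: defs)
  next
    fix x y z a b assume "x \<in> Ob ?D" "y \<in> Ob ?D" "z \<in> Ob ?D" and a: "a \<in> Hom ?D x y" and b: "b \<in> Hom ?D y z"
    have ac: "fst a \<in> carrier A" "snd a \<in> carrier B" "fst b \<in> carrier A" "snd b \<in> carrier B"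
      using a b by (auto simp: defs split: prod.splits dest: cl)
    have "Comp ?D x y z b a = (fst b \<otimes>\<^bsub>A\<^esub> fst a, snd b \<otimes>\<^bsub>B\<^esub> snd a)"
      by (simp add: defs split: prod.splits)
    then show "on_hom G x z (Comp ?D x y z b a) = Comp ?C (on_ob G x) (on_ob G y) (on_ob G z) (on_hom G y z b) (on_hom G x y a)"
      using mult_pure[OF A(9) B(9) ac(3,4,1,2)] by (simp add: G_def) (simp add: defs mP)
  qed
  have eta: "is_natural_isomorphism ?C ?C id_func (comp_func G ?F) J"
    unfolding is_natural_isomorphism_def
  proof (intro conjI ballI)
    fix x assume x: "x \<in> Ob ?C"
    then have x': "x \<in> twtr_1cells K ?X (?P, ?RP)" by (simp add: obC)
    have "inv\<^bsub>?P\<^esub> J x \<otimes>\<^bsub>?P\<^esub> J x = \<one>\<^bsub>?P\<^esub>" "J x \<otimes>\<^bsub>?P\<^esub> inv\<^bsub>?P\<^esub> J x = \<one>\<^bsub>?P\<^esub>"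
      using J(2)[OF x'] by (simp_all only: P.Units_l_inv P.Units_r_inv)
    then show "is_isomorphism ?C (on_ob id_func x) (on_ob (comp_func G ?F) x) (J x)"
      unfolding is_isomorphism_def
      using J(1)[OF x'] Jinv[OF x']
      by (simp add: id_func_def comp_func_def obF G_def homC) (auto simp: defs)
  next
    fix x y a assume xy: "x \<in> Ob ?C" "y \<in> Ob ?C" and a: "a \<in> Hom ?C x y"
    have ac: "a \<in> carrier ?P" by (rule cl[OF a[unfolded homC]])
    show "Comp ?C (on_ob id_func x) (on_ob id_func y) (on_ob (comp_func G ?F) y) (J y) (on_hom id_func x y a) =
        Comp ?C (on_ob id_func x) (on_ob (comp_func G ?F) x) (on_ob (comp_func G ?F) y) (on_hom (comp_func G ?F) x y a) (J x)"
      using Jn[of x y a] xy a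
      by (simp add: id_func_def comp_func_def homF[OF ac] G_def obC homC) (simp add: defs)
  qed
  \<comment> \<open>By \<open>pS\<close> and \<open>pp\<close> this composite fixes objects and
    2-cells strictly, so identity 2-cells serve as components.\<close>
  have theta: "is_natural_isomorphism ?D ?D (comp_func ?F G) id_func (\<lambda>_. (\<one>\<^bsub>A\<^esub>, \<one>\<^bsub>B\<^esub>))"
    unfolding is_natural_isomorphism_def
  proof (intro conjI ballI)
    fix x assume x: "x \<in> Ob ?D"
    then have e: "on_ob (comp_func ?F G) x = x"
      using pS by (auto simp: comp_func_def obF G_def obD)
    have i: "Ident ?D x = (\<one>\<^bsub>A\<^esub>, \<one>\<^bsub>B\<^esub>)" by (simp add: defs split: prod.splits)
    have "Ident ?D x \<in> Hom ?D x x" "Comp ?D x x x (Ident ?D x) (Ident ?D x) = Ident ?D x"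
      using CD(2) x unfolding is_category_def by blast+
    then show "is_isomorphism ?D (on_ob (comp_func ?F G) x) (on_ob id_func x) (\<one>\<^bsub>A\<^esub>, \<one>\<^bsub>B\<^esub>)"
      unfolding is_isomorphism_def e i[symmetric] by (auto simp: id_func_def)
  next
    fix x y a assume xy: "x \<in> Ob ?D" "y \<in> Ob ?D" and a: "a \<in> Hom ?D x y"
    have e: "on_ob (comp_func ?F G) x = x" "on_ob (comp_func ?F G) y = y"
      using pS xy by (auto simp: comp_func_def obF G_def obD)
    have a': "fst a \<in> twtr_2cells K ?X (A, RA) (fst x) (fst y)" "snd a \<in> twtr_2cells K ?X (B, RB) (snd x) (snd y)"
      using a by (auto simp: defs split: prod.splits)
    have "pure K A B (fst a) (snd a) \<in> carrier ?P" using cl[OF a'(1)] cl[OF a'(2)] A(9) B(9) by simp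
    then have ha: "on_hom (comp_func ?F G) x y a = a"
      using pp[OF a'] by (simp add: comp_func_def G_def homF)
    have "Comp ?D x y y (Ident ?D y) a = a" "Comp ?D x x y a (Ident ?D x) = a"
      using CD(2) xy a unfolding is_category_def by blast+
    moreover have "Ident ?D x = (\<one>\<^bsub>A\<^esub>, \<one>\<^bsub>B\<^esub>)" "Ident ?D y = (\<one>\<^bsub>A\<^esub>, \<one>\<^bsub>B\<^esub>)" by (simp_all add: defs split: prod.splits)
    ultimately show "Comp ?D (on_ob (comp_func ?F G) x) (on_ob (comp_func ?F G) y) (on_ob id_func y) (\<one>\<^bsub>A\<^esub>, \<one>\<^bsub>B\<^esub>) (on_hom (comp_func ?F G) x y a) =
        Comp ?D (on_ob (comp_func ?F G) x) (on_ob id_func x) (on_ob id_func y) (on_hom id_func x y a) (\<one>\<^bsub>A\<^esub>, \<one>\<^bsub>B\<^esub>)"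
      unfolding e ha by (simp add: id_func_def)
  qed
  show ?thesis
    unfolding is_equivalence_def using CD FF FG eta theta by blast
qed

end

theorem theorem5p5:
  fixes K :: "'k ring"
    and H1 :: "('k, 'a) bialg" and R1 :: "('a, 'a) tens"
    and H2 :: "('k, 'b) bialg" and R2 :: "('b, 'b) tens"
  assumes "field K"
    and "triangular_bialgebra K (H1, R1)"
    and "triangular_bialgebra K (H2, R2)"
  shows "twtr_product TYPE('c) K (H1, R1) (H2, R2)
           (tensor_triangular K (H1, R1) (H2, R2))
           (id_counit K H1 H2, \<one>\<^bsub>tensor K H1 H1\<^esub>)
           (counit_id K H1 H2, \<one>\<^bsub>tensor K H2 H2\<^esub>)"
proof -
  interpret P: tribialg_pair K H1 R1 H2 R2
    by unfold_locales fact+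
  have "is_equivalence (twtr_hom_cat K X (tensor_bialgebra K H1 H2, P.tbR H1 R1 H2 R2))
      (prod_cat (twtr_hom_cat K X (H1, R1)) (twtr_hom_cat K X (H2, R2)))
      (twtr_pairing K X (tensor_bialgebra K H1 H2, P.tbR H1 R1 H2 R2) (H1, R1) (H2, R2)
        (id_counit K H1 H2, \<one>\<^bsub>tensor K H1 H1\<^esub>) (counit_id K H1 H2, \<one>\<^bsub>tensor K H2 H2\<^esub>))"
    if "triangular_bialgebra K X" for X :: "('k, 'c) tribialg"
  proof (cases X)
    case (Pair H R)
    interpret tribialg_span K H1 R1 H2 R2 H R
      using that Pair by unfold_locales simp
    show ?thesis using pairing_equivalence by (simp only: Pair)
  qed
  then show ?thesis
    unfolding twtr_product_def P.tensor_triangular_tb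
    using P.TP P.proj_cell1 by blast
qed

end
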